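(* Let $K\ge0$ be fixed, $0=\theta_0<\theta_1<\dots<\theta_K<\theta_{K+1}=1$, and $c_k=\lfloor N\theta_k\rfloor$ for $k=0,\dots,K+1$. For each $N$ let $F_N^{(1)},\dots,F_N^{(K+1)}$ be continuous cumulative distribution functions on $\mathbb{R}$, and let $F_n=F_N^{(k)}$ for $c_{k-1}<n\le c_k$. Let $M=M_N$ be either a fixed positive integer or a sequence with $M_N\to\infty$ as $N\to\infty$. For $n=1,\dots,N$ let $Y_{n,1},\dots,Y_{n,M}\sim F_n$, with all $Y_{n,m}$ independent across $n$ and $m$, and put $$\widehat F_{n,M}(t)=\frac1M\sum_{m=1}^M\mathbb{I}\{Y_{n,m}\le t\},\qquad \varepsilon_{n,M}=\sqrt M\,[\widehat F_{n,M}-F_n].$$ Let $w$ be a continuous probability density that is positive everywhere on $\mathbb{R}$, and let $L^2(\mathbb{R})$ denote the Hilbert space with inner product $\langle f,g\rangle=\int_{\mathbb{R}}f(x)g(x)w(x)\,dx$. Suppose there exist continuous cumulative distribution functions $F^{(k,* )}$, $k=1,\dots,K+1$, with $$\lim_{N\to\infty}\max_{k=1,\dots,K+1}\sup_{x\in\mathbb{R}}|F_N^{(k)}(x)-F^{(k,* )}(x)|=0.$$ Let $$P_N(x)=N^{-1/2}\sum_{i=1}^{\lfloor xN\rfloor}\varepsilon_{i,M}+N^{-1/2}(Nx-\lfloor Nx\rfloor)\,\varepsilon_{\lfloor Nx\rfloor+1,M},\qquad x\in[0,1].$$ Then for any weight function $\rho$, polynomial ($\rho(x)=x^\beta$, $\beta\in[0,1/2)$)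 or logarithmic ($\rho(x)=x^{1/2}\log^\beta(x^{-1})$, $\beta>1/2$), $$\{P_N(x):x\in[0,1]\}\overset{d}{\to}\{W(x):x\in[0,1]\}$$ in the Hölder space $\mathcal{C}^\rho([0,1],L^2(\mathbb{R}))$, where $W$ is a centered Gaussian process with values in $L^2(\mathbb{R})$, governed by the covariance function, for $x,y\in[0,1]$, $f,g\in L^2(\mathbb{R})$, $$C^\varepsilon(x,y)[f,g]=\int_0^{\min(x,y)}\Big\{\int_{\mathbb{R}}\int_{\mathbb{R}}f(s)g(t)\,c^\varepsilon(s,t,z)\,w(s)w(t)\,ds\,dt\Big\}dz,$$ $$c^\varepsilon(s,t,z)=F^{(k,* )}(\min(s,t))-F^{(k,* )}(s)F^{(k,* )}(t)\quad\text{for } z\in(\theta_{k-1},\theta_k],\ k=1,\dots,K+1.$$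
   Context: Covariance function: $C^\varepsilon(x,y)[f,g]=\mathbb{E}[\langle W(x),f\rangle\langle W(y),g\rangle]$. Hölder space: for a separable Banach space $(\mathbb{B},\|\cdot\|)$, $\|f\|_\rho=\sup_{x\in[0,1]}\|f(x)\|+\sup_{0\le x<y\le 1}\frac{\|f(y)-f(x)\|}{\rho(y-x)}$, and $\mathcal{C}^\rho([0,1],\mathbb{B})$ is the space of continuous $f:[0,1]\to\mathbb{B}$ with $\|f\|_\rho<\infty$ and $\lim_{\delta\downarrow0}\sup_{0\le x<y\le x+\delta\le1}\|f(y)-f(x)\|/\rho(y-x)=0$, normed by $\|\cdot\|_\rho$. $\overset{d}{\to}$ denotes weak convergence in this space as $N\to\infty$.
   Formalization: The logarithmic weight vanishes at x=1, which would force f(0)=f(1) and exclude P_N; so the formula x^{1/2} log^β(1/x) is required only near 0, and ρ may be any positive continuous function on the rest of (0,1]. *)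

theory Defs
  imports "HOL-Probability.Probability"
begin

section \<open>Weighted \<open>L\<^sup>2\<close> spaces\<close>

text \<open>
  For an everywhere positive density \<open>w\<close>, equality almost everywhere with respect to
  \<open>w(x) dx\<close> is equality Lebesgue-almost everywhere. Hence the spaces \<open>L\<^sup>2(w(x) dx)\<close> for all such
  \<open>w\<close> are subspaces of one vector space \<open>l0\<close>, the measurable functions on the real line modulo
  Lebesgue-almost everywhere equality.
\<close>

definition ae_eq :: "(real \<Rightarrow> real) \<Rightarrow> (real \<Rightarrow> real) \<Rightarrow> bool" where
  "ae_eq f g \<longleftrightarrow>
     f \<in> borel_measurable borel \<and> g \<in> borel_measurable borel \<and> (AE x in lborel. f x = g x)"

lemma part_equivp_ae_eq: "part_equivp ae_eq"
proof (rule part_equivpI)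
  show "\<exists>f. ae_eq f f" by (rule exI[of _ "\<lambda>_. 0"]) (simp add: ae_eq_def)
  show "symp ae_eq" by (auto intro!: sympI simp: ae_eq_def)
  show "transp ae_eq"
  proof (rule transpI)
    fix f g h assume *: "ae_eq f g" "ae_eq g h"
    then have "AE x in lborel. f x = g x" "AE x in lborel. g x = h x" by (auto simp: ae_eq_def)
    then have "AE x in lborel. f x = h x" by eventually_elim simp
    with * show "ae_eq f h" by (simp add: ae_eq_def)
  qed
qed

quotient_type l0 = "real \<Rightarrow> real" / partial: ae_eq
  by (rule part_equivp_ae_eq)

instantiation l0 :: real_vector
begin

lift_definition zero_l0 :: l0 is "\<lambda>_. 0" by (simp add: ae_eq_def)

lift_definition plus_l0 :: "l0 \<Rightarrow> l0 \<Rightarrow> l0" is "\<lambda>f g x. f x + g x"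
  unfolding ae_eq_def by (auto elim: eventually_elim2)

lift_definition minus_l0 :: "l0 \<Rightarrow> l0 \<Rightarrow> l0" is "\<lambda>f g x. f x - g x"
  unfolding ae_eq_def by (auto elim: eventually_elim2)

lift_definition uminus_l0 :: "l0 \<Rightarrow> l0" is "\<lambda>f x. - f x"
  unfolding ae_eq_def by auto

lift_definition scaleR_l0 :: "real \<Rightarrow> l0 \<Rightarrow> l0" is "\<lambda>c f x. c * f x"
  unfolding ae_eq_def by auto

instance
  by standard (transfer, simp add: ae_eq_def algebra_simps)+

end

text \<open>
  For Borel measurable \<open>w\<close>, the integral does not depend on the representatives \<open>rep_l0\<close>.
\<close>

definition L2_inner :: "(real \<Rightarrow> real) \<Rightarrow> l0 \<Rightarrow> l0 \<Rightarrow> real" where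
  "L2_inner w f g = (LBINT x. rep_l0 f x * rep_l0 g x * w x)"

definition L2_norm :: "(real \<Rightarrow> real) \<Rightarrow> l0 \<Rightarrow> real" where
  "L2_norm w f = sqrt (L2_inner w f f)"

definition L2_space :: "(real \<Rightarrow> real) \<Rightarrow> l0 set" where
  "L2_space w = {f. integrable lborel (\<lambda>x. (rep_l0 f x)\<^sup>2 * w x)}"


section \<open>Hoelder spaces\<close>

text \<open>
  The Banach space is given by a carrier \<open>B\<close> and a norm \<open>nrm\<close> on it. Suprema are taken in
  \<^typ>\<open>ennreal\<close>, so that the norm of a function which is not Hoelder is \<open>\<infinity>\<close>. Functions on
  \<open>[0,1]\<close> are represented by functions on the reals that are \<^term>\<open>undefined\<close> outside \<open>[0,1]\<close>.
\<close>

definition hoelder_norm ::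
  "('b::real_vector \<Rightarrow> real) \<Rightarrow> (real \<Rightarrow> real) \<Rightarrow> (real \<Rightarrow> 'b) \<Rightarrow> ennreal" where
  "hoelder_norm nrm \<rho> f =
     (SUP x\<in>{0..1}. ennreal (nrm (f x))) +
     (SUP (x, y)\<in>{(x, y). 0 \<le> x \<and> x < y \<and> y \<le> 1}. ennreal (nrm (f y - f x) / \<rho> (y - x)))"

definition hoelder_space ::
  "('b::real_vector) set \<Rightarrow> ('b \<Rightarrow> real) \<Rightarrow> (real \<Rightarrow> real) \<Rightarrow> (real \<Rightarrow> 'b) set" where
  "hoelder_space B nrm \<rho> =
     {f \<in> {0..1} \<rightarrow>\<^sub>E B.
        (\<forall>x\<in>{0..1}. ((\<lambda>y. nrm (f y - f x)) \<longlongrightarrow> 0) (at x within {0..1})) \<and>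
        hoelder_norm nrm \<rho> f < \<infinity> \<and>
        ((\<lambda>\<delta>. SUP (x, y)\<in>{(x, y). 0 \<le> x \<and> x < y \<and> y \<le> x + \<delta> \<and> x + \<delta> \<le> 1}.
            ennreal (nrm (f y - f x) / \<rho> (y - x))) \<longlongrightarrow> 0) (at_right 0)}"

definition hoelder_dist ::
  "('b::real_vector \<Rightarrow> real) \<Rightarrow> (real \<Rightarrow> real) \<Rightarrow> (real \<Rightarrow> 'b) \<Rightarrow> (real \<Rightarrow> 'b) \<Rightarrow> real" where
  "hoelder_dist nrm \<rho> f g = enn2real (hoelder_norm nrm \<rho> (\<lambda>x. f x - g x))"

definition hoelder_topology ::
  "('b::real_vector) set \<Rightarrow> ('b \<Rightarrow> real) \<Rightarrow> (real \<Rightarrow> real) \<Rightarrow> (real \<Rightarrow> 'b) topology" where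
  "hoelder_topology B nrm \<rho> = Metric_space.mtopology (hoelder_space B nrm \<rho>) (hoelder_dist nrm \<rho>)"

definition polynomial_weight :: "(real \<Rightarrow> real) \<Rightarrow> bool" where
  "polynomial_weight \<rho> \<longleftrightarrow> (\<exists>\<beta>. 0 \<le> \<beta> \<and> \<beta> < 1/2 \<and> (\<forall>x\<in>{0<..1}. \<rho> x = x powr \<beta>))"

text \<open>
  The formula \<open>x\<^sup>1\<^sup>/\<^sup>2 log\<^sup>\<beta>(1/x)\<close> vanishes at \<open>x = 1\<close>. With it on all of \<open>(0,1]\<close>, finiteness of
  the Hoelder norm would force \<open>f(0) = f(1)\<close>, which the partial sum process does not satisfy.
  As usual the formula is therefore required only near \<open>0\<close>, where the weight matters, and the
  weight is an arbitrary positive continuous function otherwise. All choices with the same \<open>\<beta>\<close>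
  give the same space with equivalent norms.
\<close>

definition logarithmic_weight :: "(real \<Rightarrow> real) \<Rightarrow> bool" where
  "logarithmic_weight \<rho> \<longleftrightarrow>
     (\<exists>\<beta>>1/2. \<forall>\<^sub>F x in at_right 0. \<rho> x = x powr (1/2) * ln (1 / x) powr \<beta>) \<and>
     continuous_on {0<..1} \<rho> \<and> (\<forall>x\<in>{0<..1}. 0 < \<rho> x)"


section \<open>Weak convergence and Gaussian processes\<close>

definition borel_of :: "'a topology \<Rightarrow> 'a measure" where
  "borel_of X = sigma (topspace X) {U. openin X U}"

text \<open>
  Each \<open>Z N\<close> may live on its own probability space.
\<close>

definition converges_in_distribution ::
  "'c topology \<Rightarrow> (nat \<Rightarrow> 'a measure) \<Rightarrow> (nat \<Rightarrow> 'a \<Rightarrow> 'c) \<Rightarrow> 'b measure \<Rightarrow> ('b \<Rightarrow> 'c) \<Rightarrow> bool" where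
  "converges_in_distribution X \<Omega> Z Q W \<longleftrightarrow>
     (\<forall>N. Z N \<in> measurable (\<Omega> N) (borel_of X)) \<and> W \<in> measurable Q (borel_of X) \<and>
     (\<forall>h. continuous_map X euclideanreal h \<and> bounded (h ` topspace X) \<longrightarrow>
        (\<lambda>N. \<integral>\<omega>. h (Z N \<omega>) \<partial>\<Omega> N) \<longlonglongrightarrow> (\<integral>\<omega>. h (W \<omega>) \<partial>Q))"

definition gaussian_law :: "real measure \<Rightarrow> bool" where
  "gaussian_law \<mu> \<longleftrightarrow>
     (\<exists>m. \<mu> = return borel m) \<or>
     (\<exists>m \<sigma>. 0 < \<sigma> \<and> \<mu> = density lborel (\<lambda>x. ennreal (normal_density m \<sigma> x)))"

text \<open>
  \<open>W\<close> takes values in the Hilbert space with carrier \<open>H\<close> and inner product \<open>ip\<close>. It is Gaussian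
  if every continuous linear functional of every vector \<open>(W(x\<^sub>1), \<dots>, W(x\<^sub>n))\<close> is normal, possibly
  degenerate.
\<close>

definition centered_gaussian_process ::
  "'h set \<Rightarrow> ('h \<Rightarrow> 'h \<Rightarrow> real) \<Rightarrow> 'b measure \<Rightarrow> real set \<Rightarrow> ('b \<Rightarrow> real \<Rightarrow> 'h) \<Rightarrow> bool" where
  "centered_gaussian_process H ip Q T W \<longleftrightarrow>
     (\<forall>\<omega>\<in>space Q. \<forall>x\<in>T. W \<omega> x \<in> H) \<and>
     (\<forall>x\<in>T. \<forall>f\<in>H. (\<lambda>\<omega>. ip (W \<omega> x) f) \<in> borel_measurable Q \<and> (\<integral>\<omega>. ip (W \<omega> x) f \<partial>Q) = 0) \<and>
     (\<forall>n x f. (\<forall>i<n. x i \<in> T \<and> f i \<in> H) \<longrightarrow>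
        gaussian_law (distr Q borel (\<lambda>\<omega>. \<Sum>i<n. ip (W \<omega> (x (i::nat))) (f i))))"

definition covariance_function ::
  "('h \<Rightarrow> 'h \<Rightarrow> real) \<Rightarrow> 'b measure \<Rightarrow> ('b \<Rightarrow> real \<Rightarrow> 'h) \<Rightarrow> real \<Rightarrow> real \<Rightarrow> 'h \<Rightarrow> 'h \<Rightarrow> real" where
  "covariance_function ip Q W x y f g = (\<integral>\<omega>. ip (W \<omega> x) f * ip (W \<omega> y) g \<partial>Q)"


section \<open>The partial sum process of empirical distribution functions\<close>

definition continuous_cdf :: "(real \<Rightarrow> real) \<Rightarrow> bool" where
  "continuous_cdf F \<longleftrightarrow> (\<exists>\<mu>. real_distribution \<mu> \<and> F = cdf \<mu>) \<and> continuous_on UNIV F"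

definition change_point :: "(nat \<Rightarrow> real) \<Rightarrow> nat \<Rightarrow> nat \<Rightarrow> nat" where
  "change_point \<theta> N k = nat \<lfloor>real N * \<theta> k\<rfloor>"

definition empirical_cdf :: "nat \<Rightarrow> (nat \<Rightarrow> real) \<Rightarrow> real \<Rightarrow> real" where
  "empirical_cdf M y t = (1 / real M) * (\<Sum>m=1..M. indicator {..t} (y m))"

definition empirical_error :: "nat \<Rightarrow> (nat \<Rightarrow> real) \<Rightarrow> (real \<Rightarrow> real) \<Rightarrow> l0" where
  "empirical_error M y F = abs_l0 (\<lambda>t. sqrt (real M) * (empirical_cdf M y t - F t))"

definition partial_sum_process :: "nat \<Rightarrow> (nat \<Rightarrow> 'b::real_vector) \<Rightarrow> real \<Rightarrow> 'b" where
  "partial_sum_process N e = (\<lambda>x\<in>{0..1}.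
     (real N powr (-1/2)) *\<^sub>R (\<Sum>i=1..nat \<lfloor>x * real N\<rfloor>. e i) +
     (real N powr (-1/2) * (real N * x - of_int \<lfloor>real N * x\<rfloor>)) *\<^sub>R e (nat \<lfloor>real N * x\<rfloor> + 1))"

text \<open>The value at \<open>z\<close> outside \<open>(0,1]\<close>, here \<open>0\<close>, is irrelevant.\<close>

definition c_eps ::
  "nat \<Rightarrow> (nat \<Rightarrow> real) \<Rightarrow> (nat \<Rightarrow> real \<Rightarrow> real) \<Rightarrow> real \<Rightarrow> real \<Rightarrow> real \<Rightarrow> real" where
  "c_eps K \<theta> G s t z =
     (\<Sum>k=1..K+1. if \<theta> (k - 1) < z \<and> z \<le> \<theta> k then G k (min s t) - G k s * G k t else 0)"

definition C_eps ::
  "(real \<Rightarrow> real) \<Rightarrow> nat \<Rightarrow> (nat \<Rightarrow> real) \<Rightarrow> (nat \<Rightarrow> real \<Rightarrow> real) \<Rightarrow>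
     real \<Rightarrow> real \<Rightarrow> l0 \<Rightarrow> l0 \<Rightarrow> real" where
  "C_eps w K \<theta> G x y f g =
     (LBINT z:{0..min x y}. LBINT s. LBINT t.
        rep_l0 f s * rep_l0 g t * c_eps K \<theta> G s t z * w s * w t)"

end

theory Submission
  imports Defs "HOL-Real_Asymp.Real_Asymp"
begin

text \<open>
  Write the process as a sum of independent centered vectors of a Hilbert space, bounded by \<open>2\<close>,
  with deterministic time profiles. Convexity of \<open>x \<mapsto> cosh (sqrt x)\<close> gives exponential moments of
  such sums without any dimension dependence, so the increments over \<open>[x, y]\<close> have Gaussian tails
  at scale \<open>sqrt (y - x)\<close> uniformly in \<open>N\<close>. Both kinds of weights dominate
  \<open>sqrt h (1 + log 1/h)\<^sup>\<beta>\<close> with \<open>\<beta> > 1/2\<close>, and dyadic chaining shows that the process is close in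
  the Hoelder norm to its polygonal interpolation on a dyadic grid. The summands are centered
  indicators \<open>1{y \<le> t}\<close>, which form a totally bounded set in \<open>L\<^sup>2\<close>; hence projection to finitely many
  fixed directions costs little as well. The interpolated and projected process is a continuous
  function of finitely many terms of one sequence of scalars. That sequence converges in law to a
  Gaussian sequence, by the central limit theorem and Levy's continuity theorem on
  \<open>real\<^sup>\<infinity>\<close>, and the limit process is the almost sure limit of the polygons built from it.
\<close>

section \<open>Dyadic chaining\<close>

text \<open>Three obstacles shape the proof. The values lie in a Hilbert space, and the exponential
  bound must not see its dimension: among vectors \<open>z\<close> of norm at most \<open>b\<close>,
  the bound for \<open>cosh (l * norm (x + z))\<close> behaves as if \<open>z\<close> were plus or
  minus \<open>b\<close> times the direction of \<open>x\<close>, so each summand costs what a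
  scalar one would. The condition \<beta> > 1/2 comes from the union bound: level \<open>j\<close>
  of the dyadic grid has 2^j increments, each exceeding its threshold with probability of order exp
  (-A (1 + j)^(2 \<beta>)), and only 2 \<beta> > 1 beats 2^j for every A > 0. Finally, no limit
  process is given in advance. The chaining estimates hold under the laws for finite
  \<open>N\<close>; they pass to the limit law of the coordinates through continuous functions of
  finitely many coordinates, and completeness of the Hoelder space then produces the path. The
  single observations, not the errors \<epsilon>_n, serve as summands, with coefficients of size at
  most 1 / sqrt (N M); a fixed M and M tending to infinity thus need no separate treatment.\<close>

lemma dyadic_chaining:
  fixes f :: "real \<Rightarrow> 'h::real_normed_vector" and r :: "nat \<Rightarrow> real"
  assumes cont: "continuous_on {0..1} f" and r: "\<And>j. 0 \<le> r j" "summable r"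
    and inc: "\<And>j k. k < 2^j \<Longrightarrow> norm (f (real (k+1) / 2^j) - f (real k / 2^j)) \<le> r j"
    and xy: "0 \<le> x" "x < y" "y \<le> 1" "y - x \<le> 1 / 2^j"
  shows "norm (f y - f x) \<le> 2 * (\<Sum>i. r (i + j))"
proof -
  \<comment> \<open>Rounding is always downwards: \<open>p z i\<close> is the left end of the dyadic
    cell of length 2^(-i) that contains \<open>z\<close>. The endpoint 1 is its own approximation on
    every level.\<close>
  define k where "k z i = nat \<lfloor>2^i * z\<rfloor>" for z :: real and i :: nat
  define p where "p z i = real (k z i) / 2^i" for z i
  have k: "real (k z i) \<le> 2^i * z" "2^i * z < real (k z i) + 1" if "0 \<le> z" for z i
    using that by (auto simp: k_def)
  have pz: "p z i \<le> z" "z < p z i + 1 / 2^i" if "0 \<le> z" for z i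
    using k[OF that, of i] by (auto simp: p_def field_simps)
  have plim: "(\<lambda>i. p z i) \<longlonglongrightarrow> z" if "0 \<le> z" for z
  proof (rule tendsto_sandwich[OF always_eventually always_eventually])
    show "\<forall>i. z - 1 / 2^i \<le> p z i" "\<forall>i. p z i \<le> z"
      using pz[OF that] by (auto simp: algebra_simps less_imp_le)
    have "(\<lambda>i. z - (1/2)^i) \<longlonglongrightarrow> z - 0"
      by (intro tendsto_intros LIMSEQ_realpow_zero) auto
    then show "(\<lambda>i. z - 1 / 2^i) \<longlonglongrightarrow> z" by (simp add: power_one_over)
  qed simp
  have p01: "p z i \<in> {0..1}" if "0 \<le> z" "z \<le> 1" for z i
    proof -
    have "p z i \<le> 1" using pz(1)[OF that(1), of i] that(2) by linarith
    then show ?thesis by (simp add: p_def)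
  qed
  have step: "norm (f (p z (Suc i)) - f (p z i)) \<le> r (Suc i)" if z: "0 \<le> z" "z \<le> 1" for z i
  proof -
    \<comment> \<open>Halving the cell either keeps its left end or moves it by one step of the
      finer grid, so each refinement costs at most one increment, bounded by
      \<open>r (Suc i)\<close>.\<close>
    have "k z (Suc i) = 2 * k z i \<or> k z (Suc i) = 2 * k z i + 1"
    proof -
      have "real (k z (Suc i)) < real (2 * k z i + 2)" "real (2 * k z i) < real (k z (Suc i) + 1)"
        using k[OF z(1), of i] k[OF z(1), of "Suc i"] by auto
      then show ?thesis unfolding of_nat_less_iff by linarith
    qed
    then show ?thesis
    proof
      assume a: "k z (Suc i) = 2 * k z i + 1"
      have "real (2 * k z i + 1) \<le> real (2^Suc i)"
        unfolding a[symmetric] of_nat_power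
        by (rule order_trans[OF k(1)[OF z(1)]], subst of_nat_numeral, rule mult_left_le) (use z in auto)
      then have "2 * k z i < 2^Suc i" unfolding of_nat_le_iff by simp
      from inc[OF this] show ?thesis using a by (simp add: p_def field_simps)
    qed (use r in \<open>auto simp: p_def\<close>)
  qed
  \<comment> \<open>Telescoping over the refinements from level \<open>j\<close> on; continuity
    closes the gap between \<open>p z i\<close> and \<open>z\<close>. The sum starts at
    \<open>Suc j\<close>, because level \<open>j\<close> itself is spent once, in
    \<open>mid\<close>.\<close>
  have far: "norm (f z - f (p z j)) \<le> (\<Sum>i. r (Suc i + j))" if z: "0 \<le> z" "z \<le> 1" for z
  proof -
    have sm: "summable (\<lambda>i. r (Suc i + j))" using summable_ignore_initial_segment[OF r(2), of "Suc j"] by simp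
    have le: "norm (f (p z (j + n)) - f (p z j)) \<le> (\<Sum>i. r (Suc i + j))" for n
    proof -
      have "norm (f (p z (j + n)) - f (p z j)) \<le> (\<Sum>i<n. r (Suc i + j))"
      proof (induction n)
        case (Suc n)
        have "norm (f (p z (j + Suc n)) - f (p z j)) \<le> norm (f (p z (Suc (j + n))) - f (p z (j+n))) + norm (f (p z (j + n)) - f (p z j))"
          using dist_triangle[of "f (p z (j + Suc n))" "f (p z j)" "f (p z (j + n))"] by (simp add: dist_norm)
        also have "\<dots> \<le> r (Suc (j + n)) + (\<Sum>i<n. r (Suc i + j))" using step[OF z] Suc by (intro add_mono) auto
        finally show ?case by (simp add: ac_simps)
      qed simp
      also have "\<dots> \<le> (\<Sum>i. r (Suc i + j))" using sm r by (intro sum_le_suminf) auto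
      finally show ?thesis .
    qed
    have "(\<lambda>n. f (p z (j + n))) \<longlonglongrightarrow> f z"
    proof -
      have "(\<lambda>n. p z (j + n)) \<longlonglongrightarrow> z" using LIMSEQ_ignore_initial_segment[OF plim[OF z(1)], of j] by (simp add: add.commute)
      then show ?thesis using z p01[OF z]
        by (intro continuous_on_tendsto_compose[OF cont]) (auto intro!: always_eventually)
    qed
    then have "(\<lambda>n. norm (f (p z (j + n)) - f (p z j))) \<longlonglongrightarrow> norm (f z - f (p z j))"
      by (intro tendsto_intros)
    then show ?thesis by (rule LIMSEQ_le_const2) (use le in auto)
  qed
  \<comment> \<open>As \<open>y - x\<close> is at most one cell length, the two left ends coincide
    or are neighbours.\<close>
  have mid: "norm (f (p y j) - f (p x j)) \<le> r j"
  proof -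
    have "k y j = k x j \<or> k y j = k x j + 1"
    proof -
      have d: "2^j * y - 2^j * x \<le> 1" "2^j * x \<le> 2^j * y" using xy by (auto simp: field_simps)
      have "real (k y j) < real (k x j + 2)" "real (k x j) < real (k y j + 1)"
        unfolding of_nat_add of_nat_numeral of_nat_1
        using d k[of y j] k[of x j] xy(1,2) by linarith+
      then show ?thesis unfolding of_nat_less_iff by linarith
    qed
    then show ?thesis
    proof
      assume a: "k y j = k x j + 1"
      have "real (k x j + 1) \<le> real (2^j)"
        unfolding a[symmetric] of_nat_power
        by (rule order_trans[OF k(1)], simp add: order_trans[OF xy(1)] xy less_imp_le, subst of_nat_numeral, rule mult_left_le) (use xy in auto)
      then have "k x j < 2^j" unfolding of_nat_le_iff by simp
      from inc[OF this] show ?thesis using a by (simp add: p_def field_simps)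
    qed (use r in \<open>auto simp: p_def\<close>)
  qed
  have "norm (f y - f x) \<le> norm (f y - f (p y j)) + norm (f (p y j) - f (p x j)) + norm (f x - f (p x j))"
    using dist_triangle[of "f y" "f x" "f (p y j)"] dist_triangle[of "f (p y j)" "f x" "f (p x j)"]
    by (simp add: dist_norm norm_minus_commute)
  also have "\<dots> \<le> (\<Sum>i. r (Suc i + j)) + r j + (\<Sum>i. r (Suc i + j))"
    using far[of y] far[of x] mid xy by (intro add_mono) auto
  also have "\<dots> \<le> 2 * (r j + (\<Sum>i. r (Suc i + j)))" using r(1)[of j] by simp
  also have "r j + (\<Sum>i. r (Suc i + j)) = (\<Sum>i. r (i + j))"
    using suminf_split_head[of "\<lambda>i. r (i + j)"] summable_ignore_initial_segment[OF r(2), of j] by simp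
  finally show ?thesis .
qed

section \<open>Exponential moments of sums of independent vectors\<close>

lemma cosh_sqrt_sums:
  assumes "0 \<le> (u::real)"
  shows "(\<lambda>n. u ^ n / fact (2 * n)) sums cosh (sqrt u)"
proof -
  have "(\<lambda>n. if even n then sqrt u ^ n /\<^sub>R fact n else 0) sums cosh (sqrt u)"
    by (rule cosh_converges)
  then have "(\<lambda>n. (\<lambda>n. if even n then sqrt u ^ n /\<^sub>R fact n else 0) (2 * n)) sums cosh (sqrt u)"
    by (subst sums_mono_reindex) (auto simp: strict_mono_def elim!: oddE evenE)
  moreover have "sqrt u ^ (2 * n) = u ^ n" for n using assms by (simp add: power_mult)
  ultimately show ?thesis by (simp add: divide_inverse mult.commute)
qed

text \<open>The power series of \<open>cosh (sqrt u)\<close> in \<open>u\<close> has nonnegative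
  coefficients, so convexity holds term by term. It makes the squared norm, not the norm, the
  natural variable.\<close>

lemma cosh_sqrt_convex:
  assumes "0 \<le> (v::real)" "0 \<le> w" "0 \<le> t" "t \<le> 1"
  shows "cosh (sqrt ((1 - t) * v + t * w)) \<le> (1 - t) * cosh (sqrt v) + t * cosh (sqrt w)"
proof (rule sums_le)
  have nn: "0 \<le> (1 - t) * v + t * w" using assms by auto
  show "(\<lambda>n. ((1 - t) * v + t * w) ^ n / fact (2 * n)) sums cosh (sqrt ((1 - t) * v + t * w))"
    by (rule cosh_sqrt_sums[OF nn])
  show "(\<lambda>n. (1 - t) * (v ^ n / fact (2 * n)) + t * (w ^ n / fact (2 * n)))
      sums ((1 - t) * cosh (sqrt v) + t * cosh (sqrt w))"
    by (intro sums_add sums_mult cosh_sqrt_sums assms)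
  fix n
  have "convex_on {0::real..} (\<lambda>x. x ^ n)"
    using convex_power_odd[of n] convex_power_even[of n] convex_on_subset by blast
  then have "((1 - t) * v + t * w) ^ n \<le> (1 - t) * v ^ n + t * w ^ n"
    using assms unfolding convex_on_def by auto
  then have "((1 - t) * v + t * w) ^ n / fact (2 * n) \<le> ((1 - t) * v ^ n + t * w ^ n) / fact (2 * n)"
    by (intro divide_right_mono) auto
  then show "((1 - t) * v + t * w) ^ n / fact (2 * n)
      \<le> (1 - t) * (v ^ n / fact (2 * n)) + t * (w ^ n / fact (2 * n))"
    by (simp add: add_divide_distrib)
qed

text \<open>The bound is affine in \<open>z \<bullet> x\<close>, so that it can be integrated over a centered \<open>z\<close>.\<close>

lemma cosh_norm_add_le:
  fixes x z :: "'h::real_inner" and l :: real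
  assumes z: "norm z \<le> b" and x: "x \<noteq> 0" and b: "0 < b"
  shows "cosh (l * norm (x + z)) \<le> cosh (l * norm x) * cosh (l * b)
    + (z \<bullet> x) / (norm x * b) * (sinh (l * norm x) * sinh (l * b))"
proof -
  define a where "a = norm x"
  have a: "a > 0" using x by (simp add: a_def)
  define q where "q = (z \<bullet> x) / (a * b)"
  \<comment> \<open>\<open>t\<close> is the weight for which
    \<open>a\<^sup>2 + 2 * (z \<bullet> x) + b\<^sup>2\<close> is the mixture of the collinear
    extremes \<open>(a - b)\<^sup>2\<close> and \<open>(a + b)\<^sup>2\<close>; Cauchy-Schwarz puts
    it in the unit interval. It is affine in \<open>z \<bullet> x\<close>, and so is the bound that
    convexity yields.\<close>
  define t where "t = (1 + q) / 2"
  have "\<bar>z \<bullet> x\<bar> \<le> b * a"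
    using Cauchy_Schwarz_ineq2[of z x] z a by (smt (verit) a_def mult_right_mono)
  then have "\<bar>(z \<bullet> x) / (a * b)\<bar> \<le> 1" using a b by (simp add: abs_mult field_simps)
  then have "(z \<bullet> x) / (a * b) \<le> 1 \<and> - ((z \<bullet> x) / (a * b)) \<le> 1" unfolding abs_le_iff .
  then have t: "0 \<le> t" "t \<le> 1" by (simp_all add: t_def flip: q_def)
  have "(norm (x + z))\<^sup>2 = a\<^sup>2 + 2 * (z \<bullet> x) + (norm z)\<^sup>2"
    unfolding a_def by (simp add: power2_norm_eq_inner inner_add inner_commute)
  also have "\<dots> \<le> a\<^sup>2 + 2 * (z \<bullet> x) + b\<^sup>2" using z by (simp add: power_mono)
  also have "\<dots> = (1 - t) * (a - b)\<^sup>2 + t * (a + b)\<^sup>2"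
    using a b by (simp add: t_def q_def power2_eq_square field_simps)
  finally have "(l * norm (x + z))\<^sup>2 \<le> l\<^sup>2 * ((1 - t) * (a - b)\<^sup>2 + t * (a + b)\<^sup>2)"
    by (simp add: power_mult_distrib mult_left_mono)
  then have le: "(l * norm (x + z))\<^sup>2 \<le> (1 - t) * (l * (a - b))\<^sup>2 + t * (l * (a + b))\<^sup>2"
    by (simp only: power_mult_distrib distrib_left[of "l\<^sup>2"] mult.left_commute mult.assoc)
  have "cosh (l * norm (x + z)) = cosh (sqrt ((l * norm (x + z))\<^sup>2))"
    by (simp del: power_mult_distrib add: cosh_real_abs)
  also have "\<dots> \<le> cosh (sqrt ((1 - t) * (l * (a - b))\<^sup>2 + t * (l * (a + b))\<^sup>2))"
    using le t by (subst cosh_real_nonneg_le_iff) (auto intro!: add_nonneg_nonneg mult_nonneg_nonneg real_le_rsqrt simp del: power_mult_distrib real_sqrt_abs simp: real_sqrt_le_iff)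
  also have "\<dots> \<le> (1 - t) * cosh (sqrt ((l * (a - b))\<^sup>2)) + t * cosh (sqrt ((l * (a + b))\<^sup>2))"
    by (rule cosh_sqrt_convex) (use t in auto)
  also have "\<dots> = (1 - t) * cosh (l * a - l * b) + t * cosh (l * a + l * b)"
    by (simp del: power_mult_distrib add: cosh_real_abs algebra_simps)
  also have "\<dots> = cosh (l * a) * cosh (l * b) + (2 * t - 1) * (sinh (l * a) * sinh (l * b))"
    by (simp add: cosh_add cosh_diff algebra_simps)
  also have "2 * t - 1 = q" by (simp add: t_def field_simps)
  finally show ?thesis unfolding a_def q_def .
qed

text \<open>The pointwise bound is affine in \<open>Z \<omega> \<bullet> x\<close>, whose mean is
  zero, so its sinh part disappears on integration. In the cases \<open>b = 0\<close> and
  \<open>x = 0\<close>, where that bound divides by zero, a direct pointwise estimate takes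
  over.\<close>

lemma (in prob_space) cosh_norm_add_expectation_le:
  fixes x :: "'h::real_inner" and Z :: "'a \<Rightarrow> 'h"
  assumes b: "\<And>\<omega>. norm (Z \<omega>) \<le> b" and meas: "(\<lambda>\<omega>. norm (x + Z \<omega>)) \<in> borel_measurable M"
    and Zx: "integrable M (\<lambda>\<omega>. Z \<omega> \<bullet> x)" "expectation (\<lambda>\<omega>. Z \<omega> \<bullet> x) = 0"
  shows "(\<integral>\<^sup>+\<omega>. ennreal (cosh (l * norm (x + Z \<omega>))) \<partial>M) \<le> ennreal (cosh (l * norm x) * cosh (l * b))"
proof -
  have b0: "0 \<le> b" using b norm_ge_zero order_trans by blast
  have triv: ?thesis if "\<And>\<omega>. cosh (l * norm (x + Z \<omega>)) \<le> cosh (l * norm x) * cosh (l * b)"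
  proof -
    have "(\<integral>\<^sup>+\<omega>. ennreal (cosh (l * norm (x + Z \<omega>))) \<partial>M) \<le> (\<integral>\<^sup>+\<omega>. ennreal (cosh (l * norm x) * cosh (l * b)) \<partial>M)"
      by (intro nn_integral_mono ennreal_leI that)
    then show ?thesis by (simp add: emeasure_space_1)
  qed
  consider "b = 0" | "x = 0" | "b > 0" "x \<noteq> 0" using b0 by fastforce
  then show ?thesis
  proof cases
    case 1
    then show ?thesis using b by (intro triv) auto
  next
    case 2
    have "cosh (l * norm (Z \<omega>)) \<le> cosh (l * b)" for \<omega>
    proof -
      have "cosh \<bar>l * norm (Z \<omega>)\<bar> \<le> cosh \<bar>l * b\<bar>"
        using b[of \<omega>] b0 by (subst cosh_real_nonneg_le_iff) (auto simp: abs_mult mult_left_mono)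
      then show ?thesis by (simp add: cosh_real_abs)
    qed
    then show ?thesis using 2 by (intro triv) auto
  next
    case 3
    define c where "c = sinh (l * norm x) * sinh (l * b)"
    have i: "integrable M (\<lambda>\<omega>. cosh (l * norm x) * cosh (l * b) + (Z \<omega> \<bullet> x) / (norm x * b) * c)"
      using Zx by auto
    have "(\<integral>\<^sup>+\<omega>. ennreal (cosh (l * norm (x + Z \<omega>))) \<partial>M)
       \<le> (\<integral>\<^sup>+\<omega>. ennreal (cosh (l * norm x) * cosh (l * b) + (Z \<omega> \<bullet> x) / (norm x * b) * c) \<partial>M)"
      unfolding c_def by (intro nn_integral_mono ennreal_leI cosh_norm_add_le b 3)
    also have "\<dots> = ennreal (\<integral>\<omega>. (cosh (l * norm x) * cosh (l * b) + (Z \<omega> \<bullet> x) / (norm x * b) * c) \<partial>M)"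
    proof (intro nn_integral_eq_integral i AE_I2)
      fix \<omega>
      show "0 \<le> cosh (l * norm x) * cosh (l * b) + (Z \<omega> \<bullet> x) / (norm x * b) * c"
        unfolding c_def by (rule order_trans[OF _ cosh_norm_add_le[OF b 3(2,1)]]) (simp add: less_imp_le cosh_real_pos)
    qed
    also have "(\<integral>\<omega>. (cosh (l * norm x) * cosh (l * b) + (Z \<omega> \<bullet> x) / (norm x * b) * c) \<partial>M) = cosh (l * norm x) * cosh (l * b)"
      using Zx by (simp add: prob_space)
    finally show ?thesis .
  qed
qed

text \<open>The space \<open>'h\<close> is not assumed separable, so measurability of a sum of
  random vectors is not at hand. Expanding the squared norm leaves only inner products, which are
  continuous functions of two real variables.\<close>

lemma norm_sum_measurable:
  fixes \<psi> :: "'i \<Rightarrow> real \<Rightarrow> 'h::real_inner"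
  assumes "finite I" "\<And>i. i \<in> I \<Longrightarrow> continuous_on UNIV (\<psi> i)" "\<And>i. i \<in> I \<Longrightarrow> Y i \<in> borel_measurable M"
  shows "(\<lambda>\<omega>. norm (\<Sum>i\<in>I. c i *\<^sub>R \<psi> i (Y i \<omega>))) \<in> borel_measurable M"
proof -
  have m: "(\<lambda>\<omega>. \<psi> i (Y i \<omega>) \<bullet> \<psi> j (Y j \<omega>)) \<in> borel_measurable M" if "i \<in> I" "j \<in> I" for i j
  proof -
    have "(\<lambda>p. \<psi> i (fst p) \<bullet> \<psi> j (snd p)) \<in> borel_measurable (borel :: (real \<times> real) measure)"
      by (intro borel_measurable_continuous_onI continuous_intros
          continuous_on_compose2[OF assms(2)[OF that(1)]] continuous_on_compose2[OF assms(2)[OF that(2)]]) auto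
    from measurable_compose[OF borel_measurable_Pair[OF assms(3)[OF that(1)] assms(3)[OF that(2)]] this]
    show ?thesis by simp
  qed
  have "norm (\<Sum>i\<in>I. c i *\<^sub>R \<psi> i (Y i \<omega>)) = sqrt (\<Sum>i\<in>I. \<Sum>j\<in>I. c i * c j * (\<psi> j (Y j \<omega>) \<bullet> \<psi> i (Y i \<omega>)))" for \<omega>
    by (simp add: norm_eq_sqrt_inner inner_sum_left inner_sum_right sum_distrib_left mult.assoc)
  then show ?thesis using m by (simp add: borel_measurable_sum borel_measurable_times)
qed

text \<open>A Hilbert space form of Hoeffding's exponential bound. By independence the joint law is
  a product measure, and integrating out one coordinate at a time contributes a factor
  \<open>cosh (l * (\<bar>c i\<bar> * b))\<close>, which is at most \<open>exp\<close> of half its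
  squared argument.\<close>

proposition (in prob_space) cosh_norm_indep_sum_le:
  fixes \<psi> :: "'i \<Rightarrow> real \<Rightarrow> 'h::real_inner" and Y :: "'i \<Rightarrow> 'a \<Rightarrow> real"
  assumes I: "finite I" and indep: "indep_vars (\<lambda>_. borel) Y I"
    and cont: "\<And>i. i \<in> I \<Longrightarrow> continuous_on UNIV (\<psi> i)"
    and b: "\<And>i y. i \<in> I \<Longrightarrow> norm (\<psi> i y) \<le> b"
    and mean: "\<And>i f. i \<in> I \<Longrightarrow> expectation (\<lambda>\<omega>. \<psi> i (Y i \<omega>) \<bullet> f) = 0"
  shows "(\<integral>\<^sup>+\<omega>. ennreal (cosh (l * norm (\<Sum>i\<in>I. c i *\<^sub>R \<psi> i (Y i \<omega>)))) \<partial>M)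
    \<le> ennreal (exp (l\<^sup>2 * b\<^sup>2 * (\<Sum>i\<in>I. (c i)\<^sup>2) / 2))"
proof (cases "I = {}")
  case True
  then show ?thesis by (simp add: emeasure_space_1)
next
  case False
  have rv: "Y i \<in> borel_measurable M" if "i \<in> I" for i
    using indep that by (auto simp: indep_vars_def)
  \<comment> \<open>The product construction wants a sigma-finite factor at every index; outside
    \<open>I\<close> any probability measure serves.\<close>
  define \<mu> where "\<mu> i = (if i \<in> I then distr M borel (Y i) else return borel 0)" for i
  have ps: "prob_space (\<mu> i)" for i
    by (auto simp: \<mu>_def intro!: prob_space_distr prob_space_return rv)
  interpret P: product_sigma_finite \<mu>
    by (intro product_sigma_finite.intro prob_space_imp_sigma_finite ps)
  have [simp, measurable_cong]: "sets (\<mu> i) = sets borel" "space (\<mu> i) = UNIV" for i by (auto simp: \<mu>_def)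
  have cosh_le: "cosh x \<le> exp (x\<^sup>2 / 2)" for x :: real
  proof (rule sums_le)
    show "(\<lambda>n. (x\<^sup>2) ^ n / fact (2 * n)) sums cosh x"
      using cosh_sqrt_sums[of "x\<^sup>2"] by (simp add: cosh_real_abs)
    show "(\<lambda>n. (x\<^sup>2/2) ^ n /\<^sub>R fact n) sums exp (x\<^sup>2/2)" by (rule exp_converges)
    fix n
    \<comment> \<open>This factorial estimate puts the series of \<open>cosh x\<close> termwise
      below that of \<open>exp (x\<^sup>2 / 2)\<close>.\<close>
    have "2 ^ n * fact n \<le> (fact (2 * n) :: real)"
    proof (induction n)
      case (Suc n)
      have "2 ^ Suc n * fact (Suc n) = (2 * real (Suc n)) * (2 ^ n * fact n)" by simp
      also have "\<dots> \<le> (2 * real (Suc n)) * fact (2 * n)" using Suc by (intro mult_left_mono) auto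
      also have "\<dots> \<le> (2 * real (Suc n)) * (real (2 * n + 1) * fact (2 * n))"
        by (intro mult_left_mono) auto
        also have "\<dots> = fact (Suc (Suc (2 * n)))" unfolding fact_Suc by (simp add: algebra_simps)
        also have "\<dots> = fact (2 * Suc n)" by (simp only: mult_Suc_right add_2_eq_Suc)
      finally show ?case .
    qed simp
    then have *: "(x\<^sup>2) ^ n / fact (2 * n) \<le> (x\<^sup>2) ^ n / (2 ^ n * fact n)"
      by (intro divide_left_mono mult_pos_pos) auto
    show "(x\<^sup>2) ^ n / fact (2 * n) \<le> (x\<^sup>2/2) ^ n /\<^sub>R fact n"
    proof -
      have "(x\<^sup>2/2) ^ n /\<^sub>R fact n = (x\<^sup>2) ^ n / (2 ^ n * fact n)" by (simp add: power_divide field_simps)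
      with * show ?thesis by simp
    qed
  qed
  have main: "(\<integral>\<^sup>+x. ennreal (cosh (l * norm (\<Sum>i\<in>J. c i *\<^sub>R \<psi> i (x i)))) \<partial>(PiM J \<mu>))
    \<le> ennreal (exp (l\<^sup>2 * b\<^sup>2 * (\<Sum>i\<in>J. (c i)\<^sup>2) / 2))" if "finite J" "J \<subseteq> I" for J
    using that
  proof (induction J rule: finite_induct)
    case empty
    interpret E: prob_space "PiM {} \<mu>" by (intro prob_space_PiM ps)
    show ?case by (simp add: E.emeasure_space_1)
  next
    case (insert i J)
    then have iI: "i \<in> I" by auto
    interpret Mi: prob_space "\<mu> i" by (rule ps)
    define C where "C = cosh (l * (\<bar>c i\<bar> * b))"
    have meas: "(\<lambda>x. norm (\<Sum>j\<in>J'. c j *\<^sub>R \<psi> j (x j))) \<in> borel_measurable (PiM J' \<mu>)" if "J' \<subseteq> insert i J" for J'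
      using insert that by (intro norm_sum_measurable cont) (auto intro: finite_subset)
    have mc: "(\<lambda>x. ennreal (cosh (l * norm (\<Sum>j\<in>J'. c j *\<^sub>R \<psi> j (x j))))) \<in> borel_measurable (PiM J' \<mu>)" if "J' \<subseteq> insert i J" for J'
    proof -
      have "cosh \<in> borel_measurable (borel :: real measure)"
        by (intro borel_measurable_continuous_onI continuous_intros)
      from measurable_compose[OF borel_measurable_times[OF borel_measurable_const meas[OF that]] this]
      show ?thesis by simp
    qed
    have "(\<integral>\<^sup>+x. ennreal (cosh (l * norm (\<Sum>j\<in>insert i J. c j *\<^sub>R \<psi> j (x j)))) \<partial>(PiM (insert i J) \<mu>))
       = (\<integral>\<^sup>+x. \<integral>\<^sup>+y. ennreal (cosh (l * norm (\<Sum>j\<in>insert i J. c j *\<^sub>R \<psi> j ((x(i := y)) j)))) \<partial>\<mu> i \<partial>(PiM J \<mu>))"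
      by (rule P.product_nn_integral_insert[OF insert(1,2) mc]) simp
    also have "\<dots> = (\<integral>\<^sup>+x. \<integral>\<^sup>+y. ennreal (cosh (l * norm ((\<Sum>j\<in>J. c j *\<^sub>R \<psi> j (x j)) + c i *\<^sub>R \<psi> i y))) \<partial>\<mu> i \<partial>(PiM J \<mu>))"
    proof (intro nn_integral_cong arg_cong[where f="\<lambda>v. ennreal (cosh (l * norm v))"])
      fix x y
      have "(\<Sum>j\<in>J. c j *\<^sub>R \<psi> j ((x(i := y)) j)) = (\<Sum>j\<in>J. c j *\<^sub>R \<psi> j (x j))"
        using insert by (intro sum.cong) auto
      then show "(\<Sum>j\<in>insert i J. c j *\<^sub>R \<psi> j ((x(i := y)) j)) = (\<Sum>j\<in>J. c j *\<^sub>R \<psi> j (x j)) + c i *\<^sub>R \<psi> i y"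
        using insert by simp
    qed
    also have "\<dots> \<le> (\<integral>\<^sup>+x. ennreal (cosh (l * norm (\<Sum>j\<in>J. c j *\<^sub>R \<psi> j (x j))) * C) \<partial>(PiM J \<mu>))"
      unfolding C_def
    proof (intro nn_integral_mono Mi.cosh_norm_add_expectation_le)
      fix x y
      show "norm (c i *\<^sub>R \<psi> i y) \<le> \<bar>c i\<bar> * b" using b[OF iI] by (simp add: mult_left_mono)
      define v where "v = (\<Sum>j\<in>J. c j *\<^sub>R \<psi> j (x j))"
      have "continuous_on UNIV (\<lambda>y. norm (v + c i *\<^sub>R \<psi> i y))" by (intro continuous_intros cont iI)
      then show "(\<lambda>y. norm ((\<Sum>j\<in>J. c j *\<^sub>R \<psi> j (x j)) + c i *\<^sub>R \<psi> i y)) \<in> borel_measurable (\<mu> i)"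
        unfolding v_def by (subst measurable_cong_sets[OF _ refl, of _ borel]) (auto intro: borel_measurable_continuous_onI)
      have cv: "continuous_on UNIV (\<lambda>y. \<psi> i y \<bullet> v)" by (intro continuous_intros cont iI)
      then have mv: "(\<lambda>y. \<psi> i y \<bullet> v) \<in> borel_measurable borel" by (rule borel_measurable_continuous_onI)
      have bv: "\<bar>\<psi> i y \<bullet> v\<bar> \<le> b * norm v" for y
        using Cauchy_Schwarz_ineq2[of "\<psi> i y" v] mult_right_mono[OF b[OF iI, of y], of "norm v"] by simp
      have "integrable (\<mu> i) (\<lambda>y. \<psi> i y \<bullet> v)"
        by (rule Mi.integrable_const_bound[of _ "b * norm v"]) (use bv mv in auto)
      then show "integrable (\<mu> i) (\<lambda>y. (c i *\<^sub>R \<psi> i y) \<bullet> (\<Sum>j\<in>J. c j *\<^sub>R \<psi> j (x j)))"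
        by (simp add: v_def)
      have "(\<integral>y. \<psi> i y \<bullet> v \<partial>\<mu> i) = 0"
        using mean[OF iI, of v] mv rv[OF iI] iI by (simp add: \<mu>_def integral_distr)
      then show "Mi.expectation (\<lambda>y. (c i *\<^sub>R \<psi> i y) \<bullet> (\<Sum>j\<in>J. c j *\<^sub>R \<psi> j (x j))) = 0"
        by (simp add: v_def)
    qed
    also have "\<dots> = (\<integral>\<^sup>+x. ennreal (cosh (l * norm (\<Sum>j\<in>J. c j *\<^sub>R \<psi> j (x j)))) \<partial>(PiM J \<mu>)) * ennreal C"
      using mc[of J] by (subst nn_integral_multc[symmetric]) (auto simp: ennreal_mult cosh_real_nonneg C_def)
    also have "\<dots> \<le> ennreal (exp (l\<^sup>2 * b\<^sup>2 * (\<Sum>j\<in>J. (c j)\<^sup>2) / 2)) * ennreal (exp ((l * (\<bar>c i\<bar> * b))\<^sup>2 / 2))"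
      unfolding C_def using insert by (intro mult_mono ennreal_leI cosh_le) auto
    also have "\<dots> = ennreal (exp (l\<^sup>2 * b\<^sup>2 * (\<Sum>j\<in>insert i J. (c j)\<^sup>2) / 2))"
      using insert by (simp add: ennreal_mult[symmetric] exp_add[symmetric] power_mult_distrib algebra_simps add_divide_distrib)
    finally show ?case .
  qed
  have "distr M (PiM I (\<lambda>_. borel)) (\<lambda>\<omega>. \<lambda>i\<in>I. Y i \<omega>) = PiM I (\<lambda>i. distr M borel (Y i))"
    using indep by (subst (asm) indep_vars_iff_distr_eq_PiM'[OF False]) (auto simp: rv)
  also have "\<dots> = PiM I \<mu>" by (intro PiM_cong) (auto simp: \<mu>_def)
  finally have d: "PiM I \<mu> = distr M (PiM I (\<lambda>_. borel)) (\<lambda>\<omega>. \<lambda>i\<in>I. Y i \<omega>)" ..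
  have "(\<lambda>x. norm (\<Sum>j\<in>I. c j *\<^sub>R \<psi> j (x j))) \<in> borel_measurable (PiM I (\<lambda>_. borel))"
    using I by (intro norm_sum_measurable cont) auto
  moreover have "cosh \<in> borel_measurable (borel :: real measure)"
    by (intro borel_measurable_continuous_onI continuous_intros)
  ultimately have mI: "(\<lambda>x. ennreal (cosh (l * norm (\<Sum>j\<in>I. c j *\<^sub>R \<psi> j (x j))))) \<in> borel_measurable (PiM I (\<lambda>_. borel))"
    by (auto intro!: measurable_compose[of _ _ borel cosh])
  have mY: "(\<lambda>\<omega>. \<lambda>i\<in>I. Y i \<omega>) \<in> measurable M (PiM I (\<lambda>_. borel))"
    by (intro measurable_restrict rv)
  show ?thesis using main[OF I subset_refl] unfolding d
    by (subst (asm) nn_integral_distr[OF mY]) (use mI in \<open>auto cong: sum.cong\<close>)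
qed

corollary (in prob_space) norm_indep_sum_tail:
  fixes \<psi> :: "'i \<Rightarrow> real \<Rightarrow> 'h::real_inner" and Y :: "'i \<Rightarrow> 'a \<Rightarrow> real"
  assumes I: "finite I" and indep: "indep_vars (\<lambda>_. borel) Y I"
    and cont: "\<And>i. i \<in> I \<Longrightarrow> continuous_on UNIV (\<psi> i)"
    and b: "\<And>i y. i \<in> I \<Longrightarrow> norm (\<psi> i y) \<le> b"
    and mean: "\<And>i f. i \<in> I \<Longrightarrow> expectation (\<lambda>\<omega>. \<psi> i (Y i \<omega>) \<bullet> f) = 0"
    and s: "b\<^sup>2 * (\<Sum>i\<in>I. (c i)\<^sup>2) \<le> s" "0 < s" and a: "0 \<le> a"
  shows "prob {\<omega>\<in>space M. a \<le> norm (\<Sum>i\<in>I. c i *\<^sub>R \<psi> i (Y i \<omega>))} \<le> 2 * exp (- (a\<^sup>2 / (2 * s)))"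
proof -
  \<comment> \<open>The minimiser of \<open>l\<^sup>2 * s / 2 - l * a\<close>, as in Chernoff's
    bound. The factor 2 in the claim arises because only \<open>exp (l * a) / 2\<close> is a lower
    bound for the cosh.\<close>
  define l where "l = a / s"
  let ?S = "\<lambda>\<omega>. norm (\<Sum>i\<in>I. c i *\<^sub>R \<psi> i (Y i \<omega>))"
  have rv: "Y i \<in> borel_measurable M" if "i \<in> I" for i
    using indep that by (auto simp: indep_vars_def)
  have [measurable]: "?S \<in> borel_measurable M" by (intro norm_sum_measurable I cont rv)
  have l: "0 \<le> l" using a s by (simp add: l_def)
  have coshm: "cosh \<in> borel_measurable (borel :: real measure)"
    by (intro borel_measurable_continuous_onI continuous_intros)
  have [measurable]: "(\<lambda>\<omega>. cosh (l * ?S \<omega>)) \<in> borel_measurable M"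
    by (rule measurable_compose[OF _ coshm]) simp
  have "ennreal (exp (l * a) / 2) * emeasure M {\<omega>\<in>space M. a \<le> ?S \<omega>} = (\<integral>\<^sup>+\<omega>. ennreal (exp (l * a) / 2) * indicator {\<omega>\<in>space M. a \<le> ?S \<omega>} \<omega> \<partial>M)"
    by (subst nn_integral_cmult_indicator) auto
  also have "\<dots> \<le> (\<integral>\<^sup>+\<omega>. ennreal (cosh (l * ?S \<omega>)) \<partial>M)"
  proof (intro nn_integral_mono)
    fix \<omega>
    have "exp (l * a) / 2 \<le> cosh (l * ?S \<omega>)" if "a \<le> ?S \<omega>"
    proof -
      have "exp (l * a) \<le> exp (l * ?S \<omega>) + exp (- (l * ?S \<omega>))"
        using that l by (smt (verit, best) exp_le_cancel_iff exp_gt_zero mult_left_mono)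
      then show ?thesis by (simp add: cosh_def)
    qed
    then show "ennreal (exp (l * a) / 2) * indicator {\<omega>\<in>space M. a \<le> ?S \<omega>} \<omega> \<le> ennreal (cosh (l * ?S \<omega>))"
      by (auto simp: indicator_def intro!: ennreal_leI)
  qed
  also have "\<dots> \<le> ennreal (exp (l\<^sup>2 * b\<^sup>2 * (\<Sum>i\<in>I. (c i)\<^sup>2) / 2))"
    by (rule cosh_norm_indep_sum_le[OF I indep cont b mean])
  also have "\<dots> \<le> ennreal (exp (l\<^sup>2 * s / 2))"
    using mult_left_mono[OF s(1), of "l\<^sup>2"] by (intro ennreal_leI) (simp add: mult.assoc)
  finally have "ennreal (exp (l * a) / 2 * prob {\<omega>\<in>space M. a \<le> ?S \<omega>}) \<le> ennreal (exp (l\<^sup>2 * s / 2))"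
    by (subst ennreal_mult) (auto simp: emeasure_eq_measure)
  then have "exp (l * a) / 2 * prob {\<omega>\<in>space M. a \<le> ?S \<omega>} \<le> exp (l\<^sup>2 * s / 2)"
    by (subst (asm) ennreal_le_iff) auto
  then have "prob {\<omega>\<in>space M. a \<le> ?S \<omega>} \<le> 2 * (exp (l\<^sup>2 * s / 2) / exp (l * a))"
    by (simp add: field_simps)
  also have "exp (l\<^sup>2 * s / 2) / exp (l * a) = exp (- (a\<^sup>2 / (2 * s)))"
    using s(2) unfolding l_def by (simp add: exp_diff[symmetric] power2_eq_square field_simps)
  finally show ?thesis .
qed

section \<open>Hoelder spaces\<close>

text \<open>The modulus \<open>h\<^sup>1\<^sup>/\<^sup>2 (1 + log\<^sub>2 (1/h))\<^sup>\<beta>\<close> with \<open>\<beta> > 1/2\<close> is the strongest one that the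
  chaining bound can afford; both families of weights dominate it.\<close>

locale hoelder_weight =
  fixes \<rho> :: "real \<Rightarrow> real" and \<beta> C :: real
  assumes \<beta>: "1/2 < \<beta>" and C: "0 < C"
    and weight_pos: "\<And>h. 0 < h \<Longrightarrow> h \<le> 1 \<Longrightarrow> 0 < \<rho> h"
    and weight_ge: "\<And>h. 0 < h \<Longrightarrow> h \<le> 1 \<Longrightarrow> sqrt h * (1 + log 2 (1/h)) powr \<beta> \<le> C * \<rho> h"

text \<open>Near zero a polynomial weight exceeds \<open>sqrt h\<close> by a negative power of
  \<open>h\<close>, which absorbs a full logarithm, so the exponent 1 will do; a logarithmic weight
  keeps its own exponent, up to the base of the logarithm. Away from zero the quotient is continuous
  on a compact interval.\<close>

lemma hoelder_weight_exists:
  assumes "polynomial_weight \<rho> \<or> logarithmic_weight \<rho>"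
  obtains \<beta> C where "hoelder_weight \<rho> \<beta> C"
proof -
  have key: "\<exists>\<beta>>1/2. \<exists>K. continuous_on {0<..1} \<rho> \<and> (\<forall>x\<in>{0<..1}. 0 < \<rho> x) \<and>
      (\<forall>\<^sub>F h in at_right 0. sqrt h * (1 + log 2 (1/h)) powr \<beta> \<le> K * \<rho> h)"
    using assms
  proof
    assume "polynomial_weight \<rho>"
    then obtain b where b: "0 \<le> b" "b < 1/2" "\<And>x. x \<in> {0<..1} \<Longrightarrow> \<rho> x = x powr b"
      unfolding polynomial_weight_def by blast
    have c: "continuous_on {0<..1} \<rho>"
      by (rule continuous_on_eq[of _ "\<lambda>x. x powr b"]) (use b(3) in \<open>auto intro!: continuous_intros\<close>)
    define a where "a = 1/2 - b"
    have a: "a > 0" using b by (simp add: a_def)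
    have "((\<lambda>h. h powr a * (1 + log 2 (1/h))) \<longlongrightarrow> 0) (at_right 0)" using a by real_asymp
    then have "\<forall>\<^sub>F h in at_right 0. h powr a * (1 + log 2 (1/h)) < 1" by (rule order_tendstoD) simp
    moreover have "\<forall>\<^sub>F h in at_right 0. h \<in> {0<..1::real}"
      by (subst eventually_at_right_field) (auto intro!: exI[of _ 1])
    ultimately have "\<forall>\<^sub>F h in at_right 0. sqrt h * (1 + log 2 (1/h)) powr 1 \<le> 1 * \<rho> h"
    proof eventually_elim
      case (elim h)
      have l: "0 \<le> log 2 (1/h)" using elim by (intro zero_le_log_cancel_iff[THEN iffD2]) auto
      have "sqrt h = h powr b * h powr a" using elim by (simp add: a_def powr_half_sqrt[symmetric] flip: powr_add)
      then have "sqrt h * (1 + log 2 (1/h)) powr 1 = h powr b * (h powr a * (1 + log 2 (1/h)))" using l by simp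
      also have "\<dots> \<le> h powr b * 1" using elim by (intro mult_left_mono) auto
      finally show ?case using b(3)[of h] elim by simp
    qed
    then show ?thesis using c b(3) by (intro exI[of _ 1] conjI exI[of _ 1]) auto
  next
    assume "logarithmic_weight \<rho>"
    then obtain b where b: "b > 1/2" "\<forall>\<^sub>F x in at_right 0. \<rho> x = x powr (1/2) * ln (1 / x) powr b"
      "continuous_on {0<..1} \<rho>" "\<forall>x\<in>{0<..1}. 0 < \<rho> x"
      unfolding logarithmic_weight_def by blast
    define K where "K = (4 / ln 2) powr b"
    have "\<forall>\<^sub>F h in at_right 0. h \<in> {0<..1/2::real}"
      by (subst eventually_at_right_field) (auto intro!: exI[of _ "1/2"])
    with b(2) have "\<forall>\<^sub>F h in at_right 0. sqrt h * (1 + log 2 (1/h)) powr b \<le> K * \<rho> h"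
    proof eventually_elim
      case (elim h)
      \<comment> \<open>With \<open>h\<close> at most 1/2 the binary logarithm is at least 1 and can
        absorb the summand 1.\<close>
      have "log 2 2 \<le> log 2 (1/h)" using elim by (subst log_le_cancel_iff) (auto simp: field_simps)
      then have l: "1 \<le> log 2 (1/h)" by simp
      have ln0: "0 \<le> ln (1/h)" using elim by (intro ln_ge_zero) (auto simp: field_simps)
      have "1 + log 2 (1/h) \<le> 2 * log 2 (1/h)" using l by simp
      also have "\<dots> = (2 / ln 2) * ln (1/h)" by (simp add: log_def)
      also have "\<dots> \<le> (4 / ln 2) * ln (1/h)" by (rule mult_right_mono[OF _ ln0]) (simp add: divide_right_mono)
      finally have "(1 + log 2 (1/h)) powr b \<le> ((4 / ln 2) * ln (1/h)) powr b"
        using l b(1) ln0 by (intro powr_mono2) auto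
      also have "\<dots> = K * ln (1/h) powr b"
        using ln0 unfolding K_def by (subst powr_mult) auto
      finally have "sqrt h * (1 + log 2 (1/h)) powr b \<le> sqrt h * (K * ln (1/h) powr b)"
        using elim by (intro mult_left_mono) auto
      also have "\<dots> = K * (h powr (1/2) * ln (1/h) powr b)" using elim by (simp add: powr_half_sqrt)
      finally show ?case using elim by simp
    qed
    then show ?thesis using b by blast
  qed
  then obtain \<beta> K where \<beta>: "\<beta> > 1/2" and c: "continuous_on {0<..1} \<rho>" and p: "\<And>x. x \<in> {0<..1} \<Longrightarrow> 0 < \<rho> x"
    and ev: "\<forall>\<^sub>F h in at_right 0. sqrt h * (1 + log 2 (1/h)) powr \<beta> \<le> K * \<rho> h"
    by blast
  from ev obtain \<delta> where \<delta>: "\<delta> > 0" "\<And>h. 0 < h \<Longrightarrow> h < \<delta> \<Longrightarrow> sqrt h * (1 + log 2 (1/h)) powr \<beta> \<le> K * \<rho> h"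
    by (subst (asm) eventually_at_right_field) auto
  define q where "q h = sqrt h * (1 + log 2 (1/h)) powr \<beta> / \<rho> h" for h
  define d where "d = min \<delta> 1"
  have d: "0 < d" "d \<le> \<delta>" "d \<le> 1" using \<delta> by (auto simp: d_def)
  have l0: "0 \<le> log 2 (1/h)" if "0 < h" "h \<le> 1" for h :: real
    using that by (intro zero_le_log_cancel_iff[THEN iffD2]) auto
  have "continuous_on {d..1} q"
    unfolding q_def
  proof (intro continuous_intros continuous_on_subset[OF c])
    show "\<forall>x\<in>{d..1}. \<rho> x \<noteq> 0" using p d by (auto simp: less_le)
    show "\<forall>x\<in>{d..1}. 1 + log 2 (1/x) \<noteq> 0" using l0 d by (metis add_pos_nonneg atLeastAtMost_iff less_le_trans less_numeral_extra(1) less_irrefl)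
  qed (use d in auto)
  then have "compact (q ` {d..1})" by (intro compact_continuous_image) auto
  then have "bdd_above (q ` {d..1})" by (intro bounded_imp_bdd_above compact_imp_bounded)
  then obtain K2 where K2: "\<And>h. h \<in> {d..1} \<Longrightarrow> q h \<le> K2"
    unfolding bdd_above_def by blast
  have "hoelder_weight \<rho> \<beta> (\<bar>K\<bar> + \<bar>K2\<bar> + 1)"
  proof
    fix h :: real assume h: "0 < h" "h \<le> 1"
    show pos: "0 < \<rho> h" using p h by auto
    show "sqrt h * (1 + log 2 (1/h)) powr \<beta> \<le> (\<bar>K\<bar> + \<bar>K2\<bar> + 1) * \<rho> h"
    proof (cases "h < d")
      case True
      then have "sqrt h * (1 + log 2 (1/h)) powr \<beta> \<le> K * \<rho> h" using h d by (intro \<delta>(2)) auto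
      also have "\<dots> \<le> (\<bar>K\<bar> + \<bar>K2\<bar> + 1) * \<rho> h" using pos by (intro mult_right_mono) auto
      finally show ?thesis .
    next
      case False
      then have "q h \<le> \<bar>K\<bar> + \<bar>K2\<bar> + 1" using K2[of h] h by auto
      then show ?thesis using pos by (simp add: q_def pos_divide_le_eq)
    qed
  qed (use \<beta> in auto)
  then show ?thesis using that by blast
qed

section \<open>The Hoelder space of paths with values in a normed space\<close>

context hoelder_weight
begin

definition hnorm :: "(real \<Rightarrow> 'h::real_normed_vector) \<Rightarrow> ennreal" where
  "hnorm = hoelder_norm norm \<rho>"

definition hspace :: "(real \<Rightarrow> 'h::real_normed_vector) set" where
  "hspace = hoelder_space UNIV norm \<rho>"

definition hdist :: "(real \<Rightarrow> 'h::real_normed_vector) \<Rightarrow> (real \<Rightarrow> 'h) \<Rightarrow> real" where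
  "hdist = hoelder_dist norm \<rho>"

text \<open>The supremum in the vanishing condition that separates the little Hoelder space from all
  functions of finite norm.\<close>

definition hmod :: "real \<Rightarrow> (real \<Rightarrow> 'h::real_normed_vector) \<Rightarrow> ennreal" where
  "hmod \<delta> f = (SUP (x, y)\<in>{(x, y). 0 \<le> x \<and> x < y \<and> y \<le> x + \<delta> \<and> x + \<delta> \<le> 1}. ennreal (norm (f y - f x) / \<rho> (y - x)))"

lemma hdist_eq: "hdist f g = enn2real (hnorm (\<lambda>x. f x - g x))"
  by (simp add: hdist_def hoelder_dist_def hnorm_def)

lemma hspace_iff:
  "f \<in> hspace \<longleftrightarrow> f \<in> {0..1} \<rightarrow>\<^sub>E UNIV \<and> (\<forall>x\<in>{0..1}. ((\<lambda>y. norm (f y - f x)) \<longlongrightarrow> 0) (at x within {0..1})) \<and>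
     hnorm f < \<infinity> \<and> ((\<lambda>\<delta>. hmod \<delta> f) \<longlongrightarrow> 0) (at_right 0)"
  by (simp add: hspace_def hoelder_space_def hnorm_def hmod_def)

lemma hnorm_le:
  assumes "\<And>x. 0 \<le> x \<Longrightarrow> x \<le> 1 \<Longrightarrow> norm (f x) \<le> a"
    and "\<And>x y. 0 \<le> x \<Longrightarrow> x < y \<Longrightarrow> y \<le> 1 \<Longrightarrow> norm (f y - f x) \<le> b * \<rho> (y - x)"
  shows "hnorm f \<le> ennreal (a + b)"
proof -
  have a: "0 \<le> a" using assms(1)[of 0] norm_ge_zero[of "f 0"] by linarith
  have "0 \<le> b * \<rho> 1" using assms(2)[of 0 1] by (simp add: order_trans[OF norm_ge_zero])
  then have b: "0 \<le> b" using weight_pos[of 1] by (simp add: zero_le_mult_iff)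
  have "norm (f y - f x) / \<rho> (y - x) \<le> b" if "0 \<le> x" "x < y" "y \<le> 1" for x y
    using assms(2)[OF that] weight_pos[of "y - x"] that by (simp add: pos_divide_le_eq)
  then have "hnorm f \<le> ennreal a + ennreal b"
    unfolding hnorm_def hoelder_norm_def
    by (intro add_mono SUP_least) (use assms(1) in \<open>auto intro!: ennreal_leI\<close>)
  then show ?thesis using a b by (simp add: ennreal_plus)
qed

lemma hnorm_ge:
  assumes fin: "hnorm f < \<infinity>"
  shows "0 \<le> x \<Longrightarrow> x \<le> 1 \<Longrightarrow> norm (f x) \<le> enn2real (hnorm f)"
    and "0 \<le> x \<Longrightarrow> x < y \<Longrightarrow> y \<le> 1 \<Longrightarrow> norm (f y - f x) \<le> enn2real (hnorm f) * \<rho> (y - x)"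
proof -
  have e: "ennreal (enn2real (hnorm f)) = hnorm f" using fin by simp
  show "norm (f x) \<le> enn2real (hnorm f)" if "0 \<le> x" "x \<le> 1"
  proof -
    have "ennreal (norm (f x)) \<le> hnorm f"
      unfolding hnorm_def hoelder_norm_def using that
      by (intro order_trans[OF SUP_upper[of x] add_increasing2[OF zero_le order_refl]]) auto
    then have "ennreal (norm (f x)) \<le> ennreal (enn2real (hnorm f))" by (simp only: e)
    then show ?thesis by (subst (asm) ennreal_le_iff) auto
  qed
  show "norm (f y - f x) \<le> enn2real (hnorm f) * \<rho> (y - x)" if "0 \<le> x" "x < y" "y \<le> 1"
  proof -
    have "(case (x, y) of (x, y) \<Rightarrow> ennreal (norm (f y - f x) / \<rho> (y - x))) \<le> hnorm f"
      unfolding hnorm_def hoelder_norm_def using that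
      by (intro order_trans[OF SUP_upper[of "(x, y)"] add_increasing[OF zero_le order_refl]]) auto
    then have "ennreal (norm (f y - f x) / \<rho> (y - x)) \<le> ennreal (enn2real (hnorm f))" by (simp only: e prod.case)
    then have "norm (f y - f x) / \<rho> (y - x) \<le> enn2real (hnorm f)" by (subst (asm) ennreal_le_iff) auto
    then show ?thesis using weight_pos[of "y - x"] that by (simp add: pos_divide_le_eq)
  qed
qed

lemma hnorm_minus: "hnorm (\<lambda>x. f x - g x) = hnorm (\<lambda>x. g x - f x)"
proof -
  have "norm (f y - g y - (f x - g x)) = norm (g y - f y - (g x - f x))" for x y
    using norm_minus_commute[of "f y - g y" "f x - g x"] by (simp add: algebra_simps)
  then show ?thesis
    unfolding hnorm_def hoelder_norm_def by (simp add: norm_minus_commute)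
qed

lemma hnorm_triangle: "hnorm (\<lambda>x. f x + g x) \<le> hnorm f + hnorm g"
proof -
  have 1: "(SUP x\<in>{0..1}. ennreal (norm (f x + g x))) \<le> (SUP x\<in>{0..1}. ennreal (norm (f x))) + (SUP x\<in>{0..1}. ennreal (norm (g x)))"
  proof (rule SUP_least)
    fix x :: real assume x: "x \<in> {0..1}"
    have "ennreal (norm (f x + g x)) \<le> ennreal (norm (f x)) + ennreal (norm (g x))"
      by (simp add: norm_triangle_ineq flip: ennreal_plus)
    also have "\<dots> \<le> (SUP x\<in>{0..1}. ennreal (norm (f x))) + (SUP x\<in>{0..1}. ennreal (norm (g x)))"
      using x by (intro add_mono SUP_upper)
    finally show "ennreal (norm (f x + g x)) \<le> \<dots>" .
  qed
  let ?P = "{(x, y). 0 \<le> x \<and> x < y \<and> y \<le> (1::real)}"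
  have 2: "(SUP (x, y)\<in>?P. ennreal (norm (f y + g y - (f x + g x)) / \<rho> (y - x)))
     \<le> (SUP (x, y)\<in>?P. ennreal (norm (f y - f x) / \<rho> (y - x))) + (SUP (x, y)\<in>?P. ennreal (norm (g y - g x) / \<rho> (y - x)))"
  proof (rule SUP_least, clarify)
    fix x y :: real assume xy: "0 \<le> x" "x < y" "y \<le> 1"
    then have p: "0 < \<rho> (y - x)" by (intro weight_pos) auto
    have "norm (f y + g y - (f x + g x)) \<le> norm (f y - f x) + norm (g y - g x)"
      using norm_triangle_ineq[of "f y - f x" "g y - g x"] by (simp add: algebra_simps)
    then have "norm (f y + g y - (f x + g x)) / \<rho> (y - x) \<le> norm (f y - f x) / \<rho> (y - x) + norm (g y - g x) / \<rho> (y - x)"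
      using p by (simp add: divide_right_mono flip: add_divide_distrib)
    then have "ennreal (norm (f y + g y - (f x + g x)) / \<rho> (y - x)) \<le> ennreal (norm (f y - f x) / \<rho> (y - x)) + ennreal (norm (g y - g x) / \<rho> (y - x))"
      using p by (simp flip: ennreal_plus)
    also have "\<dots> \<le> (SUP (x, y)\<in>?P. ennreal (norm (f y - f x) / \<rho> (y - x))) + (SUP (x, y)\<in>?P. ennreal (norm (g y - g x) / \<rho> (y - x)))"
      using xy by (intro add_mono SUP_upper2[of "(x, y)"]) auto
    finally show "ennreal (norm (f y + g y - (f x + g x)) / \<rho> (y - x)) \<le> \<dots>" .
  qed
  show ?thesis unfolding hnorm_def hoelder_norm_def
    by (rule order_trans[OF add_mono[OF 1 2]]) (simp add: add_ac)
qed

lemma hnorm_diff_finite: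
  assumes "hnorm f < \<infinity>" "hnorm g < \<infinity>"
  shows "hnorm (\<lambda>x. f x - g x) < \<infinity>"
proof -
  have "hnorm (\<lambda>x. f x - g x) \<le> hnorm f + hnorm (\<lambda>x. 0 - g x)"
    using hnorm_triangle[of f "\<lambda>x. 0 - g x"] by simp
  also have "hnorm (\<lambda>x. 0 - g x) = hnorm g" using hnorm_minus[of "\<lambda>_. 0" g] by simp
  also have "hnorm f + hnorm g < \<infinity>" using assms by simp
  finally show ?thesis .
qed

lemma hspaceD: "f \<in> hspace \<Longrightarrow> hnorm f < \<infinity>" "f \<in> hspace \<Longrightarrow> f \<in> {0..1} \<rightarrow>\<^sub>E UNIV"
  by (simp_all only: hspace_iff)

lemma hdist_ge:
  assumes "f \<in> hspace" "g \<in> hspace"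
  shows "0 \<le> x \<Longrightarrow> x \<le> 1 \<Longrightarrow> norm (f x - g x) \<le> hdist f g"
    and "0 \<le> x \<Longrightarrow> x < y \<Longrightarrow> y \<le> 1 \<Longrightarrow> norm ((f y - g y) - (f x - g x)) \<le> hdist f g * \<rho> (y - x)"
  unfolding hdist_eq using hnorm_ge[OF hnorm_diff_finite[OF hspaceD(1)[OF assms(1)] hspaceD(1)[OF assms(2)]]] by auto

lemma hdist_le: "hnorm (\<lambda>x. f x - g x) \<le> ennreal c \<Longrightarrow> 0 \<le> c \<Longrightarrow> hdist f g \<le> c"
  unfolding hdist_eq using enn2real_mono[of "hnorm (\<lambda>x. f x - g x)" "ennreal c"] by simp

sublocale hoelder: Metric_space "hspace :: (real \<Rightarrow> 'h::real_normed_vector) set" hdist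
proof
  fix f g k :: "real \<Rightarrow> 'h"
  show "0 \<le> hdist f g" by (simp add: hdist_eq)
  show "hdist f g = hdist g f" unfolding hdist_eq by (subst hnorm_minus) simp
  assume f: "f \<in> hspace" and g: "g \<in> hspace"
  show "hdist f g = 0 \<longleftrightarrow> f = g"
  proof
    assume 0: "hdist f g = 0"
    show "f = g"
    proof (rule PiE_ext[OF hspaceD(2)[OF f] hspaceD(2)[OF g]])
      fix x :: real assume "x \<in> {0..1}"
      then show "f x = g x" using hdist_ge(1)[OF f g, of x] 0 by simp
    qed
  next
    assume "f = g"
    moreover have "hnorm (\<lambda>x. (0::'h)) \<le> ennreal (0 + 0)" by (rule hnorm_le) auto
    ultimately show "hdist f g = 0" by (simp add: hdist_eq)
  qed
  assume k: "k \<in> hspace"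
  have fin: "hnorm (\<lambda>x. f x - g x) < \<infinity>" "hnorm (\<lambda>x. g x - k x) < \<infinity>"
    by (rule hnorm_diff_finite[OF hspaceD(1)[OF f] hspaceD(1)[OF g]], rule hnorm_diff_finite[OF hspaceD(1)[OF g] hspaceD(1)[OF k]])
  have "hnorm (\<lambda>x. f x - k x) \<le> hnorm (\<lambda>x. f x - g x) + hnorm (\<lambda>x. g x - k x)"
    using hnorm_triangle[of "\<lambda>x. f x - g x" "\<lambda>x. g x - k x"] by simp
  then have "hdist f k \<le> enn2real (hnorm (\<lambda>x. f x - g x) + hnorm (\<lambda>x. g x - k x))"
    unfolding hdist_eq using fin by (intro enn2real_mono) auto
  also have "\<dots> = hdist f g + hdist g k" unfolding hdist_eq using fin by (intro enn2real_plus) auto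
  finally show "hdist f k \<le> hdist f g + hdist g k" .
qed

lemma log_weight_ge_1:
  fixes h :: real
  assumes "0 < h" "h \<le> 1"
  shows "1 \<le> (1 + log 2 (1/h)) powr \<beta>"
proof -
  have "0 \<le> log 2 (1/h)" using assms by (intro zero_le_log_cancel_iff[THEN iffD2]) auto
  then show ?thesis using \<beta> by (intro ge_one_powr_ge_zero) auto
qed

lemma sqrt_le_weight: "0 < h \<Longrightarrow> h \<le> 1 \<Longrightarrow> sqrt h \<le> C * \<rho> h"
  using weight_ge[of h] mult_left_mono[OF log_weight_ge_1[of h], of "sqrt h"]
  by (metis less_imp_le mult.right_neutral order_trans real_sqrt_ge_zero)

lemma hmod_le:
  assumes "\<And>x y. 0 \<le> x \<Longrightarrow> x < y \<Longrightarrow> y \<le> 1 \<Longrightarrow> y - x \<le> \<delta> \<Longrightarrow> norm (f y - f x) \<le> b * \<rho> (y - x)"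
  shows "hmod \<delta> f \<le> ennreal b"
  unfolding hmod_def
proof (rule SUP_least, clarify)
  fix x y :: real assume xy: "0 \<le> x" "x < y" "y \<le> x + \<delta>" "x + \<delta> \<le> 1"
  then have "norm (f y - f x) \<le> b * \<rho> (y - x)" by (intro assms) auto
  then show "ennreal (norm (f y - f x) / \<rho> (y - x)) \<le> ennreal b"
    using weight_pos[of "y - x"] xy by (intro ennreal_leI) (simp add: pos_divide_le_eq)
qed

text \<open>A square root modulus is smaller than the weight by the factor
  \<open>(1 + log 2 (1/h)) powr - \<beta>\<close>, up to constants, and this factor tends to zero
  with \<open>h\<close>. The partial sum processes and the polygons enter the space through this
  criterion; their constants \<open>k\<close> need not be uniform.\<close>

lemma hspace_sqrtI:
  assumes fext: "f \<in> {0..1} \<rightarrow>\<^sub>E UNIV" and k: "0 \<le> k"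
    and inc: "\<And>x y. 0 \<le> x \<Longrightarrow> x < y \<Longrightarrow> y \<le> 1 \<Longrightarrow> norm (f y - f x) \<le> k * sqrt (y - x)"
  shows "f \<in> hspace"
  unfolding hspace_iff
proof (intro conjI ballI)
  show "f \<in> {0..1} \<rightarrow>\<^sub>E UNIV" by (rule fext)
  have inc': "norm (f y - f x) \<le> k * sqrt \<bar>y - x\<bar>" if "x \<in> {0..1}" "y \<in> {0..1}" for x y
    using inc[of x y] inc[of y x] that by (cases x y rule: linorder_cases) (auto simp: norm_minus_commute abs_minus_commute)
  fix x :: real assume x: "x \<in> {0..1}"
  have "((\<lambda>y. k * sqrt \<bar>y - x\<bar>) \<longlongrightarrow> k * sqrt \<bar>x - x\<bar>) (at x within {0..1})" by (intro tendsto_intros)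
  then have "((\<lambda>y. k * sqrt \<bar>y - x\<bar>) \<longlongrightarrow> 0) (at x within {0..1})" by simp
  then show "((\<lambda>y. norm (f y - f x)) \<longlongrightarrow> 0) (at x within {0..1})"
    by (rule Lim_null_comparison[rotated]) (use inc' x in \<open>auto simp: eventually_at intro!: exI[of _ 1]\<close>)
next
  have "hnorm f \<le> ennreal ((norm (f 0) + k) + k * C)"
  proof (rule hnorm_le)
    fix x :: real assume x: "0 \<le> x" "x \<le> 1"
    show "norm (f x) \<le> norm (f 0) + k"
    proof (cases "x = 0")
      case False
      then have "norm (f x - f 0) \<le> k * sqrt (x - 0)" using x by (intro inc) auto
      also have "\<dots> \<le> k * 1" using x k by (intro mult_left_mono) auto
      finally show ?thesis using norm_triangle_sub[of "f x" "f 0"] by linarith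
    qed (use k in simp)
  next
    fix x y :: real assume x: "0 \<le> x" and y: "x < y" "y \<le> 1"
    have "norm (f y - f x) \<le> k * sqrt (y - x)" using x y by (intro inc)
    also have "\<dots> \<le> k * (C * \<rho> (y - x))" using x y k by (intro mult_left_mono sqrt_le_weight) auto
    finally show "norm (f y - f x) \<le> k * C * \<rho> (y - x)" by simp
  qed
  then show "hnorm f < \<infinity>" by (simp add: order.strict_trans1)
next
  have pos: "\<forall>\<^sub>F \<delta> in at_right 0. \<delta> \<in> {0<..1::real}"
    by (subst eventually_at_right_field) (auto intro!: exI[of _ 1])
  have le: "\<forall>\<^sub>F \<delta> in at_right 0. hmod \<delta> f \<le> ennreal (k * C * (1 + log 2 (1/\<delta>)) powr - \<beta>)"
    using pos
  proof eventually_elim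
    case (elim \<delta>)
    show ?case
    proof (rule hmod_le)
      fix x y :: real assume xy: "0 \<le> x" "x < y" "y \<le> 1" "y - x \<le> \<delta>"
      define h where "h = y - x"
      have h: "0 < h" "h \<le> 1" "h \<le> \<delta>" using xy by (auto simp: h_def)
      have l: "0 \<le> log 2 (1/\<delta>)" using elim by (intro zero_le_log_cancel_iff[THEN iffD2]) auto
      have "log 2 (1/\<delta>) \<le> log 2 (1/h)" using h elim by (subst log_le_cancel_iff) (auto simp: field_simps)
      then have m: "(1 + log 2 (1/\<delta>)) powr \<beta> \<le> (1 + log 2 (1/h)) powr \<beta>" using l \<beta> by (intro powr_mono2) auto
      have p: "(1 + log 2 (1/\<delta>)) powr \<beta> > 0" using l by auto
      have "sqrt h * (1 + log 2 (1/\<delta>)) powr \<beta> \<le> C * \<rho> h"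
        using mult_left_mono[OF m real_sqrt_ge_zero[OF less_imp_le[OF h(1)]]] weight_ge[OF h(1,2)] by linarith
      then have "sqrt h \<le> C * \<rho> h * (1 + log 2 (1/\<delta>)) powr - \<beta>" using p by (simp add: powr_minus field_simps)
      then have "k * sqrt h \<le> k * (C * \<rho> h * (1 + log 2 (1/\<delta>)) powr - \<beta>)" using k by (rule mult_left_mono)
      then show "norm (f y - f x) \<le> k * C * (1 + log 2 (1/\<delta>)) powr - \<beta> * \<rho> (y - x)"
        using inc[OF xy(1-3)] by (simp add: h_def mult_ac)
    qed
  qed
  have "((\<lambda>\<delta>. k * C * (1 + log 2 (1/\<delta>)) powr - \<beta>) \<longlongrightarrow> k * C * 0) (at_right 0)"
  proof (intro tendsto_mult tendsto_const)
    show "((\<lambda>\<delta>. (1 + log 2 (1/\<delta>)) powr - \<beta>) \<longlongrightarrow> 0) (at_right 0)"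
      using \<beta> by real_asymp
  qed
  then have "((\<lambda>\<delta>. ennreal (k * C * (1 + log 2 (1/\<delta>)) powr - \<beta>)) \<longlongrightarrow> ennreal 0) (at_right 0)"
    by (intro tendsto_ennrealI) simp
  then have "((\<lambda>\<delta>. ennreal (k * C * (1 + log 2 (1/\<delta>)) powr - \<beta>)) \<longlongrightarrow> 0) (at_right 0)" by simp
  then show "((\<lambda>\<delta>. hmod \<delta> f) \<longlongrightarrow> 0) (at_right 0)"
    by (rule tendsto_sandwich[OF _ le tendsto_const, rotated]) simp
qed

text \<open>A Cauchy sequence converges pointwise, and bounds on values and difference quotients are
  closed under pointwise limits, so the distance estimates carry over. Continuity and the vanishing
  modulus survive because they hold for one term that is close in both senses. The paths of the
  limit process will be obtained as such limits.\<close>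

lemma hoelder_mcomplete: "Metric_space.mcomplete (hspace :: (real \<Rightarrow> 'h::banach) set) hdist"
  unfolding hoelder.mcomplete_def
proof (intro allI impI)
  fix \<sigma> :: "nat \<Rightarrow> real \<Rightarrow> 'h"
  assume "hoelder.MCauchy \<sigma>"
  then have S: "\<And>n. \<sigma> n \<in> hspace" and Ca: "\<And>\<epsilon>. \<epsilon> > 0 \<Longrightarrow> \<exists>N. \<forall>n n'. N \<le> n \<longrightarrow> N \<le> n' \<longrightarrow> hdist (\<sigma> n) (\<sigma> n') < \<epsilon>"
    by (auto simp: hoelder.MCauchy_def)
  have pc: "Cauchy (\<lambda>n. \<sigma> n x)" if "0 \<le> x" "x \<le> 1" for x
  proof (rule CauchyI)
    fix e :: real assume "e > 0"
    from Ca[OF this] obtain N where "\<forall>n n'. N \<le> n \<longrightarrow> N \<le> n' \<longrightarrow> hdist (\<sigma> n) (\<sigma> n') < e" by blast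
    then show "\<exists>M. \<forall>m\<ge>M. \<forall>n\<ge>M. norm (\<sigma> m x - \<sigma> n x) < e"
      using hdist_ge(1)[OF S S that] by (meson le_less_trans)
  qed
  define f where "f = (\<lambda>x\<in>{0..1}. lim (\<lambda>n. \<sigma> n x))"
  have lim: "(\<lambda>n. \<sigma> n x) \<longlonglongrightarrow> f x" if "0 \<le> x" "x \<le> 1" for x
    using pc[OF that] that by (simp add: f_def Cauchy_convergent_iff convergent_LIMSEQ_iff)
  have close: "\<exists>N. \<forall>n\<ge>N. (\<forall>x. 0 \<le> x \<and> x \<le> 1 \<longrightarrow> norm (f x - \<sigma> n x) \<le> e) \<and>
      (\<forall>x y. 0 \<le> x \<and> x < y \<and> y \<le> 1 \<longrightarrow> norm ((f y - \<sigma> n y) - (f x - \<sigma> n x)) \<le> e * \<rho> (y - x))" if e: "e > 0" for e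
  proof -
    from Ca[OF e] obtain N where N: "\<And>n n'. N \<le> n \<Longrightarrow> N \<le> n' \<Longrightarrow> hdist (\<sigma> n) (\<sigma> n') < e" by blast
    show ?thesis
    proof (intro exI[of _ N] allI impI conjI; elim conjE)
      fix n x assume n: "N \<le> n" and x: "0 \<le> x" "x \<le> (1::real)"
      have "(\<lambda>m. norm (\<sigma> m x - \<sigma> n x)) \<longlonglongrightarrow> norm (f x - \<sigma> n x)" by (intro tendsto_intros lim x)
      moreover have "norm (\<sigma> m x - \<sigma> n x) \<le> e" if "m \<ge> N" for m
        using hdist_ge(1)[OF S S x, of m n] N[OF that n] by linarith
      ultimately show "norm (f x - \<sigma> n x) \<le> e" by (intro LIMSEQ_le_const2) auto
    next
      fix n and x y :: real assume n: "N \<le> n" and x: "0 \<le> x" "x < y" "y \<le> (1::real)"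
      have "(\<lambda>m. norm ((\<sigma> m y - \<sigma> n y) - (\<sigma> m x - \<sigma> n x))) \<longlonglongrightarrow> norm ((f y - \<sigma> n y) - (f x - \<sigma> n x))"
        using x by (intro tendsto_intros lim) auto
      moreover have "norm ((\<sigma> m y - \<sigma> n y) - (\<sigma> m x - \<sigma> n x)) \<le> e * \<rho> (y - x)" if "m \<ge> N" for m
      proof -
        have "hdist (\<sigma> m) (\<sigma> n) * \<rho> (y - x) \<le> e * \<rho> (y - x)"
          using N[OF that n] weight_pos[of "y - x"] x by (intro mult_right_mono) auto
        then show ?thesis using hdist_ge(2)[OF S S x, of m n] by linarith
      qed
      ultimately show "norm ((f y - \<sigma> n y) - (f x - \<sigma> n x)) \<le> e * \<rho> (y - x)" by (intro LIMSEQ_le_const2) auto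
    qed
  qed
  have hn: "\<exists>N. \<forall>n\<ge>N. hnorm (\<lambda>x. f x - \<sigma> n x) \<le> ennreal e" if "e > 0" for e
  proof -
    from close[OF half_gt_zero[OF that]] obtain N where N: "\<And>n x. n \<ge> N \<Longrightarrow> 0 \<le> x \<Longrightarrow> x \<le> 1 \<Longrightarrow> norm (f x - \<sigma> n x) \<le> e/2"
      "\<And>n x y. n \<ge> N \<Longrightarrow> 0 \<le> x \<Longrightarrow> x < y \<Longrightarrow> y \<le> 1 \<Longrightarrow> norm ((f y - \<sigma> n y) - (f x - \<sigma> n x)) \<le> e/2 * \<rho> (y - x)"
      by blast
    have "hnorm (\<lambda>x. f x - \<sigma> n x) \<le> ennreal (e/2 + e/2)" if "n \<ge> N" for n
      by (rule hnorm_le) (use N that in auto)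
    then show ?thesis by auto
  qed
  have fS: "f \<in> hspace"
    unfolding hspace_iff
  proof (intro conjI ballI)
    show "f \<in> {0..1} \<rightarrow>\<^sub>E UNIV" by (auto simp: f_def)
    fix x :: real assume x: "x \<in> {0..1}"
    show "((\<lambda>y. norm (f y - f x)) \<longlongrightarrow> 0) (at x within {0..1})"
    proof (rule tendstoI)
      fix e :: real assume e: "e > 0"
      have "0 < e/4" using e by simp
      from close[OF this] obtain N where N: "\<And>y. 0 \<le> y \<Longrightarrow> y \<le> 1 \<Longrightarrow> norm (f y - \<sigma> N y) \<le> e/4" by blast
      have "((\<lambda>y. norm (\<sigma> N y - \<sigma> N x)) \<longlongrightarrow> 0) (at x within {0..1})" using S[of N] x by (simp add: hspace_iff)
      then have "\<forall>\<^sub>F y in at x within {0..1}. norm (\<sigma> N y - \<sigma> N x) < e/4" by (rule order_tendstoD) (use e in simp)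
      moreover have "\<forall>\<^sub>F y in at x within {0..1}. y \<in> {0..1}" by (simp add: eventually_at_filter)
      ultimately show "\<forall>\<^sub>F y in at x within {0..1}. dist (norm (f y - f x)) 0 < e"
      proof eventually_elim
        case (elim y)
        have "norm (f y - f x) \<le> norm (f y - \<sigma> N y) + norm (\<sigma> N y - \<sigma> N x) + norm (f x - \<sigma> N x)"
          using dist_triangle[of "f y" "f x" "\<sigma> N y"] dist_triangle[of "\<sigma> N y" "f x" "\<sigma> N x"]
          by (simp add: dist_norm norm_minus_commute)
        then show ?case using N[of x] N[of y] x elim e by (auto simp: dist_real_def)
      qed
    qed
  next
    from hn[OF zero_less_one] obtain N where N: "hnorm (\<lambda>x. f x - \<sigma> N x) \<le> ennreal 1" by auto
    have "hnorm f \<le> hnorm (\<lambda>x. f x - \<sigma> N x) + hnorm (\<sigma> N)"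
      using hnorm_triangle[of "\<lambda>x. f x - \<sigma> N x" "\<sigma> N"] by simp
    also have "\<dots> < \<infinity>" using hspaceD(1)[OF S[of N]] N by (auto simp: order.strict_trans1)
    finally show "hnorm f < \<infinity>" .
  next
    show "((\<lambda>\<delta>. hmod \<delta> f) \<longlongrightarrow> 0) (at_right 0)"
    proof (rule order_tendstoI)
      fix a :: ennreal assume a: "0 < a"
      \<comment> \<open>\<open>a\<close> may be infinite, hence the case split. The factor 2 leaves
        one \<open>r\<close> for the approximation and one for the modulus of
        \<open>\<sigma> N\<close>.\<close>
      obtain r where r: "r > 0" "ennreal (2 * r) < a"
      proof (cases a)
        case (real s)
        then show ?thesis using a by (intro that[of "s/4"]) (auto simp: ennreal_less_iff)
      next
        case top
        then show ?thesis by (intro that[of 1]) auto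
      qed
      from close[OF r(1)] obtain N where N: "\<And>x y. 0 \<le> x \<Longrightarrow> x < y \<Longrightarrow> y \<le> 1 \<Longrightarrow> norm ((f y - \<sigma> N y) - (f x - \<sigma> N x)) \<le> r * \<rho> (y - x)" by blast
      have "((\<lambda>\<delta>. hmod \<delta> (\<sigma> N)) \<longlongrightarrow> 0) (at_right 0)" using S[of N] by (simp add: hspace_iff)
      then have "\<forall>\<^sub>F \<delta> in at_right 0. hmod \<delta> (\<sigma> N) < ennreal r" by (rule order_tendstoD) (use r in simp)
      then show "\<forall>\<^sub>F \<delta> in at_right 0. hmod \<delta> f < a"
      proof eventually_elim
        case (elim \<delta>)
        have "hmod \<delta> f \<le> ennreal (2 * r)"
          unfolding hmod_def
        proof (rule SUP_least, clarify)
          fix x y :: real assume xy: "0 \<le> x" "x < y" "y \<le> x + \<delta>" "x + \<delta> \<le> 1"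
          then have p: "0 < \<rho> (y - x)" by (intro weight_pos) auto
          have "(case (x, y) of (x, y) \<Rightarrow> ennreal (norm (\<sigma> N y - \<sigma> N x) / \<rho> (y - x))) \<le> hmod \<delta> (\<sigma> N)"
            unfolding hmod_def by (rule SUP_upper) (use xy in auto)
          then have "ennreal (norm (\<sigma> N y - \<sigma> N x) / \<rho> (y - x)) < ennreal r" using elim by simp
          then have "norm (\<sigma> N y - \<sigma> N x) / \<rho> (y - x) < r" using p by (subst (asm) ennreal_less_iff) auto
          then have 1: "norm (\<sigma> N y - \<sigma> N x) \<le> r * \<rho> (y - x)" using p by (simp add: pos_divide_less_eq)
          have "norm (f y - f x) \<le> norm ((f y - \<sigma> N y) - (f x - \<sigma> N x)) + norm (\<sigma> N y - \<sigma> N x)"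
            using norm_triangle_ineq[of "(f y - \<sigma> N y) - (f x - \<sigma> N x)" "\<sigma> N y - \<sigma> N x"] by (simp add: algebra_simps)
          also have "\<dots> \<le> r * \<rho> (y - x) + r * \<rho> (y - x)" using N[of x y] 1 xy by (intro add_mono) auto
          finally have "norm (f y - f x) / \<rho> (y - x) \<le> 2 * r" using p by (simp add: pos_divide_le_eq)
          then show "ennreal (norm (f y - f x) / \<rho> (y - x)) \<le> ennreal (2 * r)" by (rule ennreal_leI)
        qed
        then show ?case using r(2) by simp
      qed
    qed simp
  qed
  have "limitin hoelder.mtopology \<sigma> f sequentially"
    unfolding hoelder.limit_metric_sequentially
  proof (intro conjI allI impI fS)
    fix e :: real assume e: "e > 0"
    from hn[of "e/2"] e obtain N where N: "\<And>n. n \<ge> N \<Longrightarrow> hnorm (\<lambda>x. f x - \<sigma> n x) \<le> ennreal (e/2)" by auto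
    have "hdist (\<sigma> n) f < e" if "n \<ge> N" for n
      using hdist_le[OF N[OF that]] e by (simp add: hoelder.commute)
    then show "\<exists>N. \<forall>n\<ge>N. \<sigma> n \<in> hspace \<and> hdist (\<sigma> n) f < e" using S by blast
  qed
  then show "\<exists>x. limitin hoelder.mtopology \<sigma> x sequentially" by blast
qed

text \<open>Deterministic scalar time profiles \<open>u i\<close> with vector coefficients. Both the
  partial sum processes and their polygonal approximations have this shape, so membership, distance
  and continuity are proved once for both.\<close>

definition lincomb :: "'i set \<Rightarrow> ('i \<Rightarrow> real \<Rightarrow> real) \<Rightarrow> ('i \<Rightarrow> 'h::real_normed_vector) \<Rightarrow> real \<Rightarrow> 'h" where
  "lincomb I u a = (\<lambda>x\<in>{0..1}. \<Sum>i\<in>I. u i x *\<^sub>R a i)"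

definition sqrt_lip :: "(real \<Rightarrow> real) \<Rightarrow> bool" where
  "sqrt_lip u \<longleftrightarrow> (\<exists>k\<ge>0. \<forall>x y. 0 \<le> x \<and> x < y \<and> y \<le> 1 \<longrightarrow> \<bar>u y - u x\<bar> \<le> k * sqrt (y - x))"

lemma lincomb_hspace:
  assumes "finite I" "\<And>i. i \<in> I \<Longrightarrow> sqrt_lip (u i)"
  shows "lincomb I u a \<in> hspace"
proof -
  have "\<forall>i\<in>I. \<exists>k. k \<ge> 0 \<and> (\<forall>x y. 0 \<le> x \<and> x < y \<and> y \<le> 1 \<longrightarrow> \<bar>u i y - u i x\<bar> \<le> k * sqrt (y - x))"
    using assms(2) by (auto simp: sqrt_lip_def)
  from bchoice[OF this] obtain k where k: "\<And>i. i \<in> I \<Longrightarrow> k i \<ge> 0"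
    "\<And>i x y. i \<in> I \<Longrightarrow> 0 \<le> x \<Longrightarrow> x < y \<Longrightarrow> y \<le> 1 \<Longrightarrow> \<bar>u i y - u i x\<bar> \<le> k i * sqrt (y - x)" by blast
  show ?thesis
  proof (rule hspace_sqrtI)
    show "lincomb I u a \<in> {0..1} \<rightarrow>\<^sub>E UNIV" by (auto simp: lincomb_def)
    show "0 \<le> (\<Sum>i\<in>I. k i * norm (a i))" using k by (intro sum_nonneg) auto
    fix x y :: real assume xy: "0 \<le> x" "x < y" "y \<le> 1"
    have "norm (lincomb I u a y - lincomb I u a x) = norm (\<Sum>i\<in>I. (u i y - u i x) *\<^sub>R a i)"
      using xy by (simp add: lincomb_def sum_subtractf scaleR_left_diff_distrib)
    also have "\<dots> \<le> (\<Sum>i\<in>I. \<bar>u i y - u i x\<bar> * norm (a i))" by (rule sum_norm_le) simp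
    also have "\<dots> \<le> (\<Sum>i\<in>I. (k i * sqrt (y - x)) * norm (a i))" using k xy by (intro sum_mono mult_right_mono) auto
    finally show "norm (lincomb I u a y - lincomb I u a x) \<le> (\<Sum>i\<in>I. k i * norm (a i)) * sqrt (y - x)"
      by (simp add: sum_distrib_left sum_distrib_right mult_ac)
  qed
qed

lemma lincomb_dist:
  assumes "finite I" "\<And>i. i \<in> I \<Longrightarrow> sqrt_lip (u i)"
  shows "\<exists>k. (\<forall>i\<in>I. 0 \<le> k i) \<and>
    (\<forall>(a :: 'i \<Rightarrow> 'h::real_normed_vector) b. hdist (lincomb I u a) (lincomb I u b) \<le> (\<Sum>i\<in>I. k i * norm (a i - b i)))"
proof -
  have "\<forall>i\<in>I. \<exists>k. k \<ge> 0 \<and> (\<forall>x y. 0 \<le> x \<and> x < y \<and> y \<le> 1 \<longrightarrow> \<bar>u i y - u i x\<bar> \<le> k * sqrt (y - x))"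
    using assms(2) by (auto simp: sqrt_lip_def)
  from bchoice[OF this] obtain k where k: "\<And>i. i \<in> I \<Longrightarrow> k i \<ge> 0"
    "\<And>i x y. i \<in> I \<Longrightarrow> 0 \<le> x \<Longrightarrow> x < y \<Longrightarrow> y \<le> 1 \<Longrightarrow> \<bar>u i y - u i x\<bar> \<le> k i * sqrt (y - x)" by blast
  define k' where "k' i = (\<bar>u i 0\<bar> + k i) + k i * C" for i
  have dist: "hdist (lincomb I u a) (lincomb I u b) \<le> (\<Sum>i\<in>I. k' i * norm (a i - b i))" for a b :: "'i \<Rightarrow> 'h"
  proof (rule hdist_le)
    define c where "c i = a i - b i" for i
    have d: "lincomb I u a x - lincomb I u b x = (\<Sum>i\<in>I. u i x *\<^sub>R c i)" if "0 \<le> x" "x \<le> 1" for x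
      using that by (simp add: lincomb_def c_def sum_subtractf scaleR_right_diff_distrib)
    have ub: "\<bar>u i x\<bar> \<le> \<bar>u i 0\<bar> + k i" if "i \<in> I" "0 \<le> x" "x \<le> 1" for i x
    proof (cases "x = 0")
      case False
      then have "\<bar>u i x - u i 0\<bar> \<le> k i * sqrt (x - 0)" using that by (intro k) auto
      also have "\<dots> \<le> k i * 1" using that k by (intro mult_left_mono) auto
      finally show ?thesis by linarith
    qed (use k that in auto)
    have "hnorm (\<lambda>x. lincomb I u a x - lincomb I u b x)
      \<le> ennreal ((\<Sum>i\<in>I. (\<bar>u i 0\<bar> + k i) * norm (c i)) + (\<Sum>i\<in>I. k i * C * norm (c i)))"
    proof (rule hnorm_le)
      fix x :: real assume x: "0 \<le> x" "x \<le> 1"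
      show "norm (lincomb I u a x - lincomb I u b x) \<le> (\<Sum>i\<in>I. (\<bar>u i 0\<bar> + k i) * norm (c i))"
        unfolding d[OF x] by (rule sum_norm_le) (use ub x in \<open>auto intro!: mult_right_mono\<close>)
    next
      fix x y :: real assume x0: "0 \<le> x" and y: "x < y" "y \<le> 1"
      have x: "0 \<le> x" "x \<le> 1" using x0 y by auto
      have "norm (\<Sum>i\<in>I. (u i y - u i x) *\<^sub>R c i) \<le> (\<Sum>i\<in>I. (k i * sqrt (y - x)) * norm (c i))"
        by (rule sum_norm_le) (use k x y in \<open>auto intro!: mult_right_mono\<close>)
      also have "\<dots> \<le> (\<Sum>i\<in>I. (k i * (C * \<rho> (y - x))) * norm (c i))"
        using k x y by (intro sum_mono mult_right_mono mult_left_mono sqrt_le_weight) auto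
      also have "\<dots> = (\<Sum>i\<in>I. k i * C * norm (c i)) * \<rho> (y - x)"
        unfolding sum_distrib_right by (intro sum.cong refl) simp
      finally show "norm (lincomb I u a y - lincomb I u b y - (lincomb I u a x - lincomb I u b x)) \<le> (\<Sum>i\<in>I. k i * C * norm (c i)) * \<rho> (y - x)"
        using x y by (simp add: d scaleR_left_diff_distrib sum_subtractf)
    qed
    also have "(\<Sum>i\<in>I. (\<bar>u i 0\<bar> + k i) * norm (c i)) + (\<Sum>i\<in>I. k i * C * norm (c i)) = (\<Sum>i\<in>I. k' i * norm (a i - b i))"
      by (simp add: sum.distrib[symmetric] k'_def c_def algebra_simps)
    finally show "hnorm (\<lambda>x. lincomb I u a x - lincomb I u b x) \<le> ennreal (\<Sum>i\<in>I. k' i * norm (a i - b i))" .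
    show "0 \<le> (\<Sum>i\<in>I. k' i * norm (a i - b i))" using k C by (intro sum_nonneg) (auto simp: k'_def)
  qed
  have k'0: "0 \<le> k' i" if "i \<in> I" for i using k(1)[OF that] C by (simp add: k'_def)
  show ?thesis by (intro exI[of _ k'] conjI ballI allI k'0 dist)
qed

text \<open>The Hoelder distance is at most a fixed weighted sum of the distances of the
  coefficients. Borel measurability of the random paths in the norm topology rests on this
  continuity.\<close>

lemma lincomb_continuous:
  fixes a :: "'t::topological_space \<Rightarrow> 'i \<Rightarrow> 'h::real_normed_vector"
  assumes I: "finite I" "\<And>i. i \<in> I \<Longrightarrow> sqrt_lip (u i)" and a: "\<And>i. i \<in> I \<Longrightarrow> continuous_on UNIV (\<lambda>t. a t i)"
  shows "continuous_map euclidean hoelder.mtopology (\<lambda>t. lincomb I u (a t))"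
  unfolding hoelder.continuous_map_to_metric
proof (intro ballI allI impI)
  fix t :: 't and \<epsilon> :: real assume \<epsilon>: "0 < \<epsilon>"
  obtain k where k: "\<And>i. i \<in> I \<Longrightarrow> 0 \<le> k i"
    "\<And>(a :: 'i \<Rightarrow> 'h) b. hdist (lincomb I u a) (lincomb I u b) \<le> (\<Sum>i\<in>I. k i * norm (a i - b i))"
    using lincomb_dist[of I u, where 'h='h, OF I] by auto
  define U where "U = {s. (\<Sum>i\<in>I. k i * norm (a t i - a s i)) < \<epsilon>}"
  have "open U" unfolding U_def by (intro open_Collect_less continuous_intros a)
  moreover have "t \<in> U" using \<epsilon> by (simp add: U_def)
  moreover have "lincomb I u (a s) \<in> hoelder.mball (lincomb I u (a t)) \<epsilon>" if "s \<in> U" for s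
    using that k(2)[of "a t" "a s"] lincomb_hspace[OF I] by (auto simp: U_def)
  ultimately show "\<exists>U. openin euclidean U \<and> t \<in> U \<and> (\<forall>s\<in>U. lincomb I u (a s) \<in> hoelder.mball (lincomb I u (a t)) \<epsilon>)"
    by auto
qed

end

section \<open>Weak convergence in metric spaces\<close>

lemma space_borel_of [simp]: "space (borel_of X) = topspace X"
  unfolding borel_of_def by (rule space_measure_of) (auto dest: openin_subset)

lemma sets_borel_of: "sets (borel_of X) = sigma_sets (topspace X) {U. openin X U}"
  unfolding borel_of_def by (rule sets_measure_of) (auto dest: openin_subset)

lemma openin_sets_borel_of: "openin X U \<Longrightarrow> U \<in> sets (borel_of X)"
  unfolding sets_borel_of by auto

lemma measurable_borel_ofI:
  assumes "f \<in> space M \<rightarrow> topspace X" "\<And>U. openin X U \<Longrightarrow> f -` U \<inter> space M \<in> sets M"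
  shows "f \<in> measurable M (borel_of X)"
  unfolding borel_of_def by (rule measurable_sigma_sets[OF sets_measure_of]) (use assms in \<open>auto dest: openin_subset\<close>)

lemma continuous_map_measurable:
  assumes "continuous_map X Y f"
  shows "f \<in> measurable (borel_of X) (borel_of Y)"
proof (rule measurable_borel_ofI)
  show "f \<in> space (borel_of X) \<rightarrow> topspace Y" using continuous_map_image_subset_topspace[OF assms] by auto
  fix U assume "openin Y U"
  then have "openin X {x \<in> topspace X. f x \<in> U}" by (rule openin_continuous_map_preimage[OF assms])
  moreover have "f -` U \<inter> space (borel_of X) = {x \<in> topspace X. f x \<in> U}" by auto
  ultimately show "f -` U \<inter> space (borel_of X) \<in> sets (borel_of X)" by (simp add: openin_sets_borel_of)
qed

lemma borel_of_euclidean: "borel_of euclidean = borel"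
  unfolding borel_of_def borel_def by simp

lemma continuous_map_euclidean_measurable:
  "continuous_map X euclideanreal h \<Longrightarrow> h \<in> borel_measurable (borel_of X)"
  using continuous_map_measurable[of X euclideanreal h] by (simp add: borel_of_euclidean)

context Metric_space
begin

lemma lipschitz_continuous_map:
  assumes "\<And>x y. x \<in> M \<Longrightarrow> y \<in> M \<Longrightarrow> \<bar>h x - h y\<bar> \<le> L * d x y"
  shows "continuous_map mtopology euclideanreal h"
proof -
  \<comment> \<open>\<open>L\<close> may be negative or zero, so a positive constant at least as
    large is used as the divisor.\<close>
  have L: "0 \<le> max L 0 + 1" "max L 0 + 1 > 0" by auto
  have "\<exists>U. openin mtopology U \<and> x \<in> U \<and> (\<forall>y\<in>U. h y \<in> Met_TC.mball (h x) \<epsilon>)" if "x \<in> M" "0 < \<epsilon>" for x \<epsilon>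
  proof (intro exI conjI ballI)
    show "openin mtopology (mball x (\<epsilon> / (max L 0 + 1)))" by (rule openin_mball)
    show "x \<in> mball x (\<epsilon> / (max L 0 + 1))" using that L by auto
    fix y assume y: "y \<in> mball x (\<epsilon> / (max L 0 + 1))"
    have "\<bar>h x - h y\<bar> \<le> L * d x y" using assms that y by auto
    also have "\<dots> \<le> (max L 0 + 1) * d x y" using nonneg[of x y] by (intro mult_right_mono) auto
    also have "\<dots> < \<epsilon>" using y L by (simp add: pos_less_divide_eq mult.commute)
    finally show "h y \<in> Met_TC.mball (h x) \<epsilon>" by (simp add: dist_real_def)
  qed
  then show ?thesis
    using Met_TC.continuous_map_to_metric[of mtopology h] by simp
qed

text \<open>A bounded continuous \<open>h\<close> is the pointwise limit from below of its Lipschitz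
  envelopes, the infima over \<open>y\<close> of \<open>h y + real k * d x y\<close>. They give a
  lower bound for the lower limit of the integrals; the same bound for \<open>- h\<close> is the
  upper one.\<close>

theorem converges_in_distribution_lipschitz:
  assumes \<Omega>: "\<And>N. prob_space (\<Omega> N)" and Q: "prob_space Q"
    and Z: "\<And>N. Z N \<in> measurable (\<Omega> N) (borel_of mtopology)" and W: "W \<in> measurable Q (borel_of mtopology)"
    and lip: "\<And>h L B. (\<And>x y. x \<in> M \<Longrightarrow> y \<in> M \<Longrightarrow> \<bar>h x - h y\<bar> \<le> L * d x y) \<Longrightarrow> (\<And>x. x \<in> M \<Longrightarrow> \<bar>h x\<bar> \<le> B) \<Longrightarrow>
      (\<lambda>N. \<integral>\<omega>. h (Z N \<omega>) \<partial>\<Omega> N) \<longlonglongrightarrow> (\<integral>\<omega>. h (W \<omega>) \<partial>Q)"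
  shows "converges_in_distribution mtopology \<Omega> Z Q W"
proof -
  interpret Q: prob_space Q by fact
  have WM: "W \<omega> \<in> M" if "\<omega> \<in> space Q" for \<omega> using measurable_space[OF W that] by simp
  have ZM: "Z N \<omega> \<in> M" if "\<omega> \<in> space (\<Omega> N)" for \<omega> N using measurable_space[OF Z that] by simp
  have int: "integrable P (\<lambda>\<omega>. h (U \<omega>))"
    if "prob_space P" "U \<in> measurable P (borel_of mtopology)" "continuous_map mtopology euclideanreal h" "\<And>x. x \<in> M \<Longrightarrow> \<bar>h x\<bar> \<le> B"
    for P :: "'p measure" and U h B
  proof -
    interpret P: prob_space P by fact
    show ?thesis
    proof (rule P.integrable_const_bound[of _ B])
      show "AE \<omega> in P. norm (h (U \<omega>)) \<le> B" using measurable_space[OF that(2)] that(4) by (intro AE_I2) simp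
      show "(\<lambda>\<omega>. h (U \<omega>)) \<in> borel_measurable P"
        using measurable_compose[OF that(2) continuous_map_euclidean_measurable[OF that(3)]] .
    qed
  qed
  have lower: "\<forall>\<^sub>F N in sequentially. (\<integral>\<omega>. h (W \<omega>) \<partial>Q) - \<epsilon> < (\<integral>\<omega>. h (Z N \<omega>) \<partial>\<Omega> N)"
    if h: "continuous_map mtopology euclideanreal h" and B: "\<And>x. x \<in> M \<Longrightarrow> \<bar>h x\<bar> \<le> B" and \<epsilon>: "0 < \<epsilon>" for h B and \<epsilon> :: real
  proof -
    define g where "g k x = (INF y\<in>M. h y + real k * d x y)" for k x
    have bdd: "bdd_below ((\<lambda>y. h y + real k * d x y) ` M)" if "x \<in> M" for k x
    proof (rule bdd_belowI2[of _ "- B"])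
      fix y assume "y \<in> M"
      then show "- B \<le> h y + real k * d x y" using B[of y] nonneg[of x y] by (simp add: abs_le_iff add_increasing2)
    qed
    have gle: "g k x \<le> h y + real k * d x y" if "x \<in> M" "y \<in> M" for k x y
      unfolding g_def by (rule cINF_lower[OF bdd]) (use that in auto)
    have gh: "g k x \<le> h x" if "x \<in> M" for k x using gle[OF that that] that by simp
    have gB: "- B \<le> g k x" if "x \<in> M" for k x
      unfolding g_def
    proof (rule cINF_greatest)
      fix y assume "y \<in> M"
      then show "- B \<le> h y + real k * d x y" using B[of y] nonneg[of x y] by (simp add: abs_le_iff add_increasing2)
    qed (use that in auto)
    have gb: "\<bar>g k x\<bar> \<le> B" if "x \<in> M" for k x
      using gh[OF that, of k] gB[OF that, of k] B[OF that] by linarith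
    have glip1: "g k x - g k x' \<le> real k * d x x'" if x: "x \<in> M" "x' \<in> M" for k x x'
    proof -
      have "g k x - real k * d x x' \<le> g k x'"
        unfolding g_def[of k x']
      proof (rule cINF_greatest)
        fix y assume y: "y \<in> M"
        have "g k x \<le> h y + real k * d x y" by (rule gle[OF x(1) y])
        also have "\<dots> \<le> h y + real k * (d x x' + d x' y)" using triangle[OF x y] by (intro add_left_mono mult_left_mono) auto
        finally show "g k x - real k * d x x' \<le> h y + real k * d x' y" by (simp add: algebra_simps)
      qed (use x in auto)
      then show ?thesis by simp
    qed
    have glip: "\<bar>g k x - g k x'\<bar> \<le> real k * d x x'" if "x \<in> M" "x' \<in> M" for k x x'
      using glip1[OF that, of k] glip1[OF that(2,1), of k] commute[of x x'] by (simp add: abs_le_iff)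
    have glim: "(\<lambda>k. g k x) \<longlonglongrightarrow> h x" if x: "x \<in> M" for x
    proof (rule LIMSEQ_I)
      fix r :: real assume r: "0 < r"
      have "\<forall>x\<in>M. \<forall>\<epsilon>>0. \<exists>U. openin mtopology U \<and> x \<in> U \<and> (\<forall>y\<in>U. dist (h x) (h y) < \<epsilon>)"
        using h Met_TC.continuous_map_to_metric[of mtopology h] by simp
      from this[rule_format, OF x half_gt_zero[OF r]]
      obtain U where U: "openin mtopology U" "x \<in> U" "\<And>y. y \<in> U \<Longrightarrow> \<bar>h x - h y\<bar> < r/2"
        unfolding dist_real_def by blast
      then obtain \<delta> where \<delta>: "\<delta> > 0" "mball x \<delta> \<subseteq> U" unfolding openin_mtopology by blast
      \<comment> \<open>Points at distance at least \<delta> pay a penalty of at least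
        \<open>2 * B\<close>, the full oscillation of \<open>h\<close>, so only near points can
        lower the infimum.\<close>
      obtain k0 :: nat where k0: "2 * B / \<delta> < real k0" using reals_Archimedean2 by blast
      have "norm (g k x - h x) < r" if "k \<ge> k0" for k
      proof -
        have "h x - r/2 \<le> g k x"
          unfolding g_def
        proof (rule cINF_greatest)
          fix y assume y: "y \<in> M"
          show "h x - r/2 \<le> h y + real k * d x y"
          proof (cases "d x y < \<delta>")
            case True
            then have "\<bar>h x - h y\<bar> < r/2" using \<delta> U(3) x y by auto
            moreover have "0 \<le> real k * d x y" using nonneg[of x y] by simp
            ultimately show ?thesis by linarith
          next
            case False
            have "2 * B \<le> real k0 * \<delta>" using k0 \<delta> by (simp add: field_simps)
            also have "\<dots> \<le> real k * d x y" using that False \<delta> by (intro mult_mono) auto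
            finally show ?thesis using B[OF x] B[OF y] r by (auto simp: abs_le_iff)
          qed
        qed (use x in auto)
        then show ?thesis using gh[OF x, of k] r by simp
      qed
      then show "\<exists>no. \<forall>n\<ge>no. norm (g n x - h x) < r" by blast
    qed
    have gc: "continuous_map mtopology euclideanreal (g k)" for k
      by (rule lipschitz_continuous_map[OF glip])
    have "(\<lambda>k. \<integral>\<omega>. g k (W \<omega>) \<partial>Q) \<longlonglongrightarrow> (\<integral>\<omega>. h (W \<omega>) \<partial>Q)"
    proof (rule integral_dominated_convergence[where w="\<lambda>_. B"])
      show "(\<lambda>\<omega>. h (W \<omega>)) \<in> borel_measurable Q" "\<And>k. (\<lambda>\<omega>. g k (W \<omega>)) \<in> borel_measurable Q"
        using measurable_compose[OF W continuous_map_euclidean_measurable[OF h]]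
          measurable_compose[OF W continuous_map_euclidean_measurable[OF gc]] by auto
      show "AE \<omega> in Q. (\<lambda>k. g k (W \<omega>)) \<longlonglongrightarrow> h (W \<omega>)" by (intro AE_I2 glim WM)
      show "AE \<omega> in Q. norm (g k (W \<omega>)) \<le> B" for k using gb WM by (intro AE_I2) simp
    qed simp
    then have "\<forall>\<^sub>F k in sequentially. (\<integral>\<omega>. h (W \<omega>) \<partial>Q) - \<epsilon> < (\<integral>\<omega>. g k (W \<omega>) \<partial>Q)"
      using \<epsilon> by (simp add: order_tendsto_iff)
    then obtain k where k: "(\<integral>\<omega>. h (W \<omega>) \<partial>Q) - \<epsilon> < (\<integral>\<omega>. g k (W \<omega>) \<partial>Q)"
      using eventually_happens'[OF sequentially_bot] by blast
    have "(\<lambda>N. \<integral>\<omega>. g k (Z N \<omega>) \<partial>\<Omega> N) \<longlonglongrightarrow> (\<integral>\<omega>. g k (W \<omega>) \<partial>Q)" by (rule lip[OF glip gb])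
    then have "\<forall>\<^sub>F N in sequentially. (\<integral>\<omega>. h (W \<omega>) \<partial>Q) - \<epsilon> < (\<integral>\<omega>. g k (Z N \<omega>) \<partial>\<Omega> N)"
      using k by (simp add: order_tendsto_iff)
    then show ?thesis
    proof eventually_elim
      case (elim N)
      have "(\<integral>\<omega>. g k (Z N \<omega>) \<partial>\<Omega> N) \<le> (\<integral>\<omega>. h (Z N \<omega>) \<partial>\<Omega> N)"
        by (intro integral_mono int[OF \<Omega> Z gc gb] int[OF \<Omega> Z h B] gh ZM)
      then show ?case using elim by linarith
    qed
  qed
  have "(\<lambda>N. \<integral>\<omega>. h (Z N \<omega>) \<partial>\<Omega> N) \<longlonglongrightarrow> (\<integral>\<omega>. h (W \<omega>) \<partial>Q)"
    if h: "continuous_map mtopology euclideanreal h" and b: "bounded (h ` M)" for h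
  proof -
    obtain B where B: "\<And>x. x \<in> M \<Longrightarrow> \<bar>h x\<bar> \<le> B" using b by (auto simp: bounded_iff)
    have mh: "continuous_map mtopology euclideanreal (\<lambda>x. - h x)" using h by (intro continuous_intros)
    show ?thesis
    proof (rule LIMSEQ_I)
      fix r :: real assume r: "0 < r"
      have "\<forall>\<^sub>F N in sequentially. (\<integral>\<omega>. - h (W \<omega>) \<partial>Q) - r < (\<integral>\<omega>. - h (Z N \<omega>) \<partial>\<Omega> N)"
        by (rule lower[OF mh _ r]) (subst abs_minus_cancel, rule B)
      moreover have "\<forall>\<^sub>F N in sequentially. (\<integral>\<omega>. h (W \<omega>) \<partial>Q) - r < (\<integral>\<omega>. h (Z N \<omega>) \<partial>\<Omega> N)"
        by (rule lower[OF h _ r]) (rule B)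
      ultimately have "\<forall>\<^sub>F N in sequentially. norm ((\<integral>\<omega>. h (Z N \<omega>) \<partial>\<Omega> N) - (\<integral>\<omega>. h (W \<omega>) \<partial>Q)) < r"
        by eventually_elim (simp add: abs_less_iff)
      then show "\<exists>no. \<forall>n\<ge>no. norm ((\<integral>\<omega>. h (Z n \<omega>) \<partial>\<Omega> n) - (\<integral>\<omega>. h (W \<omega>) \<partial>Q)) < r"
        by (simp add: eventually_sequentially)
    qed
  qed
  then show ?thesis unfolding converges_in_distribution_def using Z W by simp
qed

text \<open>The distance \<open>g\<close> to the complement of an open set is Lipschitz, and a point
  lies in the set exactly where \<open>g\<close> is positive. This reduces measurability of a limit
  in the metric space to that of a limit of real functions.\<close>

lemma measurable_limit:
  assumes Z: "\<And>n. Z n \<in> measurable P (borel_of mtopology)"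
    and W: "\<And>\<omega>. \<omega> \<in> space P \<Longrightarrow> W \<omega> \<in> M" and lim: "\<And>\<omega>. \<omega> \<in> space P \<Longrightarrow> (\<lambda>n. d (Z n \<omega>) (W \<omega>)) \<longlonglongrightarrow> 0"
  shows "W \<in> measurable P (borel_of mtopology)"
proof (rule measurable_borel_ofI)
  show "W \<in> space P \<rightarrow> topspace mtopology" using W by auto
  fix U assume U: "openin mtopology U"
  have ZM: "Z n \<omega> \<in> M" if "\<omega> \<in> space P" for n \<omega> using measurable_space[OF Z that] by simp
  show "W -` U \<inter> space P \<in> sets P"
  proof (cases "M - U = {}")
    case True
    then have "W -` U \<inter> space P = space P" using W by auto
    then show ?thesis by simp
  next
    case False
    define g where "g x = (INF y\<in>M - U. d x y)" for x
    have bdd: "bdd_below ((\<lambda>y. d x y) ` (M - U))" for x by (rule bdd_belowI2[of _ 0]) simp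
    have g1: "g x - g x' \<le> d x x'" if x: "x \<in> M" "x' \<in> M" for x x'
    proof -
      have "g x - d x x' \<le> g x'" unfolding g_def[of x']
      proof (rule cINF_greatest[OF False])
        fix y assume y: "y \<in> M - U"
        have "g x \<le> d x y" unfolding g_def by (rule cINF_lower[OF bdd y])
        also have "\<dots> \<le> d x x' + d x' y" using triangle[OF x] y by auto
        finally show "g x - d x x' \<le> d x' y" by simp
      qed
      then show ?thesis by simp
    qed
    have glip: "\<bar>g x - g x'\<bar> \<le> 1 * d x x'" if "x \<in> M" "x' \<in> M" for x x'
      using g1[OF that] g1[OF that(2,1)] commute[of x x'] by (simp add: abs_le_iff)
    have gm: "g \<in> borel_measurable (borel_of mtopology)"
      by (rule continuous_map_euclidean_measurable[OF lipschitz_continuous_map[OF glip]])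
    have gZ: "(\<lambda>\<omega>. g (Z n \<omega>)) \<in> borel_measurable P" for n by (rule measurable_compose[OF Z gm])
    have lim: "(\<lambda>n. g (Z n \<omega>)) \<longlonglongrightarrow> g (W \<omega>)" if "\<omega> \<in> space P" for \<omega>
    proof (rule LIM_zero_cancel, rule Lim_null_comparison[OF always_eventually lim[OF that]])
      show "\<forall>n. norm (g (Z n \<omega>) - g (W \<omega>)) \<le> d (Z n \<omega>) (W \<omega>)" using glip[OF ZM[OF that] W[OF that]] by simp
    qed
    have gW: "(\<lambda>\<omega>. g (W \<omega>)) \<in> borel_measurable P"
      by (rule borel_measurable_LIMSEQ_real[OF lim gZ])
    have pos: "x \<in> U \<longleftrightarrow> g x > 0" if x: "x \<in> M" for x
    proof
      assume "x \<in> U"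
      then obtain r where r: "r > 0" "mball x r \<subseteq> U" using U unfolding openin_mtopology by blast
      have "r \<le> g x" unfolding g_def
      proof (rule cINF_greatest[OF False])
        fix y assume "y \<in> M - U"
        then have "y \<notin> mball x r" using r by blast
        then show "r \<le> d x y" using x \<open>y \<in> M - U\<close> by auto
      qed
      then show "g x > 0" using r by simp
    next
      assume "g x > 0"
      show "x \<in> U"
      proof (rule ccontr)
        assume "x \<notin> U"
        then have "g x \<le> d x x" unfolding g_def using x by (intro cINF_lower[OF bdd]) auto
        then show False using \<open>g x > 0\<close> x by simp
      qed
    qed
    have "W -` U \<inter> space P = {\<omega> \<in> space P. 0 < g (W \<omega>)}" using pos W by auto
    then show ?thesis using gW by simp
  qed
qed

end

section \<open>Weak convergence of random sequences\<close>

definition lin_forms :: "((nat \<Rightarrow> real) \<Rightarrow> real) set" where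
  "lin_forms = {l. \<exists>d a. l = (\<lambda>v. \<Sum>j<d. a j * v j)}"

lemma lin_forms_zero: "(\<lambda>v. 0) \<in> lin_forms"
  unfolding lin_forms_def by (intro CollectI exI[of _ 0]) simp

lemma lin_forms_lincomb:
  assumes "l \<in> lin_forms" "l' \<in> lin_forms"
  shows "(\<lambda>v. s * l v + t * l' v) \<in> lin_forms"
proof -
  obtain d a d' a' where l: "l = (\<lambda>v. \<Sum>j<d. a j * v j)" "l' = (\<lambda>v. \<Sum>j<d'. a' j * v j)"
    using assms unfolding lin_forms_def by blast
  have ext0: "(\<Sum>j<d. a j * v j) = (\<Sum>j<max d d'. (if j < d then a j else 0) * v j)"
    for d d' :: nat and a and v :: "nat \<Rightarrow> real"
    by (rule sum.mono_neutral_cong_left) auto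
  show ?thesis
    unfolding lin_forms_def l
    by (intro CollectI exI[of _ "max d d'"]
        exI[of _ "\<lambda>j. s * (if j < d then a j else 0) + t * (if j < d' then a' j else 0)"] ext)
      (simp only: ext0[where d=d and d'=d'] ext0[where d=d' and d'=d] max.commute[of d' d]
        sum.distrib[symmetric] sum_distrib_left distrib_right mult.assoc)
qed

lemma lin_forms_continuous: "l \<in> lin_forms \<Longrightarrow> continuous_on UNIV l"
  unfolding lin_forms_def by (auto intro!: continuous_intros continuous_on_product_coordinates)

text \<open>The free phase \<open>c\<close> covers sines as well and makes the set closed under
  products by the addition formula. Integrals of its members are determined by those of cosines and
  sines of linear forms.\<close>

inductive_set trig_polys :: "((nat \<Rightarrow> real) \<Rightarrow> real) set" where
  cos: "l \<in> lin_forms \<Longrightarrow> (\<lambda>v. k * cos (l v + c)) \<in> trig_polys"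
| add: "p \<in> trig_polys \<Longrightarrow> q \<in> trig_polys \<Longrightarrow> (\<lambda>v. p v + q v) \<in> trig_polys"

lemma trig_polys_mult:
  assumes "p \<in> trig_polys" "q \<in> trig_polys"
  shows "(\<lambda>v. p v * q v) \<in> trig_polys"
  using assms
proof (induction p)
  case (cos l k c)
  from \<open>q \<in> trig_polys\<close> show ?case
  proof (induction q)
    case (cos l' k' c')
    have "(\<lambda>v. k * cos (l v + c) * (k' * cos (l' v + c'))) = (\<lambda>v. (k * k' / 2) * cos ((1 * l v + 1 * l' v) + (c + c'))
       + (k * k' / 2) * cos ((1 * l v + (-1) * l' v) + (c - c')))"
    proof
      fix v
      have "cos ((1 * l v + 1 * l' v) + (c + c')) + cos ((1 * l v + (-1) * l' v) + (c - c')) = 2 * (cos (l v + c) * cos (l' v + c'))"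
        using cos_add[of "l v + c" "l' v + c'"] cos_diff[of "l v + c" "l' v + c'"] by (simp add: algebra_simps)
      then show "k * cos (l v + c) * (k' * cos (l' v + c')) = (k * k' / 2) * cos ((1 * l v + 1 * l' v) + (c + c'))
       + (k * k' / 2) * cos ((1 * l v + (-1) * l' v) + (c - c'))"
        by (subst distrib_left[symmetric]) simp
    qed
    then show ?case
      using cos \<open>l \<in> lin_forms\<close> by (simp only:) (intro trig_polys.intros lin_forms_lincomb)
  next
    case (add q q')
    then show ?case using trig_polys.add by (simp add: distrib_left)
  qed
next
  case (add p p')
  then show ?case using trig_polys.add by (simp add: distrib_right)
qed

lemma trig_polys_const: "(\<lambda>v. k) \<in> trig_polys"
  using trig_polys.cos[OF lin_forms_zero, of k 0] by simp

lemma trig_polys_continuous: "p \<in> trig_polys \<Longrightarrow> continuous_on UNIV p"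
  by (induction rule: trig_polys.induct) (auto intro!: continuous_intros dest: lin_forms_continuous)

lemma trig_polys_bounded: "p \<in> trig_polys \<Longrightarrow> \<exists>B. \<forall>v. \<bar>p v\<bar> \<le> B"
proof (induction rule: trig_polys.induct)
  case (cos l k c)
  show ?case by (rule exI[of _ "\<bar>k\<bar>"]) (auto simp: abs_mult intro!: mult_left_le)
next
  case (add p q)
  then show ?case by (meson abs_triangle_ineq add_mono order_trans)
qed

text \<open>Closure under real polynomials permits composition with a polynomial approximation of a
  cut-off.\<close>

lemma trig_polys_poly:
  assumes "real_polynomial_function q" "p \<in> trig_polys"
  shows "(\<lambda>v. q (p v)) \<in> trig_polys"
  using assms
proof (induction q rule: real_polynomial_function.induct)
  case (linear f)
  have "f (p v) = f 1 * p v" for v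
    using linear.hyps linear_simps(5)[of f "p v" 1] by simp
  then show ?case using trig_polys_mult[OF trig_polys_const linear.prems, of "f 1"] by simp
qed (auto intro: trig_polys_const trig_polys.add trig_polys_mult)

lemma compact_box: "compact {v :: nat \<Rightarrow> real. \<forall>j. \<bar>v j\<bar> \<le> L j}"
proof -
  have "compactin (product_topology (\<lambda>_. euclidean) UNIV) (PiE UNIV (\<lambda>j. {- L j..L j}))"
    by (subst compactin_PiE) auto
  moreover have "PiE UNIV (\<lambda>j. {- L j..L j}) = {v. \<forall>j. \<bar>v j\<bar> \<le> L j}"
    by (auto simp: PiE_UNIV_domain abs_le_iff minus_le_iff)
  ultimately show ?thesis by (simp add: euclidean_product_topology)
qed

text \<open>Stone-Weierstrass controls an approximant on \<open>K\<close> only, and elsewhere it may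
  be much larger than \<open>B\<close>. Composing it with a polynomial that is close to clipping at
  level \<open>B\<close>, on the whole range of the approximant, restores a global bound without
  leaving the algebra.\<close>

lemma trig_polys_dense:
  fixes g :: "(nat \<Rightarrow> real) \<Rightarrow> real"
  assumes g: "continuous_on UNIV g" and B: "\<And>v. \<bar>g v\<bar> \<le> B" and K: "compact K" and e: "0 < e"
  obtains p where "p \<in> trig_polys" "\<And>v. \<bar>p v\<bar> \<le> B + e" "\<And>v. v \<in> K \<Longrightarrow> \<bar>g v - p v\<bar> \<le> 2 * e"
proof -
  interpret function_ring_on trig_polys K
  proof
    show "continuous_on K f" if "f \<in> trig_polys" for f
      using trig_polys_continuous[OF that] continuous_on_subset by blast
    fix x y :: "nat \<Rightarrow> real" assume "x \<noteq> y"
    then obtain j where j: "x j \<noteq> y j" by auto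
    \<comment> \<open>Scaling by \<open>t\<close> brings both coordinates into the interval from -1
      to 1, on which the sine is injective.\<close>
    define t where "t = 1 / (1 + \<bar>x j\<bar> + \<bar>y j\<bar>)"
    have t: "t > 0" by (simp add: t_def)
    have b: "\<bar>t * x j\<bar> \<le> 1" "\<bar>t * y j\<bar> \<le> 1" by (auto simp: t_def field_simps)
    have "(\<lambda>v. \<Sum>i<Suc j. (if i = j then t else 0) * v i) \<in> lin_forms"
      unfolding lin_forms_def by (intro CollectI exI[of _ "Suc j"] exI[of _ "\<lambda>i. if i = j then t else 0"] refl)
    moreover have "(\<lambda>v. \<Sum>i<Suc j. (if i = j then t else 0) * v i) = (\<lambda>v. t * v j)"
      by (auto simp: if_distrib[of "\<lambda>c. c * _"] cong: if_cong)
    ultimately have "(\<lambda>v. 1 * cos (t * v j + (- pi/2))) \<in> trig_polys"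
      by (intro trig_polys.cos) simp
    then have s: "(\<lambda>v. sin (t * v j)) \<in> trig_polys" by (simp add: cos_sin_eq[of "_ - pi/2"] cos_diff)
    have "sin (t * x j) \<noteq> sin (t * y j)"
    proof
      assume "sin (t * x j) = sin (t * y j)"
      then have "t * x j = t * y j" using b pi_gt3 by (intro sin_inj_pi[of "t * x j" "t * y j"]) (auto simp: abs_le_iff)
      then show False using j t by simp
    qed
    then show "\<exists>f\<in>trig_polys. f x \<noteq> f y" using s by (intro bexI[of _ "\<lambda>v. sin (t * v j)"])
  qed (use K trig_polys.add trig_polys_mult trig_polys_const in auto)
  obtain p where p: "p \<in> trig_polys" "\<And>v. v \<in> K \<Longrightarrow> \<bar>g v - p v\<bar> < e"
    using Stone_Weierstrass_basic[OF continuous_on_subset[OF g] e] by auto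
  obtain B' where B': "\<And>v. \<bar>p v\<bar> \<le> B'" using trig_polys_bounded[OF p(1)] by auto
  define clip where "clip x = max (- B) (min B x)" for x
  have B0: "0 \<le> B" using B[of undefined] by linarith
  obtain q where q: "real_polynomial_function q" "\<And>x. x \<in> {-B'..B'} \<Longrightarrow> \<bar>clip x - q x\<bar> < e"
    by (rule Stone_Weierstrass_real_polynomial_function[of "{-B'..B'}" clip e])
      (auto simp: clip_def[abs_def] e intro!: continuous_intros)
  have q': "\<bar>clip (p v) - q (p v)\<bar> < e" for v using B'[of v] by (intro q(2)) (auto simp: abs_le_iff minus_le_iff)
  show ?thesis
  proof (rule that[OF trig_polys_poly[OF q(1) p(1)]])
    fix v
    show "\<bar>q (p v)\<bar> \<le> B + e" using q'[of v] B0 by (auto simp: clip_def abs_if max_def min_def split: if_splits)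
    assume "v \<in> K"
    from p(2)[OF this] have "\<bar>g v - clip (p v)\<bar> < e"
      using B[of v] by (auto simp: clip_def abs_if max_def min_def split: if_splits)
    then show "\<bar>g v - q (p v)\<bar> \<le> 2 * e" using q'[of v] by linarith
  qed
qed

text \<open>Second moments that are bounded in \<open>N\<close>, for each coordinate separately,
  confine all laws up to mass \<open>e\<close> to one compact box whose sides may vary with the
  coordinate. There a trigonometric polynomial replaces \<open>g\<close>, and outside the box the
  global bounds suffice.\<close>

theorem levy_continuity_sequence_space:
  fixes \<Omega> :: "nat \<Rightarrow> 'a measure" and V :: "nat \<Rightarrow> 'a \<Rightarrow> nat \<Rightarrow> real" and \<mu> :: "(nat \<Rightarrow> real) measure"
  assumes \<Omega>: "\<And>N. prob_space (\<Omega> N)" and V: "\<And>N. V N \<in> borel_measurable (\<Omega> N)"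
    and \<mu>: "prob_space \<mu>" "sets \<mu> = sets borel"
    and cos: "\<And>l. l \<in> lin_forms \<Longrightarrow> (\<lambda>N. \<integral>\<omega>. cos (l (V N \<omega>)) \<partial>\<Omega> N) \<longlonglongrightarrow> (\<integral>v. cos (l v) \<partial>\<mu>)"
    and sin: "\<And>l. l \<in> lin_forms \<Longrightarrow> (\<lambda>N. \<integral>\<omega>. sin (l (V N \<omega>)) \<partial>\<Omega> N) \<longlonglongrightarrow> (\<integral>v. sin (l v) \<partial>\<mu>)"
    and tight: "\<And>j. \<exists>C. \<forall>N. (\<integral>\<^sup>+\<omega>. ennreal ((V N \<omega> j)\<^sup>2) \<partial>\<Omega> N) \<le> ennreal C"
    and g: "continuous_on UNIV g" and B: "\<And>v. \<bar>g v\<bar> \<le> (B::real)"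
  shows "(\<lambda>N. \<integral>\<omega>. g (V N \<omega>) \<partial>\<Omega> N) \<longlonglongrightarrow> (\<integral>v. g v \<partial>\<mu>)"
proof -
  interpret \<mu>: prob_space \<mu> by fact
  have [measurable_cong]: "sets \<mu> = sets borel" by fact
  have [simp]: "space \<mu> = UNIV" using sets_eq_imp_space_eq[OF \<mu>(2)] by simp
  have contm: "f \<in> borel_measurable borel" if "continuous_on UNIV f" for f :: "(nat \<Rightarrow> real) \<Rightarrow> real"
    by (rule borel_measurable_continuous_onI[OF that])
  have coord[measurable]: "(\<lambda>v::nat\<Rightarrow>real. v j) \<in> borel_measurable borel" for j
    by (intro contm continuous_on_product_coordinates)
  have [measurable]: "V N \<in> measurable (\<Omega> N) borel" for N by (rule V)
  have trig: "(\<lambda>N. \<integral>\<omega>. p (V N \<omega>) \<partial>\<Omega> N) \<longlonglongrightarrow> (\<integral>v. p v \<partial>\<mu>)" if "p \<in> trig_polys" for p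
    using that
  proof (induction p)
    case (cos l k c)
    have [measurable]: "l \<in> borel_measurable borel" by (intro contm lin_forms_continuous cos)
    have e: "(\<integral>\<omega>. k * cos (l (U \<omega>) + c) \<partial>M) = k * (cos c * (\<integral>\<omega>. cos (l (U \<omega>)) \<partial>M) - sin c * (\<integral>\<omega>. sin (l (U \<omega>)) \<partial>M))"
      if "prob_space M" "U \<in> measurable M borel" for M :: "'c measure" and U
    proof -
      interpret M: prob_space M by fact
      have [measurable]: "U \<in> measurable M borel" by fact
      have "integrable M (\<lambda>\<omega>. cos (l (U \<omega>)))" "integrable M (\<lambda>\<omega>. sin (l (U \<omega>)))"
        by (auto intro!: M.integrable_const_bound[of _ 1])
      then show ?thesis by (simp add: cos_add algebra_simps)
    qed
    have "(\<lambda>v. v) \<in> measurable \<mu> borel" by (simp add: measurable_ident_sets \<mu>(2))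
    from e[OF \<mu>(1) this] show ?case
      unfolding e[OF \<Omega> V] by (simp only:) (intro tendsto_intros assms(5,6) cos.hyps)
  next
    case (add p q)
    have i: "integrable M (\<lambda>\<omega>. r (U \<omega>))"
      if r: "r \<in> trig_polys" and "prob_space M" "U \<in> measurable M borel" for r and M :: "'c measure" and U
    proof -
      interpret M: prob_space M by fact
      have [measurable]: "U \<in> measurable M borel" by fact
      have [measurable]: "r \<in> borel_measurable borel" by (intro contm trig_polys_continuous r)
      obtain B where "\<And>v. \<bar>r v\<bar> \<le> B" using trig_polys_bounded[OF r] by auto
      then show ?thesis by (auto intro!: M.integrable_const_bound[of _ B])
    qed
    have "(\<lambda>v. v) \<in> measurable \<mu> borel" by (simp add: measurable_ident_sets \<mu>(2))
    from i[OF _ \<mu>(1) this] show ?case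
      using add by (simp add: i[OF _ \<Omega> V] tendsto_add)
  qed
  \<comment> \<open>Replacing \<open>g\<close> by the polynomial costs \<open>2 * e\<close> on the
    box and at most \<open>2 * B + 1\<close> times the mass \<open>e\<close> outside it, once for
    the law of \<open>V N\<close> and once for \<mu>; the last \<open>e\<close> is the convergence
    for the polynomial.\<close>
  have main: "\<forall>\<^sub>F N in sequentially. \<bar>(\<integral>\<omega>. g (V N \<omega>) \<partial>\<Omega> N) - (\<integral>v. g v \<partial>\<mu>)\<bar> \<le> (2 * (2 + (2 * B + 1)) + 1) * e"
    if e: "0 < e" "e \<le> 1" for e :: real
  proof -
    \<comment> \<open>The allowances \<open>e * (1/2)^Suc j\<close> add up to \<open>e\<close> over
      all coordinates.\<close>
    have "\<exists>L. (\<forall>N. measure (\<Omega> N) {\<omega>\<in>space (\<Omega> N). L < \<bar>V N \<omega> j\<bar>} \<le> e * (1/2)^Suc j) \<and> measure \<mu> {v. L < \<bar>v j\<bar>} \<le> e * (1/2)^Suc j" for j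
    proof -
      define d where "d = e * (1/2)^Suc j"
      have d: "d > 0" using e by (simp add: d_def)
      obtain C where C: "\<And>N. (\<integral>\<^sup>+\<omega>. ennreal ((V N \<omega> j)\<^sup>2) \<partial>\<Omega> N) \<le> ennreal C" using tight[of j] by auto
      have "(\<lambda>n. measure \<mu> {v. real n < \<bar>v j\<bar>}) \<longlonglongrightarrow> measure \<mu> (\<Inter>n. {v. real n < \<bar>v j\<bar>})"
        by (rule \<mu>.finite_Lim_measure_decseq) (auto simp: decseq_def)
      also have "(\<Inter>n. {v. real n < \<bar>v j\<bar>}) = {}"
        using reals_Archimedean2 by (fastforce dest: less_asym)
      finally have "\<forall>\<^sub>F n in sequentially. measure \<mu> {v. real n < \<bar>v j\<bar>} < d"
        using d by (simp add: order_tendsto_iff)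
      moreover have "\<forall>\<^sub>F n in sequentially. \<bar>C\<bar> / d \<le> real n" by real_asymp
      moreover have "\<forall>\<^sub>F n in sequentially. 1 \<le> n" by (rule eventually_ge_at_top)
      ultimately obtain n where n: "measure \<mu> {v. real n < \<bar>v j\<bar>} < d" "\<bar>C\<bar> / d \<le> real n" "1 \<le> n"
        using eventually_happens'[OF sequentially_bot eventually_conj[OF _ eventually_conj]] by blast
      have "measure (\<Omega> N) {\<omega>\<in>space (\<Omega> N). real n < \<bar>V N \<omega> j\<bar>} \<le> d" for N
      proof -
        interpret N: prob_space "\<Omega> N" by (rule \<Omega>)
        have "ennreal (real n) * emeasure (\<Omega> N) {\<omega>\<in>space (\<Omega> N). real n < \<bar>V N \<omega> j\<bar>}
            = (\<integral>\<^sup>+\<omega>. ennreal (real n) * indicator {\<omega>\<in>space (\<Omega> N). real n < \<bar>V N \<omega> j\<bar>} \<omega> \<partial>\<Omega> N)"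
          by (subst nn_integral_cmult_indicator) auto
        also have "\<dots> \<le> (\<integral>\<^sup>+\<omega>. ennreal ((V N \<omega> j)\<^sup>2) \<partial>\<Omega> N)"
        proof (intro nn_integral_mono)
          fix \<omega>
          \<comment> \<open>For \<open>n\<close> at least 1 the threshold for
            \<open>\<bar>x\<bar>\<close> also bounds the square from below, so Markov's inequality
            applies with \<open>n\<close> itself.\<close>
          have "real n \<le> x\<^sup>2" if "real n < \<bar>x\<bar>" for x
          proof -
            have "real n * 1 \<le> \<bar>x\<bar> * \<bar>x\<bar>" using that n(3) by (intro mult_mono) auto
            then show ?thesis by (simp add: power2_eq_square)
          qed
          then show "ennreal (real n) * indicator {\<omega>\<in>space (\<Omega> N). real n < \<bar>V N \<omega> j\<bar>} \<omega> \<le> ennreal ((V N \<omega> j)\<^sup>2)"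
            by (auto simp: indicator_def simp del: ennreal_of_nat_eq_real_of_nat intro!: ennreal_leI)
        qed
        also have "\<dots> \<le> ennreal \<bar>C\<bar>" using C[of N] by (auto intro: order_trans ennreal_leI)
        finally have "ennreal (real n * N.prob {\<omega>\<in>space (\<Omega> N). real n < \<bar>V N \<omega> j\<bar>}) \<le> ennreal \<bar>C\<bar>"
          by (subst ennreal_mult) (auto simp: N.emeasure_eq_measure)
        then have "real n * N.prob {\<omega>\<in>space (\<Omega> N). real n < \<bar>V N \<omega> j\<bar>} \<le> \<bar>C\<bar>" by (subst (asm) ennreal_le_iff) auto
        also have "\<bar>C\<bar> \<le> real n * d" using n(2) d by (simp add: field_simps)
        finally show ?thesis using n(3) by simp
      qed
      then show ?thesis using n(1) unfolding d_def by (intro exI[of _ "real n"]) auto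
    qed
    then have "\<forall>j. \<exists>L. (\<forall>N. measure (\<Omega> N) {\<omega>\<in>space (\<Omega> N). L < \<bar>V N \<omega> j\<bar>} \<le> e * (1/2)^Suc j) \<and> measure \<mu> {v. L < \<bar>v j\<bar>} \<le> e * (1/2)^Suc j"
      by (intro allI)
    from choice[OF this] obtain L where L: "\<And>j N. measure (\<Omega> N) {\<omega>\<in>space (\<Omega> N). L j < \<bar>V N \<omega> j\<bar>} \<le> e * (1/2)^Suc j"
        "\<And>j. measure \<mu> {v. L j < \<bar>v j\<bar>} \<le> e * (1/2)^Suc j"
      by auto
    define K where "K = {v :: nat \<Rightarrow> real. \<forall>j. \<bar>v j\<bar> \<le> L j}"
    have K[measurable]: "K \<in> sets borel" unfolding K_def by measurable
    obtain p where p: "p \<in> trig_polys" "\<And>v. \<bar>p v\<bar> \<le> B + e" "\<And>v. v \<in> K \<Longrightarrow> \<bar>g v - p v\<bar> \<le> 2 * e"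
      using trig_polys_dense[OF g B compact_box[of L] e(1)] unfolding K_def by blast
    have [measurable]: "g \<in> borel_measurable borel" "p \<in> borel_measurable borel"
      by (intro contm g trig_polys_continuous p)+
    have close: "\<bar>(\<integral>\<omega>. g (U \<omega>) \<partial>M) - (\<integral>\<omega>. p (U \<omega>) \<partial>M)\<bar> \<le> (2 + (2 * B + 1)) * e"
      if "prob_space M" "U \<in> measurable M borel" and L: "\<And>j. measure M {\<omega>\<in>space M. L j < \<bar>U \<omega> j\<bar>} \<le> e * (1/2)^Suc j"
      for M :: "'c measure" and U
    proof -
      interpret M: prob_space M by fact
      have [measurable]: "U \<in> measurable M borel" by fact
      define A where "A = {\<omega>\<in>space M. U \<omega> \<notin> K}"
      have [measurable]: "A \<in> sets M" unfolding A_def by measurable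
      have "emeasure M A \<le> emeasure M (\<Union>j. {\<omega>\<in>space M. L j < \<bar>U \<omega> j\<bar>})"
        by (intro emeasure_mono) (auto simp: A_def K_def not_le)
      also have "\<dots> \<le> (\<Sum>j. emeasure M {\<omega>\<in>space M. L j < \<bar>U \<omega> j\<bar>})"
        by (intro emeasure_subadditive_countably) auto
      also have "\<dots> \<le> (\<Sum>j. ennreal (e * (1/2)^Suc j))"
        using L by (intro suminf_le) (auto simp: M.emeasure_eq_measure intro!: ennreal_leI simp del: power_Suc)
      also have "\<dots> = ennreal e"
        using e sums_mult[OF power_half_series, of e]
        by (intro suminf_ennreal_eq) (auto)
      finally have A: "measure M A \<le> e" using e by (simp add: M.emeasure_eq_measure)
      have i: "integrable M (\<lambda>\<omega>. g (U \<omega>))" "integrable M (\<lambda>\<omega>. p (U \<omega>))"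
        by (rule M.integrable_const_bound[of _ B] M.integrable_const_bound[of _ "B + e"], use B p(2) in auto)+
      have iA: "integrable M (indicat_real A)" by (rule M.integrable_const_bound[of _ 1]) (auto simp: indicator_def)
      have "\<bar>(\<integral>\<omega>. g (U \<omega>) \<partial>M) - (\<integral>\<omega>. p (U \<omega>) \<partial>M)\<bar> = \<bar>\<integral>\<omega>. g (U \<omega>) - p (U \<omega>) \<partial>M\<bar>" using i by simp
      also have "\<dots> \<le> (\<integral>\<omega>. \<bar>g (U \<omega>) - p (U \<omega>)\<bar> \<partial>M)" using integral_norm_bound[of M "\<lambda>\<omega>. g (U \<omega>) - p (U \<omega>)"] by simp
      also have "\<dots> \<le> (\<integral>\<omega>. 2 * e + (2 * B + 1) * indicator A \<omega> \<partial>M)"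
      proof (rule integral_mono)
        fix \<omega> assume "\<omega> \<in> space M"
        then show "\<bar>g (U \<omega>) - p (U \<omega>)\<bar> \<le> 2 * e + (2 * B + 1) * indicator A \<omega>"
          using p(3)[of "U \<omega>"] p(2)[of "U \<omega>"] B[of "U \<omega>"] e by (cases "\<omega> \<in> A") (auto simp: A_def)
      qed (use i iA in auto)
      also have "\<dots> = 2 * e + (2 * B + 1) * measure M A"
        using iA by (subst Bochner_Integration.integral_add) (auto simp: M.prob_space)
      also have "\<dots> \<le> 2 * e + (2 * B + 1) * e" using A B[of undefined] by (intro add_left_mono mult_left_mono) auto
      finally show ?thesis by (simp add: algebra_simps)
    qed
    have "\<forall>\<^sub>F N in sequentially. \<bar>(\<integral>\<omega>. p (V N \<omega>) \<partial>\<Omega> N) - (\<integral>v. p v \<partial>\<mu>)\<bar> < e"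
      using tendstoD[OF trig[OF p(1)] e(1)] by (simp add: dist_real_def)
    then show ?thesis
    proof eventually_elim
      case (elim N)
      have "\<bar>(\<integral>\<omega>. g (V N \<omega>) \<partial>\<Omega> N) - (\<integral>\<omega>. p (V N \<omega>) \<partial>\<Omega> N)\<bar> \<le> (2 + (2 * B + 1)) * e"
        by (rule close[OF \<Omega> V L(1)])
      moreover have "\<bar>(\<integral>v. g v \<partial>\<mu>) - (\<integral>v. p v \<partial>\<mu>)\<bar> \<le> (2 + (2 * B + 1)) * e"
        using close[OF \<mu>(1) measurable_ident_sets[OF \<mu>(2)]] L(2) by simp
      ultimately have "\<bar>(\<integral>\<omega>. g (V N \<omega>) \<partial>\<Omega> N) - (\<integral>v. g v \<partial>\<mu>)\<bar> \<le> 2 * ((2 + (2 * B + 1)) * e) + e"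
        using elim by linarith
      then show ?case by (simp add: algebra_simps)
    qed
  qed
  show ?thesis
  proof (rule tendstoI)
    fix e :: real assume e: "0 < e"
    define c where "c = 2 * (2 + (2 * B + 1)) + 1"
    have c: "c > 0" using B[of undefined] by (simp add: c_def)
    define d where "d = min 1 (e / (2 * c))"
    have d: "0 < d" "d \<le> 1" "c * d < e"
      using e c by (auto simp: d_def min_def field_simps)
    from main[OF d(1,2)] show "\<forall>\<^sub>F N in sequentially. dist (\<integral>\<omega>. g (V N \<omega>) \<partial>\<Omega> N) (\<integral>v. g v \<partial>\<mu>) < e"
      by eventually_elim (use d(3) in \<open>simp add: dist_real_def c_def\<close>)
  qed
qed

section \<open>Gaussian sequences\<close>

definition psd_kernel :: "(nat \<Rightarrow> nat \<Rightarrow> real) \<Rightarrow> bool" where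
  "psd_kernel S \<longleftrightarrow> (\<forall>i j. S i j = S j i) \<and>
     (\<forall>I a. finite I \<longrightarrow> 0 \<le> (\<Sum>i\<in>I. \<Sum>j\<in>I. a i * a j * S i j))"

lemma psd_kernel_sym: "psd_kernel S \<Longrightarrow> S i j = S j i"
  by (simp add: psd_kernel_def)

lemma psd_kernel_nonneg: "psd_kernel S \<Longrightarrow> finite I \<Longrightarrow> 0 \<le> (\<Sum>i\<in>I. \<Sum>j\<in>I. a i * a j * S i j)"
  unfolding psd_kernel_def by (elim conjE allE impE)

lemma psd_kernel_diag: "psd_kernel S \<Longrightarrow> 0 \<le> S m m"
  using psd_kernel_nonneg[of S "{m}" "\<lambda>_. 1"] by simp

lemma psd_kernel_diag_zero:
  assumes S: "psd_kernel S" and 0: "S m m = 0"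
  shows "S i m = 0"
proof (rule ccontr)
  assume n: "S i m \<noteq> 0"
  then have "i \<noteq> m" using 0 by auto
  \<comment> \<open>If \<open>S i m\<close> were nonzero, this coefficient at \<open>m\<close> would
    give the quadratic form the value -1: without a diagonal term at \<open>m\<close> the form is
    affine in that coefficient.\<close>
  define a where "a j = (if j = i then 1 else - (S i i + 1) / (2 * S i m))" for j
  have "0 \<le> (\<Sum>k\<in>{i,m}. \<Sum>j\<in>{i,m}. a k * a j * S k j)"
    by (rule psd_kernel_nonneg[OF S]) simp
  also have "\<dots> = S i i + a m * (S i m + S m i)"
    using \<open>i \<noteq> m\<close> 0 by (simp add: a_def distrib_left)
  also have "S m i = S i m" by (rule psd_kernel_sym[OF S])
  also have "S i i + a m * (S i m + S i m) = - 1" using n \<open>i \<noteq> m\<close> by (simp add: a_def field_simps)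
  finally show False by simp
qed

text \<open>The Schur complement of the entry \<open>m\<close>: the covariance left after regression
  on coordinate \<open>m\<close>. For a zero pivot, division by zero makes it \<open>S\<close>
  itself, which is right for a positive semidefinite kernel, since the column then vanishes.\<close>

definition schur :: "(nat \<Rightarrow> nat \<Rightarrow> real) \<Rightarrow> nat \<Rightarrow> nat \<Rightarrow> nat \<Rightarrow> real" where
  "schur S m = (\<lambda>i j. S i j - S i m * S j m / S m m)"

text \<open>Minimising the quadratic form of \<open>S\<close> over the coefficient at
  \<open>m\<close> leaves the quadratic form of the Schur complement; \<open>t\<close> is the shift
  of that coefficient to the minimiser.\<close>

lemma psd_kernel_schur:
  assumes S: "psd_kernel S"
  shows "psd_kernel (schur S m)"
proof (cases "S m m = 0")
  case True
  then show ?thesis using S by (simp add: schur_def)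
next
  case False
  then have pos: "S m m > 0" using psd_kernel_diag[OF S, of m] by simp
  have sym: "S i j = S j i" for i j by (rule psd_kernel_sym[OF S])
  show ?thesis unfolding psd_kernel_def
  proof (intro conjI allI impI)
    show "schur S m i j = schur S m j i" for i j by (simp add: schur_def sym[of i j])
    fix I :: "nat set" and a :: "nat \<Rightarrow> real" assume I: "finite I"
    define J where "J = insert m I"
    define b where "b i = (if i \<in> I then a i else 0)" for i
    have J: "finite J" "m \<in> J" using I by (auto simp: J_def)
    have ext: "(\<Sum>i\<in>I. \<Sum>j\<in>I. a i * a j * T i j) = (\<Sum>i\<in>J. \<Sum>j\<in>J. b i * b j * T i j)" for T
      unfolding b_def J_def using I by (intro sum.mono_neutral_cong_left) (auto intro!: sum.mono_neutral_cong_left sum.neutral)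
    define B where "B = (\<Sum>i\<in>J. b i * S i m)"
    define t where "t = B / S m m"
    define c where "c i = b i - (if i = m then t else 0)" for i
    have "0 \<le> (\<Sum>i\<in>J. \<Sum>j\<in>J. c i * c j * S i j)" by (rule psd_kernel_nonneg[OF S J(1)])
    also have "\<dots> = (\<Sum>i\<in>J. \<Sum>j\<in>J. b i * b j * S i j - (if j = m then t * b i * S i j else 0)
        - (if i = m then t * b j * S i j else 0) + (if i = m then (if j = m then t * t * S i j else 0) else 0))"
      by (intro sum.cong refl) (auto simp: c_def algebra_simps)
    also have "\<dots> = (\<Sum>i\<in>J. \<Sum>j\<in>J. b i * b j * S i j) - t * B - t * B + t * t * S m m"
    proof -
      have 1: "(\<Sum>i\<in>J. \<Sum>j\<in>J. (if j = m then t * b i * S i j else 0)) = t * B"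
        using J by (simp add: B_def sum_distrib_left mult.assoc)
      have 2: "(\<Sum>i\<in>J. \<Sum>j\<in>J. (if i = m then t * b j * S i j else 0)) = t * B"
        by (subst sum.swap) (use J in \<open>simp add: B_def sum_distrib_left mult.assoc sym[of m]\<close>)
      have 3: "(\<Sum>i\<in>J. \<Sum>j\<in>J. (if i = m then (if j = m then t * t * S i j else 0) else 0)) = t * t * S m m"
        by (subst sum.swap) (use J in simp)
      show ?thesis by (simp only: sum.distrib sum_subtractf 1 2 3)
    qed
    also have "\<dots> = (\<Sum>i\<in>J. \<Sum>j\<in>J. b i * b j * S i j) - B * B / S m m"
      using pos by (simp add: t_def field_simps)
    also have "B * B / S m m = (\<Sum>i\<in>J. \<Sum>j\<in>J. b i * b j * (S i m * S j m / S m m))"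
      by (simp add: B_def sum_product sum_divide_distrib mult_ac)
    also have "(\<Sum>i\<in>J. \<Sum>j\<in>J. b i * b j * S i j) - \<dots> = (\<Sum>i\<in>J. \<Sum>j\<in>J. b i * b j * schur S m i j)"
      by (simp add: schur_def sum_subtractf right_diff_distrib)
    finally show "0 \<le> (\<Sum>i\<in>I. \<Sum>j\<in>I. a i * a j * schur S m i j)" unfolding ext .
  qed
qed

primrec schur_iter :: "(nat \<Rightarrow> nat \<Rightarrow> real) \<Rightarrow> nat \<Rightarrow> nat \<Rightarrow> nat \<Rightarrow> real" where
  "schur_iter c 0 = c"
| "schur_iter c (Suc m) = schur (schur_iter c m) m"

lemma psd_schur_iter: "psd_kernel c \<Longrightarrow> psd_kernel (schur_iter c m)"
  by (induction m) (auto intro: psd_kernel_schur)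

text \<open>Column \<open>m\<close> of an infinite lower triangular square root, taken from the
  pivot column after \<open>m\<close> eliminations. A zero pivot gives a zero column.\<close>

definition cholesky :: "(nat \<Rightarrow> nat \<Rightarrow> real) \<Rightarrow> nat \<Rightarrow> nat \<Rightarrow> real" where
  "cholesky c i m = schur_iter c m i m / sqrt (schur_iter c m m m)"

lemma schur_iter_zero:
  assumes c: "psd_kernel c"
  shows "i < n \<Longrightarrow> schur_iter c n i j = 0"
proof (induction n arbitrary: i j)
  case (Suc m)
  let ?S = "schur_iter c m"
  have sym: "?S i j = ?S j i" for i j by (rule psd_kernel_sym[OF psd_schur_iter[OF c]])
  show ?case
  proof (cases "i < m")
    case False
    then have "i = m" using Suc by simp
    then show ?thesis
      using psd_kernel_diag_zero[OF psd_schur_iter[OF c], of m m j] sym[of m j] by (auto simp: schur_def)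
  qed (simp add: Suc schur_def)
qed simp

text \<open>Each elimination splits off one product of columns, and after \<open>n\<close> of them
  the rows with index below \<open>n\<close> are zero, so the finite sum is exact and leaves no
  remainder.\<close>

lemma cholesky_sum:
  assumes c: "psd_kernel c" and "i < n"
  shows "c i j = (\<Sum>m<n. cholesky c i m * cholesky c j m)"
proof -
  have "c i j = (\<Sum>m<n. cholesky c i m * cholesky c j m) + schur_iter c n i j" for n
    by (induction n) (auto simp: cholesky_def schur_def psd_kernel_diag[OF psd_schur_iter[OF c]])
  from this[of n] show ?thesis using schur_iter_zero[OF c \<open>i < n\<close>] by simp
qed

lemma cholesky_zero: "psd_kernel c \<Longrightarrow> i < m \<Longrightarrow> cholesky c i m = 0"
  by (simp add: cholesky_def schur_iter_zero)

lemma indep_vars_coordinates: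
  assumes "\<And>i. prob_space (N i)" "\<And>i. sets (N i) = sets borel"
  shows "prob_space.indep_vars (PiM UNIV N) (\<lambda>_. borel) (\<lambda>i \<omega>. \<omega> i) UNIV"
proof -
  interpret prob_space "PiM UNIV N" by (rule prob_space_PiM) (rule assms)
  have s: "sets (PiM UNIV N) = sets (PiM UNIV (\<lambda>_. borel))" by (intro sets_PiM_cong refl assms)
  have d: "distr (PiM UNIV N) borel (\<lambda>\<omega>. \<omega> i) = N i" for i
    using distr_PiM_component[of UNIV N i] assms by (subst distr_cong[OF refl, of _ "N i"]) auto
  have "distr (PiM UNIV N) (PiM UNIV (\<lambda>_. borel)) (\<lambda>x. \<lambda>i\<in>UNIV. x i) = PiM UNIV N"
    by (simp add: restrict_UNIV s distr_id2)
  then show ?thesis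
    by (subst indep_vars_iff_distr_eq_PiM)
      (auto simp: d intro!: measurable_component_singleton simp: measurable_cong_sets[OF s refl])
qed

text \<open>The triangular square root is applied to independent standard normal variables; each
  coordinate is then a finite sum. Cosine and sine integrals of linear forms record the law in the
  shape that the continuity theorem takes as input.\<close>

theorem gaussian_sequence_exists:
  fixes c :: "nat \<Rightarrow> nat \<Rightarrow> real"
  assumes c: "psd_kernel c"
  obtains \<mu> :: "(nat \<Rightarrow> real) measure" where "prob_space \<mu>" "sets \<mu> = sets borel"
    "\<And>d a. (\<integral>v. cos (\<Sum>j<d. a j * v j) \<partial>\<mu>) = exp (- (\<Sum>i<d. \<Sum>j<d. a i * a j * c i j) / 2)"
    "\<And>d a. (\<integral>v. sin (\<Sum>j<d. a j * v j) \<partial>\<mu>) = 0"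
proof -
  define P where "P = PiM (UNIV :: nat set) (\<lambda>_. std_normal_distribution)"
  interpret N: real_distribution std_normal_distribution by (rule real_dist_normal_dist)
  interpret P: prob_space P unfolding P_def by (rule prob_space_PiM) unfold_locales
  have s[measurable_cong]: "sets P = sets (PiM UNIV (\<lambda>_. borel))"
    unfolding P_def by (intro sets_PiM_cong) auto
  have mc[measurable]: "(\<lambda>\<omega>. \<omega> i) \<in> borel_measurable P" for i by measurable
  define G where "G \<omega> i = (\<Sum>m\<le>i. cholesky c i m * \<omega> m)" for \<omega> :: "nat \<Rightarrow> real" and i
  have G[measurable]: "G \<in> measurable P borel"
    unfolding G_def by (intro measurable_coordinatewise_then_product) measurable
  have indep: "P.indep_vars (\<lambda>_. borel) (\<lambda>i \<omega>. \<omega> i) UNIV"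
    unfolding P_def by (rule indep_vars_coordinates) (unfold_locales, auto)
  have coord: "distr P borel (\<lambda>\<omega>. \<omega> i) = std_normal_distribution" for i
    unfolding P_def using distr_PiM_component[of UNIV "\<lambda>_. std_normal_distribution" i]
    by (subst distr_cong[OF refl, of _ std_normal_distribution]) (auto intro: N.prob_space_axioms)
  have char: "(\<integral>\<omega>. iexp (\<Sum>j<d. a j * G \<omega> j) \<partial>P)
      = complex_of_real (exp (- (\<Sum>i<d. \<Sum>j<d. a i * a j * c i j) / 2 :: real))" for d a
  proof -
    define b where "b m = (\<Sum>j<d. a j * cholesky c j m)" for m
    have lin: "(\<Sum>j<d. a j * G \<omega> j) = (\<Sum>m<d. b m * \<omega> m)" for \<omega>
    proof -
      have "G \<omega> j = (\<Sum>m<d. cholesky c j m * \<omega> m)" if "j < d" for j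
        unfolding G_def using that cholesky_zero[OF c]
        by (intro sum.mono_neutral_cong_left) auto
      then have "(\<Sum>j<d. a j * G \<omega> j) = (\<Sum>j<d. \<Sum>m<d. a j * (cholesky c j m * \<omega> m))"
        by (simp add: sum_distrib_left)
      also have "\<dots> = (\<Sum>m<d. b m * \<omega> m)"
        by (subst sum.swap) (simp add: b_def sum_distrib_right mult.assoc)
      finally show ?thesis .
    qed
    have "(\<integral>\<omega>. iexp (\<Sum>j<d. a j * G \<omega> j) \<partial>P) = char (distr P borel (\<lambda>\<omega>. \<Sum>m<d. b m * \<omega> m)) 1"
      by (simp add: char_def integral_distr lin)
    also have "\<dots> = (\<Prod>m<d. char (distr P borel (\<lambda>\<omega>. b m * \<omega> m)) 1)"
      by (rule P.char_distr_sum)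
        (rule P.indep_vars_compose2[OF P.indep_vars_subset[OF indep subset_UNIV]], simp)
    also have "\<dots> = (\<Prod>m<d. char std_normal_distribution (b m))"
    proof (intro prod.cong refl)
      fix m
      have "char (distr P borel (\<lambda>\<omega>. b m * \<omega> m)) 1 = char (distr P borel (\<lambda>\<omega>. \<omega> m)) (b m)"
        by (simp add: char_def integral_distr)
      then show "char (distr P borel (\<lambda>\<omega>. b m * \<omega> m)) 1 = char std_normal_distribution (b m)"
        unfolding coord .
    qed
    also have "\<dots> = of_real (\<Prod>m<d. exp (- (b m)\<^sup>2 / 2))"
      by (simp only: char_std_normal_distribution of_real_prod)
    also have "(\<Prod>m<d. exp (- (b m)\<^sup>2 / 2)) = exp (- (\<Sum>m<d. (b m)\<^sup>2) / 2)"
      by (simp add: exp_sum[symmetric] sum_negf[symmetric] sum_divide_distrib)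
    also have "(\<Sum>m<d. (b m)\<^sup>2) = (\<Sum>i<d. \<Sum>j<d. a i * a j * c i j)"
    proof -
      have "(\<Sum>m<d. (b m)\<^sup>2) = (\<Sum>m<d. \<Sum>i<d. \<Sum>j<d. a i * a j * (cholesky c i m * cholesky c j m))"
        by (simp add: b_def power2_eq_square sum_product mult_ac)
      also have "\<dots> = (\<Sum>i<d. \<Sum>m<d. \<Sum>j<d. a i * a j * (cholesky c i m * cholesky c j m))"
        by (rule sum.swap)
      also have "\<dots> = (\<Sum>i<d. \<Sum>j<d. \<Sum>m<d. a i * a j * (cholesky c i m * cholesky c j m))"
        by (intro sum.cong refl sum.swap)
      also have "\<dots> = (\<Sum>i<d. \<Sum>j<d. a i * a j * c i j)"
        by (intro sum.cong refl) (simp add: sum_distrib_left[symmetric] cholesky_sum[OF c, of _ d])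
      finally show ?thesis .
    qed
    finally show ?thesis .
  qed
  have int: "integrable P (\<lambda>\<omega>. iexp (\<Sum>j<d. a j * G \<omega> j))" for d a
  proof (rule P.integrable_const_bound[of _ 1])
    have [measurable]: "(\<lambda>\<omega>. G \<omega> j) \<in> borel_measurable P" for j
      by (rule measurable_product_then_coordinatewise[OF G])
    have [measurable]: "(\<lambda>\<omega>. \<Sum>j<d. a j * G \<omega> j) \<in> borel_measurable P" by measurable
    show "(\<lambda>\<omega>. iexp (\<Sum>j<d. a j * G \<omega> j)) \<in> borel_measurable P" by (simp del: of_real_sum of_real_mult)
  qed auto
  have re: "Re (iexp x) = cos x" "Im (iexp x) = sin x" for x :: real
    by (simp_all flip: cis_conv_exp)
  show ?thesis
  proof (rule that)
    show "prob_space (distr P borel G)" by (rule P.prob_space_distr) simp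
    fix d :: nat and a :: "nat \<Rightarrow> real"
    have lm[measurable]: "(\<lambda>v::nat\<Rightarrow>real. \<Sum>j<d. a j * v j) \<in> borel_measurable borel"
      by measurable
    have "(\<integral>v. cos (\<Sum>j<d. a j * v j) \<partial>distr P borel G) = (\<integral>\<omega>. Re (iexp (\<Sum>j<d. a j * G \<omega> j)) \<partial>P)"
      unfolding re by (simp add: integral_distr)
    also have "\<dots> = Re (\<integral>\<omega>. iexp (\<Sum>j<d. a j * G \<omega> j) \<partial>P)" by (rule integral_Re[OF int])
    finally show "(\<integral>v. cos (\<Sum>j<d. a j * v j) \<partial>distr P borel G) = exp (- (\<Sum>i<d. \<Sum>j<d. a i * a j * c i j) / 2)"
      unfolding char by (simp only: Re_complex_of_real Im_complex_of_real)
    have "(\<integral>v. sin (\<Sum>j<d. a j * v j) \<partial>distr P borel G) = (\<integral>\<omega>. Im (iexp (\<Sum>j<d. a j * G \<omega> j)) \<partial>P)"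
      unfolding re by (simp add: integral_distr)
    also have "\<dots> = Im (\<integral>\<omega>. iexp (\<Sum>j<d. a j * G \<omega> j) \<partial>P)" by (rule integral_Im[OF int])
    finally show "(\<integral>v. sin (\<Sum>j<d. a j * v j) \<partial>distr P borel G) = 0"
      unfolding char by (simp only: Re_complex_of_real Im_complex_of_real)
  qed simp
qed

section \<open>A central limit theorem for bounded arrays\<close>

text \<open>\<open>(1 + x) * (1 - x + x\<^sup>2)\<close> equals \<open>1 + x ^ 3\<close>, which is
  at least 1; together with \<open>1 + x \<le> exp x\<close> this bounds \<open>exp (- x)\<close>
  from above.\<close>

lemma exp_minus_approx:
  fixes x :: real
  assumes "0 \<le> x"
  shows "\<bar>exp (- x) - (1 - x)\<bar> \<le> x\<^sup>2"
proof -
  have "1 \<le> (1 + x) * (1 - x + x\<^sup>2)"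
    using assms by (simp add: power2_eq_square algebra_simps)
  also have "\<dots> \<le> exp x * (1 - x + x\<^sup>2)"
  proof (rule mult_right_mono)
    have "0 \<le> (x - 1/2)\<^sup>2 + 3/4" by (simp add: add_nonneg_nonneg)
    then show "0 \<le> 1 - x + x\<^sup>2" by (simp add: power2_eq_square algebra_simps)
  qed (simp add: exp_ge_add_one_self)
  finally have "exp (- x) \<le> 1 - x + x\<^sup>2" by (simp add: exp_minus field_simps)
  moreover have "1 - x \<le> exp (- x)" using exp_ge_add_one_self[of "- x"] by simp
  ultimately show ?thesis by linarith
qed

text \<open>The summands are uniformly small, so the Lindeberg condition is automatic: the
  characteristic function of each differs from that of a normal variable of the same variance by at
  most its variance times \<open>c N\<close>, and differences of products of numbers in the unit
  disc add up.\<close>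

theorem clt_bounded_array:
  fixes \<Omega> :: "nat \<Rightarrow> 'a measure" and I :: "nat \<Rightarrow> 'i set" and X :: "nat \<Rightarrow> 'i \<Rightarrow> 'a \<Rightarrow> real"
  assumes \<Omega>: "\<And>N. prob_space (\<Omega> N)" and fin: "\<And>N. finite (I N)"
    and indep: "\<And>N. prob_space.indep_vars (\<Omega> N) (\<lambda>_. borel) (X N) (I N)"
    and bd: "\<And>N i \<omega>. i \<in> I N \<Longrightarrow> \<bar>X N i \<omega>\<bar> \<le> b N" and b: "b \<longlonglongrightarrow> 0"
    and mean: "\<And>N i. i \<in> I N \<Longrightarrow> (\<integral>\<omega>. X N i \<omega> \<partial>\<Omega> N) = 0"
    and var: "(\<lambda>N. \<Sum>i\<in>I N. \<integral>\<omega>. (X N i \<omega>)\<^sup>2 \<partial>\<Omega> N) \<longlonglongrightarrow> s"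
  shows "(\<lambda>N. \<integral>\<omega>. cos (\<Sum>i\<in>I N. X N i \<omega>) \<partial>\<Omega> N) \<longlonglongrightarrow> exp (- s / 2)"
    and "(\<lambda>N. \<integral>\<omega>. sin (\<Sum>i\<in>I N. X N i \<omega>) \<partial>\<Omega> N) \<longlonglongrightarrow> 0"
proof -
  define v where "v N i = (\<integral>\<omega>. (X N i \<omega>)\<^sup>2 \<partial>\<Omega> N)" for N i
  define D where "D N = (\<integral>\<omega>. iexp (\<Sum>i\<in>I N. X N i \<omega>) \<partial>\<Omega> N)" for N
  \<comment> \<open>One term from the third moment and one from the second order error of
    \<open>exp\<close>. The absolute value allows for a negative \<open>b N\<close>, which is
    possible when \<open>I N\<close> is empty.\<close>
  define c where "c N = \<bar>b N\<bar> / 6 + (b N)\<^sup>2 / 4" for N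
  have main: "cmod (D N - of_real (exp (- (\<Sum>i\<in>I N. v N i) / 2))) \<le> (\<Sum>i\<in>I N. v N i) * c N" for N
  proof -
    interpret prob_space "\<Omega> N" by (rule \<Omega>)
    have rv: "X N i \<in> borel_measurable (\<Omega> N)" if "i \<in> I N" for i
      using indep[of N] that by (auto simp: indep_vars_def)
    define f where "f i = char (distr (\<Omega> N) borel (X N i)) 1" for i
    have "D N = char (distr (\<Omega> N) borel (\<lambda>\<omega>. \<Sum>i\<in>I N. X N i \<omega>)) 1"
      using rv by (simp add: D_def char_def integral_distr)
    also have "\<dots> = (\<Prod>i\<in>I N. f i)" unfolding f_def by (rule char_distr_sum[OF indep])
    finally have "D N - of_real (exp (- (\<Sum>i\<in>I N. v N i) / 2)) = (\<Prod>i\<in>I N. f i) - (\<Prod>i\<in>I N. of_real (exp (- v N i / 2)))"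
      using fin[of N] by (simp add: exp_sum[symmetric] sum_negf[symmetric] sum_divide_distrib flip: of_real_prod)
    also have "cmod \<dots> \<le> (\<Sum>i\<in>I N. cmod (f i - of_real (exp (- v N i / 2))))"
    proof (rule norm_prod_diff)
      fix i assume i: "i \<in> I N"
      interpret D: real_distribution "distr (\<Omega> N) borel (X N i)" using rv[OF i] by simp
      show "norm (f i) \<le> 1" unfolding f_def by (rule D.cmod_char_le_1)
      have "0 \<le> v N i" by (simp add: v_def)
      then show "norm (of_real (exp (- v N i / 2)) :: complex) \<le> 1" by simp
    qed
    also have "\<dots> \<le> (\<Sum>i\<in>I N. v N i * c N)"
    proof (rule sum_mono)
      fix i assume i: "i \<in> I N"
      note [measurable] = rv[OF i]
      have int: "integrable (\<Omega> N) (X N i)" "integrable (\<Omega> N) (\<lambda>\<omega>. (X N i \<omega>)\<^sup>2)"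
        by (rule integrable_const_bound[of _ "b N"] integrable_const_bound[of _ "(b N)\<^sup>2"],
            use bd[OF i] power_mono[OF bd[OF i] abs_ge_zero, of _ 2] in auto)+
      have v0: "0 \<le> v N i" by (simp add: v_def)
      have vb: "v N i \<le> (b N)\<^sup>2"
      proof -
        have "v N i \<le> (\<integral>\<omega>. (b N)\<^sup>2 \<partial>\<Omega> N)"
          unfolding v_def
        proof (rule integral_mono[OF int(2)])
          show "(X N i \<omega>)\<^sup>2 \<le> (b N)\<^sup>2" for \<omega> using power_mono[OF bd[OF i] abs_ge_zero, of \<omega> 2] by simp
        qed simp
        then show ?thesis by (simp add: prob_space)
      qed
      have "cmod (f i - (1 - 1\<^sup>2 * v N i / 2)) \<le> (1\<^sup>2 / 6) * expectation (\<lambda>\<omega>. min (6 * (X N i \<omega>)\<^sup>2) (\<bar>1\<bar> * \<bar>X N i \<omega>\<bar> ^ 3))"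
        unfolding f_def by (rule char_approx3') (use int mean[OF i] in \<open>auto simp: v_def\<close>)
      also have "expectation (\<lambda>\<omega>. min (6 * (X N i \<omega>)\<^sup>2) (\<bar>1\<bar> * \<bar>X N i \<omega>\<bar> ^ 3)) \<le> expectation (\<lambda>\<omega>. \<bar>b N\<bar> * (X N i \<omega>)\<^sup>2)"
      proof (rule integral_mono)
        show "integrable (\<Omega> N) (\<lambda>\<omega>. min (6 * (X N i \<omega>)\<^sup>2) (\<bar>1\<bar> * \<bar>X N i \<omega>\<bar> ^ 3))"
          by (rule Bochner_Integration.integrable_bound[of _ "\<lambda>\<omega>. 6 * (X N i \<omega>)\<^sup>2"]) (use int in auto)
        fix \<omega>
        have "\<bar>X N i \<omega>\<bar> ^ 3 = \<bar>X N i \<omega>\<bar> * (X N i \<omega>)\<^sup>2" by (simp add: power3_eq_cube power2_eq_square)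
        also have "\<dots> \<le> \<bar>b N\<bar> * (X N i \<omega>)\<^sup>2" using bd[OF i, of \<omega>] by (intro mult_right_mono) auto
        finally show "min (6 * (X N i \<omega>)\<^sup>2) (\<bar>1\<bar> * \<bar>X N i \<omega>\<bar> ^ 3) \<le> \<bar>b N\<bar> * (X N i \<omega>)\<^sup>2" by simp
      qed (use int in auto)
      finally have 1: "cmod (f i - (1 - v N i / 2)) \<le> \<bar>b N\<bar> / 6 * v N i"
        by (simp add: v_def)
      have "cmod (of_real (exp (- v N i / 2)) - (1 - v N i / 2)) = \<bar>exp (- (v N i / 2)) - (1 - v N i / 2)\<bar>"
        by (simp only: of_real_diff[symmetric] norm_of_real minus_divide_left of_real_eq_id id_apply)
      also have "\<dots> \<le> (v N i / 2)\<^sup>2" using v0 by (intro exp_minus_approx) simp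
      also have "\<dots> \<le> (b N)\<^sup>2 / 4 * v N i"
        using mult_right_mono[OF vb v0] by (simp add: power2_eq_square)
      finally have 2: "cmod (of_real (exp (- v N i / 2)) - (1 - v N i / 2)) \<le> (b N)\<^sup>2 / 4 * v N i" .
      have "cmod (f i - of_real (exp (- v N i / 2))) \<le> cmod (f i - (1 - v N i / 2)) + cmod (of_real (exp (- v N i / 2)) - (1 - v N i / 2))"
        by (rule order_trans[OF _ norm_triangle_ineq4]) simp
      also have "\<dots> \<le> v N i * c N" using 1 2 by (simp add: c_def algebra_simps)
      finally show "cmod (f i - of_real (exp (- v N i / 2))) \<le> v N i * c N" .
    qed
    finally show ?thesis by (simp add: sum_distrib_right)
  qed
  have "c \<longlonglongrightarrow> \<bar>0\<bar> / 6 + 0\<^sup>2 / 4" unfolding c_def by (intro tendsto_intros b) auto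
  then have "(\<lambda>N. (\<Sum>i\<in>I N. v N i) * c N) \<longlonglongrightarrow> s * 0"
    using var unfolding v_def by (intro tendsto_mult) auto
  then have "(\<lambda>N. (\<Sum>i\<in>I N. v N i) * c N) \<longlonglongrightarrow> 0" by simp
  then have "(\<lambda>N. D N - of_real (exp (- (\<Sum>i\<in>I N. v N i) / 2))) \<longlonglongrightarrow> 0"
    by (rule Lim_null_comparison[rotated]) (intro always_eventually allI main)
  moreover have "(\<lambda>N. of_real (exp (- (\<Sum>i\<in>I N. v N i) / 2)) :: complex) \<longlonglongrightarrow> of_real (exp (- s / 2))"
    by (intro tendsto_intros) (use var in \<open>simp_all add: v_def\<close>)
  ultimately have "(\<lambda>N. (D N - of_real (exp (- (\<Sum>i\<in>I N. v N i) / 2))) + of_real (exp (- (\<Sum>i\<in>I N. v N i) / 2))) \<longlonglongrightarrow> 0 + of_real (exp (- s / 2))"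
    by (rule tendsto_add)
  then have D: "D \<longlonglongrightarrow> of_real (exp (- s / 2))" by simp
  have parts: "Re (D N) = (\<integral>\<omega>. cos (\<Sum>i\<in>I N. X N i \<omega>) \<partial>\<Omega> N)" "Im (D N) = (\<integral>\<omega>. sin (\<Sum>i\<in>I N. X N i \<omega>) \<partial>\<Omega> N)" for N
  proof -
    interpret prob_space "\<Omega> N" by (rule \<Omega>)
    have [measurable]: "X N i \<in> borel_measurable (\<Omega> N)" if "i \<in> I N" for i
      using indep[of N] that by (auto simp: indep_vars_def)
    have re: "Re (iexp x) = cos x" "Im (iexp x) = sin x" for x :: real by (simp_all flip: cis_conv_exp)
    have i: "integrable (\<Omega> N) (\<lambda>\<omega>. iexp (\<Sum>i\<in>I N. X N i \<omega>))"
      by (rule integrable_const_bound[of _ 1]) auto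
    show "Re (D N) = (\<integral>\<omega>. cos (\<Sum>i\<in>I N. X N i \<omega>) \<partial>\<Omega> N)" "Im (D N) = (\<integral>\<omega>. sin (\<Sum>i\<in>I N. X N i \<omega>) \<partial>\<Omega> N)"
      unfolding D_def integral_Re[OF i, symmetric] integral_Im[OF i, symmetric] by (simp_all only: re)
  qed
  show "(\<lambda>N. \<integral>\<omega>. cos (\<Sum>i\<in>I N. X N i \<omega>) \<partial>\<Omega> N) \<longlonglongrightarrow> exp (- s / 2)"
    using tendsto_Re[OF D] by (simp add: parts)
  show "(\<lambda>N. \<integral>\<omega>. sin (\<Sum>i\<in>I N. X N i \<omega>) \<partial>\<Omega> N) \<longlonglongrightarrow> 0"
    using tendsto_Im[OF D] by (simp add: parts)
qed

section \<open>Finite-dimensional approximation of totally bounded families\<close>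

text \<open>Vectors are allowed to vanish, so that Gram-Schmidt needs no independence.\<close>

definition ortho_seq :: "(nat \<Rightarrow> 'h::real_inner) \<Rightarrow> bool" where
  "ortho_seq e \<longleftrightarrow> (\<forall>i j. i \<noteq> j \<longrightarrow> e i \<bullet> e j = 0) \<and> (\<forall>i. e i = 0 \<or> norm (e i) = 1)"

definition ortho_proj :: "(nat \<Rightarrow> 'h::real_inner) \<Rightarrow> nat \<Rightarrow> 'h \<Rightarrow> 'h" where
  "ortho_proj e d x = (\<Sum>i<d. (x \<bullet> e i) *\<^sub>R e i)"

lemma ortho_seq_inner_self: "ortho_seq e \<Longrightarrow> (x \<bullet> e i) * (e i \<bullet> e i) = x \<bullet> e i"
  unfolding ortho_seq_def by (metis inner_zero_right mult.right_neutral mult_zero_left norm_eq_1)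

lemma ortho_proj_inner:
  assumes "ortho_seq e"
  shows "ortho_proj e d x \<bullet> e i = (if i < d then x \<bullet> e i else 0)"
proof -
  have "ortho_proj e d x \<bullet> e i = (\<Sum>j<d. if j = i then x \<bullet> e i else 0)"
    unfolding ortho_proj_def inner_sum_left
    using assms ortho_seq_inner_self[OF assms, of x i] by (intro sum.cong) (auto simp: ortho_seq_def)
  then show ?thesis by simp
qed

lemma ortho_proj_linear: "linear (ortho_proj e d)"
  by (rule linearI) (simp_all add: ortho_proj_def inner_add_left scaleR_left_distrib sum.distrib scaleR_right.sum)

lemma ortho_proj_self_adjoint: "ortho_proj e d x \<bullet> y = x \<bullet> ortho_proj e d y"
  by (simp add: ortho_proj_def inner_sum_left inner_sum_right inner_commute mult.commute)

lemma ortho_proj_idem: "ortho_seq e \<Longrightarrow> ortho_proj e d (ortho_proj e d x) = ortho_proj e d x"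
  unfolding ortho_proj_def[of e d "ortho_proj e d x"] by (simp add: ortho_proj_inner) (simp add: ortho_proj_def)

lemma ortho_proj_pythagoras:
  assumes "ortho_seq e"
  shows "(norm x)\<^sup>2 = (norm (ortho_proj e d x))\<^sup>2 + (norm (x - ortho_proj e d x))\<^sup>2"
proof -
  have "ortho_proj e d x \<bullet> (x - ortho_proj e d x) = 0"
    using ortho_proj_self_adjoint[of e d x "x - ortho_proj e d x"] ortho_proj_idem[OF assms, of d x]
    by (simp add: linear_diff[OF ortho_proj_linear])
  then show ?thesis
    using norm_add_Pythagorean[of "ortho_proj e d x" "x - ortho_proj e d x"] by (simp add: orthogonal_def)
qed

lemma ortho_proj_norm_le:
  assumes "ortho_seq e"
  shows "norm (ortho_proj e d x) \<le> norm x" "norm (x - ortho_proj e d x) \<le> norm x"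
proof -
  show "norm (ortho_proj e d x) \<le> norm x"
    by (rule power2_le_imp_le) (use ortho_proj_pythagoras[OF assms, of x d] in auto)
  show "norm (x - ortho_proj e d x) \<le> norm x"
    by (rule power2_le_imp_le) (use ortho_proj_pythagoras[OF assms, of x d] in auto)
qed

text \<open>The residual of \<open>x - y\<close> is that of \<open>x\<close>, and taking residuals
  does not increase the norm.\<close>

lemma ortho_proj_best_approx:
  assumes "ortho_seq e" "ortho_proj e d y = y"
  shows "norm (x - ortho_proj e d x) \<le> norm (x - y)"
  using ortho_proj_norm_le(2)[OF assms(1), of "x - y" d] assms(2)
  by (simp add: linear_diff[OF ortho_proj_linear])

text \<open>\<open>sgn\<close> normalises and sends zero to zero, so a vector that depends on its
  predecessors contributes a zero vector.\<close>

fun gram_schmidt :: "(nat \<Rightarrow> 'h::real_inner) \<Rightarrow> nat \<Rightarrow> 'h" where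
  "gram_schmidt x n = sgn (x n - (\<Sum>i<n. (x n \<bullet> gram_schmidt x i) *\<^sub>R gram_schmidt x i))"

declare gram_schmidt.simps[simp del]

lemma ortho_seq_gram_schmidt: "ortho_seq (gram_schmidt x)"
proof -
  let ?e = "gram_schmidt x"
  have unit: "?e n = 0 \<or> norm (?e n) = 1" for n
    by (subst (1 2) gram_schmidt.simps) (simp add: norm_sgn)
  have self: "(v \<bullet> ?e i) * (?e i \<bullet> ?e i) = v \<bullet> ?e i" for v i
    using unit[of i] by (auto simp: norm_eq_1)
  have orth: "\<forall>i<n. ?e n \<bullet> ?e i = 0" for n
  proof (induction n rule: less_induct)
    case (less n)
    have z: "?e j \<bullet> ?e i = 0" if "i < n" "j < n" "i \<noteq> j" for i j
      using less[of i] less[of j] that by (metis inner_commute linorder_neqE_nat)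
    show ?case
    proof (intro allI impI)
      fix i assume i: "i < n"
      have "(\<Sum>j<n. (x n \<bullet> ?e j) *\<^sub>R ?e j) \<bullet> ?e i = (\<Sum>j<n. if j = i then x n \<bullet> ?e i else 0)"
        unfolding inner_sum_left using z[OF i] self[of "x n" i] by (intro sum.cong) auto
      then have "(x n - (\<Sum>j<n. (x n \<bullet> ?e j) *\<^sub>R ?e j)) \<bullet> ?e i = 0"
        using i by (simp add: inner_diff_left)
      then show "?e n \<bullet> ?e i = 0"
        by (subst gram_schmidt.simps) (simp add: sgn_div_norm)
    qed
  qed
  show ?thesis unfolding ortho_seq_def
    using unit orth by (metis inner_commute linorder_neqE_nat)
qed

text \<open>By construction \<open>x n\<close> lies in the span of the first \<open>n + 1\<close>
  vectors; orthogonality kills the later coefficients, so a longer projection changes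
  nothing.\<close>

lemma ortho_proj_gram_schmidt:
  assumes "n < d"
  shows "ortho_proj (gram_schmidt x) d (x n) = x n"
proof -
  let ?e = "gram_schmidt x"
  have o: "ortho_seq ?e" by (rule ortho_seq_gram_schmidt)
  define r where "r = x n - ortho_proj ?e n (x n)"
  have e: "?e n = sgn r" by (subst gram_schmidt.simps) (simp add: r_def ortho_proj_def)
  have "x n \<bullet> ?e n = r \<bullet> ?e n" unfolding r_def using o by (simp add: inner_diff_left ortho_proj_inner)
  also have "\<dots> = norm r" by (cases "r = 0") (simp_all add: e sgn_div_norm power2_norm_eq_inner[symmetric] power2_eq_square)
  finally have "(x n \<bullet> ?e n) *\<^sub>R ?e n = r" by (cases "r = 0") (simp_all add: e sgn_div_norm)
  then have "ortho_proj ?e (Suc n) (x n) = x n" by (simp add: ortho_proj_def r_def)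
  then have "x n \<bullet> ?e i = 0" if "i > n" for i
    using ortho_proj_inner[OF o, of "Suc n" "x n" i] that by simp
  then have "ortho_proj ?e d (x n) = ortho_proj ?e (Suc n) (x n)"
    unfolding ortho_proj_def using assms by (intro sum.mono_neutral_right) auto
  then show ?thesis using \<open>ortho_proj ?e (Suc n) (x n) = x n\<close> by simp
qed

text \<open>Gram-Schmidt is run through the union of finite nets for all radii 1 / (k + 1). Once
  \<open>d\<close> has passed the net of index \<open>k\<close>, the projection fixes that net, and
  the best approximation of a point is no worse than its nearest net point. This makes the rate
  uniform in \<open>y\<close>.\<close>

proposition ortho_seq_totally_bounded:
  fixes \<phi> :: "'a \<Rightarrow> 'h::real_inner"
  assumes net: "\<And>\<epsilon>. 0 < \<epsilon> \<Longrightarrow> \<exists>F. finite F \<and> (\<forall>y. \<exists>z\<in>F. norm (\<phi> y - \<phi> z) \<le> \<epsilon>)"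
    and bd: "\<And>y. norm (\<phi> y) \<le> B"
  obtains e \<eta> where "ortho_seq e" "\<eta> \<longlonglongrightarrow> 0" "\<And>d y. norm (\<phi> y - ortho_proj e d (\<phi> y)) \<le> \<eta> d"
proof -
  have "\<forall>k. \<exists>F. finite F \<and> (\<forall>y. \<exists>z\<in>F. norm (\<phi> y - \<phi> z) \<le> 1 / real (Suc k))"
    by (intro allI net) simp
  from choice[OF this] obtain F where F: "\<And>k. finite (F k)" "\<And>k y. \<exists>z\<in>F k. norm (\<phi> y - \<phi> z) \<le> 1 / real (Suc k)"
    by auto
  define x where "x n = \<phi> (from_nat_into (\<Union>k. F k) n)" for n
  have cnt: "countable (\<Union>k. F k)" by (intro countable_UN) (auto intro: countable_finite F(1))
  define e where "e = gram_schmidt x"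
  have o: "ortho_seq e" unfolding e_def by (rule ortho_seq_gram_schmidt)
  define \<eta> where "\<eta> d = (SUP y. norm (\<phi> y - ortho_proj e d (\<phi> y)))" for d
  have bdd: "bdd_above (range (\<lambda>y. norm (\<phi> y - ortho_proj e d (\<phi> y))))" for d
    by (rule bdd_aboveI2[where M=B]) (rule order_trans[OF ortho_proj_norm_le(2)[OF o] bd])
  have le: "norm (\<phi> y - ortho_proj e d (\<phi> y)) \<le> \<eta> d" for d y
    unfolding \<eta>_def by (rule cSUP_upper[OF UNIV_I bdd])
  have "\<eta> \<longlonglongrightarrow> 0"
  proof (rule LIMSEQ_I)
    fix r :: real assume "0 < r"
    then obtain k where k: "1 / real (Suc k) < r" using nat_approx_posE by blast
    define i where "i z = to_nat_on (\<Union>k. F k) z" for z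
    have xi: "x (i z) = \<phi> z" if "z \<in> F k" for z
      unfolding x_def i_def using that cnt by (subst from_nat_into_to_nat_on) auto
    define d0 where "d0 = Suc (Max (insert 0 (i ` F k)))"
    have "norm (\<eta> d - 0) < r" if "d \<ge> d0" for d
    proof -
      have "norm (\<phi> y - ortho_proj e d (\<phi> y)) \<le> 1 / real (Suc k)" for y
      proof -
        obtain z where z: "z \<in> F k" "norm (\<phi> y - \<phi> z) \<le> 1 / real (Suc k)" using F(2) by blast
        have "i z \<le> Max (insert 0 (i ` F k))" using z F(1) by (intro Max_ge) auto
        then have "i z < d" using that by (simp add: d0_def)
        then have "ortho_proj e d (\<phi> z) = \<phi> z"
          using ortho_proj_gram_schmidt[of "i z" d x] xi[OF z(1)] by (simp add: e_def)
        from ortho_proj_best_approx[OF o this, of "\<phi> y"] show ?thesis using z(2) by linarith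
      qed
      then have "\<eta> d \<le> 1 / real (Suc k)" unfolding \<eta>_def by (intro cSUP_least) auto
      moreover have "0 \<le> \<eta> d" using le[of undefined d] norm_ge_zero order_trans by blast
      ultimately show ?thesis using k by simp
    qed
    then show "\<exists>no. \<forall>n\<ge>no. norm (\<eta> n - 0) < r" by blast
  qed
  then show ?thesis using that[OF o _ le] by blast
qed

section \<open>Dyadic tail bounds\<close>

context hoelder_weight
begin

text \<open>The modulus \<open>sqrt h * (1 + log 2 (1/h)) powr \<beta>\<close> at the dyadic length
  h = 2^(-j): the threshold granted to one increment of level \<open>j\<close>, up to a common
  factor.\<close>

definition level :: "nat \<Rightarrow> real" where
  "level j = sqrt (1 / 2^j) * (1 + real j) powr \<beta>"

lemma level_nonneg: "0 \<le> level j"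
  by (simp add: level_def)

lemma level_0: "level 0 = 1"
  by (simp add: level_def)

lemma level_summable: "summable level"
proof (rule summable_comparison_test_ev)
  have "2 powr (- 1/4) < 2 powr (0::real)" by (rule powr_less_mono) auto
  then show "summable (\<lambda>j. (2 powr (- 1/4) :: real) ^ j)" by (intro summable_geometric) simp
  have "\<forall>\<^sub>F j in sequentially. 2 powr (- real j / 2) * (1 + real j) powr \<beta> \<le> 2 powr (- real j / 4)"
    using \<beta> by real_asymp
  then show "\<forall>\<^sub>F j in sequentially. norm (level j) \<le> (2 powr (- 1/4)) ^ j"
  proof eventually_elim
    case (elim j)
    have "sqrt (1 / 2^j) = 2 powr (- real j / 2)"
      by (simp add: real_sqrt_divide powr_minus_divide powr_half_sqrt_powr powr_realpow)
    moreover have "(2 powr (- 1/4)) ^ j = 2 powr (- real j / 4)"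
      by (simp add: powr_realpow[symmetric] powr_powr)
    ultimately show ?case using elim level_nonneg[of j] by (simp add: level_def)
  qed
qed

definition level_const :: real where
  "level_const = (\<Sum>j. level j)"

text \<open>The levels are submultiplicative, because \<open>1 + i + j\<close> is at most
  \<open>(1 + i) * (1 + j)\<close>; hence the tail from \<open>j\<close> on is comparable with its
  first term.\<close>

lemma level_tail: "(\<Sum>i. level (i + j)) \<le> level_const * level j"
proof -
  have "level (i + j) \<le> level i * level j" for i
  proof -
    have "1 + real (i + j) \<le> (1 + real i) * (1 + real j)" by (simp add: algebra_simps)
    then have "(1 + real (i + j)) powr \<beta> \<le> ((1 + real i) * (1 + real j)) powr \<beta>" using \<beta> by (intro powr_mono2) auto
    also have "\<dots> = (1 + real i) powr \<beta> * (1 + real j) powr \<beta>" by (rule powr_mult)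
    finally have "level (i + j) \<le> sqrt (1 / 2^(i + j)) * ((1 + real i) powr \<beta> * (1 + real j) powr \<beta>)"
      unfolding level_def by (rule mult_left_mono) simp
    also have "\<dots> = level i * level j"
      by (simp add: level_def power_add real_sqrt_mult real_sqrt_divide)
    finally show ?thesis .
  qed
  then have "(\<Sum>i. level (i + j)) \<le> (\<Sum>i. level i * level j)"
    by (intro suminf_le summable_mult2 level_summable summable_ignore_initial_segment)
  then show ?thesis by (simp add: level_const_def suminf_mult2[OF level_summable, symmetric])
qed

lemma level_const_pos: "0 \<le> level_const"
  unfolding level_const_def by (intro suminf_nonneg level_summable level_nonneg)

text \<open>Refining a linear piece halves its increments at each step, while the levels drop at
  most by the square root of two. A polygon therefore obeys all finer thresholds once it obeys those
  of its own grid.\<close>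

lemma level_decay: "i \<le> j \<Longrightarrow> level i / 2^(j - i) \<le> level j"
proof -
  assume ij: "i \<le> j"
  define k where "k = j - i"
  have "sqrt (1 / 2^i) / 2^k \<le> sqrt (1 / 2^(i + k))"
  proof (rule real_le_rsqrt)
    have "(sqrt (1 / 2^i) / 2^k)\<^sup>2 = 1 / (2^i * (2^k * 2^k))" by (simp add: power_divide power2_eq_square[of "2^k"])
    also have "\<dots> \<le> 1 / (2^i * (2^k * 1))" by (intro divide_left_mono mult_left_mono mult_pos_pos) auto
    finally show "(sqrt (1 / 2^i) / 2^k)\<^sup>2 \<le> 1 / 2^(i + k)" by (simp add: power_add)
  qed
  moreover have "(1 + real i) powr \<beta> \<le> (1 + real (i + k)) powr \<beta>" using \<beta> by (intro powr_mono2) auto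
  ultimately have "sqrt (1 / 2^i) / 2^k * (1 + real i) powr \<beta> \<le> sqrt (1 / 2^(i + k)) * (1 + real (i + k)) powr \<beta>"
    by (intro mult_mono) auto
  then show ?thesis using ij by (simp add: level_def k_def)
qed

lemma level_le_weight:
  assumes h: "0 < h" "h \<le> 1"
  obtains j where "h \<le> 1 / 2^j" "level j \<le> sqrt 2 * C * \<rho> h"
proof -
  define l where "l = log 2 (1/h)"
  have l0: "0 \<le> l" unfolding l_def using h by (intro zero_le_log_cancel_iff[THEN iffD2]) auto
  \<comment> \<open>Rounding down puts 2^(-j) between \<open>h\<close> and \<open>2 * h\<close>,
    which is the origin of the factor \<open>sqrt 2\<close>.\<close>
  define j where "j = nat \<lfloor>l\<rfloor>"
  have j: "real j \<le> l" "l < real j + 1" using l0 by (auto simp: j_def)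
  have e: "2 powr l = 1 / h" unfolding l_def using h by (intro powr_log_cancel) auto
  have "2 powr real j \<le> 2 powr l" using j by (intro powr_mono) auto
  then have "2^j \<le> 1/h" unfolding e by (simp add: powr_realpow)
  then have 1: "h \<le> 1 / 2^j" using h by (simp add: field_simps)
  have "2 powr l \<le> 2 powr (real j + 1)" using j by (intro powr_mono) auto
  then have "1/h \<le> 2^j * 2" unfolding e powr_add by (simp add: powr_realpow)
  then have 2: "1 / 2^j \<le> 2 * h" using h by (simp add: field_simps)
  have "level j \<le> sqrt (2 * h) * (1 + l) powr \<beta>"
    unfolding level_def using 2 j \<beta> h by (intro mult_mono powr_mono2 real_sqrt_le_mono) auto
  also have "\<dots> = sqrt 2 * (sqrt h * (1 + l) powr \<beta>)" by (simp add: real_sqrt_mult)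
  also have "\<dots> \<le> sqrt 2 * (C * \<rho> h)" using weight_ge[OF h] unfolding l_def by (intro mult_left_mono) auto
  finally show ?thesis using that[OF 1] by simp
qed

text \<open>The two summands belong to the supremum and to the Hoelder quotient: chaining costs
  twice a tail of the levels, taken from level 0 for the former and from the level matching
  \<open>y - x\<close> for the latter.\<close>

definition chain_const :: real where
  "chain_const = 2 * level_const + 2 * level_const * sqrt 2 * C"

lemma chain_const_nonneg: "0 \<le> chain_const"
  using level_const_pos C by (simp add: chain_const_def)

proposition hnorm_chaining:
  fixes f :: "real \<Rightarrow> 'h::real_normed_vector"
  assumes cont: "continuous_on {0..1} f" and d: "0 \<le> d" and f0: "f 0 = 0"
    and inc: "\<And>j k. k < 2^j \<Longrightarrow> norm (f (real (k+1) / 2^j) - f (real k / 2^j)) \<le> d * level j"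
  shows "hnorm f \<le> ennreal (chain_const * d)"
proof -
  have chain: "norm (f y - f x) \<le> 2 * d * level_const * level j" if "0 \<le> x" "x < y" "y \<le> 1" "y - x \<le> 1/2^j" for x y j
  proof -
    have "norm (f y - f x) \<le> 2 * (\<Sum>i. d * level (i + j))"
      by (rule dyadic_chaining[OF cont _ _ inc that]) (use d level_nonneg level_summable in auto)
    also have "(\<Sum>i. d * level (i + j)) = d * (\<Sum>i. level (i + j))"
      by (intro suminf_mult summable_ignore_initial_segment level_summable)
    also have "\<dots> \<le> d * (level_const * level j)" by (intro mult_left_mono level_tail d)
    finally show ?thesis by simp
  qed
  have "hnorm f \<le> ennreal (2 * d * level_const + 2 * d * level_const * (sqrt 2 * C))"
  proof (rule hnorm_le)
    fix x :: real assume x: "0 \<le> x" "x \<le> 1"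
    show "norm (f x) \<le> 2 * d * level_const"
      using chain[of 0 x 0] x d level_const_pos by (cases "x = 0") (auto simp: f0 level_0)
  next
    fix x y :: real assume x: "0 \<le> x" "x < y" "y \<le> 1"
    then have "0 < y - x" "y - x \<le> 1" by auto
    then obtain j where j: "y - x \<le> 1/2^j" "level j \<le> sqrt 2 * C * \<rho> (y - x)" by (rule level_le_weight)
    have "norm (f y - f x) \<le> 2 * d * level_const * level j" by (rule chain[OF x j(1)])
    also have "\<dots> \<le> 2 * d * level_const * (sqrt 2 * C * \<rho> (y - x))" using d level_const_pos j by (intro mult_left_mono) auto
    finally show "norm (f y - f x) \<le> 2 * d * level_const * (sqrt 2 * C) * \<rho> (y - x)" by (simp add: mult_ac)
  qed
  also have "2 * d * level_const + 2 * d * level_const * (sqrt 2 * C) = chain_const * d"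
    by (simp add: chain_const_def algebra_simps)
  finally show ?thesis .
qed

text \<open>The union bound for level \<open>j\<close>: 2^j increments, each with a Gaussian tail at
  its threshold. The length 2^(-j) cancels between squared threshold and variance, which leaves the
  logarithmic factor with exponent \<open>2 * \<beta>\<close>.\<close>

definition tail_term :: "real \<Rightarrow> nat \<Rightarrow> real" where
  "tail_term A j = 2^j * (2 * exp (- (A * (1 + real j) powr (2 * \<beta>))))"

lemma tail_term_nonneg: "0 \<le> tail_term A j"
  by (simp add: tail_term_def)

lemma tail_term_summable:
  assumes A: "0 < A"
  shows "summable (tail_term A)"
proof (rule summable_comparison_test_ev)
  show "summable (\<lambda>j. 2 * (2 / exp 1 :: real) ^ j)"
  proof (intro summable_mult summable_geometric)
    have "2 < exp (1::real)" using exp_lower_Taylor_quadratic[of 1] by simp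
    then show "norm (2 / exp 1 :: real) < 1" by simp
  qed
  \<comment> \<open>The place where \<open>2 * \<beta> > 1\<close> is decisive: the exponent
    eventually exceeds \<open>j\<close> for every positive \<open>A\<close>, and 2 / exp 1 is below
    1.\<close>
  have "\<forall>\<^sub>F j in sequentially. real j \<le> A * (1 + real j) powr (2 * \<beta>)"
    using A \<beta> by real_asymp
  then show "\<forall>\<^sub>F j in sequentially. norm (tail_term A j) \<le> 2 * (2 / exp 1) ^ j"
  proof eventually_elim
    case (elim j)
    have "exp (- (A * (1 + real j) powr (2 * \<beta>))) \<le> exp (- real j)" using elim by simp
    also have "\<dots> = 1 / exp 1 ^ j" by (simp add: exp_minus exp_of_nat_mult[symmetric] divide_inverse)
    finally show ?case by (simp add: tail_term_def power_divide field_simps)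
  qed
qed

text \<open>As \<open>(1 + real j) powr (2 * \<beta>)\<close> is at least 1, raising the constant
  from 1 to \<open>A\<close> gains at least \<open>exp (- (A - 1))\<close> on every level at
  once.\<close>

lemma tail_term_le:
  assumes "1 \<le> A"
  shows "(\<Sum>j. tail_term A j) \<le> exp (- (A - 1)) * (\<Sum>j. tail_term 1 j)"
proof -
  have "tail_term A j \<le> exp (- (A - 1)) * tail_term 1 j" for j
  proof -
    have "1 \<le> (1 + real j) powr (2 * \<beta>)" using \<beta> by (intro ge_one_powr_ge_zero) auto
    then have "(A - 1) * 1 \<le> (A - 1) * (1 + real j) powr (2 * \<beta>)" using assms by (intro mult_left_mono) auto
    then have "exp (- (A * (1 + real j) powr (2 * \<beta>))) \<le> exp (- (A - 1) + - (1 * (1 + real j) powr (2 * \<beta>)))"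
      by (simp add: algebra_simps)
    then have "2^j * (2 * exp (- (A * (1 + real j) powr (2 * \<beta>)))) \<le> 2^j * (2 * exp (- (A - 1) + - (1 * (1 + real j) powr (2 * \<beta>))))"
      by (intro mult_left_mono) auto
    then show ?thesis by (simp only: tail_term_def exp_add mult_ac)
  qed
  then have "(\<Sum>j. tail_term A j) \<le> (\<Sum>j. exp (- (A - 1)) * tail_term 1 j)"
    using assms by (intro suminf_le summable_mult tail_term_summable) auto
  then show ?thesis by (simp add: suminf_mult[OF tail_term_summable])
qed

lemma tail_term_limit: "((\<lambda>A. \<Sum>j. tail_term A j) \<longlongrightarrow> 0) at_top"
proof (rule tendsto_sandwich)
  show "\<forall>\<^sub>F A in at_top. 0 \<le> (\<Sum>j. tail_term A j)"
    using eventually_gt_at_top[of 0] by eventually_elim (intro suminf_nonneg tail_term_summable tail_term_nonneg)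
  show "\<forall>\<^sub>F A in at_top. (\<Sum>j. tail_term A j) \<le> exp (- (A - 1)) * (\<Sum>j. tail_term 1 j)"
    using eventually_ge_at_top[of 1] by eventually_elim (rule tail_term_le)
  have "((\<lambda>A::real. exp (- (A - 1)) * (\<Sum>j. tail_term 1 j)) \<longlongrightarrow> 0 * (\<Sum>j. tail_term 1 j)) at_top"
    by (intro tendsto_mult tendsto_const) real_asymp
  then show "((\<lambda>A::real. exp (- (A - 1)) * (\<Sum>j. tail_term 1 j)) \<longlongrightarrow> 0) at_top" by simp
qed simp

lemma level_sq: "(level j)\<^sup>2 * 2^j = (1 + real j) powr (2 * \<beta>)"
proof -
  have "((1 + real j) powr \<beta>)\<^sup>2 = (1 + real j) powr (2 * \<beta>)" by (simp add: power2_eq_square powr_add[symmetric])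
  then show ?thesis by (simp add: level_def power_mult_distrib)
qed

end

text \<open>\<open>s / 2^j\<close> is the variance proxy of an increment of level \<open>j\<close>,
  so the bound depends on \<open>d\<^sup>2 / (2 * s)\<close> and \<open>n\<close> alone. For large
  \<open>n\<close> it is the tail of a fixed series; for \<open>n = 0\<close> smallness has to come
  from \<open>s\<close>.\<close>

lemma (in prob_space) dyadic_union_bound:
  fixes D :: "nat \<Rightarrow> nat \<Rightarrow> 'a \<Rightarrow> real"
  assumes w: "hoelder_weight \<rho> \<beta> C"
    and meas: "\<And>j k. k < 2^j \<Longrightarrow> D j k \<in> borel_measurable M"
    and tail: "\<And>j k. k < 2^j \<Longrightarrow> prob {\<omega>\<in>space M. d * hoelder_weight.level \<beta> j \<le> D j k \<omega>} \<le> 2 * exp (- ((d * hoelder_weight.level \<beta> j)\<^sup>2 / (2 * (s / 2^j))))"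
    and s: "0 < s" and d: "0 < d"
  shows "prob {\<omega>\<in>space M. \<exists>j\<ge>n. \<exists>k<2^j. d * hoelder_weight.level \<beta> j \<le> D j k \<omega>}
    \<le> (\<Sum>j. hoelder_weight.tail_term \<beta> (d\<^sup>2 / (2 * s)) (j + n))"
proof -
  interpret hoelder_weight \<rho> \<beta> C by fact
  let ?A = "d\<^sup>2 / (2 * s)"
  have A: "0 < ?A" using s d by simp
  define E where "E j k = {\<omega>\<in>space M. d * level j \<le> D j k \<omega>}" for j k
  have E[measurable]: "E j k \<in> sets M" if "k < 2^j" for j k
    unfolding E_def using meas[OF that] by measurable
  have lev: "prob (\<Union>k\<in>{..<2^j}. E j k) \<le> tail_term ?A j" for j
  proof -
    have "prob (\<Union>k\<in>{..<2^j}. E j k) \<le> (\<Sum>k\<in>{..<(2::nat)^j}. prob (E j k))"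
      by (rule finite_measure_subadditive_finite) (use E in auto)
    also have "\<dots> \<le> (\<Sum>k\<in>{..<(2::nat)^j}. 2 * exp (- (?A * (1 + real j) powr (2 * \<beta>))))"
    proof (rule sum_mono)
      fix k :: nat assume "k \<in> {..<2^j}"
      then have "prob (E j k) \<le> 2 * exp (- ((d * level j)\<^sup>2 / (2 * (s / 2^j))))" unfolding E_def by (intro tail) auto
      also have "(d * level j)\<^sup>2 / (2 * (s / 2^j)) = ?A * ((level j)\<^sup>2 * 2^j)" using s by (simp add: power_mult_distrib field_simps)
      finally show "prob (E j k) \<le> 2 * exp (- (?A * (1 + real j) powr (2 * \<beta>)))" by (simp only: level_sq)
    qed
    also have "\<dots> = tail_term ?A j" by (simp add: tail_term_def)
    finally show ?thesis .
  qed
  have "{\<omega>\<in>space M. \<exists>j\<ge>n. \<exists>k<2^j. d * level j \<le> D j k \<omega>} = (\<Union>j. \<Union>k\<in>{..<2^(j+n)}. E (j+n) k)"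
  proof (intro set_eqI iffI)
    fix \<omega> assume "\<omega> \<in> {\<omega>\<in>space M. \<exists>j\<ge>n. \<exists>k<2^j. d * level j \<le> D j k \<omega>}"
    then obtain j k where "n \<le> j" "k < 2^j" "\<omega> \<in> E j k" by (auto simp: E_def)
    then show "\<omega> \<in> (\<Union>j. \<Union>k\<in>{..<2^(j+n)}. E (j+n) k)" by (intro UN_I[of "j - n"] UN_I[of k]) auto
  next
    fix \<omega> assume "\<omega> \<in> (\<Union>j. \<Union>k\<in>{..<2^(j+n)}. E (j+n) k)"
    then obtain j k where jk: "k < 2^(j+n)" "\<omega> \<in> E (j+n) k" by auto
    then show "\<omega> \<in> {\<omega>\<in>space M. \<exists>j\<ge>n. \<exists>k<2^j. d * level j \<le> D j k \<omega>}"
      unfolding E_def by (intro CollectI conjI exI[of _ "j+n"] exI[of _ k]) auto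
  qed
  then have "emeasure M {\<omega>\<in>space M. \<exists>j\<ge>n. \<exists>k<2^j. d * level j \<le> D j k \<omega>} \<le> (\<Sum>j. emeasure M (\<Union>k\<in>{..<2^(j+n)}. E (j+n) k))"
    by (simp only:) (rule emeasure_subadditive_countably, use E in auto)
  also have "\<dots> \<le> (\<Sum>j. ennreal (tail_term ?A (j + n)))"
    using lev by (intro suminf_le) (auto simp: emeasure_eq_measure intro!: ennreal_leI)
  also have "\<dots> = ennreal (\<Sum>j. tail_term ?A (j + n))"
    by (intro suminf_ennreal2 tail_term_nonneg summable_ignore_initial_segment tail_term_summable A)
  finally show ?thesis
    by (simp add: emeasure_eq_measure suminf_nonneg tail_term_nonneg summable_ignore_initial_segment tail_term_summable A)
qed

section \<open>Partial sum processes in a Hilbert space\<close>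

definition hat :: "nat \<Rightarrow> nat \<Rightarrow> real \<Rightarrow> real" where
  "hat n k x = max 0 (1 - \<bar>2^n * x - real k\<bar>)"

definition interp :: "nat \<Rightarrow> (real \<Rightarrow> 'h::real_vector) \<Rightarrow> real \<Rightarrow> 'h" where
  "interp n f x = (\<Sum>k\<le>2^n. hat n k x *\<^sub>R f (real k / 2^n))"

lemma interp_eq:
  assumes k: "k < 2^n" and t: "0 \<le> t" "t \<le> 1"
  shows "interp n f ((real k + t) / 2^n) = (1 - t) *\<^sub>R f (real k / 2^n) + t *\<^sub>R f (real (k + 1) / 2^n)"
proof -
  have h: "hat n i ((real k + t) / 2^n) = (if i = k then 1 - t else if i = k + 1 then t else 0)" for i
  proof -
    have "hat n i ((real k + t) / 2^n) = max 0 (1 - \<bar>(real k - real i) + t\<bar>)"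
      by (simp add: hat_def)
    moreover consider "i = k" | "i = k + 1" | "i + 1 \<le> k" | "k + 2 \<le> i" by linarith
    then have "max 0 (1 - \<bar>(real k - real i) + t\<bar>) = (if i = k then 1 - t else if i = k + 1 then t else 0)"
    proof cases
      case 3
      then have "1 \<le> real k - real i" by linarith
      then show ?thesis using 3 t by auto
    next
      case 4
      then have "real k - real i \<le> - 2" by linarith
      then show ?thesis using 4 t by auto
    qed (use t in auto)
    ultimately show ?thesis by simp
  qed
  have "interp n f ((real k + t) / 2^n) = (\<Sum>i\<in>{k, k+1}. (if i = k then 1 - t else t) *\<^sub>R f (real i / 2^n))"
    unfolding interp_def h using k by (intro sum.mono_neutral_cong_right) auto
  then show ?thesis by simp
qed

lemma interp_grid_fine:
  assumes k: "k \<le> 2^n"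
  shows "interp n f (real k / 2^n) = f (real k / 2^n)"
proof (cases "k = 2^n")
  case True
  \<comment> \<open>The right end has no cell to its right; it is read as the end of the last
    cell.\<close>
  define i :: nat where "i = 2^n - 1"
  have i: "k = i + 1" "i < 2^n" using True by (auto simp: i_def)
  then show ?thesis using interp_eq[of i n 1 f] by (simp add: add.commute)
next
  case False
  then show ?thesis using interp_eq[of k n 0 f] k by simp
qed

lemma interp_grid_coarse:
  assumes "j \<le> n" "k \<le> 2^j"
  shows "interp n f (real k / 2^j) = f (real k / 2^j)"
proof -
  have p: "(2::nat)^n = 2^(n - j) * 2^j" using assms by (simp flip: power_add)
  have "(2::real)^n = 2^(n - j) * 2^j" using assms by (simp flip: power_add)
  then have "real k / 2^j = real (k * 2^(n - j)) / 2^n" by simp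
  moreover have "k * 2^(n - j) \<le> 2^n" unfolding p using assms by simp
  ultimately show ?thesis using interp_grid_fine[of "k * 2^(n - j)" n f] by simp
qed

text \<open>A cell of the finer grid lies inside one coarse cell, on which the polygon is affine; it
  sees the fraction 2^(-(j-n)) of a single coarse increment.\<close>

lemma interp_increment:
  assumes "n \<le> j" "k < 2^j"
  obtains k' where "k' < 2^n" "interp n f (real (k+1) / 2^j) - interp n f (real k / 2^j)
    = (1 / 2^(j - n)) *\<^sub>R (f (real (k'+1) / 2^n) - f (real k' / 2^n))"
proof -
  define m :: nat where "m = 2^(j - n)"
  have m: "m > 0" "real m = 2^(j - n)" by (auto simp: m_def)
  define k' where "k' = k div m"
  define s where "s = k mod m"
  have k: "k = k' * m + s" "s < m"
    unfolding k'_def s_def by (rule div_mult_mod_eq[symmetric], rule mod_less_divisor[OF m(1)])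
  have p: "(2::nat)^j = 2^n * m" using assms by (simp add: m_def flip: power_add)
  have k': "k' < 2^n" using assms(2) m unfolding k'_def p by (simp add: less_mult_imp_div_less)
  have pj: "(2::real)^j = 2^n * real m" using assms by (simp add: m(2) flip: power_add)
  have e1: "real k / 2^j = (real k' + real s / real m) / 2^n" using m unfolding pj by (subst k(1)) (simp add: field_simps)
  have e2: "real (k+1) / 2^j = (real k' + real (s+1) / real m) / 2^n" using m unfolding pj by (subst k(1)) (simp add: field_simps)
  have "real (s+1) / real m \<le> 1" "real s / real m \<le> 1" using k(2) m(1) by (simp_all add: divide_le_eq_1)
  then have "interp n f (real (k+1) / 2^j) - interp n f (real k / 2^j)
     = (1 - real (s+1) / real m) *\<^sub>R f (real k' / 2^n) + (real (s+1) / real m) *\<^sub>R f (real (k' + 1) / 2^n)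
       - ((1 - real s / real m) *\<^sub>R f (real k' / 2^n) + (real s / real m) *\<^sub>R f (real (k' + 1) / 2^n))"
    unfolding e1 e2 by (subst (1 2) interp_eq[OF k']) auto
  also have "\<dots> = (1 / real m) *\<^sub>R (f (real (k'+1) / 2^n) - f (real k' / 2^n))"
    by (simp add: add_divide_distrib algebra_simps)
  finally show ?thesis using that[OF k'] m(2) by simp
qed

lemma (in hoelder_weight) sqrt_lip_hat: "sqrt_lip (hat n k)"
  unfolding sqrt_lip_def
proof (intro exI[of _ "2^n"] conjI allI impI)
  fix x y :: real assume "0 \<le> x \<and> x < y \<and> y \<le> 1"
  then have xy: "0 \<le> x" "x < y" "y \<le> 1" by auto
  have "\<bar>hat n k y - hat n k x\<bar> \<le> \<bar>2^n * y - 2^n * x\<bar>" by (auto simp: hat_def)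
  also have "\<dots> = 2^n * (y - x)" using xy by (simp add: right_diff_distrib[symmetric] abs_mult)
  also have "y - x \<le> sqrt (y - x)" using xy by (intro real_le_rsqrt) (simp add: power2_eq_square mult_left_le)
  finally show "\<bar>hat n k y - hat n k x\<bar> \<le> 2^n * sqrt (y - x)" by simp
qed simp

text \<open>The processes \<open>Z N\<close> are linear combinations of independent bounded centered vectors with
  deterministic time profiles \<open>u N i\<close>. The orthogonal projections onto the first vectors of \<open>e\<close>
  approximate the summands uniformly.\<close>

locale hilbert_fclt = hoelder_weight \<rho> \<beta> C for \<rho> :: "real \<Rightarrow> real" and \<beta> C :: real +
  fixes \<Omega> :: "nat \<Rightarrow> 'a measure" and I :: "nat \<Rightarrow> 'i::countable set" and Y :: "nat \<Rightarrow> 'i \<Rightarrow> 'a \<Rightarrow> real"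
    and u :: "nat \<Rightarrow> 'i \<Rightarrow> real \<Rightarrow> real" and \<phi> :: "real \<Rightarrow> 'h::{real_inner,banach}" and m :: "nat \<Rightarrow> 'i \<Rightarrow> 'h"
    and b :: "nat \<Rightarrow> real" and \<Gamma> :: "real \<Rightarrow> real \<Rightarrow> 'h \<Rightarrow> 'h \<Rightarrow> real"
    and e :: "nat \<Rightarrow> 'h" and \<eta> :: "nat \<Rightarrow> real"
  assumes prob: "\<And>N. prob_space (\<Omega> N)" and fin: "\<And>N. finite (I N)"
    and indep: "\<And>N. prob_space.indep_vars (\<Omega> N) (\<lambda>_. borel) (Y N) (I N)"
    and \<phi>_cont: "continuous_on UNIV \<phi>" and \<phi>_norm: "\<And>y. norm (\<phi> y) \<le> 1"
    and mean: "\<And>N i f. i \<in> I N \<Longrightarrow> (\<integral>\<omega>. \<phi> (Y N i \<omega>) \<bullet> f \<partial>\<Omega> N) = m N i \<bullet> f"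
    and u_0: "\<And>N i. i \<in> I N \<Longrightarrow> u N i 0 = 0"
    and u_inc: "\<And>N x y. 0 \<le> x \<Longrightarrow> x < y \<Longrightarrow> y \<le> 1 \<Longrightarrow> (\<Sum>i\<in>I N. (u N i y - u N i x)\<^sup>2) \<le> y - x"
    and u_bound: "\<And>N i x. i \<in> I N \<Longrightarrow> 0 \<le> x \<Longrightarrow> x \<le> 1 \<Longrightarrow> \<bar>u N i x\<bar> \<le> b N" and b_lim: "b \<longlonglongrightarrow> 0"
    and cov: "\<And>x y f g. x \<in> {0..1} \<Longrightarrow> y \<in> {0..1} \<Longrightarrow>
      (\<lambda>N. \<Sum>i\<in>I N. u N i x * u N i y * (\<integral>\<omega>. ((\<phi> (Y N i \<omega>) - m N i) \<bullet> f) * ((\<phi> (Y N i \<omega>) - m N i) \<bullet> g) \<partial>\<Omega> N))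
        \<longlonglongrightarrow> \<Gamma> x y f g"
    and e_ortho: "ortho_seq e" and \<eta>_lim: "\<eta> \<longlonglongrightarrow> 0"
    and e_approx: "\<And>d y. norm (\<phi> y - ortho_proj e d (\<phi> y)) \<le> \<eta> d"
begin

section \<open>Tail bounds for the process and for the remainders of its projections\<close>

abbreviation X :: "nat \<Rightarrow> 'i \<Rightarrow> 'a \<Rightarrow> 'h" where
  "X N i \<omega> \<equiv> \<phi> (Y N i \<omega>) - m N i"

definition Z :: "nat \<Rightarrow> 'a \<Rightarrow> real \<Rightarrow> 'h" where
  "Z N \<omega> = lincomb (I N) (u N) (\<lambda>i. X N i \<omega>)"

lemma Y_measurable: "i \<in> I N \<Longrightarrow> Y N i \<in> borel_measurable (\<Omega> N)"
proof -
  interpret prob_space "\<Omega> N" by (rule prob)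
  show "i \<in> I N \<Longrightarrow> Y N i \<in> borel_measurable (\<Omega> N)" using indep[of N] by (auto simp: indep_vars_def)
qed

lemma \<phi>_inner_measurable: "i \<in> I N \<Longrightarrow> (\<lambda>\<omega>. \<phi> (Y N i \<omega>) \<bullet> f) \<in> borel_measurable (\<Omega> N)"
  by (rule measurable_compose[OF Y_measurable], assumption)
    (intro borel_measurable_continuous_onI continuous_intros \<phi>_cont)

lemma \<phi>_inner_bound: "\<bar>\<phi> y \<bullet> f\<bar> \<le> norm f"
  using Cauchy_Schwarz_ineq2[of "\<phi> y" f] mult_right_mono[OF \<phi>_norm[of y], of "norm f"] by simp

lemma \<phi>_inner_integrable: "i \<in> I N \<Longrightarrow> integrable (\<Omega> N) (\<lambda>\<omega>. \<phi> (Y N i \<omega>) \<bullet> f)"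
proof -
  assume i: "i \<in> I N"
  interpret prob_space "\<Omega> N" by (rule prob)
  show ?thesis
    by (rule integrable_const_bound[of _ "norm f"]) (use \<phi>_inner_bound \<phi>_inner_measurable[OF i] in auto)
qed

text \<open>The mean \<open>m N i\<close> is given only weakly, through its inner products. Bounds
  on it are obtained by testing against suitable vectors, among them itself, in place of a
  vector-valued integral.\<close>

lemma m_inner_le:
  assumes i: "i \<in> I N" and c: "\<And>y. \<phi> y \<bullet> f \<le> c"
  shows "m N i \<bullet> f \<le> c"
proof -
  interpret prob_space "\<Omega> N" by (rule prob)
  have "m N i \<bullet> f \<le> (\<integral>\<omega>. c \<partial>\<Omega> N)"
    unfolding mean[OF i, symmetric] by (rule integral_mono[OF \<phi>_inner_integrable[OF i]]) (use c in auto)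
  then show ?thesis by (simp add: prob_space)
qed

lemma m_norm: "i \<in> I N \<Longrightarrow> norm (m N i) \<le> 1"
proof -
  assume i: "i \<in> I N"
  have "m N i \<bullet> m N i \<le> norm (m N i)"
    by (rule m_inner_le[OF i]) (rule order_trans[OF abs_ge_self \<phi>_inner_bound])
  then have "norm (m N i) * norm (m N i) \<le> norm (m N i) * 1" by (simp add: power2_norm_eq_inner[symmetric] power2_eq_square)
  then show ?thesis by (cases "m N i = 0") auto
qed

lemma X_norm: "i \<in> I N \<Longrightarrow> norm (\<phi> y - m N i) \<le> 2"
  using norm_triangle_ineq4[of "\<phi> y" "m N i"] \<phi>_norm[of y] m_norm[of i N] by simp

lemma X_mean: "i \<in> I N \<Longrightarrow> (\<integral>\<omega>. X N i \<omega> \<bullet> f \<partial>\<Omega> N) = 0"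
proof -
  assume i: "i \<in> I N"
  interpret prob_space "\<Omega> N" by (rule prob)
  show ?thesis using \<phi>_inner_integrable[OF i, of f] mean[OF i] by (simp add: inner_diff_left prob_space)
qed

definition rest :: "nat \<Rightarrow> 'h \<Rightarrow> 'h" where
  "rest n x = x - ortho_proj e n x"

lemma rest_linear: "linear (rest n)"
  unfolding rest_def by (intro linear_compose_sub linear_ident ortho_proj_linear)

lemma rest_self_adjoint: "rest n x \<bullet> y = x \<bullet> rest n y"
  by (simp add: rest_def inner_diff_left inner_diff_right ortho_proj_self_adjoint)

lemma rest_continuous: "continuous_on S f \<Longrightarrow> continuous_on S (\<lambda>x. rest n (f x))"
  unfolding rest_def ortho_proj_def by (intro continuous_intros)

text \<open>Adding \<open>1/(n+1)\<close> keeps the variance proxy positive.\<close>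

definition rest_bound :: "nat \<Rightarrow> real" where
  "rest_bound n = 2 * (\<bar>\<eta> n\<bar> + 1 / real (n + 1))"

lemma rest_bound_pos: "0 < rest_bound n"
  by (simp add: rest_bound_def add_nonneg_pos)

lemma rest_bound_neq [simp]: "rest_bound n \<noteq> 0"
  using rest_bound_pos[of n] by simp

lemma rest_bound_lim: "rest_bound \<longlonglongrightarrow> 0"
proof -
  have "rest_bound \<longlonglongrightarrow> 2 * (\<bar>0\<bar> + 0)"
    unfolding rest_bound_def using LIMSEQ_inverse_real_of_nat
    by (intro tendsto_intros \<eta>_lim) (simp add: inverse_eq_divide)
  then show ?thesis by simp
qed

text \<open>The remainder of the mean is tested against itself: \<open>rest n\<close> is
  self-adjoint and idempotent, so \<open>m N i \<bullet> rest n (m N i)\<close> is its squared norm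
  and is at most \<open>\<eta> n\<close> times its norm. Observation and mean together give the
  factor 2.\<close>

lemma rest_X_norm:
  assumes i: "i \<in> I N"
  shows "norm (rest n (\<phi> y - m N i)) \<le> rest_bound n"
proof -
  have e: "0 \<le> \<eta> n" using e_approx[of undefined n] norm_ge_zero order_trans by blast
  have p: "norm (rest n (\<phi> y)) \<le> \<eta> n" for y using e_approx[of y n] by (simp add: rest_def)
  have idem: "rest n (rest n x) = rest n x" for x
    unfolding rest_def using ortho_proj_idem[OF e_ortho] by (simp add: linear_diff[OF ortho_proj_linear])
  have "m N i \<bullet> rest n (m N i) \<le> \<eta> n * norm (rest n (m N i))"
  proof (rule m_inner_le[OF i])
    fix y
    have "\<phi> y \<bullet> rest n (m N i) = rest n (\<phi> y) \<bullet> rest n (m N i)"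
      using rest_self_adjoint[of n "\<phi> y" "rest n (m N i)"] by (simp add: idem)
    also have "\<dots> \<le> norm (rest n (\<phi> y)) * norm (rest n (m N i))" by (rule norm_cauchy_schwarz)
    also have "\<dots> \<le> \<eta> n * norm (rest n (m N i))" by (intro mult_right_mono p) auto
    finally show "\<phi> y \<bullet> rest n (m N i) \<le> \<eta> n * norm (rest n (m N i))" .
  qed
  also have "m N i \<bullet> rest n (m N i) = norm (rest n (m N i)) * norm (rest n (m N i))"
    using rest_self_adjoint[of n "m N i" "rest n (m N i)"] by (simp add: idem power2_norm_eq_inner[symmetric] power2_eq_square)
  finally have "norm (rest n (m N i)) \<le> \<eta> n" using e by (cases "rest n (m N i) = 0") auto
  then have "norm (rest n (\<phi> y - m N i)) \<le> 2 * \<eta> n"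
    using p[of y] norm_triangle_ineq4[of "rest n (\<phi> y)" "rest n (m N i)"] by (simp add: linear_diff[OF rest_linear])
  also have "\<dots> \<le> rest_bound n" using e by (simp add: rest_bound_def)
  finally show ?thesis .
qed

lemma u_sqrt_lip: "i \<in> I N \<Longrightarrow> sqrt_lip (u N i)"
  unfolding sqrt_lip_def
proof (intro exI[of _ 1] conjI allI impI)
  fix x y :: real assume i: "i \<in> I N" and "0 \<le> x \<and> x < y \<and> y \<le> 1"
  then have xy: "0 \<le> x" "x < y" "y \<le> 1" by auto
  have "(u N i y - u N i x)\<^sup>2 \<le> (\<Sum>i\<in>I N. (u N i y - u N i x)\<^sup>2)"
    using i fin by (intro member_le_sum) auto
  also have "\<dots> \<le> y - x" by (rule u_inc[OF xy])
  finally show "\<bar>u N i y - u N i x\<bar> \<le> 1 * sqrt (y - x)" by (simp add: real_le_rsqrt)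
qed simp

lemma Z_hspace: "Z N \<omega> \<in> hspace"
  unfolding Z_def by (rule lincomb_hspace[OF fin u_sqrt_lip])

lemma Z_eq: "0 \<le> x \<Longrightarrow> x \<le> 1 \<Longrightarrow> Z N \<omega> x = (\<Sum>i\<in>I N. u N i x *\<^sub>R X N i \<omega>)"
  by (simp add: Z_def lincomb_def)

lemma Z_0: "Z N \<omega> 0 = 0"
  by (simp add: Z_eq u_0)

text \<open>Only finitely many observations enter, so the path is a continuous image of a random
  point in a countable product of reals. Coordinates outside the index set are set to zero, which
  makes all of them measurable.\<close>

lemma Z_measurable: "Z N \<in> measurable (\<Omega> N) (borel_of hoelder.mtopology)"
proof -
  define y where "y \<omega> = (\<lambda>i. if i \<in> I N then Y N i \<omega> else 0)" for \<omega>
  define g where "g t = lincomb (I N) (u N) (\<lambda>i. \<phi> (t i) - m N i)" for t :: "'i \<Rightarrow> real"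
  have "y \<in> borel_measurable (\<Omega> N)"
    unfolding y_def
  proof (rule measurable_coordinatewise_then_product)
    show "(\<lambda>\<omega>. if i \<in> I N then Y N i \<omega> else 0) \<in> borel_measurable (\<Omega> N)" for i
      by (cases "i \<in> I N") (auto simp: Y_measurable)
  qed
  moreover have "g \<in> measurable (borel_of euclidean) (borel_of hoelder.mtopology)"
    unfolding g_def
    by (intro continuous_map_measurable lincomb_continuous fin u_sqrt_lip continuous_intros
        continuous_on_compose2[OF \<phi>_cont] continuous_on_product_coordinates) auto
  ultimately have "(\<lambda>\<omega>. g (y \<omega>)) \<in> measurable (\<Omega> N) (borel_of hoelder.mtopology)"
    by (simp add: borel_of_euclidean)
  moreover have "g (y \<omega>) = Z N \<omega>" for \<omega>
    unfolding g_def Z_def lincomb_def y_def by (intro restrict_ext sum.cong) auto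
  ultimately show ?thesis by simp
qed

text \<open>The squared coefficients of an increment add up to at most \<open>y - x\<close>. The
  summands are bounded by 2, hence the variance proxy \<open>4 * (y - x)\<close>, and their
  remainders by \<open>rest_bound n\<close>.\<close>

lemma Z_increment_tail:
  assumes xy: "0 \<le> x" "x < y" "y \<le> 1" and a: "0 \<le> a"
  shows "(\<lambda>\<omega>. norm (Z N \<omega> y - Z N \<omega> x)) \<in> borel_measurable (\<Omega> N)"
    and "measure (\<Omega> N) {\<omega>\<in>space (\<Omega> N). a \<le> norm (Z N \<omega> y - Z N \<omega> x)} \<le> 2 * exp (- (a\<^sup>2 / (2 * (4 * (y - x)))))"
    and "(\<lambda>\<omega>. norm (rest n (Z N \<omega> y - Z N \<omega> x))) \<in> borel_measurable (\<Omega> N)"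
    and "measure (\<Omega> N) {\<omega>\<in>space (\<Omega> N). a \<le> norm (rest n (Z N \<omega> y - Z N \<omega> x))} \<le> 2 * exp (- (a\<^sup>2 / (2 * ((rest_bound n)\<^sup>2 * (y - x)))))"
proof -
  interpret prob_space "\<Omega> N" by (rule prob)
  define c where "c i = u N i y - u N i x" for i
  have c: "(\<Sum>i\<in>I N. (c i)\<^sup>2) \<le> y - x" unfolding c_def by (rule u_inc[OF xy])
  have e1: "Z N \<omega> y - Z N \<omega> x = (\<Sum>i\<in>I N. c i *\<^sub>R (\<phi> (Y N i \<omega>) - m N i))" for \<omega>
    using xy by (simp add: Z_eq c_def scaleR_left_diff_distrib sum_subtractf)
  have e2: "rest n (Z N \<omega> y - Z N \<omega> x) = (\<Sum>i\<in>I N. c i *\<^sub>R rest n (\<phi> (Y N i \<omega>) - m N i))" for \<omega>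
    unfolding e1 by (simp add: linear_sum[OF rest_linear] linear_scale[OF rest_linear])
  have cont: "continuous_on UNIV (\<lambda>y. \<phi> y - m N i)" for i by (intro continuous_intros \<phi>_cont)
  show "(\<lambda>\<omega>. norm (Z N \<omega> y - Z N \<omega> x)) \<in> borel_measurable (\<Omega> N)"
    unfolding e1 by (rule norm_sum_measurable[OF fin, of _ "\<lambda>i y. \<phi> y - m N i"]) (auto intro: cont Y_measurable)
  show "(\<lambda>\<omega>. norm (rest n (Z N \<omega> y - Z N \<omega> x))) \<in> borel_measurable (\<Omega> N)"
    unfolding e2 by (rule norm_sum_measurable[OF fin, of _ "\<lambda>i y. rest n (\<phi> y - m N i)"])
      (auto intro: cont Y_measurable rest_continuous)
  show "prob {\<omega>\<in>space (\<Omega> N). a \<le> norm (Z N \<omega> y - Z N \<omega> x)} \<le> 2 * exp (- (a\<^sup>2 / (2 * (4 * (y - x)))))"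
    unfolding e1
    by (rule norm_indep_sum_tail[where b=2 and \<psi>="\<lambda>i y. \<phi> y - m N i", OF fin indep cont X_norm X_mean _ _ a])
      (use c xy in auto)
  show "prob {\<omega>\<in>space (\<Omega> N). a \<le> norm (rest n (Z N \<omega> y - Z N \<omega> x))} \<le> 2 * exp (- (a\<^sup>2 / (2 * ((rest_bound n)\<^sup>2 * (y - x)))))"
    unfolding e2
    by (rule norm_indep_sum_tail[where b="rest_bound n" and \<psi>="\<lambda>i y. rest n (\<phi> y - m N i)", OF fin indep _ rest_X_norm _ _ _ a])
      (use c xy rest_bound_pos in \<open>auto intro: rest_continuous cont mult_left_mono simp: X_mean rest_self_adjoint\<close>)
qed

text \<open>A pair of a rational time and a direction becomes one natural number, so a single scalar
  sequence holds the coordinates on all dyadic grids and for all projections.\<close>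

definition code :: "real \<Rightarrow> nat \<Rightarrow> nat" where
  "code x i = to_nat (inv_into UNIV (of_rat :: rat \<Rightarrow> real) x, i)"

definition decode :: "nat \<Rightarrow> real \<times> nat" where
  "decode j = (of_rat (fst (from_nat j :: rat \<times> nat)), snd (from_nat j :: rat \<times> nat))"

lemma decode_code: "x \<in> \<rat> \<Longrightarrow> decode (code x i) = (x, i)"
  by (auto simp: decode_def code_def Rats_def f_inv_into_f)

definition coords :: "(real \<Rightarrow> 'h) \<Rightarrow> nat \<Rightarrow> real" where
  "coords f j = (if fst (decode j) \<in> {0..1} then f (fst (decode j)) \<bullet> e (snd (decode j)) else 0)"

text \<open>The index \<open>n\<close> is both the dyadic resolution and the number of directions
  kept. Only finitely many entries of \<open>v\<close> are read, hence continuity in the product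
  topology.\<close>

definition recon :: "nat \<Rightarrow> (nat \<Rightarrow> real) \<Rightarrow> real \<Rightarrow> 'h" where
  "recon n v = lincomb {..2^n} (hat n) (\<lambda>k. \<Sum>i<n. v (code (real k / 2^n) i) *\<^sub>R e i)"

lemma recon_hspace: "recon n v \<in> hspace"
  unfolding recon_def by (rule lincomb_hspace) (auto intro: sqrt_lip_hat)

lemma recon_continuous: "continuous_map euclidean hoelder.mtopology (recon n)"
  unfolding recon_def
  by (intro lincomb_continuous continuous_intros continuous_on_product_coordinates sqrt_lip_hat) auto

lemma recon_coords:
  assumes "0 \<le> x" "x \<le> 1"
  shows "recon n (coords f) x = interp n (\<lambda>x. ortho_proj e n (f x)) x"
proof -
  have "(\<Sum>i<n. coords f (code (real k / 2^n) i) *\<^sub>R e i) = ortho_proj e n (f (real k / 2^n))" if "k \<le> 2^n" for k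
  proof -
    have "real k \<le> 2^n" using that by (metis of_nat_le_iff of_nat_numeral of_nat_power)
    then have "real k / 2^n \<in> {0..1}" "real k / 2^n \<in> \<rat>" by auto
    then show ?thesis by (simp add: coords_def decode_code ortho_proj_def)
  qed
  then show ?thesis using assms by (simp add: recon_def lincomb_def interp_def)
qed

definition incr :: "(real \<Rightarrow> 'h) \<Rightarrow> nat \<Rightarrow> nat \<Rightarrow> 'h" where
  "incr f j k = f (real (k+1) / 2^j) - f (real k / 2^j)"

text \<open>There are two sources of error: increments on levels from that of the grid on, whose
  details the polygon flattens, and the part of any increment outside the first \<open>n\<close>
  directions, which must be controlled from level 0 on.\<close>

definition bad :: "nat \<Rightarrow> nat \<Rightarrow> real \<Rightarrow> 'a set" where
  "bad N n d = {\<omega>\<in>space (\<Omega> N). \<exists>j\<ge>n. \<exists>k<2^j. d * level j \<le> norm (incr (Z N \<omega>) j k)}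
     \<union> {\<omega>\<in>space (\<Omega> N). \<exists>j\<ge>0. \<exists>k<2^j. d * level j \<le> norm (rest n (incr (Z N \<omega>) j k))}"

text \<open>The variance proxies per unit of time are 4 and \<open>(rest_bound n)\<^sup>2\<close>.
  As \<open>n\<close> grows, the first sum is small as the tail of a fixed series, the second
  through its growing exponent.\<close>

definition err :: "nat \<Rightarrow> real \<Rightarrow> real" where
  "err n d = (\<Sum>j. tail_term (d\<^sup>2 / (2 * 4)) (j + n)) + (\<Sum>j. tail_term (d\<^sup>2 / (2 * (rest_bound n)\<^sup>2)) j)"

lemma dyadic_cell:
  fixes k j :: nat
  assumes "k < 2^j"
  shows "0 \<le> real k / 2^j" "real k / 2^j < real (k+1) / 2^j" "real (k+1) / 2^j \<le> 1" "real (k+1) / 2^j - real k / 2^j = 1 / 2^j"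
proof -
  have "real (k+1) \<le> real (2^j)" using assms unfolding of_nat_le_iff by simp
  then show "real (k+1) / 2^j \<le> 1" by simp
qed (auto simp: field_simps)

lemma incr_tail:
  assumes k: "k < 2^j"
  shows "(\<lambda>\<omega>. norm (incr (Z N \<omega>) j k)) \<in> borel_measurable (\<Omega> N)"
    and "0 \<le> a \<Longrightarrow> measure (\<Omega> N) {\<omega>\<in>space (\<Omega> N). a \<le> norm (incr (Z N \<omega>) j k)} \<le> 2 * exp (- (a\<^sup>2 / (2 * (4 / 2^j))))"
    and "(\<lambda>\<omega>. norm (rest n (incr (Z N \<omega>) j k))) \<in> borel_measurable (\<Omega> N)"
    and "0 \<le> a \<Longrightarrow> measure (\<Omega> N) {\<omega>\<in>space (\<Omega> N). a \<le> norm (rest n (incr (Z N \<omega>) j k))} \<le> 2 * exp (- (a\<^sup>2 / (2 * ((rest_bound n)\<^sup>2 / 2^j))))"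
  using Z_increment_tail(1,3)[OF dyadic_cell(1-3)[OF k] order_refl] Z_increment_tail(2,4)[OF dyadic_cell(1-3)[OF k], of a]
  unfolding incr_def dyadic_cell(4)[OF k] by (simp_all only: times_divide_eq_right mult_1_right)

lemma bad_parts:
  shows "{\<omega>\<in>space (\<Omega> N). \<exists>j\<ge>n'. \<exists>k<2^j. d * level j \<le> norm (incr (Z N \<omega>) j k)} \<in> sets (\<Omega> N)" (is ?A)
    and "{\<omega>\<in>space (\<Omega> N). \<exists>j\<ge>n'. \<exists>k<2^j. d * level j \<le> norm (rest n (incr (Z N \<omega>) j k))} \<in> sets (\<Omega> N)" (is ?B)
proof -
  have eq: "{\<omega>\<in>space (\<Omega> N). \<exists>j\<ge>n'. \<exists>k<2^j. d * level j \<le> D j k \<omega>} = (\<Union>j\<in>{n'..}. \<Union>k\<in>{..<2^j}. {\<omega>\<in>space (\<Omega> N). d * level j \<le> D j k \<omega>})"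
    for D :: "nat \<Rightarrow> nat \<Rightarrow> 'a \<Rightarrow> real" by auto
  have m: "{\<omega>\<in>space (\<Omega> N). c \<le> D \<omega>} \<in> sets (\<Omega> N)" if "D \<in> borel_measurable (\<Omega> N)" for c and D :: "'a \<Rightarrow> real"
    using that by measurable
  show ?A unfolding eq by (intro sets.countable_UN'' m incr_tail) auto
  show ?B unfolding eq by (intro sets.countable_UN'' m incr_tail) auto
qed

lemma bad_measurable: "bad N n d \<in> sets (\<Omega> N)"
  unfolding bad_def by (intro sets.Un bad_parts)

lemma bad_prob:
  assumes d: "0 < d"
  shows "measure (\<Omega> N) (bad N n d) \<le> err n d"
proof -
  interpret prob_space "\<Omega> N" by (rule prob)
  have lv: "0 \<le> d * level j" for j using d level_nonneg by simp
  let ?A = "{\<omega>\<in>space (\<Omega> N). \<exists>j\<ge>n. \<exists>k<2^j. d * level j \<le> norm (incr (Z N \<omega>) j k)}"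
  let ?B = "{\<omega>\<in>space (\<Omega> N). \<exists>j\<ge>0. \<exists>k<2^j. d * level j \<le> norm (rest n (incr (Z N \<omega>) j k))}"
  have A: "prob ?A \<le> (\<Sum>j. tail_term (d\<^sup>2 / (2 * 4)) (j + n))"
    by (rule dyadic_union_bound[OF hoelder_weight_axioms incr_tail(1) incr_tail(2)]) (use lv d in auto)
  have B: "prob ?B \<le> (\<Sum>j. tail_term (d\<^sup>2 / (2 * (rest_bound n)\<^sup>2)) (j + 0))"
    by (rule dyadic_union_bound[OF hoelder_weight_axioms incr_tail(3) incr_tail(4)]) (use lv d in auto)
  have "prob (?A \<union> ?B) \<le> prob ?A + prob ?B" by (intro measure_Un_le bad_parts)
  then show ?thesis using A B unfolding bad_def err_def by simp
qed

text \<open>On coarse levels process and polygon differ only by the discarded directions. On fine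
  levels the difference splits into the discarded part, the projected increment and the increment of
  the polygon; each is within one threshold, which gives the factor 3.\<close>

lemma not_bad:
  assumes \<omega>: "\<omega> \<in> space (\<Omega> N)" "\<omega> \<notin> bad N n d" and d: "0 \<le> d"
  shows "hdist (Z N \<omega>) (recon n (coords (Z N \<omega>))) \<le> chain_const * (3 * d)"
proof (rule hdist_le)
  let ?P = "ortho_proj e n"
  define z where "z = Z N \<omega>"
  define f where "f x = z x - recon n (coords z) x" for x
  have A: "norm (incr z j k) \<le> d * level j" if "n \<le> j" "k < 2^j" for j k
  proof (rule ccontr)
    assume "\<not> norm (incr z j k) \<le> d * level j"
    then have "\<omega> \<in> bad N n d"
      unfolding bad_def z_def using \<omega>(1) that by (intro UnI1 CollectI conjI exI[of _ j] exI[of _ k]) auto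
    then show False using \<omega>(2) by contradiction
  qed
  have B: "norm (rest n (incr z j k)) \<le> d * level j" if "k < 2^j" for j k
  proof (rule ccontr)
    assume "\<not> norm (rest n (incr z j k)) \<le> d * level j"
    then have "\<omega> \<in> bad N n d"
      unfolding bad_def z_def using \<omega>(1) that by (intro UnI2 CollectI conjI exI[of _ j] exI[of _ k]) auto
    then show False using \<omega>(2) by contradiction
  qed
  have zc: "continuous_on {0..1} g" if "g \<in> hspace" for g :: "real \<Rightarrow> 'h"
    using that unfolding continuous_on hspace_iff by (metis LIM_zero_cancel tendsto_norm_zero_cancel)
  show "hnorm (\<lambda>x. Z N \<omega> x - recon n (coords (Z N \<omega>)) x) \<le> ennreal (chain_const * (3 * d))"
    unfolding z_def[symmetric] f_def[symmetric]
  proof (rule hnorm_chaining)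
    show "continuous_on {0..1} f" unfolding f_def
      by (intro continuous_on_diff zc recon_hspace) (simp add: z_def Z_hspace)
    show "f 0 = 0" using interp_grid_coarse[of 0 n 0 "\<lambda>x. ?P (z x)"]
      by (simp add: f_def recon_coords z_def Z_0 linear_0[OF ortho_proj_linear])
    show "0 \<le> 3 * d" using d by simp
    fix j k :: nat assume k: "k < 2^j"
    let ?x = "real k / 2^j" and ?y = "real (k+1) / 2^j"
    have c: "0 \<le> ?x" "?x \<le> 1" "0 \<le> ?y" "?y \<le> 1" using dyadic_cell[OF k] by linarith+
    have fi: "f ?y - f ?x = (incr z j k) - (interp n (\<lambda>x. ?P (z x)) ?y - interp n (\<lambda>x. ?P (z x)) ?x)"
      unfolding f_def incr_def recon_coords[OF c(1,2)] recon_coords[OF c(3,4)] by (simp del: of_nat_add of_nat_Suc)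
    show "norm (f ?y - f ?x) \<le> 3 * d * level j"
    proof (cases "j \<le> n")
      case True
      have "k + 1 \<le> 2^j" "k \<le> 2^j" using k by auto
      then have "f ?y - f ?x = rest n (incr z j k)"
        unfolding fi by (simp only: interp_grid_coarse[OF True] rest_def incr_def linear_diff[OF ortho_proj_linear])
      then show ?thesis using B[OF k] mult_nonneg_nonneg[OF d level_nonneg[of j]] by simp
    next
      case False
      then have nj: "n \<le> j" by simp
      obtain k' where k': "k' < 2^n" and i: "interp n (\<lambda>x. ?P (z x)) ?y - interp n (\<lambda>x. ?P (z x)) ?x
          = (1 / 2^(j - n)) *\<^sub>R (?P (z (real (k'+1) / 2^n)) - ?P (z (real k' / 2^n)))"
        by (rule interp_increment[OF nj k, of "\<lambda>x. ?P (z x)"])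
      let ?D = "incr z n k'"
      have "f ?y - f ?x = rest n (incr z j k) + ?P (incr z j k) - (1 / 2^(j - n)) *\<^sub>R ?P ?D"
        unfolding fi i incr_def by (simp add: rest_def linear_diff[OF ortho_proj_linear])
      then have "norm (f ?y - f ?x) \<le> norm (rest n (incr z j k)) + norm (?P (incr z j k)) + norm ((1 / 2^(j - n)) *\<^sub>R ?P ?D)"
        by (simp only:) (rule order_trans[OF norm_triangle_ineq4], rule add_right_mono, rule norm_triangle_ineq)
      also have "\<dots> \<le> d * level j + d * level j + d * (level n / 2^(j - n))"
      proof (intro add_mono B[OF k])
        show "norm (?P (incr z j k)) \<le> d * level j"
          using ortho_proj_norm_le(1)[OF e_ortho, of n "incr z j k"] A[of j k] False k by simp
        have "norm (?P ?D) \<le> d * level n"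
          using ortho_proj_norm_le(1)[OF e_ortho, of n ?D] A[OF order_refl k'] by linarith
        then have "norm (?P ?D) / 2^(j - n) \<le> d * level n / 2^(j - n)" by (rule divide_right_mono) simp
        then show "norm ((1 / 2^(j - n)) *\<^sub>R ?P ?D) \<le> d * (level n / 2^(j - n))" by simp
      qed
      also have "\<dots> \<le> d * level j + d * level j + d * level j"
        using level_decay[of n j] False d by (intro add_left_mono mult_left_mono) auto
      finally show ?thesis by simp
    qed
  qed
  show "0 \<le> chain_const * (3 * d)" using d chain_const_nonneg by simp
qed

lemma err_lim:
  assumes d: "0 < d"
  shows "(\<lambda>n. err n d) \<longlonglongrightarrow> 0"
proof -
  have "(\<lambda>n. \<Sum>j. tail_term (d\<^sup>2 / (2 * 4)) (j + n)) \<longlonglongrightarrow> 0"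
    using d by (intro suminf_exist_split2 tail_term_summable) auto
  moreover have "(\<lambda>n. \<Sum>j. tail_term (d\<^sup>2 / (2 * (rest_bound n)\<^sup>2)) j) \<longlonglongrightarrow> 0"
  proof (rule filterlim_compose[OF tail_term_limit])
    have "(\<lambda>n. 2 * (rest_bound n)\<^sup>2) \<longlonglongrightarrow> 2 * 0\<^sup>2" by (intro tendsto_intros rest_bound_lim)
    then have "filterlim (\<lambda>n. 2 * (rest_bound n)\<^sup>2) (at_right 0) sequentially"
      by (intro tendsto_imp_filterlim_at_right always_eventually allI) auto
    then have "filterlim (\<lambda>n. inverse (2 * (rest_bound n)\<^sup>2)) at_top sequentially"
      by (rule filterlim_compose[OF filterlim_inverse_at_top_right])
    then have "filterlim (\<lambda>n. d\<^sup>2 * inverse (2 * (rest_bound n)\<^sup>2)) at_top sequentially"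
      using d by (intro filterlim_tendsto_pos_mult_at_top[OF tendsto_const]) auto
    then show "filterlim (\<lambda>n. d\<^sup>2 / (2 * (rest_bound n)\<^sup>2)) at_top sequentially" by (simp only: divide_inverse)
  qed
  ultimately have "(\<lambda>n. err n d) \<longlonglongrightarrow> 0 + 0" unfolding err_def by (rule tendsto_add)
  then show ?thesis by simp
qed

end

text \<open>The term of index 1 in the series of cosh is half the square. This turns the exponential
  moment bound into a second moment bound.\<close>

lemma square_le_cosh: "t\<^sup>2 \<le> 2 * cosh (t :: real)"
proof -
  have s: "(\<lambda>n. (t\<^sup>2) ^ n / fact (2 * n)) sums cosh t" using cosh_sqrt_sums[of "t\<^sup>2"] by (simp add: cosh_real_abs)
  have "(\<Sum>n\<in>{1}. (t\<^sup>2) ^ n / fact (2 * n)) \<le> (\<Sum>n. (t\<^sup>2) ^ n / fact (2 * n))"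
    using s by (intro sum_le_suminf sums_summable[OF s]) auto
  also have "\<dots> = cosh t" using s by (simp add: sums_iff)
  finally show ?thesis by (simp add: fact_numeral)
qed

section \<open>Scalar limits and the law of the coordinate sequence\<close>

context hilbert_fclt
begin

lemma X_inner_bound: "i \<in> I N \<Longrightarrow> \<bar>(\<phi> y - m N i) \<bullet> f\<bar> \<le> 2 * norm f"
  using Cauchy_Schwarz_ineq2[of "\<phi> y - m N i" f] mult_right_mono[OF X_norm[of i N y], of "norm f"] by simp

lemma X_inner_cont: "continuous_on UNIV (\<lambda>y. (\<phi> y - m N i) \<bullet> f)"
  by (intro continuous_intros \<phi>_cont)

lemma X_inner_measurable: "i \<in> I N \<Longrightarrow> (\<lambda>\<omega>. X N i \<omega> \<bullet> f) \<in> borel_measurable (\<Omega> N)"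
  by (rule measurable_compose[OF Y_measurable borel_measurable_continuous_onI[OF X_inner_cont]])

lemma X_inner_integrable: "i \<in> I N \<Longrightarrow> integrable (\<Omega> N) (\<lambda>\<omega>. X N i \<omega> \<bullet> f)"
proof -
  assume i: "i \<in> I N"
  interpret prob_space "\<Omega> N" by (rule prob)
  show ?thesis
    by (rule integrable_const_bound[of _ "2 * norm f"]) (use X_inner_bound[OF i] X_inner_measurable[OF i] in auto)
qed

lemma X_inner_mult_integrable: "i \<in> I N \<Longrightarrow> integrable (\<Omega> N) (\<lambda>\<omega>. (X N i \<omega> \<bullet> f) * (X N i \<omega> \<bullet> g))"
proof -
  assume i: "i \<in> I N"
  interpret prob_space "\<Omega> N" by (rule prob)
  have "\<bar>X N i \<omega> \<bullet> f\<bar> * \<bar>X N i \<omega> \<bullet> g\<bar> \<le> (2 * norm f) * (2 * norm g)" for \<omega>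
    by (intro mult_mono X_inner_bound i) auto
  then show ?thesis
    by (intro integrable_const_bound[of _ "(2 * norm f) * (2 * norm g)"])
      (auto simp: abs_mult intro!: borel_measurable_times X_inner_measurable i)
qed

lemma Z_inner_measurable:
  assumes x: "x \<in> {0..1}"
  shows "(\<lambda>\<omega>. Z N \<omega> x \<bullet> f) \<in> borel_measurable (\<Omega> N)"
proof -
  have "Z N \<omega> x \<bullet> f = (\<Sum>i\<in>I N. u N i x * (X N i \<omega> \<bullet> f))" for \<omega>
    using x by (simp add: Z_eq inner_sum_left)
  moreover have "(\<lambda>\<omega>. \<Sum>i\<in>I N. u N i x * (X N i \<omega> \<bullet> f)) \<in> borel_measurable (\<Omega> N)"
    by (intro borel_measurable_sum borel_measurable_times borel_measurable_const X_inner_measurable)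
  ultimately show ?thesis by simp
qed

text \<open>The variance of a finite combination of scalars \<open>W (x j) \<bullet> f j\<close> for
  a centered process \<open>W\<close> with covariance \<Gamma>.\<close>

definition sumvar :: "'j set \<Rightarrow> ('j \<Rightarrow> real) \<Rightarrow> ('j \<Rightarrow> real) \<Rightarrow> ('j \<Rightarrow> 'h) \<Rightarrow> real" where
  "sumvar J a x f = (\<Sum>j\<in>J. \<Sum>k\<in>J. a j * a k * \<Gamma> (x j) (x k) (f j) (f k))"

lemma scalar_variance:
  assumes J: "finite J" and x: "\<And>j. j \<in> J \<Longrightarrow> x j \<in> {0..1}"
  shows "(\<lambda>N. \<Sum>i\<in>I N. \<integral>\<omega>. (\<Sum>j\<in>J. a j * (u N i (x j) * (X N i \<omega> \<bullet> f j)))\<^sup>2 \<partial>\<Omega> N) \<longlonglongrightarrow> sumvar J a x f"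
proof -
  have "(\<Sum>i\<in>I N. \<integral>\<omega>. (\<Sum>j\<in>J. a j * (u N i (x j) * (X N i \<omega> \<bullet> f j)))\<^sup>2 \<partial>\<Omega> N)
    = (\<Sum>j\<in>J. \<Sum>k\<in>J. a j * a k * (\<Sum>i\<in>I N. u N i (x j) * u N i (x k) * (\<integral>\<omega>. (X N i \<omega> \<bullet> f j) * (X N i \<omega> \<bullet> f k) \<partial>\<Omega> N)))" for N
  proof -
    have "(\<integral>\<omega>. (\<Sum>j\<in>J. a j * (u N i (x j) * (X N i \<omega> \<bullet> f j)))\<^sup>2 \<partial>\<Omega> N)
      = (\<Sum>j\<in>J. \<Sum>k\<in>J. a j * a k * (u N i (x j) * u N i (x k) * (\<integral>\<omega>. (X N i \<omega> \<bullet> f j) * (X N i \<omega> \<bullet> f k) \<partial>\<Omega> N)))" if i: "i \<in> I N" for i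
    proof -
      have "(\<integral>\<omega>. (\<Sum>j\<in>J. a j * (u N i (x j) * (X N i \<omega> \<bullet> f j)))\<^sup>2 \<partial>\<Omega> N)
         = (\<integral>\<omega>. (\<Sum>j\<in>J. \<Sum>k\<in>J. (a j * a k * (u N i (x j) * u N i (x k))) * ((X N i \<omega> \<bullet> f j) * (X N i \<omega> \<bullet> f k))) \<partial>\<Omega> N)"
        by (simp add: power2_eq_square sum_product mult_ac)
      also have "\<dots> = (\<Sum>j\<in>J. \<Sum>k\<in>J. (a j * a k * (u N i (x j) * u N i (x k))) * (\<integral>\<omega>. (X N i \<omega> \<bullet> f j) * (X N i \<omega> \<bullet> f k) \<partial>\<Omega> N))"
        using X_inner_mult_integrable[OF i] by (subst Bochner_Integration.integral_sum; (intro Bochner_Integration.integrable_sum)?; simp?)+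
      finally show ?thesis by (simp add: mult.assoc)
    qed
    then have "(\<Sum>i\<in>I N. \<integral>\<omega>. (\<Sum>j\<in>J. a j * (u N i (x j) * (X N i \<omega> \<bullet> f j)))\<^sup>2 \<partial>\<Omega> N)
      = (\<Sum>i\<in>I N. \<Sum>j\<in>J. \<Sum>k\<in>J. a j * a k * (u N i (x j) * u N i (x k) * (\<integral>\<omega>. (X N i \<omega> \<bullet> f j) * (X N i \<omega> \<bullet> f k) \<partial>\<Omega> N)))" by simp
    also have "\<dots> = (\<Sum>j\<in>J. \<Sum>i\<in>I N. \<Sum>k\<in>J. a j * a k * (u N i (x j) * u N i (x k) * (\<integral>\<omega>. (X N i \<omega> \<bullet> f j) * (X N i \<omega> \<bullet> f k) \<partial>\<Omega> N)))"
      by (rule sum.swap)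
    also have "\<dots> = (\<Sum>j\<in>J. \<Sum>k\<in>J. \<Sum>i\<in>I N. a j * a k * (u N i (x j) * u N i (x k) * (\<integral>\<omega>. (X N i \<omega> \<bullet> f j) * (X N i \<omega> \<bullet> f k) \<partial>\<Omega> N)))"
      by (intro sum.cong refl sum.swap)
    finally show ?thesis by (simp only: sum_distrib_left)
  qed
  then show ?thesis
    unfolding sumvar_def by (simp only:) (intro tendsto_sum tendsto_mult tendsto_const cov x)
qed

text \<open>\<Gamma> is known only as a limit. Positivity, like symmetry, is inherited from the
  variances for finite \<open>N\<close>, so \<Gamma> is a covariance without being computed.\<close>

lemma sumvar_nonneg:
  assumes J: "finite J" and x: "\<And>j. j \<in> J \<Longrightarrow> x j \<in> {0..1}"
  shows "0 \<le> sumvar J a x f"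
  by (rule LIMSEQ_le_const[OF scalar_variance[OF J x]]) (auto intro!: sum_nonneg)

lemma \<Gamma>_sym:
  assumes "x \<in> {0..1}" "y \<in> {0..1}"
  shows "\<Gamma> x y f g = \<Gamma> y x g f"
  by (rule LIMSEQ_unique[OF cov[OF assms]]) (use cov[OF assms(2,1), of g f] in \<open>simp add: mult_ac\<close>)

theorem scalar_clt:
  assumes J: "finite J" and x: "\<And>j. j \<in> J \<Longrightarrow> x j \<in> {0..1}"
  shows "(\<lambda>N. \<integral>\<omega>. cos (\<Sum>j\<in>J. a j * (Z N \<omega> (x j) \<bullet> f j)) \<partial>\<Omega> N) \<longlonglongrightarrow> exp (- sumvar J a x f / 2)"
    and "(\<lambda>N. \<integral>\<omega>. sin (\<Sum>j\<in>J. a j * (Z N \<omega> (x j) \<bullet> f j)) \<partial>\<Omega> N) \<longlonglongrightarrow> 0"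
proof -
  \<comment> \<open>All times and directions of one observation are collected in a single scalar, so
    that the sum over the observations has independent terms.\<close>
  define T where "T N i y = (\<Sum>j\<in>J. a j * (u N i (x j) * ((\<phi> y - m N i) \<bullet> f j)))" for N i y
  have T: "(\<Sum>j\<in>J. a j * (Z N \<omega> (x j) \<bullet> f j)) = (\<Sum>i\<in>I N. T N i (Y N i \<omega>))" for N \<omega>
  proof -
    have "(\<Sum>j\<in>J. a j * (Z N \<omega> (x j) \<bullet> f j)) = (\<Sum>j\<in>J. \<Sum>i\<in>I N. a j * (u N i (x j) * (X N i \<omega> \<bullet> f j)))"
      using x by (intro sum.cong refl) (simp add: Z_eq inner_sum_left sum_distrib_left)
    then show ?thesis unfolding T_def by (subst sum.swap) simp
  qed
  have Tm: "T N i \<in> borel_measurable borel" for N i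
    unfolding T_def by (intro borel_measurable_continuous_onI continuous_intros \<phi>_cont)
  define B where "B = (\<Sum>j\<in>J. \<bar>a j\<bar> * (2 * norm (f j)))"
  have bd: "\<bar>T N i y\<bar> \<le> b N * B" if i: "i \<in> I N" for N i y
  proof -
    have "\<bar>T N i y\<bar> \<le> (\<Sum>j\<in>J. \<bar>a j\<bar> * (b N * (2 * norm (f j))))"
      unfolding T_def
    proof (rule order_trans[OF sum_abs sum_mono])
      fix j assume "j \<in> J"
      then have "\<bar>u N i (x j)\<bar> * \<bar>(\<phi> y - m N i) \<bullet> f j\<bar> \<le> b N * (2 * norm (f j))"
        using x by (intro mult_mono' u_bound X_inner_bound i) auto
      then show "\<bar>a j * (u N i (x j) * ((\<phi> y - m N i) \<bullet> f j))\<bar> \<le> \<bar>a j\<bar> * (b N * (2 * norm (f j)))"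
        by (simp add: abs_mult mult_left_mono)
    qed
    then show ?thesis by (simp add: B_def sum_distrib_left mult_ac)
  qed
  have ind: "prob_space.indep_vars (\<Omega> N) (\<lambda>_. borel) (\<lambda>i \<omega>. T N i (Y N i \<omega>)) (I N)" for N
    by (rule prob_space.indep_vars_compose2[OF prob indep Tm])
  have bl: "(\<lambda>N. b N * B) \<longlonglongrightarrow> 0" using tendsto_mult[OF b_lim tendsto_const, of B] by simp
  have mn: "(\<integral>\<omega>. T N i (Y N i \<omega>) \<partial>\<Omega> N) = 0" if i: "i \<in> I N" for N i
    unfolding T_def using X_inner_integrable[OF i]
    by (subst Bochner_Integration.integral_sum) (auto simp: X_mean[OF i])
  have vr: "(\<lambda>N. \<Sum>i\<in>I N. \<integral>\<omega>. (T N i (Y N i \<omega>))\<^sup>2 \<partial>\<Omega> N) \<longlonglongrightarrow> sumvar J a x f"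
    unfolding T_def by (rule scalar_variance[OF J x])
  show "(\<lambda>N. \<integral>\<omega>. cos (\<Sum>j\<in>J. a j * (Z N \<omega> (x j) \<bullet> f j)) \<partial>\<Omega> N) \<longlonglongrightarrow> exp (- sumvar J a x f / 2)"
    "(\<lambda>N. \<integral>\<omega>. sin (\<Sum>j\<in>J. a j * (Z N \<omega> (x j) \<bullet> f j)) \<partial>\<Omega> N) \<longlonglongrightarrow> 0"
    unfolding T
    by (rule clt_bounded_array[OF prob fin ind bd bl mn vr]; assumption)+
qed

definition V :: "nat \<Rightarrow> 'a \<Rightarrow> nat \<Rightarrow> real" where
  "V N \<omega> = coords (Z N \<omega>)"

text \<open>The covariance of the limiting coordinate sequence, set to zero at times outside the
  unit interval just as \<open>coords\<close> is.\<close>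

definition ker :: "nat \<Rightarrow> nat \<Rightarrow> real" where
  "ker j k = (if fst (decode j) \<in> {0..1} \<and> fst (decode k) \<in> {0..1}
     then \<Gamma> (fst (decode j)) (fst (decode k)) (e (snd (decode j))) (e (snd (decode k))) else 0)"

lemma ker_sum:
  assumes "finite J"
  shows "(\<Sum>j\<in>J. \<Sum>k\<in>J. a j * a k * ker j k)
    = sumvar {j\<in>J. fst (decode j) \<in> {0..1}} a (\<lambda>j. fst (decode j)) (\<lambda>j. e (snd (decode j)))"
  unfolding sumvar_def using assms
  by (intro sum.mono_neutral_cong_right)
    (auto simp: ker_def split: if_splits intro!: sum.mono_neutral_cong_right sum.neutral)

lemma psd_ker: "psd_kernel ker"
  unfolding psd_kernel_def
proof (intro conjI allI impI)
  show "ker i j = ker j i" for i j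
    by (auto simp: ker_def intro: \<Gamma>_sym simp del: atLeastAtMost_iff)
  show "0 \<le> (\<Sum>i\<in>J. \<Sum>j\<in>J. a i * a j * ker i j)" if "finite J" for J a
    unfolding ker_sum[OF that] using that by (intro sumvar_nonneg) auto
qed

text \<open>A fixed choice of the centered Gaussian law with covariance \<open>ker\<close>; it
  carries the limit process constructed below.\<close>

definition \<mu> :: "(nat \<Rightarrow> real) measure" where
  "\<mu> = (SOME \<mu>. prob_space \<mu> \<and> sets \<mu> = sets borel \<and>
    (\<forall>d a. (\<integral>v. cos (\<Sum>j<d. a j * v j) \<partial>\<mu>) = exp (- (\<Sum>i<d. \<Sum>j<d. a i * a j * ker i j) / 2)) \<and>
    (\<forall>d a. (\<integral>v. sin (\<Sum>j<d. a j * v j) \<partial>\<mu>) = 0))"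

lemma \<mu>: "prob_space \<mu>" "sets \<mu> = sets borel"
    "(\<integral>v. cos (\<Sum>j<d. a j * v j) \<partial>\<mu>) = exp (- (\<Sum>i<d. \<Sum>j<d. a i * a j * ker i j) / 2)"
    "(\<integral>v. sin (\<Sum>j<d. a j * v j) \<partial>\<mu>) = 0"
proof -
  have "\<exists>\<mu>. prob_space \<mu> \<and> sets \<mu> = sets borel \<and>
    (\<forall>d a. (\<integral>v. cos (\<Sum>j<d. a j * v j) \<partial>\<mu>) = exp (- (\<Sum>i<d. \<Sum>j<d. a i * a j * ker i j) / 2)) \<and>
    (\<forall>d a. (\<integral>v. sin (\<Sum>j<d. a j * v j) \<partial>\<mu>) = 0)"
    by (rule gaussian_sequence_exists[OF psd_ker]) blast
  from someI_ex[OF this, folded \<mu>_def]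
  show "prob_space \<mu>" "sets \<mu> = sets borel"
    "(\<integral>v. cos (\<Sum>j<d. a j * v j) \<partial>\<mu>) = exp (- (\<Sum>i<d. \<Sum>j<d. a i * a j * ker i j) / 2)"
    "(\<integral>v. sin (\<Sum>j<d. a j * v j) \<partial>\<mu>) = 0" by auto
qed

lemma V_measurable: "V N \<in> borel_measurable (\<Omega> N)"
  unfolding V_def coords_def
proof (rule measurable_coordinatewise_then_product)
  fix j
  show "(\<lambda>\<omega>. if fst (decode j) \<in> {0..1} then Z N \<omega> (fst (decode j)) \<bullet> e (snd (decode j)) else 0) \<in> borel_measurable (\<Omega> N)"
    by (cases "fst (decode j) \<in> {0..1}") (simp_all only: if_True if_False Z_inner_measurable borel_measurable_const)
qed

lemma V_tight: "\<exists>K. \<forall>N. (\<integral>\<^sup>+\<omega>. ennreal ((V N \<omega> j)\<^sup>2) \<partial>\<Omega> N) \<le> ennreal K"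
proof (intro exI allI)
  fix N
  interpret prob_space "\<Omega> N" by (rule prob)
  define x where "x = fst (decode j)"
  define f where "f = e (snd (decode j))"
  \<comment> \<open>The square is at most \<open>2 * cosh (norm (Z N \<omega> x))\<close>. With
    summands bounded by 2 and squared coefficients adding up to at most 1, the exponential bound at
    parameter 1 is \<open>exp 2\<close>.\<close>
  show "(\<integral>\<^sup>+\<omega>. ennreal ((V N \<omega> j)\<^sup>2) \<partial>\<Omega> N) \<le> ennreal (2 * exp 2)"
  proof (cases "x \<in> {0..1}")
    case False
    then show ?thesis unfolding V_def coords_def x_def by (simp only: if_False) simp
  next
    case True
    have c: "(\<Sum>i\<in>I N. (u N i x)\<^sup>2) \<le> 1"
    proof (cases "x = 0")
      case False
      have "(\<Sum>i\<in>I N. (u N i x - u N i 0)\<^sup>2) \<le> x - 0" by (rule u_inc) (use True False in auto)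
      also have "(\<Sum>i\<in>I N. (u N i x - u N i 0)\<^sup>2) = (\<Sum>i\<in>I N. (u N i x)\<^sup>2)" by (simp add: u_0)
      finally show ?thesis using True by simp
    qed (simp add: u_0)
    have f1: "norm f \<le> 1" using e_ortho unfolding ortho_seq_def f_def by (metis norm_zero order_refl zero_le_one)
    have cont: "continuous_on UNIV (\<lambda>y. \<phi> y - m N i)" for i by (intro continuous_intros \<phi>_cont)
    have le: "(V N \<omega> j)\<^sup>2 \<le> 2 * cosh (1 * norm (\<Sum>i\<in>I N. u N i x *\<^sub>R (\<phi> (Y N i \<omega>) - m N i)))" for \<omega>
    proof -
      have "(V N \<omega> j)\<^sup>2 = (Z N \<omega> x \<bullet> f)\<^sup>2" using True by (simp add: V_def coords_def x_def f_def)
      also have "\<dots> \<le> (norm (Z N \<omega> x))\<^sup>2"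
        using Cauchy_Schwarz_ineq2[of "Z N \<omega> x" f] mult_left_mono[OF f1, of "norm (Z N \<omega> x)"]
        by (intro abs_le_square_iff[THEN iffD1]) simp
      also have "\<dots> \<le> 2 * cosh (norm (Z N \<omega> x))" by (rule square_le_cosh)
      finally show ?thesis using True by (simp add: Z_eq)
    qed
    have "(\<integral>\<^sup>+\<omega>. ennreal ((V N \<omega> j)\<^sup>2) \<partial>\<Omega> N) \<le> (\<integral>\<^sup>+\<omega>. 2 * ennreal (cosh (1 * norm (\<Sum>i\<in>I N. u N i x *\<^sub>R (\<phi> (Y N i \<omega>) - m N i)))) \<partial>\<Omega> N)"
      using le by (intro nn_integral_mono) (simp flip: ennreal_mult' ennreal_numeral add: ennreal_leI)
    also have "\<dots> = 2 * (\<integral>\<^sup>+\<omega>. ennreal (cosh (1 * norm (\<Sum>i\<in>I N. u N i x *\<^sub>R (\<phi> (Y N i \<omega>) - m N i)))) \<partial>\<Omega> N)"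
    proof (rule nn_integral_cmult)
      have "cosh \<in> borel_measurable (borel :: real measure)" by (intro borel_measurable_continuous_onI continuous_intros)
      moreover have "(\<lambda>\<omega>. norm (\<Sum>i\<in>I N. u N i x *\<^sub>R (\<phi> (Y N i \<omega>) - m N i))) \<in> borel_measurable (\<Omega> N)"
        by (rule norm_sum_measurable[OF fin, of _ "\<lambda>i y. \<phi> y - m N i"]) (auto intro: cont Y_measurable)
      ultimately show "(\<lambda>\<omega>. ennreal (cosh (1 * norm (\<Sum>i\<in>I N. u N i x *\<^sub>R (\<phi> (Y N i \<omega>) - m N i))))) \<in> borel_measurable (\<Omega> N)"
        by simp
    qed
    also have "\<dots> \<le> 2 * ennreal (exp (1\<^sup>2 * 2\<^sup>2 * (\<Sum>i\<in>I N. (u N i x)\<^sup>2) / 2))"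
      by (intro mult_left_mono cosh_norm_indep_sum_le[where b=2 and \<psi>="\<lambda>i y. \<phi> y - m N i"] fin indep cont X_norm X_mean) auto
    also have "\<dots> \<le> 2 * ennreal (exp 2)"
      using c by (intro mult_left_mono ennreal_leI) auto
    finally show ?thesis by (simp add: ennreal_mult)
  qed
qed

theorem V_converges:
  assumes g: "continuous_on UNIV g" and B: "\<And>v. \<bar>g v\<bar> \<le> (B::real)"
  shows "(\<lambda>N. \<integral>\<omega>. g (V N \<omega>) \<partial>\<Omega> N) \<longlonglongrightarrow> (\<integral>v. g v \<partial>\<mu>)"
proof (rule levy_continuity_sequence_space[OF prob V_measurable \<mu>(1,2) _ _ V_tight g B])
  fix l :: "(nat \<Rightarrow> real) \<Rightarrow> real" assume "l \<in> lin_forms"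
  then obtain d a where l: "l = (\<lambda>v. \<Sum>j<d. a j * v j)" unfolding lin_forms_def by blast
  define J where "J = {j\<in>{..<d}. fst (decode j) \<in> {0..1}}"
  have lV: "l (V N \<omega>) = (\<Sum>j\<in>J. a j * (Z N \<omega> (fst (decode j)) \<bullet> e (snd (decode j))))" for N \<omega>
    unfolding l J_def by (intro sum.mono_neutral_cong_right) (auto simp: V_def coords_def)
  have J: "finite J" "\<And>j. j \<in> J \<Longrightarrow> fst (decode j) \<in> {0..1}" by (auto simp: J_def)
  show "(\<lambda>N. \<integral>\<omega>. cos (l (V N \<omega>)) \<partial>\<Omega> N) \<longlonglongrightarrow> (\<integral>v. cos (l v) \<partial>\<mu>)"
    unfolding lV unfolding l \<mu>(3) ker_sum[OF finite_lessThan] J_def[symmetric] by (rule scalar_clt(1)[OF J])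
  show "(\<lambda>N. \<integral>\<omega>. sin (l (V N \<omega>)) \<partial>\<Omega> N) \<longlonglongrightarrow> (\<integral>v. sin (l v) \<partial>\<mu>)"
    unfolding lV unfolding l \<mu>(4) by (rule scalar_clt(2)[OF J])
qed

end

section \<open>The limit process\<close>

lemma (in Metric_space) dist_continuous_on:
  fixes f g :: "'t::topological_space \<Rightarrow> 'a"
  assumes "continuous_map euclidean mtopology f" "continuous_map euclidean mtopology g"
  shows "continuous_on UNIV (\<lambda>x. d (f x) (g x))"
  using continuous_map_mdist[of euclidean "metric (M, d)" f g] assms by (simp add: mtopology_of)

lemma (in Metric_space) MCauchy_geometric:
  assumes \<sigma>: "\<And>k. \<sigma> k \<in> M" and c: "\<And>k. K \<le> k \<Longrightarrow> d (\<sigma> (Suc k)) (\<sigma> k) \<le> c * (1/2)^k"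
  shows "MCauchy \<sigma>"
  unfolding MCauchy_def
proof (intro conjI allI impI)
  show "range \<sigma> \<subseteq> M" using \<sigma> by auto
  fix \<epsilon> :: real assume \<epsilon>: "0 < \<epsilon>"
  have "0 \<le> c * (1/2)^K" by (rule order_trans[OF nonneg c[OF order_refl]])
  then have c0: "0 \<le> c" by (intro mult_right_le_imp_le[of 0 "(1/2)^K" c]) auto
  \<comment> \<open>The geometric sum is written in closed form, so that the induction step closes
    with an equality.\<close>
  have step: "d (\<sigma> (k + n)) (\<sigma> k) \<le> c * (2 * (1/2)^k - 2 * (1/2)^(k + n))" if k: "K \<le> k" for k n
  proof (induction n)
    case (Suc n)
    have "d (\<sigma> (k + Suc n)) (\<sigma> k) \<le> d (\<sigma> (Suc (k + n))) (\<sigma> (k + n)) + d (\<sigma> (k + n)) (\<sigma> k)"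
      using triangle[OF \<sigma> \<sigma> \<sigma>] by simp
    also have "\<dots> \<le> c * (1/2)^(k + n) + c * (2 * (1/2)^k - 2 * (1/2)^(k + n))"
      using c[of "k + n"] k Suc by (intro add_mono) auto
    also have "\<dots> = c * (2 * (1/2)^k - 2 * (1/2)^(k + Suc n))" by (simp add: algebra_simps)
    finally show ?case .
  qed (simp add: \<sigma>)
  have "(\<lambda>k. c * 2 * (1/2)^k) \<longlonglongrightarrow> c * 2 * 0" by (intro tendsto_intros LIMSEQ_realpow_zero) auto
  then have "\<forall>\<^sub>F k in sequentially. c * 2 * (1/2)^k < \<epsilon>" using \<epsilon> by (intro order_tendstoD(2)[where y=0]) auto
  then obtain k1 where k1: "\<And>k. k1 \<le> k \<Longrightarrow> c * 2 * (1/2)^k < \<epsilon>" unfolding eventually_sequentially by blast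
  have close: "d (\<sigma> n) (\<sigma> n') < \<epsilon>" if "max K k1 \<le> n'" "n' \<le> n" for n n'
  proof -
    have "d (\<sigma> n) (\<sigma> n') \<le> c * (2 * (1/2)^n' - 2 * (1/2)^n)" using step[of n' "n - n'"] that by simp
    also have "\<dots> \<le> c * 2 * (1/2)^n'" using c0 by (simp add: algebra_simps)
    finally show ?thesis using k1[of n'] that by simp
  qed
  show "\<exists>N. \<forall>n n'. N \<le> n \<longrightarrow> N \<le> n' \<longrightarrow> d (\<sigma> n) (\<sigma> n') < \<epsilon>"
  proof (intro exI[of _ "max K k1"] allI impI)
    fix n n' assume "max K k1 \<le> n" "max K k1 \<le> n'"
    then show "d (\<sigma> n) (\<sigma> n') < \<epsilon>" using close[of n n'] close[of n' n] commute[of "\<sigma> n" "\<sigma> n'"] by (cases "n' \<le> n") auto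
  qed
qed

context hilbert_fclt
begin

text \<open>Inverts the constant of \<open>not_bad\<close>: off the bad set at
  \<open>scale \<epsilon>\<close> the approximation error is at most \<epsilon>. The added 1 keeps
  the divisor positive.\<close>

definition scale :: "real \<Rightarrow> real" where
  "scale \<epsilon> = \<epsilon> / (3 * chain_const + 1)"

lemma scale: "0 < \<epsilon> \<Longrightarrow> 0 < scale \<epsilon>" "0 < \<epsilon> \<Longrightarrow> chain_const * (3 * scale \<epsilon>) \<le> \<epsilon>"
  using chain_const_nonneg by (auto simp: scale_def field_simps)

definition gap :: "nat \<Rightarrow> nat \<Rightarrow> (nat \<Rightarrow> real) \<Rightarrow> real" where
  "gap n n' v = hdist (recon n v) (recon n' v)"

lemma gap_continuous: "continuous_on UNIV (gap n n')"
  unfolding gap_def by (intro hoelder.dist_continuous_on recon_continuous)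

lemma gap_measurable [measurable]: "gap n n' \<in> borel_measurable borel"
  by (rule borel_measurable_continuous_onI[OF gap_continuous])

lemma approx_close:
  assumes "\<omega> \<in> space (\<Omega> N)" "\<omega> \<notin> bad N n (scale \<epsilon>)" "0 < \<epsilon>"
  shows "hdist (Z N \<omega>) (recon n (V N \<omega>)) \<le> \<epsilon>"
  using not_bad[OF assms(1,2)] scale[OF assms(3)] by (simp add: V_def)

text \<open>Under \<mu> there is no process yet with which both polygons could be compared. For
  finite \<open>N\<close> there is one, and the estimate is passed to the limit. The test function
  has to be continuous, so \<open>g\<close> rises linearly from 0 at \<open>2 * \<epsilon>\<close>
  to 1 at \<open>3 * \<epsilon>\<close>.\<close>

lemma gap_prob:
  assumes \<epsilon>: "0 < \<epsilon>"
  shows "measure \<mu> {v. 3 * \<epsilon> < gap n n' v} \<le> err n (scale \<epsilon>) + err n' (scale \<epsilon>)"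
proof -
  interpret \<mu>: prob_space \<mu> by (rule \<mu>)
  have [measurable_cong]: "sets \<mu> = sets borel" by (rule \<mu>)
  define g where "g v = min 1 (max 0 (gap n n' v / \<epsilon> - 2))" for v
  have gc: "continuous_on UNIV g" unfolding g_def using \<epsilon> by (intro continuous_intros gap_continuous) auto
  have gb: "\<bar>g v\<bar> \<le> 1" for v by (auto simp: g_def)
  have gm[measurable]: "g \<in> borel_measurable borel" by (rule borel_measurable_continuous_onI[OF gc])
  have sp: "space \<mu> = UNIV" using sets_eq_imp_space_eq[OF \<mu>(2)] by simp
  have "measure \<mu> {v. 3 * \<epsilon> < gap n n' v} = (\<integral>v. indicator {v. 3 * \<epsilon> < gap n n' v} v \<partial>\<mu>)"
    by (simp add: sp)
  also have "\<dots> \<le> (\<integral>v. g v \<partial>\<mu>)"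
  proof (rule integral_mono)
    show "integrable \<mu> (indicat_real {v. 3 * \<epsilon> < gap n n' v})"
      by (rule \<mu>.integrable_const_bound[of _ 1]) (auto simp: indicator_def sp)
    show "integrable \<mu> g" by (rule \<mu>.integrable_const_bound[of _ 1]) (use gb in auto)
    show "indicator {v. 3 * \<epsilon> < gap n n' v} v \<le> g v" for v
      using \<epsilon> by (auto simp: indicator_def g_def field_simps)
  qed
  also have "\<dots> \<le> err n (scale \<epsilon>) + err n' (scale \<epsilon>)"
  proof (rule LIMSEQ_le_const2[OF V_converges[OF gc gb]], intro exI[of _ 0] allI impI)
    fix N
    interpret prob_space "\<Omega> N" by (rule prob)
    have Vm[measurable]: "V N \<in> borel_measurable (\<Omega> N)" by (rule V_measurable)
    let ?B = "bad N n (scale \<epsilon>) \<union> bad N n' (scale \<epsilon>)"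
    have B: "?B \<in> events" by (intro sets.Un bad_measurable)
    have "(\<integral>\<omega>. g (V N \<omega>) \<partial>\<Omega> N) \<le> (\<integral>\<omega>. indicator ?B \<omega> \<partial>\<Omega> N)"
    proof (rule integral_mono)
      show "integrable (\<Omega> N) (\<lambda>\<omega>. g (V N \<omega>))"
        by (rule integrable_const_bound[of _ 1]) (use gb in auto)
      show "integrable (\<Omega> N) (indicat_real ?B)"
        by (rule integrable_real_indicator[OF B]) (simp add: emeasure_eq_measure)
      fix \<omega> assume \<omega>: "\<omega> \<in> space (\<Omega> N)"
      show "g (V N \<omega>) \<le> indicator ?B \<omega>"
      proof (cases "\<omega> \<in> ?B")
        case True
        then show ?thesis using gb[of "V N \<omega>"] by (simp add: abs_le_iff)
      next
        case False
        have "gap n n' (V N \<omega>) \<le> hdist (Z N \<omega>) (recon n (V N \<omega>)) + hdist (Z N \<omega>) (recon n' (V N \<omega>))"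
          unfolding gap_def using hoelder.triangle[OF recon_hspace Z_hspace recon_hspace] by (metis hoelder.commute)
        also have "\<dots> \<le> \<epsilon> + \<epsilon>" using False by (intro add_mono approx_close \<omega> \<epsilon>) auto
        finally have "gap n n' (V N \<omega>) / \<epsilon> \<le> 2" using \<epsilon> by (simp add: pos_divide_le_eq)
        then show ?thesis using False by (simp add: g_def)
      qed
    qed
    also have "\<dots> = prob ?B" using sets.sets_into_space[OF B] by (simp add: Int_absorb2)
    also have "\<dots> \<le> prob (bad N n (scale \<epsilon>)) + prob (bad N n' (scale \<epsilon>))" by (intro measure_Un_le bad_measurable)
    also have "\<dots> \<le> err n (scale \<epsilon>) + err n' (scale \<epsilon>)" by (intro add_mono bad_prob scale \<epsilon>)
    finally show "(\<integral>\<omega>. g (V N \<omega>) \<partial>\<Omega> N) \<le> err n (scale \<epsilon>) + err n' (scale \<epsilon>)" .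
  qed
  finally show ?thesis .
qed

text \<open>A sequence of indices along which errors of scale 2^(-k) have probability at most
  2^(-k). The bound covers all later \<open>n\<close>, and the sequence is monotone, because
  neighbouring terms are compared at the same scale.\<close>

definition fast :: "nat \<Rightarrow> nat" where
  "fast = (SOME s. mono s \<and> (\<forall>k n. s k \<le> n \<longrightarrow> err n (scale ((1/2)^k)) \<le> (1/2)^k))"

lemma fast: "mono fast" "fast k \<le> n \<Longrightarrow> err n (scale ((1/2)^k)) \<le> (1/2)^k"
proof -
  have "\<forall>k. \<exists>s. \<forall>n\<ge>s. err n (scale ((1/2)^k)) \<le> (1/2)^k"
  proof
    fix k :: nat
    have "\<forall>\<^sub>F n in sequentially. err n (scale ((1/2)^k)) < (1/2)^k"
      by (rule order_tendstoD(2)[OF err_lim]) (auto intro: scale)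
    then show "\<exists>s. \<forall>n\<ge>s. err n (scale ((1/2)^k)) \<le> (1/2)^k"
      unfolding eventually_sequentially by (meson less_imp_le)
  qed
  from choice[OF this] obtain s where s: "\<And>k n. s k \<le> n \<Longrightarrow> err n (scale ((1/2)^k)) \<le> (1/2)^k" by blast
  define s' where "s' k = (\<Sum>i\<le>k. s i)" for k
  have "mono s'" unfolding s'_def by (intro monoI sum_mono2) auto
  moreover have "s k \<le> s' k" for k unfolding s'_def by (rule member_le_sum) auto
  ultimately have "\<exists>s. mono s \<and> (\<forall>k n. s k \<le> n \<longrightarrow> err n (scale ((1/2)^k)) \<le> (1/2)^k)"
    using s by (meson order_trans)
  from someI_ex[OF this, folded fast_def]
  show "mono fast" "fast k \<le> n \<Longrightarrow> err n (scale ((1/2)^k)) \<le> (1/2)^k" by auto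
qed

definition good :: "(nat \<Rightarrow> real) set" where
  "good = {v. \<exists>K. \<forall>k\<ge>K. gap (fast (Suc k)) (fast k) v \<le> 3 * (1/2)^k}"

lemma good_measurable: "good \<in> sets borel"
  unfolding good_def by measurable

text \<open>Borel-Cantelli: the gaps exceed \<open>3 * (1/2)^k\<close> with probability at most
  \<open>2 * (1/2)^k\<close>, which is summable.\<close>

lemma good_AE: "AE v in \<mu>. v \<in> good"
proof -
  interpret \<mu>: prob_space \<mu> by (rule \<mu>)
  have [measurable_cong]: "sets \<mu> = sets borel" by (rule \<mu>)
  have sp: "space \<mu> = UNIV" using sets_eq_imp_space_eq[OF \<mu>(2)] by simp
  define A where "A k = {v. 3 * (1/2)^k < gap (fast (Suc k)) (fast k) v}" for k
  have [measurable]: "A k \<in> sets \<mu>" for k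
  proof -
    have "{v \<in> space \<mu>. 3 * (1/2)^k < gap (fast (Suc k)) (fast k) v} \<in> sets \<mu>" by measurable
    then show ?thesis by (simp add: A_def sp)
  qed
  have pA: "measure \<mu> (A k) \<le> 2 * (1/2)^k" for k
  proof -
    have "measure \<mu> (A k) \<le> err (fast (Suc k)) (scale ((1/2)^k)) + err (fast k) (scale ((1/2)^k))"
      unfolding A_def by (rule gap_prob) simp
    also have "\<dots> \<le> (1/2)^k + (1/2)^k" using monoD[OF fast(1), of k "Suc k"] by (intro add_mono fast(2)) auto
    finally show ?thesis by simp
  qed
  have "AE v in \<mu>. \<forall>\<^sub>F k in sequentially. v \<in> space \<mu> - A k"
  proof (rule borel_cantelli_AE1)
    show "summable (\<lambda>k. measure \<mu> (A k))"
      by (rule summable_comparison_test'[OF summable_mult[OF summable_geometric[of "1/2::real"]], of 0 _ 2]) (use pA in auto)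
  qed (auto simp: \<mu>.emeasure_eq_measure)
  then show ?thesis
    by eventually_elim (auto simp: good_def A_def eventually_sequentially not_less)
qed

text \<open>Off \<open>good\<close> the value is an arbitrary element of the space, so that every
  path of \<open>W\<close>, not just almost every one, is admissible.\<close>

definition W :: "(nat \<Rightarrow> real) \<Rightarrow> real \<Rightarrow> 'h" where
  "W v = (if v \<in> good then SOME f. f \<in> hspace \<and> (\<lambda>k. hdist (recon (fast k) v) f) \<longlonglongrightarrow> 0 else recon 0 (\<lambda>_. 0))"

lemma W_hspace: "W v \<in> hspace"
  and W_lim: "v \<in> good \<Longrightarrow> (\<lambda>k. hdist (recon (fast k) v) (W v)) \<longlonglongrightarrow> 0"
proof -
  have key: "W v \<in> hspace \<and> (\<lambda>k. hdist (recon (fast k) v) (W v)) \<longlonglongrightarrow> 0" if v: "v \<in> good"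
  proof -
    obtain K where "\<And>k. K \<le> k \<Longrightarrow> hdist (recon (fast (Suc k)) v) (recon (fast k) v) \<le> 3 * (1/2)^k"
      using v unfolding good_def gap_def by blast
    then have "hoelder.MCauchy (\<lambda>k. recon (fast k) v)"
      by (intro hoelder.MCauchy_geometric recon_hspace)
    then obtain f where "limitin hoelder.mtopology (\<lambda>k. recon (fast k) v) f sequentially"
      using hoelder_mcomplete unfolding hoelder.mcomplete_def by blast
    then have "f \<in> hspace \<and> (\<lambda>k. hdist (recon (fast k) v) f) \<longlonglongrightarrow> 0"
      by (simp add: hoelder.limitin_metric_dist_null)
    then have "\<exists>f. f \<in> hspace \<and> (\<lambda>k. hdist (recon (fast k) v) f) \<longlonglongrightarrow> 0" by blast
    from someI_ex[OF this] show ?thesis using v by (simp add: W_def)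
  qed
  show "W v \<in> hspace" using key recon_hspace by (cases "v \<in> good") (auto simp: W_def)
  show "v \<in> good \<Longrightarrow> (\<lambda>k. hdist (recon (fast k) v) (W v)) \<longlonglongrightarrow> 0" using key by blast
qed

lemma W_measurable: "W \<in> measurable \<mu> (borel_of hoelder.mtopology)"
proof (rule hoelder.measurable_limit)
  have [measurable_cong]: "sets \<mu> = sets borel" by (rule \<mu>)
  show "W v \<in> hspace" for v by (rule W_hspace)
  \<comment> \<open>The approximants are replaced off \<open>good\<close> by the default path, so
    that they converge at every point, as \<open>measurable_limit\<close> asks.\<close>
  show "(\<lambda>v. if v \<in> good then recon (fast k) v else recon 0 (\<lambda>_. 0)) \<in> measurable \<mu> (borel_of hoelder.mtopology)" for k
  proof (rule measurable_If_set)
    show "recon (fast k) \<in> measurable \<mu> (borel_of hoelder.mtopology)"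
      using continuous_map_measurable[OF recon_continuous, of "fast k"]
      by (simp add: borel_of_euclidean measurable_cong_sets[OF \<mu>(2) refl])
    show "(\<lambda>v. recon 0 (\<lambda>_. 0)) \<in> measurable \<mu> (borel_of hoelder.mtopology)"
      using recon_hspace by (intro measurable_const) auto
    show "good \<inter> space \<mu> \<in> sets \<mu>" using good_measurable sets_eq_imp_space_eq[OF \<mu>(2)] \<mu>(2) by simp
  qed
  show "(\<lambda>k. hdist (if v \<in> good then recon (fast k) v else recon 0 (\<lambda>_. 0)) (W v)) \<longlonglongrightarrow> 0" for v
    using W_lim[of v] recon_hspace by (cases "v \<in> good") (auto simp: W_def)
qed

text \<open>Both sides are compared with the polygon of index \<open>fast k\<close>. The error for
  the process is bounded uniformly in \<open>N\<close>, the polygons converge in law as a fixed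
  continuous function of the coordinate sequence, and on the side of \<open>W\<close> dominated
  convergence applies.\<close>

theorem Z_converges: "converges_in_distribution hoelder.mtopology \<Omega> Z \<mu> W"
proof (rule hoelder.converges_in_distribution_lipschitz[OF prob \<mu>(1) Z_measurable W_measurable])
  fix h :: "(real \<Rightarrow> 'h) \<Rightarrow> real" and L B
  assume L: "\<And>x y. x \<in> hspace \<Longrightarrow> y \<in> hspace \<Longrightarrow> \<bar>h x - h y\<bar> \<le> L * hdist x y" and B: "\<And>x. x \<in> hspace \<Longrightarrow> \<bar>h x\<bar> \<le> B"
  have hc: "continuous_map hoelder.mtopology euclideanreal h" by (rule hoelder.lipschitz_continuous_map[OF L])
  have hm: "h \<in> borel_measurable (borel_of hoelder.mtopology)" by (rule continuous_map_euclidean_measurable[OF hc])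
  have B0: "0 \<le> B" using B[OF W_hspace, of undefined] by linarith
  interpret \<mu>: prob_space \<mu> by (rule \<mu>)
  have [measurable_cong]: "sets \<mu> = sets borel" by (rule \<mu>)
  define c where "c k v = h (recon (fast k) v)" for k v
  have cc: "continuous_on UNIV (c k)" for k
    using continuous_map_compose[OF recon_continuous hc, of "fast k"] by (simp add: c_def comp_def)
  have cb: "\<bar>c k v\<bar> \<le> B" for k v unfolding c_def by (rule B[OF recon_hspace])
  have [measurable]: "c k \<in> borel_measurable borel" for k by (rule borel_measurable_continuous_onI[OF cc])
  have lim: "(\<lambda>k. \<integral>v. c k v \<partial>\<mu>) \<longlonglongrightarrow> (\<integral>v. h (W v) \<partial>\<mu>)"
  proof (rule integral_dominated_convergence[where w="\<lambda>_. B"])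
    show "(\<lambda>v. h (W v)) \<in> borel_measurable \<mu>" by (rule measurable_compose[OF W_measurable hm])
    show "c k \<in> borel_measurable \<mu>" for k by measurable
    show "AE v in \<mu>. (\<lambda>k. c k v) \<longlonglongrightarrow> h (W v)"
      using good_AE
    proof eventually_elim
      case (elim v)
      have "(\<lambda>k. L * hdist (recon (fast k) v) (W v)) \<longlonglongrightarrow> L * 0" by (intro tendsto_intros W_lim elim)
      then have "(\<lambda>k. L * hdist (recon (fast k) v) (W v)) \<longlonglongrightarrow> 0" by simp
      then have "(\<lambda>k. c k v - h (W v)) \<longlonglongrightarrow> 0"
        by (rule Lim_null_comparison[rotated]) (intro always_eventually allI, simp add: c_def L recon_hspace W_hspace)
      then show ?case by (rule LIM_zero_cancel)
    qed
    show "AE v in \<mu>. norm (c k v) \<le> B" for k using cb by (intro AE_I2) simp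
  qed simp
  have close: "\<bar>(\<integral>\<omega>. h (Z N \<omega>) \<partial>\<Omega> N) - (\<integral>\<omega>. c k (V N \<omega>) \<partial>\<Omega> N)\<bar> \<le> (\<bar>L\<bar> + 2 * B) * (1/2)^k" for N k
  proof -
    interpret prob_space "\<Omega> N" by (rule prob)
    have [measurable]: "V N \<in> borel_measurable (\<Omega> N)" by (rule V_measurable)
    have [measurable]: "(\<lambda>\<omega>. h (Z N \<omega>)) \<in> borel_measurable (\<Omega> N)" by (rule measurable_compose[OF Z_measurable hm])
    let ?B = "bad N (fast k) (scale ((1/2)^k))"
    have Bm: "?B \<in> events" by (rule bad_measurable)
    have i1: "integrable (\<Omega> N) (\<lambda>\<omega>. h (Z N \<omega>))"
      by (rule integrable_const_bound[of _ B]) (use B[OF Z_hspace] in auto)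
    have i2: "integrable (\<Omega> N) (\<lambda>\<omega>. c k (V N \<omega>))"
      by (rule integrable_const_bound[of _ B]) (use cb in auto)
    have i3: "integrable (\<Omega> N) (indicat_real ?B)"
      by (rule integrable_real_indicator[OF Bm]) (simp add: emeasure_eq_measure)
    have "\<bar>(\<integral>\<omega>. h (Z N \<omega>) \<partial>\<Omega> N) - (\<integral>\<omega>. c k (V N \<omega>) \<partial>\<Omega> N)\<bar> = \<bar>\<integral>\<omega>. h (Z N \<omega>) - c k (V N \<omega>) \<partial>\<Omega> N\<bar>"
      using i1 i2 by simp
    also have "\<dots> \<le> (\<integral>\<omega>. \<bar>h (Z N \<omega>) - c k (V N \<omega>)\<bar> \<partial>\<Omega> N)"
      using integral_norm_bound[of "\<Omega> N" "\<lambda>\<omega>. h (Z N \<omega>) - c k (V N \<omega>)"] by simp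
    also have "\<dots> \<le> (\<integral>\<omega>. \<bar>L\<bar> * (1/2)^k + 2 * B * indicator ?B \<omega> \<partial>\<Omega> N)"
    proof (rule integral_mono)
      fix \<omega> assume \<omega>: "\<omega> \<in> space (\<Omega> N)"
      show "\<bar>h (Z N \<omega>) - c k (V N \<omega>)\<bar> \<le> \<bar>L\<bar> * (1/2)^k + 2 * B * indicator ?B \<omega>"
      proof (cases "\<omega> \<in> ?B")
        case True
        have "\<bar>h (Z N \<omega>) - c k (V N \<omega>)\<bar> \<le> 2 * B" using B[OF Z_hspace, of N \<omega>] cb[of k "V N \<omega>"] by linarith
        moreover have "0 \<le> \<bar>L\<bar> * (1/2)^k" by simp
        ultimately show ?thesis using True by (simp add: add_increasing)
      next
        case False
        have "\<bar>h (Z N \<omega>) - c k (V N \<omega>)\<bar> \<le> L * hdist (Z N \<omega>) (recon (fast k) (V N \<omega>))"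
          unfolding c_def by (rule L[OF Z_hspace recon_hspace])
        also have "\<dots> \<le> \<bar>L\<bar> * (1/2)^k"
          using approx_close[OF \<omega> False] by (intro mult_mono) auto
        finally show ?thesis using False by simp
      qed
    qed (use i1 i2 i3 in auto)
    also have "\<dots> = \<bar>L\<bar> * (1/2)^k + 2 * B * prob ?B"
      using i3 sets.sets_into_space[OF Bm] by (subst Bochner_Integration.integral_add) (auto simp: prob_space Int_absorb2)
    also have "\<dots> \<le> \<bar>L\<bar> * (1/2)^k + 2 * B * (1/2)^k"
    proof (intro add_left_mono mult_left_mono)
      show "prob ?B \<le> (1/2)^k" by (rule order_trans[OF bad_prob[OF scale(1)] fast(2)[OF order_refl]]) simp
    qed (use B0 in simp)
    finally show ?thesis by (simp add: algebra_simps)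
  qed
  show "(\<lambda>N. \<integral>\<omega>. h (Z N \<omega>) \<partial>\<Omega> N) \<longlonglongrightarrow> (\<integral>v. h (W v) \<partial>\<mu>)"
  proof (rule LIMSEQ_I)
    fix r :: real assume r: "0 < r"
    have "(\<lambda>k. (\<bar>L\<bar> + 2 * B) * (1/2)^k) \<longlonglongrightarrow> (\<bar>L\<bar> + 2 * B) * 0" by (intro tendsto_intros LIMSEQ_realpow_zero) auto
    then have "\<forall>\<^sub>F k in sequentially. (\<bar>L\<bar> + 2 * B) * (1/2)^k < r/3"
      by (rule order_tendstoD(2)) (use r in simp)
    moreover have "\<forall>\<^sub>F k in sequentially. dist (\<integral>v. c k v \<partial>\<mu>) (\<integral>v. h (W v) \<partial>\<mu>) < r/3"
      by (rule tendstoD[OF lim]) (use r in simp)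
    ultimately obtain k where k: "(\<bar>L\<bar> + 2 * B) * (1/2)^k < r/3" "dist (\<integral>v. c k v \<partial>\<mu>) (\<integral>v. h (W v) \<partial>\<mu>) < r/3"
      using eventually_happens'[OF sequentially_bot eventually_conj] by blast
    have "\<forall>\<^sub>F N in sequentially. dist (\<integral>\<omega>. c k (V N \<omega>) \<partial>\<Omega> N) (\<integral>v. c k v \<partial>\<mu>) < r/3"
      by (rule tendstoD[OF V_converges[OF cc cb]]) (use r in simp)
    then obtain N0 where N0: "\<And>N. N0 \<le> N \<Longrightarrow> dist (\<integral>\<omega>. c k (V N \<omega>) \<partial>\<Omega> N) (\<integral>v. c k v \<partial>\<mu>) < r/3"
      unfolding eventually_sequentially by blast
    show "\<exists>N0. \<forall>N\<ge>N0. norm ((\<integral>\<omega>. h (Z N \<omega>) \<partial>\<Omega> N) - (\<integral>v. h (W v) \<partial>\<mu>)) < r"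
    proof (intro exI[of _ N0] allI impI)
      fix N assume "N0 \<le> N"
      from N0[OF this] k close[of N k] show "norm ((\<integral>\<omega>. h (Z N \<omega>) \<partial>\<Omega> N) - (\<integral>v. h (W v) \<partial>\<mu>)) < r"
        unfolding dist_real_def real_norm_def by linarith
    qed
  qed
qed

text \<open>A finite combination of evaluations is Lipschitz on the Hoelder space, so its cosine and
  sine integrals converge by the weak convergence just proved, while the scalar limit theorem
  identifies the limits. Arbitrary times and directions are thus covered, although \<open>W\<close>
  was built from dyadic times and the directions \<open>e\<close>.\<close>

theorem W_char:
  assumes J: "finite J" and x: "\<And>j. j \<in> J \<Longrightarrow> x j \<in> {0..1}"
  shows "(\<integral>v. cos (\<Sum>j\<in>J. a j * (W v (x j) \<bullet> f j)) \<partial>\<mu>) = exp (- sumvar J a x f / 2)"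
    and "(\<integral>v. sin (\<Sum>j\<in>J. a j * (W v (x j) \<bullet> f j)) \<partial>\<mu>) = 0"
    and "(\<lambda>v. \<Sum>j\<in>J. a j * (W v (x j) \<bullet> f j)) \<in> borel_measurable \<mu>"
proof -
  define l where "l z = (\<Sum>j\<in>J. a j * (z (x j) \<bullet> f j))" for z :: "real \<Rightarrow> 'h"
  have lip: "\<bar>l y - l z\<bar> \<le> (\<Sum>j\<in>J. \<bar>a j\<bar> * norm (f j)) * hdist y z" if "y \<in> hspace" "z \<in> hspace" for y z
  proof -
    have "\<bar>l y - l z\<bar> = \<bar>\<Sum>j\<in>J. a j * ((y (x j) - z (x j)) \<bullet> f j)\<bar>"
      by (simp add: l_def sum_subtractf inner_diff_left right_diff_distrib)
    also have "\<dots> \<le> (\<Sum>j\<in>J. \<bar>a j\<bar> * (norm (f j) * hdist y z))"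
    proof (rule order_trans[OF sum_abs sum_mono])
      fix j assume j: "j \<in> J"
      have "\<bar>(y (x j) - z (x j)) \<bullet> f j\<bar> \<le> norm (y (x j) - z (x j)) * norm (f j)" by (rule Cauchy_Schwarz_ineq2)
      also have "\<dots> \<le> hdist y z * norm (f j)" using x[OF j] by (intro mult_right_mono hdist_ge(1)[OF that]) auto
      finally show "\<bar>a j * ((y (x j) - z (x j)) \<bullet> f j)\<bar> \<le> \<bar>a j\<bar> * (norm (f j) * hdist y z)"
        by (simp add: abs_mult mult_left_mono mult.commute)
    qed
    finally show ?thesis by (simp add: sum_distrib_right mult.assoc)
  qed
  have lc: "continuous_map hoelder.mtopology euclideanreal l" by (rule hoelder.lipschitz_continuous_map[OF lip])
  have "(\<lambda>v. l (W v)) \<in> borel_measurable \<mu>"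
    by (rule measurable_compose[OF W_measurable continuous_map_euclidean_measurable[OF lc]])
  then show "(\<lambda>v. \<Sum>j\<in>J. a j * (W v (x j) \<bullet> f j)) \<in> borel_measurable \<mu>" by (simp add: l_def)
  have weak: "(\<lambda>N. \<integral>\<omega>. g (l (Z N \<omega>)) \<partial>\<Omega> N) \<longlonglongrightarrow> (\<integral>v. g (l (W v)) \<partial>\<mu>)"
    if g: "continuous_on UNIV g" "\<And>t. \<bar>g t\<bar> \<le> 1" for g :: "real \<Rightarrow> real"
  proof -
    have "continuous_map hoelder.mtopology euclideanreal (\<lambda>z. g (l z))"
      using continuous_map_compose[OF lc, of euclideanreal g] g(1) by (simp add: comp_def)
    moreover have "bounded ((\<lambda>z. g (l z)) ` topspace hoelder.mtopology)" using g(2) by (auto simp: bounded_iff)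
    ultimately show ?thesis using Z_converges unfolding converges_in_distribution_def by blast
  qed
  show "(\<integral>v. cos (\<Sum>j\<in>J. a j * (W v (x j) \<bullet> f j)) \<partial>\<mu>) = exp (- sumvar J a x f / 2)"
    by (rule LIMSEQ_unique[OF weak[of cos, unfolded l_def] scalar_clt(1)[OF J x]]) (auto intro: continuous_intros)
  show "(\<integral>v. sin (\<Sum>j\<in>J. a j * (W v (x j) \<bullet> f j)) \<partial>\<mu>) = 0"
    by (rule LIMSEQ_unique[OF weak[of sin, unfolded l_def] scalar_clt(2)[OF J x]]) (auto intro: continuous_intros)
qed

end

text \<open>The hypotheses give the characteristic function of a scaled standard normal variable.
  Uniqueness identifies the laws, and the moments are read off the standard normal. The scale may be
  zero, which is the Dirac case.\<close>

lemma (in prob_space) gaussian_lawI: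
  fixes U :: "'a \<Rightarrow> real"
  assumes U [measurable]: "U \<in> borel_measurable M" and s: "0 \<le> s"
    and cos: "\<And>t. expectation (\<lambda>\<omega>. cos (t * U \<omega>)) = exp (- (t\<^sup>2 * s) / 2)"
    and sin: "\<And>t. expectation (\<lambda>\<omega>. sin (t * U \<omega>)) = 0"
  shows "gaussian_law (distr M borel U)" "expectation U = 0"
    "integrable M (\<lambda>\<omega>. (U \<omega>)\<^sup>2)" "expectation (\<lambda>\<omega>. (U \<omega>)\<^sup>2) = s"
proof -
  let ?S = std_normal_distribution
  interpret S: real_distribution ?S by (rule real_dist_normal_dist)
  define \<sigma> where "\<sigma> = sqrt s"
  have \<sigma>: "0 \<le> \<sigma>" "\<sigma>\<^sup>2 = s" using s by (auto simp: \<sigma>_def)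
  define \<nu> where "\<nu> = distr ?S borel (\<lambda>x. \<sigma> * x)"
  have [measurable]: "(\<lambda>x. \<sigma> * x) \<in> borel_measurable ?S" by simp
  have eq: "distr M borel U = \<nu>"
  proof (rule Levy_uniqueness)
    show "real_distribution (distr M borel U)" by simp
    show "real_distribution \<nu>" unfolding \<nu>_def by simp
    show "char (distr M borel U) = char \<nu>"
    proof
      fix t
      have i: "integrable M (\<lambda>\<omega>. iexp (t * U \<omega>))" by (rule integrable_const_bound[of _ 1]) auto
      have re: "Re (iexp x) = cos x" "Im (iexp x) = sin x" for x :: real by (simp_all flip: cis_conv_exp)
      have "char (distr M borel U) t = (\<integral>\<omega>. iexp (t * U \<omega>) \<partial>M)" by (simp add: char_def integral_distr)
      also have "\<dots> = Complex (exp (- (t\<^sup>2 * s) / 2)) 0"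
        using cos[of t] sin[of t] integral_Re[OF i] integral_Im[OF i] unfolding re by (intro complex_eqI) simp_all
      also have "\<dots> = char ?S (t * \<sigma>)" unfolding char_std_normal_distribution using \<sigma>
        by (simp add: power_mult_distrib Complex_eq)
      also have "\<dots> = char \<nu> t" by (simp add: \<nu>_def char_def integral_distr mult.assoc)
      finally show "char (distr M borel U) t = char \<nu> t" .
    qed
  qed
  show "gaussian_law (distr M borel U)"
  proof (cases "\<sigma> = 0")
    case True
    have "\<nu> = return borel 0" unfolding \<nu>_def True mult_zero_left by (rule S.distr_const) simp
    then show ?thesis unfolding eq gaussian_law_def by blast
  next
    case False
    have "distributed ?S lborel (\<lambda>x. x) (\<lambda>x. ennreal (normal_density 0 1 x))"
      by (auto simp: distributed_def distr_id2)
    from S.normal_density_affine[OF this, of \<sigma> 0] False \<sigma>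
    have "distributed ?S lborel (\<lambda>x. \<sigma> * x) (\<lambda>x. ennreal (normal_density 0 \<sigma> x))" by simp
    then have "distr ?S lborel (\<lambda>x. \<sigma> * x) = density lborel (\<lambda>x. ennreal (normal_density 0 \<sigma> x))"
      by (simp add: distributed_def)
    moreover have "distr ?S lborel (\<lambda>x. \<sigma> * x) = \<nu>" unfolding \<nu>_def by (rule distr_cong) auto
    ultimately show ?thesis unfolding eq gaussian_law_def using False \<sigma>
      by (intro disjI2 exI[of _ 0] exI[of _ \<sigma>]) auto
  qed
  have m1: "integrable ?S (\<lambda>x. x)" "(\<integral>x. x \<partial>?S) = 0"
    using integrable_std_normal_distribution_moment[of 1] integral_std_normal_distribution_moment_odd[of 1] by simp_all
  have m2: "integrable ?S (\<lambda>x. x\<^sup>2)" "(\<integral>x. x\<^sup>2 \<partial>?S) = 1"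
    using integrable_std_normal_distribution_moment[of 2] std_normal_distribution_even_moments[of 1] by (simp_all add: fact_numeral)
  have "expectation U = (\<integral>x. x \<partial>distr M borel U)" by (simp add: integral_distr)
  also have "\<dots> = (\<integral>x. \<sigma> * x \<partial>?S)" unfolding eq \<nu>_def by (simp add: integral_distr)
  finally show "expectation U = 0" using m1 by simp
  have "expectation (\<lambda>\<omega>. (U \<omega>)\<^sup>2) = (\<integral>x. x\<^sup>2 \<partial>distr M borel U)" by (simp add: integral_distr)
  also have "\<dots> = (\<integral>x. (\<sigma> * x)\<^sup>2 \<partial>?S)" unfolding eq \<nu>_def by (simp add: integral_distr)
  finally show "expectation (\<lambda>\<omega>. (U \<omega>)\<^sup>2) = s" using m2 \<sigma> by (simp add: power_mult_distrib)
  have "integrable (distr M borel U) (\<lambda>x. x\<^sup>2)"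
    unfolding eq \<nu>_def using m2(1) by (simp add: integrable_distr_eq power_mult_distrib)
  then show "integrable M (\<lambda>\<omega>. (U \<omega>)\<^sup>2)" by (simp add: integrable_distr_eq)
qed

section \<open>Gaussian marginals and covariance of the limit\<close>

context hilbert_fclt
begin

theorem W_gaussian:
  assumes J: "finite J" and x: "\<And>j. j \<in> J \<Longrightarrow> x j \<in> {0..1}"
  shows "gaussian_law (distr \<mu> borel (\<lambda>v. \<Sum>j\<in>J. W v (x j) \<bullet> f j))"
    "(\<integral>v. (\<Sum>j\<in>J. W v (x j) \<bullet> f j) \<partial>\<mu>) = 0"
    "integrable \<mu> (\<lambda>v. (\<Sum>j\<in>J. W v (x j) \<bullet> f j)\<^sup>2)"
    "(\<integral>v. (\<Sum>j\<in>J. W v (x j) \<bullet> f j)\<^sup>2 \<partial>\<mu>) = sumvar J (\<lambda>_. 1) x f"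
proof -
  interpret \<mu>: prob_space \<mu> by (rule \<mu>)
  have m: "(\<lambda>v. \<Sum>j\<in>J. W v (x j) \<bullet> f j) \<in> borel_measurable \<mu>"
    using W_char(3)[where J=J and x=x and a="\<lambda>_. 1" and f=f, OF J x] by simp
  have sv: "sumvar J (\<lambda>_. t) x f = t\<^sup>2 * sumvar J (\<lambda>_. 1) x f" for t
    by (simp add: sumvar_def sum_distrib_left power2_eq_square)
  have c: "(\<integral>v. cos (t * (\<Sum>j\<in>J. W v (x j) \<bullet> f j)) \<partial>\<mu>) = exp (- (t\<^sup>2 * sumvar J (\<lambda>_. 1) x f) / 2)" for t
    using W_char(1)[where J=J and x=x and a="\<lambda>_. t" and f=f, OF J x] unfolding sv[of t] by (simp add: sum_distrib_left)
  have s: "(\<integral>v. sin (t * (\<Sum>j\<in>J. W v (x j) \<bullet> f j)) \<partial>\<mu>) = 0" for t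
    using W_char(2)[where J=J and x=x and a="\<lambda>_. t" and f=f, OF J x] by (simp add: sum_distrib_left)
  note g = \<mu>.gaussian_lawI[OF m sumvar_nonneg[where J=J and x=x, OF J x] c s]
  show "gaussian_law (distr \<mu> borel (\<lambda>v. \<Sum>j\<in>J. W v (x j) \<bullet> f j))" by (rule g(1))
  show "(\<integral>v. (\<Sum>j\<in>J. W v (x j) \<bullet> f j) \<partial>\<mu>) = 0" by (rule g(2))
  show "integrable \<mu> (\<lambda>v. (\<Sum>j\<in>J. W v (x j) \<bullet> f j)\<^sup>2)" by (rule g(3))
  show "(\<integral>v. (\<Sum>j\<in>J. W v (x j) \<bullet> f j)\<^sup>2 \<partial>\<mu>) = sumvar J (\<lambda>_. 1) x f" by (rule g(4))
qed

theorem W_covariance: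
  assumes xy: "x \<in> {0..1}" "y \<in> {0..1}"
  shows "(\<integral>v. (W v x \<bullet> f) * (W v y \<bullet> g) \<partial>\<mu>) = \<Gamma> x y f g"
proof -
  \<comment> \<open>Polarization: the covariance is half the difference between the variance of the
    sum and the two single variances. \<open>?x\<close> and \<open>?f\<close> encode the pair as a
    family over the indices 0 and 1.\<close>
  let ?x = "\<lambda>j::nat. if j = 0 then x else y" and ?f = "\<lambda>j::nat. if j = 0 then f else g"
  have v: "integrable \<mu> (\<lambda>v. (W v z \<bullet> h)\<^sup>2)" "(\<integral>v. (W v z \<bullet> h)\<^sup>2 \<partial>\<mu>) = \<Gamma> z z h h" if "z \<in> {0..1}" for z h
    using W_gaussian(3,4)[of "{0::nat}" "\<lambda>_. z", where f="\<lambda>_. h"] that by (simp_all add: sumvar_def)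
  have s: "integrable \<mu> (\<lambda>v. (W v x \<bullet> f + W v y \<bullet> g)\<^sup>2)"
    "(\<integral>v. (W v x \<bullet> f + W v y \<bullet> g)\<^sup>2 \<partial>\<mu>) = \<Gamma> x x f f + \<Gamma> x y f g + (\<Gamma> y x g f + \<Gamma> y y g g)"
    using W_gaussian(3,4)[of "{0::nat, 1}" ?x, where f="?f"] xy by (simp_all add: sumvar_def)
  have "(\<integral>v. (W v x \<bullet> f) * (W v y \<bullet> g) \<partial>\<mu>)
      = (\<integral>v. ((W v x \<bullet> f + W v y \<bullet> g)\<^sup>2 - (W v x \<bullet> f)\<^sup>2 - (W v y \<bullet> g)\<^sup>2) / 2 \<partial>\<mu>)"
    by (intro Bochner_Integration.integral_cong refl) (simp add: power2_eq_square algebra_simps)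
  also have "\<dots> = ((\<Gamma> x x f f + \<Gamma> x y f g + (\<Gamma> y x g f + \<Gamma> y y g g)) - \<Gamma> x x f f - \<Gamma> y y g g) / 2"
    using v[OF xy(1), of f] v[OF xy(2), of g] s by simp
  also have "\<dots> = \<Gamma> x y f g" using \<Gamma>_sym[OF xy, of f g] by simp
  finally show ?thesis .
qed

end

section \<open>The Hilbert space of square integrable functions\<close>

lemma rep_l0_measurable [measurable]: "rep_l0 f \<in> borel_measurable borel"
  using Quotient3_rep_reflp[OF Quotient3_l0, of f] by (simp add: ae_eq_def)

lemma abs_rep_l0: "abs_l0 (rep_l0 f) = f"
  by (rule Quotient3_abs_rep[OF Quotient3_l0])

lemma rep_abs_l0: "f \<in> borel_measurable borel \<Longrightarrow> AE x in lborel. rep_l0 (abs_l0 f) x = f x"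
  using Quotient3_rep_abs[OF Quotient3_l0, of f] by (simp add: ae_eq_def)

lemma abs_l0_eqI:
  "f \<in> borel_measurable borel \<Longrightarrow> g \<in> borel_measurable borel \<Longrightarrow> (AE x in lborel. f x = g x) \<Longrightarrow> abs_l0 f = abs_l0 g"
  using Quotient3_rel_abs[OF Quotient3_l0, of f g] by (simp add: ae_eq_def)

lemma abs_l0_add:
  assumes "f \<in> borel_measurable borel" "g \<in> borel_measurable borel"
  shows "abs_l0 f + abs_l0 g = abs_l0 (\<lambda>x. f x + g x)"
  using assms by (intro plus_l0.abs_eq) (auto simp: ae_eq_def)

lemma abs_l0_diff:
  assumes "f \<in> borel_measurable borel" "g \<in> borel_measurable borel"
  shows "abs_l0 f - abs_l0 g = abs_l0 (\<lambda>x. f x - g x)"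
  using assms by (intro minus_l0.abs_eq) (auto simp: ae_eq_def)

lemma abs_l0_scaleR:
  assumes "f \<in> borel_measurable borel"
  shows "c *\<^sub>R abs_l0 f = abs_l0 (\<lambda>x. c * f x)"
  using assms by (intro scaleR_l0.abs_eq) (auto simp: ae_eq_def)

lemma rep_l0_scaleR: "AE x in lborel. rep_l0 (c *\<^sub>R f) x = c * rep_l0 f x"
  using rep_abs_l0[of "\<lambda>x. c * rep_l0 f x"] abs_l0_scaleR[of "rep_l0 f" c] by (simp add: abs_rep_l0)

lemma rep_l0_zero: "AE x in lborel. rep_l0 0 x = 0"
  using rep_abs_l0[of "\<lambda>_. 0"] by (simp add: zero_l0_def)

definition sq_int :: "(real \<Rightarrow> real) \<Rightarrow> bool" where
  "sq_int f \<longleftrightarrow> f \<in> borel_measurable borel \<and> integrable lborel (\<lambda>x. (f x)\<^sup>2)"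

lemma sq_int_measurable: "sq_int f \<Longrightarrow> f \<in> borel_measurable borel"
  by (simp add: sq_int_def)

lemma sq_int_mult:
  assumes "sq_int f" "sq_int g"
  shows "integrable lborel (\<lambda>x. f x * g x)"
proof (rule Bochner_Integration.integrable_bound)
  have [measurable]: "f \<in> borel_measurable borel" "g \<in> borel_measurable borel" using assms by (auto simp: sq_int_def)
  show "integrable lborel (\<lambda>x. (f x)\<^sup>2 + (g x)\<^sup>2)" using assms by (auto simp: sq_int_def)
  show "(\<lambda>x. f x * g x) \<in> borel_measurable lborel" by measurable
  have "\<bar>a * b\<bar> \<le> a\<^sup>2 + b\<^sup>2" for a b :: real
  proof -
    have "2 * (\<bar>a\<bar> * \<bar>b\<bar>) \<le> a\<^sup>2 + b\<^sup>2" using sum_squares_bound[of "\<bar>a\<bar>" "\<bar>b\<bar>"] by (simp add: mult.assoc)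
    moreover have "0 \<le> \<bar>a\<bar> * \<bar>b\<bar>" by simp
    ultimately show ?thesis unfolding abs_mult by linarith
  qed
  then show "AE x in lborel. norm (f x * g x) \<le> norm ((f x)\<^sup>2 + (g x)\<^sup>2)" by (intro AE_I2) simp
qed

lemma sq_int_add:
  assumes "sq_int f" "sq_int g"
  shows "sq_int (\<lambda>x. f x + g x)"
proof -
  have [measurable]: "f \<in> borel_measurable borel" "g \<in> borel_measurable borel" using assms by (auto simp: sq_int_def)
  have "integrable lborel (\<lambda>x. (f x)\<^sup>2 + 2 * (f x * g x) + (g x)\<^sup>2)"
    using assms sq_int_mult[OF assms] by (auto simp: sq_int_def)
  then show ?thesis by (simp add: sq_int_def power2_sum algebra_simps)
qed

lemma sq_int_scale: "sq_int f \<Longrightarrow> sq_int (\<lambda>x. c * f x)"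
  by (auto simp: sq_int_def power_mult_distrib intro: borel_measurable_times)

lemma sq_int_diff: "sq_int f \<Longrightarrow> sq_int g \<Longrightarrow> sq_int (\<lambda>x. f x - g x)"
  using sq_int_add[OF _ sq_int_scale[of g "-1"], of f] by simp

lemma sq_int_cong_AE:
  assumes "sq_int f" "g \<in> borel_measurable borel" "AE x in lborel. f x = g x"
  shows "sq_int g"
proof -
  have [measurable]: "f \<in> borel_measurable borel" "g \<in> borel_measurable borel" using assms by (auto simp: sq_int_def)
  have "integrable lborel (\<lambda>x. (f x)\<^sup>2) \<longleftrightarrow> integrable lborel (\<lambda>x. (g x)\<^sup>2)"
    by (rule integrable_cong_AE) (use assms(3) in auto)
  then show ?thesis using assms by (simp add: sq_int_def)
qed

text \<open>The Hilbert space \<open>L\<^sup>2(dx)\<close> as a type. Multiplication by \<open>w\<^sup>1\<^sup>/\<^sup>2\<close> is an isometry from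
  \<open>L\<^sup>2(w(x) dx)\<close> onto it.\<close>

typedef lsq = "L2_space (\<lambda>_. 1)"
proof
  show "0 \<in> L2_space (\<lambda>_. 1)"
    unfolding L2_space_def using integrable_cong_AE[of "\<lambda>x. (rep_l0 0 x)\<^sup>2" lborel "\<lambda>_. 0"] rep_l0_zero by auto
qed


text \<open>A fixed representative of the class. It respects the algebraic operations only almost
  everywhere, so identities in the space are proved through \<open>lsq_eqI\<close>.\<close>

definition fn :: "lsq \<Rightarrow> real \<Rightarrow> real" where
  "fn a = rep_l0 (Rep_lsq a)"

definition to_lsq :: "(real \<Rightarrow> real) \<Rightarrow> lsq" where
  "to_lsq f = Abs_lsq (abs_l0 f)"

lemma fn_sq_int: "sq_int (fn a)"
  using Rep_lsq[of a] by (simp add: sq_int_def fn_def L2_space_def)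

lemma fn_measurable [measurable]: "fn a \<in> borel_measurable borel"
  by (simp add: fn_def)

lemma Rep_to_lsq:
  assumes "sq_int f"
  shows "Rep_lsq (to_lsq f) = abs_l0 f"
proof -
  have "sq_int (rep_l0 (abs_l0 f))"
    by (rule sq_int_cong_AE[OF assms]) (use rep_abs_l0[OF sq_int_measurable[OF assms]] in auto)
  then show ?thesis unfolding to_lsq_def by (intro Abs_lsq_inverse) (simp add: L2_space_def sq_int_def)
qed

lemma fn_to_lsq:
  assumes "sq_int f"
  shows "AE x in lborel. fn (to_lsq f) x = f x"
  unfolding fn_def Rep_to_lsq[OF assms] by (rule rep_abs_l0[OF sq_int_measurable[OF assms]])

lemma to_lsq_fn: "to_lsq (fn a) = a"
  by (simp add: to_lsq_def fn_def abs_rep_l0 Rep_lsq_inverse)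

lemma to_lsq_eqI:
  assumes "sq_int f" "sq_int g" "AE x in lborel. f x = g x"
  shows "to_lsq f = to_lsq g"
  unfolding to_lsq_def using abs_l0_eqI[of f g] assms by (simp add: sq_int_def)

lemma lsq_eqI: "(AE x in lborel. fn a x = fn b x) \<Longrightarrow> a = b"
  using to_lsq_eqI[OF fn_sq_int fn_sq_int, of a b] by (simp add: to_lsq_fn)

instantiation lsq :: real_inner
begin

definition "zero_lsq = to_lsq (\<lambda>_. 0)"
definition "plus_lsq a b = to_lsq (\<lambda>x. fn a x + fn b x)"
definition "minus_lsq a b = to_lsq (\<lambda>x. fn a x - fn b x)"
definition "uminus_lsq a = to_lsq (\<lambda>x. - 1 * fn a x)"
definition "scaleR_lsq c a = to_lsq (\<lambda>x. c * fn a x)"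
definition "inner_lsq a b = (\<integral>x. fn a x * fn b x \<partial>lborel)"
definition "norm_lsq (a::lsq) = sqrt (inner a a)"
definition "dist_lsq (a::lsq) b = norm (a - b)"
definition "sgn_lsq (a::lsq) = scaleR (inverse (norm a)) a"
definition "uniformity_lsq = (INF e\<in>{0<..}. principal {(x::lsq, y). dist x y < e})"
definition "open_lsq (U::lsq set) = (\<forall>x\<in>U. \<forall>\<^sub>F (x', y) in uniformity. x' = x \<longrightarrow> y \<in> U)"

lemma fn_zero: "AE x in lborel. fn 0 x = 0"
  unfolding zero_lsq_def by (rule fn_to_lsq) (simp add: sq_int_def)

lemma fn_plus: "AE x in lborel. fn (a + b) x = fn a x + fn b x"
  unfolding plus_lsq_def by (intro fn_to_lsq sq_int_add fn_sq_int)

lemma fn_minus: "AE x in lborel. fn (a - b) x = fn a x - fn b x"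
  unfolding minus_lsq_def by (intro fn_to_lsq sq_int_diff fn_sq_int)

lemma fn_uminus: "AE x in lborel. fn (- a) x = - fn a x"
  unfolding uminus_lsq_def using fn_to_lsq[OF sq_int_scale[OF fn_sq_int, of "-1" a]] by simp

lemma fn_scaleR: "AE x in lborel. fn (c *\<^sub>R a) x = c * fn a x"
  unfolding scaleR_lsq_def by (intro fn_to_lsq sq_int_scale fn_sq_int)

instance
proof
  fix a b c :: lsq and s t :: real
  show "a + b + c = a + (b + c)"
    by (rule lsq_eqI) (use fn_plus[of "a + b" c] fn_plus[of a b] fn_plus[of a "b + c"] fn_plus[of b c] in eventually_elim, simp)
  show "a + b = b + a"
    by (rule lsq_eqI) (use fn_plus[of a b] fn_plus[of b a] in eventually_elim, simp)
  show "0 + a = a"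
    by (rule lsq_eqI) (use fn_plus[of 0 a] fn_zero in eventually_elim, simp)
  show "- a + a = 0"
    by (rule lsq_eqI) (use fn_plus[of "- a" a] fn_uminus[of a] fn_zero in eventually_elim, simp)
  show "a - b = a + - b"
    by (rule lsq_eqI) (use fn_plus[of a "- b"] fn_uminus[of b] fn_minus[of a b] in eventually_elim, simp)
  show "s *\<^sub>R (a + b) = s *\<^sub>R a + s *\<^sub>R b"
    by (rule lsq_eqI) (use fn_scaleR[of s "a + b"] fn_plus[of a b] fn_plus[of "s *\<^sub>R a" "s *\<^sub>R b"] fn_scaleR[of s a] fn_scaleR[of s b] in
      eventually_elim, simp add: algebra_simps)
  show "(s + t) *\<^sub>R a = s *\<^sub>R a + t *\<^sub>R a"
    by (rule lsq_eqI) (use fn_scaleR[of "s + t" a] fn_plus[of "s *\<^sub>R a" "t *\<^sub>R a"] fn_scaleR[of s a] fn_scaleR[of t a] in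
      eventually_elim, simp add: algebra_simps)
  show "s *\<^sub>R t *\<^sub>R a = (s * t) *\<^sub>R a"
    by (rule lsq_eqI) (use fn_scaleR[of s "t *\<^sub>R a"] fn_scaleR[of t a] fn_scaleR[of "s * t" a] in eventually_elim, simp)
  show "1 *\<^sub>R a = a"
    by (rule lsq_eqI) (use fn_scaleR[of 1 a] in eventually_elim, simp)
  show "dist a b = norm (a - b)" by (rule dist_lsq_def)
  show "sgn a = scaleR (inverse (norm a)) a" by (rule sgn_lsq_def)
  show "uniformity = (INF e\<in>{0<..}. principal {(x::lsq, y). dist x y < e})" by (rule uniformity_lsq_def)
  show "open (U::lsq set) = (\<forall>x\<in>U. \<forall>\<^sub>F (x', y) in uniformity. x' = x \<longrightarrow> y \<in> U)" for U by (rule open_lsq_def)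
  show "inner a b = inner b a" by (simp add: inner_lsq_def mult.commute)
  show "inner (a + b) c = inner a c + inner b c"
  proof -
    have "inner (a + b) c = (\<integral>x. fn a x * fn c x + fn b x * fn c x \<partial>lborel)"
      unfolding inner_lsq_def by (rule integral_cong_AE) (use fn_plus[of a b] in \<open>auto simp: distrib_right\<close>)
    also have "\<dots> = inner a c + inner b c"
      unfolding inner_lsq_def by (intro Bochner_Integration.integral_add sq_int_mult fn_sq_int)
    finally show ?thesis .
  qed
  show "inner (s *\<^sub>R a) b = s * inner a b"
  proof -
    have "inner (s *\<^sub>R a) b = (\<integral>x. s * (fn a x * fn b x) \<partial>lborel)"
      unfolding inner_lsq_def by (rule integral_cong_AE) (use fn_scaleR[of s a] in auto)
    then show ?thesis by (simp add: inner_lsq_def)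
  qed
  show "0 \<le> inner a a" by (simp add: inner_lsq_def)
  show "inner a a = 0 \<longleftrightarrow> a = 0"
  proof
    assume "inner a a = 0"
    then have n: "AE x in lborel. fn a x * fn a x = 0"
      using integral_nonneg_eq_0_iff_AE[OF sq_int_mult[OF fn_sq_int fn_sq_int, of a a]] by (simp add: inner_lsq_def)
    show "a = 0"
      by (rule lsq_eqI) (use n fn_zero in eventually_elim, simp)
  next
    assume "a = 0"
    have "inner 0 (0::lsq) = (\<integral>x. 0 \<partial>(lborel :: real measure))"
      unfolding inner_lsq_def by (rule integral_cong_AE) (use fn_zero in auto)
    then show "inner a a = 0" using \<open>a = 0\<close> by simp
  qed
  show "norm a = sqrt (inner a a)" by (rule norm_lsq_def)
qed

end

lemma to_lsq_inner:
  assumes "sq_int f"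
  shows "to_lsq f \<bullet> a = (\<integral>x. f x * fn a x \<partial>lborel)"
  unfolding inner_lsq_def
  by (rule integral_cong_AE) (use fn_to_lsq[OF assms] sq_int_measurable[OF assms] in auto)

lemma to_lsq_diff:
  assumes "sq_int f" "sq_int g"
  shows "to_lsq f - to_lsq g = to_lsq (\<lambda>x. f x - g x)"
  unfolding minus_lsq_def
  by (rule to_lsq_eqI) (use fn_to_lsq[OF assms(1)] fn_to_lsq[OF assms(2)] assms in \<open>auto intro: sq_int_diff fn_sq_int\<close>)

lemma to_lsq_norm:
  assumes "sq_int f"
  shows "(norm (to_lsq f))\<^sup>2 = (\<integral>x. (f x)\<^sup>2 \<partial>lborel)"
proof -
  have "(norm (to_lsq f))\<^sup>2 = (\<integral>x. f x * fn (to_lsq f) x \<partial>lborel)"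
    unfolding power2_norm_eq_inner by (rule to_lsq_inner[OF assms])
  also have "\<dots> = (\<integral>x. (f x)\<^sup>2 \<partial>lborel)"
    by (rule integral_cong_AE) (use fn_to_lsq[OF assms] sq_int_measurable[OF assms] in \<open>auto simp: power2_eq_square\<close>)
  finally show ?thesis .
qed

text \<open>Riesz-Fischer: along a fast subsequence, \<open>\<Sum> 2\<^sup>k \<parallel>f\<^bsub>k+1\<^esub> - f\<^bsub>k\<^esub>\<parallel>\<^sup>2 < \<infinity>\<close>, so that the
  representatives converge geometrically almost everywhere.\<close>

instance lsq :: banach
proof
  fix X :: "nat \<Rightarrow> lsq"
  assume X: "Cauchy X"
  have "\<forall>k. \<exists>N. \<forall>n\<ge>N. \<forall>n'\<ge>N. norm (X n - X n') < (1/2)^k"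
    using X by (intro allI) (rule CauchyD, auto)
  from choice[OF this] obtain N where N: "\<And>k n n'. N k \<le> n \<Longrightarrow> N k \<le> n' \<Longrightarrow> norm (X n - X n') < (1/2)^k" by blast
  \<comment> \<open>Summing makes \<open>r\<close> dominate every earlier \<open>N i\<close>, and
    the added 1 makes it strictly increasing.\<close>
  define r where "r k = (\<Sum>i\<le>k. N i + 1)" for k
  have r: "strict_mono r" by (rule strict_monoI_Suc) (simp add: r_def)
  have rN: "N k \<le> r n" if "k \<le> n" for k n
  proof -
    have "N k + 1 \<le> r n" unfolding r_def using that by (intro member_le_sum[of k _ "\<lambda>i. N i + 1"]) auto
    then show ?thesis by simp
  qed
  define f where "f k = fn (X (r k))" for k
  have fm[measurable]: "f k \<in> borel_measurable borel" for k by (simp add: f_def)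
  have sqd: "(\<integral>\<^sup>+x. ennreal ((f j x - f k x)\<^sup>2) \<partial>lborel) \<le> ennreal ((1/4)^n)" if "n \<le> j" "n \<le> k" for j k n
  proof -
    have s: "sq_int (\<lambda>x. f j x - f k x)" unfolding f_def by (intro sq_int_diff fn_sq_int)
    have "(\<integral>\<^sup>+x. ennreal ((f j x - f k x)\<^sup>2) \<partial>lborel) = ennreal (\<integral>x. (f j x - f k x)\<^sup>2 \<partial>lborel)"
      using s by (intro nn_integral_eq_integral) (auto simp: sq_int_def)
    also have "(\<integral>x. (f j x - f k x)\<^sup>2 \<partial>lborel) = (norm (X (r j) - X (r k)))\<^sup>2"
      using to_lsq_norm[OF s] by (simp add: f_def minus_lsq_def)
    also have "\<dots> \<le> ((1/2)^n)\<^sup>2" using N[of n "r j" "r k"] rN that by (intro power_mono) auto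
    also have "((1/2)^n)\<^sup>2 = (1/4 :: real)^n" by (simp add: power2_eq_square flip: power_mult_distrib)
    finally show ?thesis by (simp add: ennreal_leI)
  qed
  have "(\<integral>\<^sup>+x. (\<Sum>k. ennreal (2^k) * ennreal ((f (Suc k) x - f k x)\<^sup>2)) \<partial>lborel)
     = (\<Sum>k. \<integral>\<^sup>+x. ennreal (2^k) * ennreal ((f (Suc k) x - f k x)\<^sup>2) \<partial>lborel)"
    by (rule nn_integral_suminf) measurable
  also have "\<dots> = (\<Sum>k. ennreal (2^k) * (\<integral>\<^sup>+x. ennreal ((f (Suc k) x - f k x)\<^sup>2) \<partial>lborel))"
    by (intro suminf_cong nn_integral_cmult) measurable
  also have "\<dots> \<le> (\<Sum>k. ennreal ((1/2)^k))"
  proof (intro suminf_le)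
    fix k
    have "ennreal (2^k) * (\<integral>\<^sup>+x. ennreal ((f (Suc k) x - f k x)\<^sup>2) \<partial>lborel) \<le> ennreal (2^k) * ennreal ((1/4)^k)"
      by (intro mult_left_mono sqd) auto
    also have "\<dots> = ennreal (2^k * (1/4)^k)" by (rule ennreal_mult[symmetric]) auto
    also have "(2::real)^k * (1/4)^k = (1/2)^k" by (simp flip: power_mult_distrib)
    finally show "ennreal (2^k) * (\<integral>\<^sup>+x. ennreal ((f (Suc k) x - f k x)\<^sup>2) \<partial>lborel) \<le> ennreal ((1/2)^k)" .
  qed auto
  also have "\<dots> = ennreal (\<Sum>k. (1/2)^k)" by (rule suminf_ennreal2) (auto intro: summable_geometric)
  finally have "(\<integral>\<^sup>+x. (\<Sum>k. ennreal (2^k) * ennreal ((f (Suc k) x - f k x)\<^sup>2)) \<partial>lborel) \<noteq> \<infinity>"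
    by (auto simp: top_unique)
  then have "AE x in lborel. (\<Sum>k. ennreal (2^k) * ennreal ((f (Suc k) x - f k x)\<^sup>2)) \<noteq> \<infinity>"
    by (intro nn_integral_PInf_AE) measurable
  then have conv: "AE x in lborel. convergent (\<lambda>k. f k x)"
  proof eventually_elim
    case (elim x)
    then obtain c where c: "(\<Sum>k. ennreal (2^k) * ennreal ((f (Suc k) x - f k x)\<^sup>2)) = ennreal c" "0 \<le> c"
      by (cases "\<Sum>k. ennreal (2^k) * ennreal ((f (Suc k) x - f k x)\<^sup>2)" rule: ennreal_cases) auto
    have "norm (f (Suc k) x - f k x) \<le> sqrt c * (sqrt (1/2))^k" for k
    proof -
      have "ennreal (2^k * (f (Suc k) x - f k x)\<^sup>2) \<le> ennreal c"
        using sum_le_suminf[of "\<lambda>k. ennreal (2^k) * ennreal ((f (Suc k) x - f k x)\<^sup>2)" "{k}"]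
        by (simp only: c(1)) (simp add: ennreal_mult)
      then have "2^k * (f (Suc k) x - f k x)\<^sup>2 \<le> c" using c(2) by (simp add: ennreal_le_iff)
      then have "(f (Suc k) x - f k x)\<^sup>2 \<le> c * (1/2)^k" by (simp add: field_simps power_one_over)
      then have "\<bar>f (Suc k) x - f k x\<bar> \<le> sqrt (c * (1/2)^k)" by (intro real_le_rsqrt) (simp only: power2_abs)
      then show ?thesis by (simp add: real_sqrt_mult real_sqrt_power)
    qed
    then have "summable (\<lambda>k. f (Suc k) x - f k x)"
      by (intro summable_comparison_test'[OF summable_mult[OF summable_geometric[of "sqrt (1/2)"]], of 0]) (auto simp: real_sqrt_lt_1_iff)
    then have "convergent (\<lambda>n. \<Sum>k<n. f (Suc k) x - f k x)" by (simp add: summable_iff_convergent)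
    moreover have "(\<Sum>k<n. f (Suc k) x - f k x) = f n x - f 0 x" for n by (induction n) auto
    ultimately have "convergent (\<lambda>n. f n x - f 0 x)" by simp
    then show ?case using convergent_add[OF _ convergent_const[of "f 0 x"], of "\<lambda>n. f n x - f 0 x"] by simp
  qed
  define F where "F x = lim (\<lambda>k. f k x)" for x
  have Fm[measurable]: "F \<in> borel_measurable borel" unfolding F_def by (rule borel_measurable_lim_metric) measurable
  have lim: "AE x in lborel. (\<lambda>k. f k x) \<longlonglongrightarrow> F x"
    using conv by eventually_elim (simp add: F_def convergent_LIMSEQ_iff)
  \<comment> \<open>Fatou's lemma in \<open>j\<close>: the bound on \<open>f j - f k\<close>
    survives the pointwise limit. It yields both the square integrability of \<open>F\<close> and
    the rate of convergence.\<close>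
  have Fk: "(\<integral>\<^sup>+x. ennreal ((F x - f k x)\<^sup>2) \<partial>lborel) \<le> ennreal ((1/4)^k)" for k
  proof -
    have "(\<integral>\<^sup>+x. ennreal ((F x - f k x)\<^sup>2) \<partial>lborel) = (\<integral>\<^sup>+x. liminf (\<lambda>j. ennreal ((f j x - f k x)\<^sup>2)) \<partial>lborel)"
    proof (rule nn_integral_cong_AE)
      show "AE x in lborel. ennreal ((F x - f k x)\<^sup>2) = liminf (\<lambda>j. ennreal ((f j x - f k x)\<^sup>2))"
        using lim
      proof eventually_elim
        case (elim x)
        have "(\<lambda>j. ennreal ((f j x - f k x)\<^sup>2)) \<longlonglongrightarrow> ennreal ((F x - f k x)\<^sup>2)"
          by (intro tendsto_ennrealI tendsto_intros elim)
        then show ?case by (rule lim_imp_Liminf[OF sequentially_bot, symmetric])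
      qed
    qed
    also have "\<dots> \<le> liminf (\<lambda>j. \<integral>\<^sup>+x. ennreal ((f j x - f k x)\<^sup>2) \<partial>lborel)"
      by (rule nn_integral_liminf) measurable
    also have "\<dots> \<le> ennreal ((1/4)^k)"
      by (rule Liminf_le) (auto simp: eventually_sequentially intro!: exI[of _ k] sqd)
    finally show ?thesis .
  qed
  have sFk: "sq_int (\<lambda>x. F x - f k x)" for k
    unfolding sq_int_def using Fk[of k] by (auto intro!: integrableI_bounded simp: order.strict_trans1)
  have "sq_int (\<lambda>x. (F x - f 0 x) + f 0 x)" by (rule sq_int_add[OF sFk]) (simp add: f_def fn_sq_int)
  then have sF: "sq_int F" by simp
  have le: "norm (X (r k) - to_lsq F) \<le> (1/2)^k" for k
  proof -
    have "(norm (to_lsq F - X (r k)))\<^sup>2 = (norm (to_lsq (\<lambda>x. F x - f k x)))\<^sup>2"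
      using to_lsq_diff[OF sF fn_sq_int, of "X (r k)"] by (simp add: f_def to_lsq_fn)
    also have "\<dots> = (\<integral>x. (F x - f k x)\<^sup>2 \<partial>lborel)" by (rule to_lsq_norm[OF sFk])
    also have "\<dots> \<le> (1/4)^k"
    proof -
      have "ennreal (\<integral>x. (F x - f k x)\<^sup>2 \<partial>lborel) \<le> ennreal ((1/4)^k)"
        using Fk[of k] sFk[of k] by (subst nn_integral_eq_integral[symmetric]) (auto simp: sq_int_def)
      then show ?thesis by (subst (asm) ennreal_le_iff) auto
    qed
    also have "(1/4 :: real)^k = ((1/2)^k)\<^sup>2" by (simp add: power2_eq_square flip: power_mult_distrib)
    finally show ?thesis by (subst norm_minus_commute) (rule power2_le_imp_le, auto)
  qed
  have "(X \<circ> r) \<longlonglongrightarrow> to_lsq F"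
    unfolding LIM_zero_iff[symmetric, of _ "to_lsq F"] comp_def
    by (rule Lim_null_comparison[of _ "\<lambda>k. (1/2)^k"]) (use le in \<open>auto intro: LIMSEQ_realpow_zero\<close>)
  then have "X \<longlonglongrightarrow> to_lsq F" by (rule Cauchy_converges_subseq[OF X r])
  then show "convergent X" by (rule convergentI)
qed

section \<open>Empirical distribution functions as vectors\<close>

locale weight_fun =
  fixes w :: "real \<Rightarrow> real"
  assumes w_cont: "continuous_on UNIV w" and w_pos: "\<And>x. 0 < w x"
    and w_int: "integrable lborel w" and w_one: "(\<integral>x. w x \<partial>lborel) = 1"
begin

definition sw :: "real \<Rightarrow> real" where
  "sw t = sqrt (w t)"

lemma w_measurable [measurable]: "w \<in> borel_measurable borel"
  by (rule borel_measurable_continuous_onI[OF w_cont])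

lemma sw_measurable [measurable]: "sw \<in> borel_measurable borel"
  unfolding sw_def[abs_def] by measurable

lemma sw: "0 < sw t" "sw t * sw t = w t" "(sw t)\<^sup>2 = w t"
  using w_pos[of t] by (simp_all add: sw_def)

lemma sq_int_sw: "f \<in> borel_measurable borel \<Longrightarrow> (\<And>t. \<bar>f t\<bar> \<le> 1) \<Longrightarrow> sq_int (\<lambda>t. f t * sw t)"
proof -
  assume [measurable]: "f \<in> borel_measurable borel" and f: "\<And>t. \<bar>f t\<bar> \<le> 1"
  have "integrable lborel (\<lambda>t. (f t)\<^sup>2 * w t)"
  proof (rule Bochner_Integration.integrable_bound[OF w_int])
    show "AE t in lborel. norm ((f t)\<^sup>2 * w t) \<le> norm (w t)"
    proof (rule AE_I2)
      fix t
      have "(f t)\<^sup>2 \<le> 1" using f[of t] by (simp add: abs_square_le_1)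
      then show "norm ((f t)\<^sup>2 * w t) \<le> norm (w t)" using w_pos[of t] by (simp add: abs_mult mult_left_le_one_le)
    qed
  qed measurable
  then show ?thesis by (simp add: sq_int_def power_mult_distrib sw)
qed

lemma sq_int_sw_1: "sq_int sw"
  using sq_int_sw[of "\<lambda>_. 1"] by simp

text \<open>The inverse of the isometry given by multiplication with the square root of
  \<open>w\<close>; positivity of \<open>w\<close> makes the division meaningful everywhere.\<close>

definition embed :: "lsq \<Rightarrow> l0" where
  "embed a = abs_l0 (\<lambda>t. fn a t / sw t)"

lemma rep_embed: "AE t in lborel. rep_l0 (embed a) t = fn a t / sw t"
  unfolding embed_def by (rule rep_abs_l0) measurable

lemma embed_inner: "L2_inner w (embed a) (embed b) = a \<bullet> b"
  unfolding L2_inner_def inner_lsq_def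
proof (rule integral_cong_AE)
  show "AE t in lborel. rep_l0 (embed a) t * rep_l0 (embed b) t * w t = fn a t * fn b t"
    using rep_embed[of a] rep_embed[of b]
  proof eventually_elim
    case (elim t)
    then show ?case using sw(1)[of t] by (simp add: sw(2)[of t, symmetric])
  qed
qed measurable

lemma embed_norm: "L2_norm w (embed a) = norm a"
  by (simp add: L2_norm_def embed_inner norm_eq_sqrt_inner)

lemma embed_mem: "embed a \<in> L2_space w"
proof -
  have "integrable lborel (\<lambda>t. (rep_l0 (embed a) t)\<^sup>2 * w t) \<longleftrightarrow> integrable lborel (\<lambda>t. (fn a t)\<^sup>2)"
  proof (rule integrable_cong_AE)
    show "AE t in lborel. (rep_l0 (embed a) t)\<^sup>2 * w t = (fn a t)\<^sup>2"
      using rep_embed[of a]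
    proof eventually_elim
      case (elim t)
      then show ?case using sw(1)[of t] by (simp add: sw(3)[of t, symmetric] power_divide)
    qed
  qed measurable
  then show ?thesis using fn_sq_int[of a] by (simp add: L2_space_def sq_int_def)
qed

lemma embed_to_lsq:
  assumes "sq_int f"
  shows "embed (to_lsq f) = abs_l0 (\<lambda>t. f t / sw t)"
  unfolding embed_def
proof (rule abs_l0_eqI)
  have [measurable]: "f \<in> borel_measurable borel" by (rule sq_int_measurable[OF assms])
  show "(\<lambda>t. f t / sw t) \<in> borel_measurable borel" by measurable
  show "AE t in lborel. fn (to_lsq f) t / sw t = f t / sw t" using fn_to_lsq[OF assms] by eventually_elim simp
qed measurable

lemma embed_surj:
  assumes "f \<in> L2_space w"
  obtains a where "f = embed a"
proof -
  have s: "sq_int (\<lambda>t. rep_l0 f t * sw t)"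
    using assms by (simp add: sq_int_def L2_space_def power_mult_distrib sw)
  have "embed (to_lsq (\<lambda>t. rep_l0 f t * sw t)) = abs_l0 (rep_l0 f)"
    unfolding embed_to_lsq[OF s] using sw(1) by (simp add: less_imp_neq[symmetric])
  then show ?thesis by (intro that[of "to_lsq (\<lambda>t. rep_l0 f t * sw t)"]) (simp add: abs_rep_l0)
qed

lemma embed_add: "embed (a + b) = embed a + embed b"
proof -
  have "embed a + embed b = abs_l0 (\<lambda>t. fn a t / sw t + fn b t / sw t)"
    unfolding embed_def by (rule abs_l0_add) measurable
  also have "\<dots> = embed (a + b)" unfolding plus_lsq_def
    by (subst embed_to_lsq) (auto intro: sq_int_add fn_sq_int simp: add_divide_distrib)
  finally show ?thesis by simp
qed

lemma embed_scaleR: "embed (c *\<^sub>R a) = c *\<^sub>R embed a"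
proof -
  have "c *\<^sub>R embed a = abs_l0 (\<lambda>t. c * (fn a t / sw t))"
    unfolding embed_def by (rule abs_l0_scaleR) measurable
  also have "\<dots> = embed (c *\<^sub>R a)" unfolding scaleR_lsq_def
    by (subst embed_to_lsq) (auto intro: sq_int_scale fn_sq_int)
  finally show ?thesis by simp
qed

lemma embed_linear: "linear embed"
  by (rule linearI) (simp_all add: embed_add embed_scaleR)

lemma embed_inj: "embed a = embed b \<Longrightarrow> a = b"
proof -
  assume "embed a = embed b"
  then have "L2_norm w (embed (a - b)) = L2_norm w (embed 0)"
    using linear_diff[OF embed_linear, of a b] linear_0[OF embed_linear] by simp
  then show "a = b" by (simp add: embed_norm)
qed

text \<open>The image under the isometry of the distribution function of the point mass at
  \<open>y\<close>. An empirical distribution function is an average of such jumps.\<close>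

definition jump :: "real \<Rightarrow> lsq" where
  "jump y = to_lsq (\<lambda>t. indicator {y..} t * sw t)"

definition profile :: "(real \<Rightarrow> real) \<Rightarrow> lsq" where
  "profile F = to_lsq (\<lambda>t. F t * sw t)"

lemma jump_sq_int: "sq_int (\<lambda>t. indicator {y..} t * sw t)"
  by (rule sq_int_sw) (auto simp: indicator_def)

lemma embed_jump: "embed (jump y) = abs_l0 (\<lambda>t. indicator {y..} t)"
  unfolding jump_def embed_to_lsq[OF jump_sq_int] using sw(1) by (simp add: less_imp_neq[symmetric])

lemma embed_profile:
  assumes "F \<in> borel_measurable borel" "\<And>t. \<bar>F t\<bar> \<le> 1"
  shows "embed (profile F) = abs_l0 F"
  unfolding profile_def embed_to_lsq[OF sq_int_sw[OF assms]] using sw(1) by (simp add: less_imp_neq[symmetric])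

text \<open>The probability measure w(x) dx. Its distribution function measures the distances
  between jumps.\<close>

definition law :: "real measure" where
  "law = density lborel (\<lambda>x. ennreal (w x))"

lemma law_prob: "prob_space law"
proof
  have "emeasure law (space law) = (\<integral>\<^sup>+x. ennreal (w x) \<partial>lborel)" by (simp add: law_def emeasure_density)
  also have "\<dots> = 1" using w_int w_one w_pos by (subst nn_integral_eq_integral) (auto simp: less_imp_le)
  finally show "emeasure law (space law) = 1" .
qed

sublocale law: real_distribution law
  using law_prob by (simp add: real_distribution_def real_distribution_axioms_def law_def)

lemma law_measure: "A \<in> sets borel \<Longrightarrow> measure law A = (\<integral>x. indicator A x * w x \<partial>lborel)"
proof -
  assume [measurable]: "A \<in> sets borel"
  have "measure law A = (\<integral>x. indicator A x \<partial>law)" by (simp add: law_def)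
  also have "\<dots> = (\<integral>x. w x * indicator A x \<partial>lborel)"
    unfolding law_def using w_pos by (subst integral_density) (auto simp: less_imp_le)
  finally show ?thesis by (simp add: mult.commute)
qed

text \<open>Up to an endpoint the two indicators differ exactly on the interval from
  \<open>y\<close> to \<open>z\<close>, and the squared distance is the mass of this interval under
  \<open>law\<close>.\<close>

lemma jump_diff:
  assumes "y \<le> z"
  shows "(norm (jump y - jump z))\<^sup>2 = cdf law z - cdf law y"
proof (cases "y = z")
  case False
  then have yz: "y < z" using assms by simp
  have "(norm (jump y - jump z))\<^sup>2 = (\<integral>t. (indicator {y..} t * sw t - indicator {z..} t * sw t)\<^sup>2 \<partial>lborel)"
    unfolding jump_def to_lsq_diff[OF jump_sq_int jump_sq_int]
    by (intro to_lsq_norm sq_int_diff jump_sq_int)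
  also have "\<dots> = (\<integral>t. indicator {y<..z} t * w t \<partial>lborel)"
  proof (rule integral_cong_AE)
    show "AE t in lborel. (indicator {y..} t * sw t - indicator {z..} t * sw t)\<^sup>2 = indicator {y<..z} t * w t"
      using AE_lborel_singleton[of y] AE_lborel_singleton[of z]
      by eventually_elim (use yz in \<open>auto simp: indicator_def sw\<close>)
  qed measurable
  also have "\<dots> = measure law {y<..z}" by (simp add: law_measure)
  also have "\<dots> = cdf law z - cdf law y" by (rule law.cdf_diff_eq[symmetric, OF yz])
  finally show ?thesis .
qed simp

lemma jump_dist: "norm (jump y - jump z) = sqrt \<bar>cdf law y - cdf law z\<bar>"
proof -
  have "norm (jump y - jump z) = sqrt \<bar>cdf law y - cdf law z\<bar>" if "y \<le> z" for y z
  proof -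
    have "norm (jump y - jump z) = sqrt ((norm (jump y - jump z))\<^sup>2)" by simp
    then show ?thesis unfolding jump_diff[OF that] using law.cdf_nondecreasing[OF that] by (simp add: abs_minus_commute)
  qed
  from this[of y z] this[of z y] show ?thesis
    by (cases "y \<le> z") (auto simp: norm_minus_commute abs_minus_commute)
qed

lemma law_cdf_cont: "isCont (cdf law) x"
  unfolding law.isCont_cdf
proof -
  have "measure law {x} = (\<integral>t. indicator {x} t * w t \<partial>lborel)" by (simp add: law_measure)
  also have "\<dots> = (\<integral>t. 0 \<partial>(lborel :: real measure))"
    by (rule integral_cong_AE) (measurable, use AE_lborel_singleton[of x] in eventually_elim, simp)
  finally show "measure law {x} = 0" by simp
qed

lemma jump_cont: "continuous_on UNIV jump"
proof (rule continuous_at_imp_continuous_on, rule ballI)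
  fix x
  have "((\<lambda>y. sqrt \<bar>cdf law y - cdf law x\<bar>) \<longlongrightarrow> sqrt \<bar>cdf law x - cdf law x\<bar>) (at x)"
    using law_cdf_cont[of x] unfolding isCont_def by (intro tendsto_intros)
  then have "((\<lambda>y. norm (jump y - jump x)) \<longlongrightarrow> 0) (at x)" by (simp add: jump_dist)
  then show "isCont jump x" unfolding isCont_def by (simp add: LIM_zero_iff tendsto_norm_zero_iff LIM_zero_cancel)
qed

lemma jump_norm: "norm (jump y) \<le> 1"
proof -
  have "(norm (jump y))\<^sup>2 = (\<integral>t. (indicator {y..} t * sw t)\<^sup>2 \<partial>lborel)" unfolding jump_def by (rule to_lsq_norm[OF jump_sq_int])
  also have "\<dots> \<le> (\<integral>t. w t \<partial>lborel)"
    using jump_sq_int[of y] w_int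
    by (intro integral_mono) (auto simp: sq_int_def indicator_def sw less_imp_le[OF w_pos])
  finally show ?thesis unfolding w_one by (simp add: power2_le_imp_le[of _ 1])
qed

text \<open>By the distance formula, the jump at \<open>y\<close> is determined up to isometry by
  \<open>cdf law y\<close>, a number in a bounded interval with the square root of the usual metric.
  Quantiles at the multiples of 1/n therefore form a net.\<close>

lemma jump_net:
  assumes "0 < \<epsilon>"
  shows "\<exists>F. finite F \<and> (\<forall>y. \<exists>z\<in>F. norm (jump y - jump z) \<le> \<epsilon>)"
proof -
  obtain n0 where n0: "1 / real (Suc n0) < \<epsilon>\<^sup>2" using nat_approx_posE[of "\<epsilon>\<^sup>2"] assms by auto
  \<comment> \<open>At least 2, so that an interior quantile exists; the values 0 and 1 are not
    attained by \<open>cdf law\<close>, whose density is positive everywhere.\<close>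
  define n where "n = n0 + 2"
  have n: "2 \<le> n" "1 / real n < \<epsilon>\<^sup>2"
  proof -
    have "1 / real n \<le> 1 / real (Suc n0)" by (simp add: n_def frac_le)
    then show "1 / real n < \<epsilon>\<^sup>2" using n0 by simp
  qed (simp add: n_def)
  have ex: "\<exists>q. cdf law q = real k / real n" if k: "0 < k" "k < n" for k
  proof -
    have p: "0 < real k / real n" "real k / real n < 1" using k by auto
    have "\<forall>\<^sub>F x in at_bot. cdf law x < real k / real n" by (rule order_tendstoD(2)[OF law.cdf_lim_at_bot p(1)])
    then obtain a where a: "cdf law a < real k / real n" by (auto simp: eventually_at_bot_linorder)
    have "\<forall>\<^sub>F x in at_top. real k / real n < cdf law x" by (rule order_tendstoD(1)[OF law.cdf_lim_at_top_prob p(2)])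
    then obtain b where b: "real k / real n < cdf law b" by (auto simp: eventually_at_top_linorder)
    have "a \<le> b" using a b law.cdf_nondecreasing[of b a] by (cases "a \<le> b") auto
    then show ?thesis
      using IVT[of "cdf law" a "real k / real n" b] a b law_cdf_cont by auto
  qed
  then have "\<forall>k\<in>{0<..<n}. \<exists>q. cdf law q = real k / real n" by auto
  from bchoice[OF this] obtain q where q': "\<forall>k\<in>{0<..<n}. cdf law (q k) = real k / real n" ..
  then have q: "cdf law (q k) = real k / real n" if "0 < k" "k < n" for k using that by simp
  have "\<exists>z\<in>q ` {0<..<n}. norm (jump y - jump z) \<le> \<epsilon>" for y
  proof -
    define p where "p = cdf law y"
    have p: "0 \<le> p" "p \<le> 1" by (auto simp: p_def law.cdf_nonneg law.cdf_bounded_prob)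
    \<comment> \<open>Values near 0 or 1 are assigned to the first or last interior quantile, which
      keeps the distance within \<open>1 / real n\<close>.\<close>
    define k where "k = max 1 (min (n - 1) (nat \<lfloor>real n * p\<rfloor>))"
    have k: "0 < k" "k < n" using n by (auto simp: k_def)
    have f: "real (nat \<lfloor>real n * p\<rfloor>) \<le> real n * p" "real n * p < real (nat \<lfloor>real n * p\<rfloor>) + 1"
      using p by (auto simp: of_nat_nat)
    have np: "real n * p \<le> real n" using p by (simp add: mult_left_le)
    have "\<bar>real n * p - real k\<bar> \<le> 1"
    proof (cases "nat \<lfloor>real n * p\<rfloor> = 0")
      case True
      then have "k = 1" using n by (simp add: k_def)
      then show ?thesis using f True p by auto
    next
      case False
      show ?thesis
      proof (cases "nat \<lfloor>real n * p\<rfloor> \<le> n - 1")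
        case True
        then have "k = nat \<lfloor>real n * p\<rfloor>" using False by (simp only: k_def)
        then show ?thesis using f by linarith
      next
        case ge: False
        then have "k = n - 1" using n by (simp add: k_def)
        then have "real k = real n - 1" using n by simp
        moreover have "real n \<le> real (nat \<lfloor>real n * p\<rfloor>)" using ge by simp
        ultimately show ?thesis using f np by auto
      qed
    qed
    then have "\<bar>p - real k / real n\<bar> \<le> 1 / real n"
      using n by (simp add: abs_le_iff field_simps)
    then have "\<bar>p - cdf law (q k)\<bar> \<le> \<epsilon>\<^sup>2" using q[OF k] n by simp
    then have "norm (jump y - jump (q k)) \<le> sqrt (\<epsilon>\<^sup>2)" unfolding jump_dist p_def by (rule real_sqrt_le_mono)
    then show ?thesis using assms k by auto
  qed
  then show ?thesis by (intro exI[of _ "q ` {0<..<n}"]) auto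
qed

end

text \<open>\<open>indicator {y..} t\<close> and \<open>indicator {..t} y\<close> are the same
  function of two variables. The bounded factor \<open>q\<close> lets the identity be applied twice
  when second moments are computed.\<close>

lemma fubini_jump:
  fixes a q :: "real \<Rightarrow> real"
  assumes M: "real_distribution M" and a: "integrable lborel a"
    and q [measurable]: "q \<in> borel_measurable borel" and B: "\<And>y. \<bar>q y\<bar> \<le> B"
  shows "(\<integral>y. q y * (\<integral>t. indicator {y..} t * a t \<partial>lborel) \<partial>M) = (\<integral>t. a t * (\<integral>y. q y * indicator {..t} y \<partial>M) \<partial>lborel)"
proof -
  interpret M: real_distribution M by fact
  have [measurable]: "a \<in> borel_measurable borel" using a by auto
  have [measurable]: "(\<lambda>x. a (snd x)) \<in> borel_measurable (M \<Otimes>\<^sub>M lborel)"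
    by (rule measurable_compose[OF measurable_snd]) simp
  interpret P: pair_sigma_finite M lborel
    by (intro pair_sigma_finite.intro M.sigma_finite_measure_axioms sigma_finite_lborel)
  have i: "integrable (M \<Otimes>\<^sub>M lborel) (\<lambda>(y, t). q y * (indicator {..t} y * a t))"
  proof (rule Bochner_Integration.integrable_bound)
    show "integrable (M \<Otimes>\<^sub>M lborel) (\<lambda>(y, t). B * \<bar>a t\<bar>)"
      by (rule P.Fubini_integrable) (use a in \<open>auto simp: split_beta'\<close>)
    show "(\<lambda>(y, t). q y * (indicator {..t} y * a t)) \<in> borel_measurable (M \<Otimes>\<^sub>M lborel)"
      unfolding indicator_def atMost_iff by measurable
    show "AE p in M \<Otimes>\<^sub>M lborel. norm (case p of (y, t) \<Rightarrow> q y * (indicator {..t} y * a t)) \<le> norm (case p of (y, t) \<Rightarrow> B * \<bar>a t\<bar>)"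
    proof (intro AE_I2, clarify)
      fix y t
      have "\<bar>q y\<bar> * \<bar>indicator {..t} y * a t\<bar> \<le> B * \<bar>a t\<bar>"
        using B[of y] by (intro mult_mono) (auto simp: indicator_def)
      moreover have "B * \<bar>a t\<bar> \<le> \<bar>B\<bar> * \<bar>a t\<bar>" by (intro mult_right_mono) auto
      ultimately show "norm (q y * (indicator {..t} y * a t)) \<le> norm (B * \<bar>a t\<bar>)" by (simp add: abs_mult)
    qed
  qed
  have ind: "indicator {y..} t = (indicator {..t} y :: real)" for y t :: real by (simp add: indicator_def)
  have "(\<integral>y. q y * (\<integral>t. indicator {y..} t * a t \<partial>lborel) \<partial>M) = (\<integral>y. (\<integral>t. q y * (indicator {..t} y * a t) \<partial>lborel) \<partial>M)"
    by (simp add: ind)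
  also have "\<dots> = (\<integral>t. (\<integral>y. q y * (indicator {..t} y * a t) \<partial>M) \<partial>lborel)"
    by (rule P.Fubini_integral[OF i, symmetric])
  also have "\<dots> = (\<integral>t. (\<integral>y. (q y * indicator {..t} y) * a t \<partial>M) \<partial>lborel)" by (simp add: mult.assoc)
  finally show ?thesis by (simp add: mult.commute)
qed

lemma fubini_jump_simple:
  assumes "real_distribution M" "integrable lborel a"
  shows "(\<integral>y. (\<integral>t. indicator {y..} t * a t \<partial>lborel) \<partial>M) = (\<integral>t. a t * cdf M t \<partial>lborel)"
proof -
  interpret M: real_distribution M by fact
  show ?thesis
    using fubini_jump[OF assms, of "\<lambda>_. 1" 1] by (simp add: cdf_def)
qed

text \<open>First the second integral plays the part of the bounded factor \<open>q\<close>; then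
  \<open>q\<close> is expanded with an indicator as the factor. The two half lines meet in the one
  that ends at \<open>min s t\<close>.\<close>

lemma fubini_jump_mult:
  assumes M: "real_distribution M" and a: "integrable lborel a" and b: "integrable lborel b"
  shows "(\<integral>y. (\<integral>s. indicator {y..} s * a s \<partial>lborel) * (\<integral>t. indicator {y..} t * b t \<partial>lborel) \<partial>M)
    = (\<integral>s. \<integral>t. a s * b t * cdf M (min s t) \<partial>lborel \<partial>lborel)"
proof -
  interpret M: real_distribution M by fact
  have [measurable]: "a \<in> borel_measurable borel" "b \<in> borel_measurable borel" using a b by auto
  define q where "q y = (\<integral>t. indicator {y..} t * b t \<partial>lborel)" for y
  have [measurable]: "(\<lambda>x. b (snd x)) \<in> borel_measurable (borel \<Otimes>\<^sub>M lborel)"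
    by (rule measurable_compose[OF measurable_snd]) simp
  have [measurable]: "q \<in> borel_measurable borel"
    unfolding q_def[abs_def] indicator_def atLeast_iff by measurable
  have B: "\<bar>q y\<bar> \<le> (\<integral>t. \<bar>b t\<bar> \<partial>lborel)" for y
    unfolding q_def
    by (rule order_trans[OF integral_abs_bound]) (intro integral_mono integrable_abs, auto simp: indicator_def intro: b
        Bochner_Integration.integrable_bound[OF b])
  have inner: "(\<integral>y. q y * indicator {..s} y \<partial>M) = (\<integral>t. b t * cdf M (min s t) \<partial>lborel)" for s
  proof -
    have "(\<integral>y. indicator {..s} y * (\<integral>t. indicator {y..} t * b t \<partial>lborel) \<partial>M) = (\<integral>t. b t * (\<integral>y. indicator {..s} y * indicator {..t} y \<partial>M) \<partial>lborel)"
      by (rule fubini_jump[OF M b, of _ 1]) (auto simp: indicator_def)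
    also have "(\<lambda>t. \<integral>y. indicator {..s} y * indicator {..t} y \<partial>M) = (\<lambda>t. cdf M (min s t))"
    proof
      fix t
      have "(\<lambda>y. indicator {..s} y * indicator {..t} y :: real) = indicator {..min s t}" by (auto simp: indicator_def)
      then show "(\<integral>y. indicator {..s} y * indicator {..t} y \<partial>M) = cdf M (min s t)" by (simp add: cdf_def)
    qed
    finally show ?thesis unfolding q_def by (simp add: mult.commute)
  qed
  have "(\<integral>y. (\<integral>s. indicator {y..} s * a s \<partial>lborel) * q y \<partial>M) = (\<integral>y. q y * (\<integral>s. indicator {y..} s * a s \<partial>lborel) \<partial>M)"
    by (simp add: mult.commute)
  also have "\<dots> = (\<integral>s. a s * (\<integral>y. q y * indicator {..s} y \<partial>M) \<partial>lborel)"
    by (rule fubini_jump[OF M a _ B]) measurable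
  finally show ?thesis unfolding inner by (simp add: mult.assoc q_def)
qed

section \<open>Mean and covariance of centered jumps\<close>

context weight_fun
begin

lemma sw_fn_integrable: "integrable lborel (\<lambda>t. sw t * fn f t)"
  by (rule sq_int_mult[OF sq_int_sw_1 fn_sq_int])

lemma jump_inner: "jump y \<bullet> f = (\<integral>t. indicator {y..} t * (sw t * fn f t) \<partial>lborel)"
  unfolding jump_def to_lsq_inner[OF jump_sq_int] by (simp add: mult.assoc)

lemma profile_inner:
  assumes "F \<in> borel_measurable borel" "\<And>t. \<bar>F t\<bar> \<le> 1"
  shows "profile F \<bullet> f = (\<integral>t. (sw t * fn f t) * F t \<partial>lborel)"
  unfolding profile_def to_lsq_inner[OF sq_int_sw[OF assms]] by (simp add: mult_ac)

lemma jump_mean: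
  assumes "real_distribution M" "cdf M \<in> borel_measurable borel"
  shows "(\<integral>y. jump y \<bullet> f \<partial>M) = profile (cdf M) \<bullet> f"
proof -
  interpret M: real_distribution M by fact
  have "\<bar>cdf M t\<bar> \<le> 1" for t using M.cdf_nonneg[of t] M.cdf_bounded_prob[of t] by simp
  then show ?thesis
    unfolding jump_inner using fubini_jump_simple[OF assms(1) sw_fn_integrable, of f] profile_inner[OF assms(2), of f] by simp
qed

text \<open>The covariance of a Brownian bridge composed with \<open>F\<close>, as a bilinear form.
  The factor \<open>sw s * fn f s\<close> is f(s) w(s) for the function that \<open>f\<close>
  represents under the isometry.\<close>

definition bridge :: "(real \<Rightarrow> real) \<Rightarrow> lsq \<Rightarrow> lsq \<Rightarrow> real" where
  "bridge F f g = (\<integral>s. \<integral>t. (sw s * fn f s) * (sw t * fn g t) * (F (min s t) - F s * F t) \<partial>lborel \<partial>lborel)"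

lemma jump_cov:
  assumes M: "real_distribution M" and F [measurable]: "cdf M \<in> borel_measurable borel"
  shows "(\<integral>y. ((jump y - profile (cdf M)) \<bullet> f) * ((jump y - profile (cdf M)) \<bullet> g) \<partial>M) = bridge (cdf M) f g"
proof -
  interpret M: real_distribution M by fact
  let ?F = "cdf M" and ?a = "\<lambda>t. sw t * fn f t" and ?b = "\<lambda>t. sw t * fn g t"
  have F1: "\<bar>?F t\<bar> \<le> 1" for t using M.cdf_nonneg[of t] M.cdf_bounded_prob[of t] by simp
  have a: "integrable lborel ?a" "integrable lborel ?b" by (rule sw_fn_integrable)+
  have b1: "\<bar>jump y \<bullet> h\<bar> \<le> norm h" for y h
    using Cauchy_Schwarz_ineq2[of "jump y" h] mult_right_mono[OF jump_norm[of y], of "norm h"] by simp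
  have m: "(\<lambda>y. jump y \<bullet> h) \<in> borel_measurable M" for h
    unfolding measurable_cong_sets[OF M.events_eq_borel refl] by (intro borel_measurable_continuous_onI continuous_intros jump_cont)
  have i1: "integrable M (\<lambda>y. jump y \<bullet> h)" for h
    by (rule M.integrable_const_bound[of _ "norm h"]) (use b1 m in auto)
  have i2: "integrable M (\<lambda>y. (jump y \<bullet> f) * (jump y \<bullet> g))"
  proof (rule M.integrable_const_bound[of _ "norm f * norm g"])
    show "AE y in M. norm ((jump y \<bullet> f) * (jump y \<bullet> g)) \<le> norm f * norm g"
      using mult_mono[OF b1 b1] by (intro AE_I2) (simp add: abs_mult)
  qed (intro borel_measurable_times m)
  define p q where "p = profile ?F \<bullet> f" and "q = profile ?F \<bullet> g"
  have "(\<integral>y. ((jump y - profile ?F) \<bullet> f) * ((jump y - profile ?F) \<bullet> g) \<partial>M)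
      = (\<integral>y. (jump y \<bullet> f) * (jump y \<bullet> g) - (jump y \<bullet> f) * q - p * (jump y \<bullet> g) + p * q \<partial>M)"
    unfolding p_def q_def by (intro Bochner_Integration.integral_cong refl) (simp add: inner_diff_left algebra_simps)
  also have "\<dots> = (\<integral>y. (jump y \<bullet> f) * (jump y \<bullet> g) \<partial>M) - p * q"
    using i1 i2 M.prob_space jump_mean[OF M F] by (simp add: p_def q_def)
  also have "(\<integral>y. (jump y \<bullet> f) * (jump y \<bullet> g) \<partial>M) = (\<integral>s. \<integral>t. ?a s * ?b t * ?F (min s t) \<partial>lborel \<partial>lborel)"
    unfolding jump_inner by (rule fubini_jump_mult[OF M a])
  also have "p * q = (\<integral>s. \<integral>t. ?a s * ?b t * (?F s * ?F t) \<partial>lborel \<partial>lborel)"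
  proof -
    have "p * q = (\<integral>s. (?a s * ?F s) * (\<integral>t. ?b t * ?F t \<partial>lborel) \<partial>lborel)"
      unfolding p_def q_def profile_inner[OF F F1] by simp
    also have "\<dots> = (\<integral>s. \<integral>t. (?a s * ?F s) * (?b t * ?F t) \<partial>lborel \<partial>lborel)"
      by (simp only: integral_mult_right_zero)
    finally show ?thesis by (simp only: mult_ac)
  qed
  also have "(\<integral>s. \<integral>t. ?a s * ?b t * ?F (min s t) \<partial>lborel \<partial>lborel) - (\<integral>s. \<integral>t. ?a s * ?b t * (?F s * ?F t) \<partial>lborel \<partial>lborel)
      = bridge ?F f g"
  proof -
    have in1: "integrable lborel (\<lambda>t. ?a s * ?b t * k t)" if [measurable]: "k \<in> borel_measurable borel" and k: "\<And>t. \<bar>k t\<bar> \<le> 1" for s k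
    proof (rule Bochner_Integration.integrable_bound[of _ "\<lambda>t. ?a s * ?b t"])
      show "AE t in lborel. norm (?a s * ?b t * k t) \<le> norm (?a s * ?b t)"
        using k by (intro AE_I2) (simp add: abs_mult mult_left_le)
    qed (use a in auto)
    \<comment> \<open>The kernel \<open>k\<close> is bounded by 1, so the inner integral is
      dominated by a multiple of \<open>?a s\<close>. This justifies splitting the outer integral of
      the difference.\<close>
    have out: "integrable lborel (\<lambda>s. \<integral>t. ?a s * ?b t * k s t \<partial>lborel)"
      if [measurable]: "case_prod k \<in> borel_measurable (borel \<Otimes>\<^sub>M borel)" and k: "\<And>s t. \<bar>k s t\<bar> \<le> 1" for k
    proof (rule Bochner_Integration.integrable_bound[of _ "\<lambda>s. ?a s * (\<integral>t. \<bar>?b t\<bar> \<partial>lborel)"])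
      show "integrable lborel (\<lambda>s. ?a s * (\<integral>t. \<bar>?b t\<bar> \<partial>lborel))" using a by simp
      show "(\<lambda>s. \<integral>t. ?a s * ?b t * k s t \<partial>lborel) \<in> borel_measurable lborel" by measurable
      show "AE s in lborel. norm (\<integral>t. ?a s * ?b t * k s t \<partial>lborel) \<le> norm (?a s * (\<integral>t. \<bar>?b t\<bar> \<partial>lborel))"
      proof (rule AE_I2)
        fix s
        have "k s \<in> borel_measurable borel" by measurable
        have "\<bar>\<integral>t. ?a s * ?b t * k s t \<partial>lborel\<bar> \<le> (\<integral>t. \<bar>?a s * ?b t * k s t\<bar> \<partial>lborel)" by (rule integral_abs_bound)
        also have "\<dots> \<le> (\<integral>t. \<bar>?a s\<bar> * \<bar>?b t\<bar> \<partial>lborel)"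
        proof (rule integral_mono)
          show "integrable lborel (\<lambda>t. \<bar>?a s * ?b t * k s t\<bar>)" by (intro integrable_abs in1 k) measurable
          show "integrable lborel (\<lambda>t. \<bar>?a s\<bar> * \<bar>?b t\<bar>)" using a by (intro integrable_mult_right integrable_abs)
          show "\<bar>?a s * ?b t * k s t\<bar> \<le> \<bar>?a s\<bar> * \<bar>?b t\<bar>" for t
            using k[of s t] by (simp add: abs_mult mult_left_le)
        qed
        finally show "norm (\<integral>t. ?a s * ?b t * k s t \<partial>lborel) \<le> norm (?a s * (\<integral>t. \<bar>?b t\<bar> \<partial>lborel))"
          by (simp add: abs_mult)
      qed
    qed
    have k2: "\<bar>?F s * ?F t\<bar> \<le> 1" for s t using mult_mono[OF F1[of s] F1[of t]] by (simp add: abs_mult)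
    have "bridge ?F f g = (\<integral>s. (\<integral>t. ?a s * ?b t * ?F (min s t) \<partial>lborel) - (\<integral>t. ?a s * ?b t * (?F s * ?F t) \<partial>lborel) \<partial>lborel)"
      unfolding bridge_def
    proof (intro Bochner_Integration.integral_cong refl)
      fix s
      have "(\<integral>t. ?a s * ?b t * (?F (min s t) - ?F s * ?F t) \<partial>lborel) = (\<integral>t. ?a s * ?b t * ?F (min s t) - ?a s * ?b t * (?F s * ?F t) \<partial>lborel)"
        by (simp add: right_diff_distrib)
      also have "\<dots> = (\<integral>t. ?a s * ?b t * ?F (min s t) \<partial>lborel) - (\<integral>t. ?a s * ?b t * (?F s * ?F t) \<partial>lborel)"
        by (intro Bochner_Integration.integral_diff in1 F1 k2) measurable
      finally show "(\<integral>t. ?a s * ?b t * (?F (min s t) - ?F s * ?F t) \<partial>lborel) = \<dots>" .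
    qed
    also have "\<dots> = (\<integral>s. \<integral>t. ?a s * ?b t * ?F (min s t) \<partial>lborel \<partial>lborel) - (\<integral>s. \<integral>t. ?a s * ?b t * (?F s * ?F t) \<partial>lborel \<partial>lborel)"
      by (intro Bochner_Integration.integral_diff out F1 k2) measurable
    finally show ?thesis by simp
  qed
  finally show ?thesis .
qed

text \<open>Dominated convergence, first in the inner and then in the outer integral; the kernels
  are bounded by 2 throughout.\<close>

lemma bridge_converges:
  assumes F: "\<And>N. F N \<in> borel_measurable borel" "\<And>N t. \<bar>F N t\<bar> \<le> 1" and G: "G \<in> borel_measurable borel"
    and lim: "\<And>t. (\<lambda>N. F N t) \<longlonglongrightarrow> G t"
  shows "(\<lambda>N. bridge (F N) f g) \<longlonglongrightarrow> bridge G f g"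
proof -
  let ?a = "\<lambda>t. sw t * fn f t" and ?b = "\<lambda>t. sw t * fn g t"
  have [measurable]: "F N \<in> borel_measurable borel" "G \<in> borel_measurable borel" for N by (rule F G)+
  have a: "integrable lborel ?a" "integrable lborel ?b" by (rule sw_fn_integrable)+
  have k: "\<bar>F N (min s t) - F N s * F N t\<bar> \<le> 2" for N s t
    using F(2)[of N "min s t"] mult_mono[OF F(2)[of N s] F(2)[of N t]]
    abs_triangle_ineq4[of "F N (min s t)" "F N s * F N t"] by (simp add: abs_mult)
  have inner: "norm (?a s * ?b t * (F N (min s t) - F N s * F N t)) \<le> \<bar>?a s\<bar> * (2 * \<bar>?b t\<bar>)" for N s t
    using mult_left_mono[OF k, of "\<bar>?a s\<bar> * \<bar>?b t\<bar>" N s t] by (simp add: abs_mult mult_ac)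
  have ib: "integrable lborel (\<lambda>t. \<bar>?a s\<bar> * (2 * \<bar>?b t\<bar>))" for s
    using a by (intro integrable_mult_right integrable_abs)
  show ?thesis unfolding bridge_def
  proof (rule integral_dominated_convergence[where w="\<lambda>s. \<bar>?a s\<bar> * (\<integral>t. 2 * \<bar>?b t\<bar> \<partial>lborel)"])
    show "integrable lborel (\<lambda>s. \<bar>?a s\<bar> * (\<integral>t. 2 * \<bar>?b t\<bar> \<partial>lborel))"
      using a by (intro integrable_mult_left integrable_abs)
    show "AE s in lborel. (\<lambda>N. \<integral>t. ?a s * ?b t * (F N (min s t) - F N s * F N t) \<partial>lborel) \<longlonglongrightarrow> (\<integral>t. ?a s * ?b t * (G (min s t) - G s * G t) \<partial>lborel)"
    proof (rule AE_I2)
      fix s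
      show "(\<lambda>N. \<integral>t. ?a s * ?b t * (F N (min s t) - F N s * F N t) \<partial>lborel) \<longlonglongrightarrow> (\<integral>t. ?a s * ?b t * (G (min s t) - G s * G t) \<partial>lborel)"
      proof (rule integral_dominated_convergence[where w="\<lambda>t. \<bar>?a s\<bar> * (2 * \<bar>?b t\<bar>)"])
        show "integrable lborel (\<lambda>t. \<bar>?a s\<bar> * (2 * \<bar>?b t\<bar>))" by (rule ib)
        show "AE t in lborel. norm (?a s * ?b t * (F N (min s t) - F N s * F N t)) \<le> \<bar>?a s\<bar> * (2 * \<bar>?b t\<bar>)" for N
          by (intro AE_I2 inner)
        show "AE t in lborel. (\<lambda>N. ?a s * ?b t * (F N (min s t) - F N s * F N t)) \<longlonglongrightarrow> ?a s * ?b t * (G (min s t) - G s * G t)"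
          by (intro AE_I2 tendsto_intros lim)
      qed measurable
    qed
    show "AE s in lborel. norm (\<integral>t. ?a s * ?b t * (F N (min s t) - F N s * F N t) \<partial>lborel) \<le> \<bar>?a s\<bar> * (\<integral>t. 2 * \<bar>?b t\<bar> \<partial>lborel)" for N
    proof (rule AE_I2)
      fix s
      have "norm (\<integral>t. ?a s * ?b t * (F N (min s t) - F N s * F N t) \<partial>lborel) \<le> (\<integral>t. \<bar>?a s\<bar> * (2 * \<bar>?b t\<bar>) \<partial>lborel)"
      proof (rule Bochner_Integration.integral_norm_bound_integral)
        show "integrable lborel (\<lambda>t. ?a s * ?b t * (F N (min s t) - F N s * F N t))"
          by (rule Bochner_Integration.integrable_bound[OF ib[of s]]) (use inner in auto)
      qed (rule ib, rule inner)
      also have "\<dots> = \<bar>?a s\<bar> * (\<integral>t. 2 * \<bar>?b t\<bar> \<partial>lborel)" by (rule integral_mult_right_zero)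
      finally show "norm (\<integral>t. ?a s * ?b t * (F N (min s t) - F N s * F N t) \<partial>lborel) \<le> \<bar>?a s\<bar> * (\<integral>t. 2 * \<bar>?b t\<bar> \<partial>lborel)" .
    qed
  qed measurable
qed

text \<open>\<open>rep_l0 (embed f) s * w s\<close> equals \<open>sw s * fn f s\<close> almost
  everywhere. As representatives agree only up to null sets, the substitution is made in each
  variable separately.\<close>

lemma bridge_embed:
  assumes [measurable]: "G \<in> borel_measurable borel"
  shows "(\<integral>s. \<integral>t. rep_l0 (embed f) s * rep_l0 (embed g) t * (G (min s t) - G s * G t) * w s * w t \<partial>lborel \<partial>lborel) = bridge G f g"
proof -
  have e: "AE t in lborel. rep_l0 (embed h) t * w t = sw t * fn h t" for h
    using rep_embed[of h]
  proof eventually_elim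
    case (elim t)
    then show ?case using sw(1)[of t] by (simp add: sw(2)[of t, symmetric])
  qed
  have inner: "(\<integral>t. rep_l0 (embed f) s * rep_l0 (embed g) t * (G (min s t) - G s * G t) * w s * w t \<partial>lborel)
      = (\<integral>t. (rep_l0 (embed f) s * w s) * (sw t * fn g t) * (G (min s t) - G s * G t) \<partial>lborel)" for s
  proof (rule integral_cong_AE)
    show "AE t in lborel. rep_l0 (embed f) s * rep_l0 (embed g) t * (G (min s t) - G s * G t) * w s * w t
       = (rep_l0 (embed f) s * w s) * (sw t * fn g t) * (G (min s t) - G s * G t)"
      using e[of g]
    proof eventually_elim
      case (elim t)
      have "rep_l0 (embed f) s * rep_l0 (embed g) t * (G (min s t) - G s * G t) * w s * w t
        = (rep_l0 (embed f) s * w s) * (rep_l0 (embed g) t * w t) * (G (min s t) - G s * G t)" by (simp only: mult_ac)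
      then show ?case by (simp only: elim)
    qed
  qed measurable
  show ?thesis unfolding inner bridge_def
  proof (rule integral_cong_AE)
    show "AE s in lborel. (\<integral>t. (rep_l0 (embed f) s * w s) * (sw t * fn g t) * (G (min s t) - G s * G t) \<partial>lborel)
      = (\<integral>t. (sw s * fn f s) * (sw t * fn g t) * (G (min s t) - G s * G t) \<partial>lborel)"
      using e[of f] by eventually_elim simp
  qed measurable
qed

end

section \<open>Time profiles and change points\<close>

text \<open>The share of the \<open>n\<close>-th summand in the polygonal partial sum at time
  \<open>s\<close>: 1 if the summand is complete, the fractional part of \<open>s\<close> for the
  one in progress, 0 for later ones.\<close>

definition unit_clamp :: "nat \<Rightarrow> real \<Rightarrow> real" where
  "unit_clamp n s = max 0 (min 1 (s - (real n - 1)))"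

lemma unit_clamp_bounds: "0 \<le> unit_clamp n s" "unit_clamp n s \<le> 1"
  by (auto simp: unit_clamp_def)

lemma unit_clamp_mono: "s \<le> t \<Longrightarrow> unit_clamp n s \<le> unit_clamp n t"
  by (auto simp: unit_clamp_def)

lemma unit_clamp_0: "1 \<le> n \<Longrightarrow> unit_clamp n 0 = 0"
  by (auto simp: unit_clamp_def)

lemma unit_clamp_sum: "0 \<le> s \<Longrightarrow> (\<Sum>n=1..c. unit_clamp n s) = min s (real c)"
proof (induction c)
  case (Suc c)
  have "(\<Sum>n=1..Suc c. unit_clamp n s) = min s (real c) + max 0 (min 1 (s - real c))"
    using Suc by (simp add: unit_clamp_def)
  then show ?case by (auto simp: min_def max_def simp del: sum.cl_ivl_Suc)
qed auto

text \<open>For s \<le> t the product differs from \<open>unit_clamp n s\<close> only where the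
  latter lies strictly between 0 and 1, that is, for at most one index. The telescoping sum of
  neighbouring clamps turns this into the bound 1.\<close>

lemma unit_clamp_product_sum:
  assumes "0 \<le> s" "0 \<le> t"
  shows "\<bar>(\<Sum>n=1..c. unit_clamp n s * unit_clamp n t) - min (min s t) (real c)\<bar> \<le> 1"
proof -
  have main: "\<bar>(\<Sum>n=1..c. unit_clamp n s * unit_clamp n t) - min s (real c)\<bar> \<le> 1" if s: "0 \<le> s" and st: "s \<le> t" for s t
  proof -
    have eq: "(\<Sum>n=1..c. unit_clamp n s * (1 - unit_clamp n t)) = min s (real c) - (\<Sum>n=1..c. unit_clamp n s * unit_clamp n t)"
      unfolding unit_clamp_sum[OF s, of c, symmetric] by (simp add: sum_subtractf right_diff_distrib)
    have "0 \<le> (\<Sum>n=1..c. unit_clamp n s * (1 - unit_clamp n t))"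
      by (intro sum_nonneg mult_nonneg_nonneg) (simp_all add: unit_clamp_bounds)
    moreover have "(\<Sum>n=1..c. unit_clamp n s * (1 - unit_clamp n t)) \<le> (\<Sum>n=1..c. unit_clamp n s - unit_clamp (Suc n) s)"
    proof (rule sum_mono)
      fix n
      show "unit_clamp n s * (1 - unit_clamp n t) \<le> unit_clamp n s - unit_clamp (Suc n) s"
      proof (cases "unit_clamp (Suc n) s = 0")
        case True
        then show ?thesis using unit_clamp_bounds[of n s] unit_clamp_bounds[of n t] by (simp add: mult_left_le)
      next
        case False
        then have "unit_clamp n s = 1" "unit_clamp n t = 1" using st by (auto simp: unit_clamp_def split: if_splits)
        then show ?thesis using unit_clamp_bounds[of "Suc n" s] by simp
      qed
    qed
    moreover have "(\<Sum>n=1..c. unit_clamp n s - unit_clamp (Suc n) s) = unit_clamp 1 s - unit_clamp (Suc c) s"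
      by (induction c) auto
    ultimately show ?thesis using unit_clamp_bounds[of 1 s] unit_clamp_bounds[of "Suc c" s] unfolding eq by linarith
  qed
  show ?thesis
  proof (cases "s \<le> t")
    case True
    then show ?thesis using main[OF assms(1) True] by simp
  next
    case False
    then show ?thesis using main[OF assms(2), of s] by (simp add: mult.commute min.absorb2)
  qed
qed

lemma partial_sum_process_unit_clamp:
  assumes N: "0 < N" and x: "x \<in> {0..1}"
  shows "partial_sum_process N e x = (\<Sum>n=1..N. (real N powr (-1/2) * unit_clamp n (real N * x)) *\<^sub>R e n)"
proof -
  define s where "s = real N * x"
  define j where "j = nat \<lfloor>s\<rfloor>"
  have s: "0 \<le> s" "s \<le> real N" using x by (auto simp: s_def mult_left_le)
  have j: "real j \<le> s" "s < real j + 1" "of_int \<lfloor>s\<rfloor> = real j" using s by (auto simp: j_def of_nat_nat)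
  have jN: "j \<le> N" using j s by linarith
  have key: "(\<Sum>n=1..N. unit_clamp n s *\<^sub>R e n) = (\<Sum>n=1..j. e n) + (s - real j) *\<^sub>R e (j + 1)"
  proof -
    have low: "(\<Sum>n=1..j. unit_clamp n s *\<^sub>R e n) = (\<Sum>n=1..j. e n)"
    proof (rule sum.cong)
      fix n assume "n \<in> {1..j}"
      then have "real n \<le> real j" by simp
      then have "unit_clamp n s = 1" using j by (simp add: unit_clamp_def)
      then show "unit_clamp n s *\<^sub>R e n = e n" by simp
    qed simp
    show ?thesis
    proof (cases "j = N")
      case True
      \<comment> \<open>At the right end the summand of index N + 1 carries the coefficient 0, so
        its value does not matter.\<close>
      then have "s - real j = 0" using j s by linarith
      then show ?thesis using low True by simp
    next
      case False
      have "(\<Sum>n=1..N. unit_clamp n s *\<^sub>R e n) = (\<Sum>n=1..Suc j. unit_clamp n s *\<^sub>R e n)"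
      proof (rule sum.mono_neutral_right)
        show "\<forall>n\<in>{1..N} - {1..Suc j}. unit_clamp n s *\<^sub>R e n = 0"
        proof
          fix n assume "n \<in> {1..N} - {1..Suc j}"
          then have "real (Suc (Suc j)) \<le> real n" unfolding of_nat_le_iff by auto
          then have "unit_clamp n s = 0" using j by (simp add: unit_clamp_def)
          then show "unit_clamp n s *\<^sub>R e n = 0" by simp
        qed
      qed (use False jN in auto)
      also have "\<dots> = (\<Sum>n=1..j. e n) + unit_clamp (Suc j) s *\<^sub>R e (Suc j)" using low by simp
      also have "unit_clamp (Suc j) s = s - real j" using j by (simp add: unit_clamp_def)
      finally show ?thesis by simp
    qed
  qed
  have "partial_sum_process N e x = (real N powr (-1/2)) *\<^sub>R ((\<Sum>n=1..j. e n) + (s - real j) *\<^sub>R e (j + 1))"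
    using x by (simp add: partial_sum_process_def s_def[symmetric] j_def[symmetric] j(3) mult.commute[of x] scaleR_add_right)
  also have "\<dots> = (\<Sum>n=1..N. (real N powr (-1/2) * unit_clamp n s) *\<^sub>R e n)"
    unfolding key[symmetric] by (simp add: scaleR_sum_right)
  finally show ?thesis by (simp only: s_def)
qed

lemma change_point_limit:
  assumes "0 \<le> \<theta> k"
  shows "(\<lambda>N. real (change_point \<theta> N k) / real N) \<longlonglongrightarrow> \<theta> k"
proof (rule LIM_zero_cancel, rule Lim_null_comparison)
  show "(\<lambda>N. 1 / real N) \<longlonglongrightarrow> 0" by (rule lim_1_over_n)
  show "\<forall>\<^sub>F N in sequentially. norm (real (change_point \<theta> N k) / real N - \<theta> k) \<le> 1 / real N"
    using eventually_gt_at_top[of "0::nat"]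
  proof eventually_elim
    case (elim N)
    have "\<bar>real (change_point \<theta> N k) - real N * \<theta> k\<bar> \<le> 1"
      using assms by (simp add: change_point_def of_nat_nat) linarith
    then have "\<bar>real (change_point \<theta> N k) - real N * \<theta> k\<bar> / real N \<le> 1 / real N" by (rule divide_right_mono) simp
    also have "\<bar>real (change_point \<theta> N k) - real N * \<theta> k\<bar> / real N = \<bar>(real (change_point \<theta> N k) - real N * \<theta> k) / real N\<bar>"
      by simp
    also have "(real (change_point \<theta> N k) - real N * \<theta> k) / real N = real (change_point \<theta> N k) / real N - \<theta> k"
      using elim by (simp add: diff_divide_distrib)
    finally show ?case by simp
  qed
qed

text \<open>Within a regime the factor \<open>v\<close> is constant, so only sums of clamp products
  up to the change points matter; these are known up to an error of 1, which vanishes after division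
  by \<open>N\<close>. The increments of \<open>min (min x y) (\<theta> k)\<close> in
  \<open>k\<close> are the times spent in each regime before \<open>min x y\<close>.\<close>

lemma unit_clamp_covariance_limit:
  fixes \<theta> :: "nat \<Rightarrow> real" and v r :: "nat \<Rightarrow> nat \<Rightarrow> real"
  assumes \<theta>0: "\<theta> 0 = 0" and \<theta>1: "\<theta> (K + 1) = 1" and \<theta>: "\<And>k. k \<le> K \<Longrightarrow> \<theta> k < \<theta> (k + 1)"
    and v: "\<And>N k n. k \<in> {1..K+1} \<Longrightarrow> change_point \<theta> N (k - 1) < n \<Longrightarrow> n \<le> change_point \<theta> N k \<Longrightarrow> v N n = r N k"
    and r: "\<And>k. k \<in> {1..K+1} \<Longrightarrow> (\<lambda>N. r N k) \<longlonglongrightarrow> R k"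
    and xy: "0 \<le> x" "0 \<le> y"
  shows "(\<lambda>N. (1 / real N) * (\<Sum>n=1..N. unit_clamp n (real N * x) * unit_clamp n (real N * y) * v N n))
    \<longlonglongrightarrow> (\<Sum>k=1..K+1. (min (min x y) (\<theta> k) - min (min x y) (\<theta> (k - 1))) * R k)"
proof -
  have \<theta>_nonneg: "0 \<le> \<theta> k" if "k \<le> K + 1" for k
    using that
  proof (induction k)
    case (Suc k)
    then show ?case using \<theta>[of k] by simp
  qed (simp add: \<theta>0)
  define c where "c N k = change_point \<theta> N k" for N k
  define S where "S N m = (\<Sum>n=1..m. unit_clamp n (real N * x) * unit_clamp n (real N * y))" for N m
  have c0: "c N 0 = 0" and c1: "c N (K + 1) = N" for N by (simp_all add: c_def change_point_def \<theta>0 \<theta>1[simplified])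
  have c_mono: "c N k \<le> c N (Suc k)" if "k \<le> K" for N k
    unfolding c_def change_point_def using \<theta>[OF that] by (intro nat_mono floor_mono mult_left_mono) auto
  have split: "(\<Sum>n=1..c N j. unit_clamp n (real N * x) * unit_clamp n (real N * y) * v N n)
      = (\<Sum>k=1..j. (S N (c N k) - S N (c N (k - 1))) * r N k)" if "j \<le> K + 1" for N j
    using that
  proof (induction j)
    case (Suc j)
    have le: "c N j \<le> c N (Suc j)" using Suc by (intro c_mono) simp
    have I: "{1..c N (Suc j)} = {1..c N j} \<union> {c N j<..c N (Suc j)}" "{1..c N j} \<inter> {c N j<..c N (Suc j)} = {}"
      using le by auto
    have union: "(\<Sum>n=1..c N (Suc j). h n) = (\<Sum>n=1..c N j. h n) + (\<Sum>n\<in>{c N j<..c N (Suc j)}. h n)" for h :: "nat \<Rightarrow> real"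
      unfolding I(1) by (rule sum.union_disjoint) (use I(2) in auto)
    have "(\<Sum>n\<in>{c N j<..c N (Suc j)}. unit_clamp n (real N * x) * unit_clamp n (real N * y) * v N n)
        = (\<Sum>n\<in>{c N j<..c N (Suc j)}. unit_clamp n (real N * x) * unit_clamp n (real N * y) * r N (Suc j))"
      using Suc.prems by (intro sum.cong refl) (simp add: v[of "Suc j"] c_def)
    also have "\<dots> = (S N (c N (Suc j)) - S N (c N j)) * r N (Suc j)"
      unfolding S_def union by (simp add: sum_distrib_right)
    finally show ?case unfolding union using Suc by simp
  qed (simp add: c0)
  have S_lim: "(\<lambda>N. S N (c N k) / real N) \<longlonglongrightarrow> min (min x y) (\<theta> k)" if k: "k \<le> K + 1" for k
  proof -
    have "(\<lambda>N. S N (c N k) / real N - min (min x y) (real (c N k) / real N)) \<longlonglongrightarrow> 0"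
    proof (rule Lim_null_comparison)
      show "(\<lambda>N. 1 / real N) \<longlonglongrightarrow> 0" by (rule lim_1_over_n)
      show "\<forall>\<^sub>F N in sequentially. norm (S N (c N k) / real N - min (min x y) (real (c N k) / real N)) \<le> 1 / real N"
        using eventually_gt_at_top[of "0::nat"]
      proof eventually_elim
        case (elim N)
        have "min (min (real N * x) (real N * y)) (real (c N k)) = real N * min (min x y) (real (c N k) / real N)"
          using elim by (auto simp: min_def field_simps)
        then have "\<bar>S N (c N k) - real N * min (min x y) (real (c N k) / real N)\<bar> \<le> 1"
          using unit_clamp_product_sum[of "real N * x" "real N * y" "c N k"] xy by (simp add: S_def)
        then have "\<bar>S N (c N k) - real N * min (min x y) (real (c N k) / real N)\<bar> / real N \<le> 1 / real N"
          by (rule divide_right_mono) simp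
        also have "\<bar>S N (c N k) - real N * min (min x y) (real (c N k) / real N)\<bar> / real N
          = \<bar>(S N (c N k) - real N * min (min x y) (real (c N k) / real N)) / real N\<bar>" by simp
        also have "(S N (c N k) - real N * min (min x y) (real (c N k) / real N)) / real N
          = S N (c N k) / real N - min (min x y) (real (c N k) / real N)" using elim by (simp add: diff_divide_distrib)
        finally show ?case by simp
      qed
    qed
    moreover have "(\<lambda>N. min (min x y) (real (c N k) / real N)) \<longlonglongrightarrow> min (min x y) (\<theta> k)"
      unfolding c_def by (intro tendsto_min tendsto_const change_point_limit \<theta>_nonneg k)
    ultimately show ?thesis using tendsto_add by fastforce
  qed
  have "(\<lambda>N. \<Sum>k=1..K+1. (S N (c N k) / real N - S N (c N (k - 1)) / real N) * r N k)
      \<longlonglongrightarrow> (\<Sum>k=1..K+1. (min (min x y) (\<theta> k) - min (min x y) (\<theta> (k - 1))) * R k)"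
    by (intro tendsto_sum tendsto_mult tendsto_diff S_lim r) auto
  moreover have "(\<Sum>k=1..K+1. (S N (c N k) / real N - S N (c N (k - 1)) / real N) * r N k)
     = (1 / real N) * (\<Sum>n=1..N. unit_clamp n (real N * x) * unit_clamp n (real N * y) * v N n)" for N
    using split[of "K + 1" N] unfolding c1
    by (simp only: order_refl sum_distrib_left) (intro sum.cong refl, simp only: diff_divide_distrib[symmetric], simp)
  ultimately show ?thesis by simp
qed

lemma integral_time_cell:
  fixes a b m :: real
  assumes "0 \<le> m" "0 \<le> a" "a \<le> b"
  shows "(\<integral>z. indicator {0..m} z * indicator {a<..b} z \<partial>lborel) = min m b - min m a"
proof (cases "a \<le> m")
  case True
  have "(\<lambda>z. indicator {0..m} z * indicator {a<..b} z) = (indicator {a<..min m b} :: real \<Rightarrow> real)"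
    using assms by (auto simp: indicator_def)
  then show ?thesis using True assms by simp
next
  case False
  then have "(\<lambda>z. indicator {0..m} z * indicator {a<..b} z) = (\<lambda>_. 0 :: real)"
    using assms by (auto simp: indicator_def)
  then show ?thesis using False assms by simp
qed

text \<open>The metric space axioms ask for symmetry of the distance at all points, also for
  functions with values outside the Hilbert space, where the isometry is of no help.\<close>

lemma L2_inner_minus: "w \<in> borel_measurable borel \<Longrightarrow> L2_inner w (- f) (- f) = L2_inner w f f"
proof -
  assume [measurable]: "w \<in> borel_measurable borel"
  have "AE x in lborel. rep_l0 (- f) x = - rep_l0 f x" using rep_l0_scaleR[of "-1" f] by simp
  then show ?thesis unfolding L2_inner_def
    by (intro integral_cong_AE) (measurable, auto elim: eventually_mono)
qed

section \<open>The covariance and the empirical errors in terms of the Hilbert space\<close>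

context weight_fun
begin

lemma embed_diff: "embed (a - b) = embed a - embed b"
  by (rule linear_diff[OF embed_linear])

lemma embed_sum: "embed (\<Sum>i\<in>I. f i) = (\<Sum>i\<in>I. embed (f i))"
  by (rule linear_sum[OF embed_linear])

text \<open>The regimes are disjoint, so at a given time the sum in \<open>c_eps\<close> has at most
  one active term, and the double integral is the bridge form of that regime. Integration over time
  leaves the lengths of the regimes up to \<open>min x y\<close>.\<close>

lemma C_eps_embed:
  assumes \<theta>0: "\<theta> 0 = 0" and \<theta>: "\<And>k. k \<le> K \<Longrightarrow> \<theta> k < \<theta> (k + 1)"
    and G: "\<And>k. k \<in> {1..K+1} \<Longrightarrow> G k \<in> borel_measurable borel" and xy: "0 \<le> x" "0 \<le> y"
  shows "C_eps w K \<theta> G x y (embed f) (embed g)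
    = (\<Sum>k=1..K+1. (min (min x y) (\<theta> k) - min (min x y) (\<theta> (k - 1))) * bridge (G k) f g)"
proof -
  have mono: "\<theta> i \<le> \<theta> j" if "i \<le> j" "j \<le> K + 1" for i j
    using that(1) that(2)
  proof (induction j rule: dec_induct)
    case (step j)
    then show ?case using \<theta>[of j] by simp
  qed simp
  have uniq: "j = k" if "j \<in> {1..K+1}" "k \<in> {1..K+1}" "\<theta> (j - 1) < z" "z \<le> \<theta> j" "\<theta> (k - 1) < z" "z \<le> \<theta> k" for j k z
  proof (rule ccontr)
    assume "j \<noteq> k"
    then have "j \<le> k - 1 \<or> k \<le> j - 1" by arith
    then show False
    proof
      assume "j \<le> k - 1"
      then have "\<theta> j \<le> \<theta> (k - 1)" by (rule mono) (use that(2) in auto)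
      then show False using that by linarith
    next
      assume "k \<le> j - 1"
      then have "\<theta> k \<le> \<theta> (j - 1)" by (rule mono) (use that(1) in auto)
      then show False using that by linarith
    qed
  qed
  have inner: "(\<integral>s. \<integral>t. rep_l0 (embed f) s * rep_l0 (embed g) t * c_eps K \<theta> G s t z * w s * w t \<partial>lborel \<partial>lborel)
      = (\<Sum>k=1..K+1. indicator {\<theta> (k - 1)<..\<theta> k} z * bridge (G k) f g)" for z
  proof (cases "\<exists>k\<in>{1..K+1}. \<theta> (k - 1) < z \<and> z \<le> \<theta> k")
    case True
    then obtain k where k: "k \<in> {1..K+1}" "\<theta> (k - 1) < z" "z \<le> \<theta> k" by auto
    have only: "(\<theta> (j - 1) < z \<and> z \<le> \<theta> j) \<longleftrightarrow> j = k" if "j \<in> {1..K+1}" for j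
      using uniq[OF that k(1) _ _ k(2,3)] k by auto
    have "c_eps K \<theta> G s t z = (\<Sum>j=1..K+1. if j = k then G j (min s t) - G j s * G j t else 0)" for s t
      unfolding c_eps_def by (intro sum.cong refl) (simp only: only)
    then have ce: "c_eps K \<theta> G s t z = G k (min s t) - G k s * G k t" for s t using k(1) by (simp add: sum.delta')
    have "(\<Sum>j=1..K+1. indicator {\<theta> (j - 1)<..\<theta> j} z * bridge (G j) f g) = (\<Sum>j=1..K+1. if j = k then bridge (G j) f g else 0)"
    proof (intro sum.cong refl)
      fix j assume j: "j \<in> {1..K+1}"
      show "indicator {\<theta> (j - 1)<..\<theta> j} z * bridge (G j) f g = (if j = k then bridge (G j) f g else 0)"
        unfolding only[OF j, symmetric] by (simp add: indicator_def)
    qed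
    also have "\<dots> = bridge (G k) f g" using k(1) by (simp add: sum.delta')
    finally show ?thesis unfolding ce bridge_embed[OF G[OF k(1)]] by simp
  next
    case False
    have ce: "c_eps K \<theta> G s t z = 0" for s t
      unfolding c_eps_def using False by (intro sum.neutral) auto
    have "(\<Sum>k=1..K+1. indicator {\<theta> (k - 1)<..\<theta> k} z * bridge (G k) f g) = 0"
      using False by (intro sum.neutral) (auto simp: indicator_def)
    then show ?thesis unfolding ce by simp
  qed
  have "C_eps w K \<theta> G x y (embed f) (embed g)
    = (\<integral>z. (\<Sum>k=1..K+1. indicator {0..min x y} z * indicator {\<theta> (k - 1)<..\<theta> k} z * bridge (G k) f g) \<partial>lborel)"
    unfolding C_eps_def set_lebesgue_integral_def inner by (simp only: real_scaleR_def sum_distrib_left mult.assoc)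
  also have "\<dots> = (\<Sum>k=1..K+1. \<integral>z. indicator {0..min x y} z * indicator {\<theta> (k - 1)<..\<theta> k} z * bridge (G k) f g \<partial>lborel)"
  proof (rule Bochner_Integration.integral_sum)
    fix k
    have "bounded {\<theta> (k - 1)<..\<theta> k}" by (rule bounded_subset[OF bounded_closed_interval[of "\<theta> (k - 1)" "\<theta> k"]]) auto
    then have "integrable lborel (indicator {\<theta> (k - 1)<..\<theta> k} :: real \<Rightarrow> real)"
      by (intro integrable_real_indicator emeasure_bounded_finite) simp_all
    then have "integrable lborel (\<lambda>z. indicator {0..min x y} z *\<^sub>R (indicator {\<theta> (k - 1)<..\<theta> k} z :: real))"
      by (intro integrable_mult_indicator) simp_all
    then show "integrable lborel (\<lambda>z. indicator {0..min x y} z * indicator {\<theta> (k - 1)<..\<theta> k} z * bridge (G k) f g)" by simp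
  qed
  also have "\<dots> = (\<Sum>k=1..K+1. (min (min x y) (\<theta> k) - min (min x y) (\<theta> (k - 1))) * bridge (G k) f g)"
  proof (intro sum.cong refl)
    fix k assume k: "k \<in> {1..K+1}"
    have "(\<integral>z. indicator {0..min x y} z * indicator {\<theta> (k - 1)<..\<theta> k} z \<partial>lborel) = min (min x y) (\<theta> k) - min (min x y) (\<theta> (k - 1))"
      using mono[of 0 "k - 1"] mono[of "k - 1" k] k xy by (intro integral_time_cell) (auto simp: \<theta>0)
    then show "(\<integral>z. indicator {0..min x y} z * indicator {\<theta> (k - 1)<..\<theta> k} z * bridge (G k) f g \<partial>lborel)
       = (min (min x y) (\<theta> k) - min (min x y) (\<theta> (k - 1))) * bridge (G k) f g" by simp
  qed
  finally show ?thesis .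
qed

text \<open>Splits the error into its \<open>M\<close> centered observations, each with weight 1 /
  sqrt M, so that single observations can serve as the independent summands.\<close>

lemma empirical_error_embed:
  assumes M: "0 < M" and F [measurable]: "F \<in> borel_measurable borel" and F1: "\<And>t. \<bar>F t\<bar> \<le> 1"
  shows "empirical_error M y F = (1 / sqrt (real M)) *\<^sub>R (\<Sum>m=1..M. embed (jump (y m) - profile F))"
proof -
  have sum: "(\<Sum>m\<in>A. abs_l0 (h m)) = abs_l0 (\<lambda>t. \<Sum>m\<in>A. h m t)"
    if "finite A" "\<And>m. h m \<in> borel_measurable borel" for A :: "nat set" and h
    using that by (induction A) (auto simp: zero_l0_def abs_l0_add)
  have ind: "indicator {y..} t = (indicator {..t} y :: real)" for y t :: real by (simp add: indicator_def)
  have jp: "embed (jump (y m) - profile F) = abs_l0 (\<lambda>t. indicator {y m..} t - F t)" for m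
    unfolding embed_diff embed_jump embed_profile[OF F F1] by (rule abs_l0_diff) measurable
  have "(1 / sqrt (real M)) *\<^sub>R (\<Sum>m=1..M. embed (jump (y m) - profile F))
      = abs_l0 (\<lambda>t. 1 / sqrt (real M) * (\<Sum>m=1..M. indicator {y m..} t - F t))"
    unfolding jp by (subst sum, simp, measurable) (rule abs_l0_scaleR, measurable)
  also have "(\<lambda>t. 1 / sqrt (real M) * (\<Sum>m=1..M. indicator {y m..} t - F t)) = (\<lambda>t. sqrt (real M) * (empirical_cdf M y t - F t))"
  proof
    fix t
    have "sqrt (real M) * (empirical_cdf M y t - F t) = sqrt (real M) / real M * ((\<Sum>m=1..M. indicator {..t} (y m)) - real M * F t)"
      using M by (simp add: empirical_cdf_def right_diff_distrib diff_divide_distrib)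
    also have "sqrt (real M) / real M = 1 / sqrt (real M)" using M by (simp add: field_simps)
    finally show "1 / sqrt (real M) * (\<Sum>m=1..M. indicator {y m..} t - F t) = sqrt (real M) * (empirical_cdf M y t - F t)"
      by (simp only: ind sum_subtractf sum_constant card_atLeastAtMost) simp
  qed
  finally show ?thesis by (simp add: empirical_error_def)
qed

end

section \<open>The empirical process in the weighted Hoelder space\<close>

locale weighted_hoelder = weight_fun w + hoelder_weight \<rho> \<beta> C for w \<rho> :: "real \<Rightarrow> real" and \<beta> C :: real
begin

text \<open>Transport of paths along the isometry. It identifies the Hoelder space over the type
  \<open>lsq\<close> with the one over the carrier \<open>L2_space w\<close>, to which the results
  for the type are moved.\<close>

definition path :: "(real \<Rightarrow> lsq) \<Rightarrow> real \<Rightarrow> l0" where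
  "path z = (\<lambda>x\<in>{0..1}. embed (z x))"

abbreviation wspace :: "(real \<Rightarrow> l0) set" where
  "wspace \<equiv> hoelder_space (L2_space w) (L2_norm w) \<rho>"

abbreviation wdist :: "(real \<Rightarrow> l0) \<Rightarrow> (real \<Rightarrow> l0) \<Rightarrow> real" where
  "wdist \<equiv> hoelder_dist (L2_norm w) \<rho>"

lemma L2_norm_diff_embed: "a = embed c \<Longrightarrow> b = embed d \<Longrightarrow> L2_norm w (a - b) = norm (c - d)"
  by (simp add: embed_norm flip: embed_diff)

lemma hoelder_norm_embed:
  assumes "\<And>x. x \<in> {0..1} \<Longrightarrow> F x = embed (f x)"
  shows "hoelder_norm (L2_norm w) \<rho> F = hnorm f"
  unfolding hoelder_norm_def hnorm_def
proof (intro arg_cong2[where f="(+)"] SUP_cong refl)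
  show "ennreal (L2_norm w (F x)) = ennreal (norm (f x))" if "x \<in> {0..1}" for x
    using assms[OF that] by (simp add: embed_norm)
  fix p :: "real \<times> real" assume p: "p \<in> {(x, y). 0 \<le> x \<and> x < y \<and> y \<le> 1}"
  obtain x y where xy: "p = (x, y)" by (cases p)
  have "L2_norm w (F y - F x) = norm (f y - f x)"
    by (rule L2_norm_diff_embed) (use p xy in \<open>auto intro: assms\<close>)
  then show "(case p of (x, y) \<Rightarrow> ennreal (L2_norm w (F y - F x) / \<rho> (y - x)))
      = (case p of (x, y) \<Rightarrow> ennreal (norm (f y - f x) / \<rho> (y - x)))" by (simp add: xy)
qed

lemma hoelder_space_embed:
  assumes F: "F \<in> extensional {0..1}" and f: "f \<in> extensional {0..1}"
    and eq: "\<And>x. x \<in> {0..1} \<Longrightarrow> F x = embed (f x)"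
  shows "F \<in> wspace \<longleftrightarrow> f \<in> hspace"
proof -
  have d: "L2_norm w (F y - F x) = norm (f y - f x)" if "x \<in> {0..1}" "y \<in> {0..1}" for x y
    by (rule L2_norm_diff_embed) (use that in \<open>auto intro: eq\<close>)
  have 1: "F \<in> {0..1} \<rightarrow>\<^sub>E L2_space w" using F eq by (auto simp: PiE_iff embed_mem)
  have 2: "f \<in> {0..1} \<rightarrow>\<^sub>E UNIV" using f by (auto simp: PiE_iff)
  have 3: "((\<lambda>y. L2_norm w (F y - F x)) \<longlongrightarrow> 0) (at x within {0..1}) \<longleftrightarrow> ((\<lambda>y. norm (f y - f x)) \<longlongrightarrow> 0) (at x within {0..1})"
    if x: "x \<in> {0..1}" for x
    by (rule filterlim_cong[OF refl refl]) (use d[OF x] in \<open>auto simp: eventually_at_filter\<close>)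
  have 4: "(SUP (x, y)\<in>{(x, y). 0 \<le> x \<and> x < y \<and> y \<le> x + \<delta> \<and> x + \<delta> \<le> 1}. ennreal (L2_norm w (F y - F x) / \<rho> (y - x))) = hmod \<delta> f" for \<delta>
    unfolding hmod_def
  proof (intro SUP_cong refl)
    fix p :: "real \<times> real" assume p: "p \<in> {(x, y). 0 \<le> x \<and> x < y \<and> y \<le> x + \<delta> \<and> x + \<delta> \<le> 1}"
    obtain x y where xy: "p = (x, y)" by (cases p)
    then show "(case p of (x, y) \<Rightarrow> ennreal (L2_norm w (F y - F x) / \<rho> (y - x)))
      = (case p of (x, y) \<Rightarrow> ennreal (norm (f y - f x) / \<rho> (y - x)))" using p d[of x y] by simp
  qed
  have 5: "hoelder_norm (L2_norm w) \<rho> F = hnorm f" by (rule hoelder_norm_embed[OF eq])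
  show ?thesis
    unfolding hspace_iff hoelder_space_def mem_Collect_eq 4 5 using 1 2 3 by auto
qed

lemma path_eq: "x \<in> {0..1} \<Longrightarrow> path f x = embed (f x)"
  by (simp add: path_def)

lemma path_extensional: "path f \<in> extensional {0..1}"
  by (simp add: path_def)

lemma path_wspace: "f \<in> hspace \<Longrightarrow> path f \<in> wspace"
  by (subst hoelder_space_embed[OF path_extensional _ path_eq]) (auto dest: hspaceD(2) simp: PiE_iff)

lemma wspace_path:
  assumes F: "F \<in> wspace"
  obtains f where "f \<in> hspace" "F = path f"
proof -
  have ext: "F \<in> {0..1} \<rightarrow>\<^sub>E L2_space w" using F by (simp add: hoelder_space_def)
  define f where "f = (\<lambda>x\<in>{0..1}. SOME a. F x = embed a)"
  have eq: "F x = embed (f x)" if "x \<in> {0..1}" for x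
  proof -
    have "F x \<in> L2_space w" using ext that by (rule PiE_mem)
    then obtain a where "F x = embed a" by (rule embed_surj)
    then have "F x = embed (SOME a. F x = embed a)" by (rule someI)
    then show ?thesis using that by (simp add: f_def)
  qed
  have Fe: "F \<in> extensional {0..1}" using ext by (simp add: PiE_iff)
  have fe: "f \<in> extensional {0..1}" by (simp add: f_def)
  have "f \<in> hspace" using hoelder_space_embed[OF Fe fe eq] F by simp
  moreover have "F = path f"
    by (rule extensionalityI[OF Fe path_extensional]) (simp only: eq path_eq)
  ultimately show ?thesis by (rule that)
qed

lemma wdist_path: "wdist (path f) (path g) = hdist f g"
proof -
  have "hoelder_norm (L2_norm w) \<rho> (\<lambda>x. path f x - path g x) = hnorm (\<lambda>x. f x - g x)"
    by (rule hoelder_norm_embed) (simp add: path_eq embed_diff)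
  then show ?thesis by (simp add: hoelder_dist_def hdist_eq)
qed

lemma path_eqD:
  assumes "f \<in> hspace" "g \<in> hspace" "path f = path g"
  shows "f = g"
proof (rule extensionalityI[of _ "{0..1}"])
  show "f \<in> extensional {0..1}" "g \<in> extensional {0..1}" using hspaceD(2)[OF assms(1)] hspaceD(2)[OF assms(2)] by (auto simp: PiE_iff)
  show "f x = g x" if "x \<in> {0..1}" for x
    using path_eq[OF that, of f] path_eq[OF that, of g] assms(3) by (intro embed_inj) simp
qed

lemma L2_norm_commute: "L2_norm w (a - b) = L2_norm w (b - a)"
  using L2_inner_minus[OF w_measurable, of "a - b"] by (simp add: L2_norm_def)

sublocale wspace: Metric_space wspace wdist
proof
  fix F G H :: "real \<Rightarrow> l0"
  show "0 \<le> wdist F G" by (simp add: hoelder_dist_def)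
  have "(F y - G y) - (F x - G x) = (F y - F x) - (G y - G x)" "(G y - F y) - (G x - F x) = (G y - G x) - (F y - F x)" for x y
    by simp_all
  then have "hoelder_norm (L2_norm w) \<rho> (\<lambda>x. F x - G x) = hoelder_norm (L2_norm w) \<rho> (\<lambda>x. G x - F x)"
    unfolding hoelder_norm_def by (simp only: L2_norm_commute)
  then show "wdist F G = wdist G F" by (simp add: hoelder_dist_def)
  assume F: "F \<in> wspace" and G: "G \<in> wspace"
  obtain f where f: "f \<in> hspace" "F = path f" by (rule wspace_path[OF F])
  obtain g where g: "g \<in> hspace" "G = path g" by (rule wspace_path[OF G])
  show "wdist F G = 0 \<longleftrightarrow> F = G"
    using path_eqD[OF f(1) g(1)] hoelder.zero[OF f(1) g(1)] unfolding f(2) g(2) wdist_path by auto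
  assume H: "H \<in> wspace"
  obtain h where h: "h \<in> hspace" "H = path h" by (rule wspace_path[OF H])
  show "wdist F H \<le> wdist F G + wdist G H"
    unfolding f(2) g(2) h(2) wdist_path by (rule hoelder.triangle[OF f(1) g(1) h(1)])
qed

lemma hoelder_topology_eq: "hoelder_topology (L2_space w) (L2_norm w) \<rho> = wspace.mtopology"
  by (simp add: hoelder_topology_def)

lemma continuous_path: "continuous_map hoelder.mtopology wspace.mtopology path"
  unfolding wspace.continuous_map_to_metric
proof (intro ballI allI impI)
  fix f :: "real \<Rightarrow> lsq" and \<epsilon> :: real
  assume f: "f \<in> topspace hoelder.mtopology" and \<epsilon>: "0 < \<epsilon>"
  show "\<exists>U. openin hoelder.mtopology U \<and> f \<in> U \<and> (\<forall>g\<in>U. path g \<in> wspace.mball (path f) \<epsilon>)"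
  proof (intro exI conjI ballI)
    show "openin hoelder.mtopology (hoelder.mball f \<epsilon>)" by (rule hoelder.openin_mball)
    show "f \<in> hoelder.mball f \<epsilon>" using f \<epsilon> by simp
    show "path g \<in> wspace.mball (path f) \<epsilon>" if "g \<in> hoelder.mball f \<epsilon>" for g
      using that by (auto simp: wdist_path path_wspace)
  qed
qed

text \<open>Makes the scalar evaluations of a random path Borel measurable, as the definition of a
  Gaussian process requires.\<close>

lemma continuous_eval:
  assumes x: "x \<in> {0..1}"
  shows "continuous_map wspace.mtopology euclideanreal (\<lambda>F. L2_inner w (F x) (embed a))"
proof (rule wspace.lipschitz_continuous_map)
  fix F G assume F: "F \<in> wspace" and G: "G \<in> wspace"
  obtain f where f: "f \<in> hspace" "F = path f" by (rule wspace_path[OF F])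
  obtain g where g: "g \<in> hspace" "G = path g" by (rule wspace_path[OF G])
  have "\<bar>L2_inner w (F x) (embed a) - L2_inner w (G x) (embed a)\<bar> = \<bar>(f x - g x) \<bullet> a\<bar>"
    unfolding f(2) g(2) path_eq[OF x] embed_inner by (simp add: inner_diff_left)
  also have "\<dots> \<le> norm (f x - g x) * norm a" by (rule Cauchy_Schwarz_ineq2)
  also have "\<dots> \<le> hdist f g * norm a" using hdist_ge(1)[OF f(1) g(1), of x] x by (intro mult_right_mono) auto
  finally show "\<bar>L2_inner w (F x) (embed a) - L2_inner w (G x) (embed a)\<bar> \<le> norm a * wdist F G"
    unfolding f(2) g(2) wdist_path by (simp only: mult.commute)
qed

end

text \<open>Both regimes of \<open>M\<close> are covered by eventual positivity: an observation
  carries the weight 1 / sqrt (N M) and there are \<open>M\<close> of them at each time, so the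
  variance does not depend on \<open>M\<close>.\<close>

locale change_point_model = weight_fun w for w :: "real \<Rightarrow> real" +
  fixes K :: nat and \<theta> :: "nat \<Rightarrow> real" and F Fn :: "nat \<Rightarrow> nat \<Rightarrow> real \<Rightarrow> real" and Fstar :: "nat \<Rightarrow> real \<Rightarrow> real"
    and M :: "nat \<Rightarrow> nat" and \<Omega> :: "nat \<Rightarrow> 'a measure" and Y :: "nat \<Rightarrow> nat \<Rightarrow> nat \<Rightarrow> 'a \<Rightarrow> real"
  assumes \<theta>_0: "\<theta> 0 = 0" and \<theta>_1: "\<theta> (K + 1) = 1" and \<theta>_less: "\<And>k. k \<le> K \<Longrightarrow> \<theta> k < \<theta> (k + 1)"
    and F_cdf: "\<And>N k. k \<in> {1..K+1} \<Longrightarrow> continuous_cdf (F N k)"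
    and Fn_eq: "\<And>N k n. k \<in> {1..K+1} \<Longrightarrow> change_point \<theta> N (k - 1) < n \<Longrightarrow> n \<le> change_point \<theta> N k \<Longrightarrow> Fn N n = F N k"
    and M_pos: "\<forall>\<^sub>F N in sequentially. 0 < M N"
    and prob_\<Omega>: "\<And>N. prob_space (\<Omega> N)"
    and indep_Y: "\<And>N. prob_space.indep_vars (\<Omega> N) (\<lambda>_. borel) (\<lambda>(n, m). Y N n m) ({1..N} \<times> {1..M N})"
    and cdf_Y: "\<And>N n m. n \<in> {1..N} \<Longrightarrow> m \<in> {1..M N} \<Longrightarrow> cdf (distr (\<Omega> N) borel (Y N n m)) = Fn N n"
    and Fstar_cdf: "\<And>k. k \<in> {1..K+1} \<Longrightarrow> continuous_cdf (Fstar k)"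
    and F_lim: "(\<lambda>N. MAX k\<in>{1..K+1}. SUP x. \<bar>F N k x - Fstar k x\<bar>) \<longlonglongrightarrow> 0"
begin

lemma continuous_cdf_bounds:
  assumes "continuous_cdf G"
  shows "G \<in> borel_measurable borel" "0 \<le> G t" "G t \<le> 1"
proof -
  obtain \<nu> where \<nu>: "real_distribution \<nu>" "G = cdf \<nu>" using assms by (auto simp: continuous_cdf_def)
  then interpret \<nu>: real_distribution \<nu> by simp
  show "G \<in> borel_measurable borel" using assms by (intro borel_measurable_continuous_onI) (simp add: continuous_cdf_def)
  show "0 \<le> G t" "G t \<le> 1" by (simp_all add: \<nu>(2) \<nu>.cdf_nonneg \<nu>.cdf_bounded_prob)
qed

lemma Y_measurable: "n \<in> {1..N} \<Longrightarrow> m \<in> {1..M N} \<Longrightarrow> Y N n m \<in> borel_measurable (\<Omega> N)"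
proof -
  interpret prob_space "\<Omega> N" by (rule prob_\<Omega>)
  show "n \<in> {1..N} \<Longrightarrow> m \<in> {1..M N} \<Longrightarrow> Y N n m \<in> borel_measurable (\<Omega> N)"
    using indep_Y[of N] by (auto simp: indep_vars_def)
qed

lemma distribution_Y:
  assumes n: "n \<in> {1..N}" and m: "m \<in> {1..M N}"
  shows "real_distribution (distr (\<Omega> N) borel (Y N n m))"
    and "Fn N n \<in> borel_measurable borel" and "\<bar>Fn N n t\<bar> \<le> 1"
proof -
  interpret prob_space "\<Omega> N" by (rule prob_\<Omega>)
  have [measurable]: "Y N n m \<in> borel_measurable (\<Omega> N)" by (rule Y_measurable[OF n m])
  show d: "real_distribution (distr (\<Omega> N) borel (Y N n m))"
    by (intro real_distribution.intro prob_space_distr) (simp_all add: real_distribution_axioms_def)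
  interpret d: real_distribution "distr (\<Omega> N) borel (Y N n m)" by (rule d)
  show "Fn N n \<in> borel_measurable borel"
    unfolding cdf_Y[OF n m, symmetric] by (rule borel_measurable_mono) (simp add: mono_def d.cdf_nondecreasing)
  show "\<bar>Fn N n t\<bar> \<le> 1"
    unfolding cdf_Y[OF n m, symmetric] using d.cdf_nonneg[of t] d.cdf_bounded_prob[of t] by simp
qed

lemma F_pointwise:
  assumes k: "k \<in> {1..K+1}"
  shows "(\<lambda>N. F N k t) \<longlonglongrightarrow> Fstar k t"
proof (rule LIM_zero_cancel, rule Lim_null_comparison[OF always_eventually F_lim], rule allI)
  fix N
  \<comment> \<open>A real supremum bounds its members only if they are bounded above; two
    distribution functions differ by at most 1.\<close>
  have b: "\<bar>F N k x - Fstar k x\<bar> \<le> 1" for x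
    using continuous_cdf_bounds(2,3)[OF F_cdf[OF k], of N x] continuous_cdf_bounds(2,3)[OF Fstar_cdf[OF k], of x] by linarith
  have "\<bar>F N k t - Fstar k t\<bar> \<le> (SUP x. \<bar>F N k x - Fstar k x\<bar>)"
    by (rule cSUP_upper) (use b in \<open>auto intro!: bdd_aboveI\<close>)
  also have "\<dots> \<le> (MAX k\<in>{1..K+1}. SUP x. \<bar>F N k x - Fstar k x\<bar>)" by (rule Max_ge) (use k in auto)
  finally show "norm (F N k t - Fstar k t) \<le> (MAX k\<in>{1..K+1}. SUP x. \<bar>F N k x - Fstar k x\<bar>)" by simp
qed

lemma bridge_limit:
  assumes k: "k \<in> {1..K+1}"
  shows "(\<lambda>N. bridge (F N k) f g) \<longlonglongrightarrow> bridge (Fstar k) f g"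
proof (rule bridge_converges)
  show "F N k \<in> borel_measurable borel" for N by (rule continuous_cdf_bounds(1)[OF F_cdf[OF k]])
  show "\<bar>F N k t\<bar> \<le> 1" for N t using continuous_cdf_bounds(2,3)[OF F_cdf[OF k], of N t] by simp
  show "Fstar k \<in> borel_measurable borel" by (rule continuous_cdf_bounds(1)[OF Fstar_cdf[OF k]])
  show "(\<lambda>N. F N k t) \<longlonglongrightarrow> Fstar k t" for t by (rule F_pointwise[OF k])
qed

definition index :: "nat \<Rightarrow> (nat \<times> nat) set" where
  "index N = {1..N} \<times> {1..M N}"

definition obs :: "nat \<Rightarrow> nat \<times> nat \<Rightarrow> 'a \<Rightarrow> real" where
  "obs N = (\<lambda>(n, m). Y N n m)"

text \<open>The factor 1 / sqrt N comes from the partial sum, 1 / sqrt M from the empirical error,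
  and the clamp is the share of time step \<open>fst i\<close> at time \<open>x\<close>.\<close>

definition coef :: "nat \<Rightarrow> nat \<times> nat \<Rightarrow> real \<Rightarrow> real" where
  "coef N i x = unit_clamp (fst i) (real N * x) / sqrt (real N * real (M N))"

definition centre :: "nat \<Rightarrow> nat \<times> nat \<Rightarrow> lsq" where
  "centre N i = profile (Fn N (fst i))"

definition \<Gamma> :: "real \<Rightarrow> real \<Rightarrow> lsq \<Rightarrow> lsq \<Rightarrow> real" where
  "\<Gamma> x y f g = (\<Sum>k=1..K+1. (min (min x y) (\<theta> k) - min (min x y) (\<theta> (k - 1))) * bridge (Fstar k) f g)"

text \<open>Increments of a clamp lie between 0 and 1, so their squares are bounded by the
  increments themselves, whose sum over the time steps is \<open>N * (y - x)\<close>. If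
  \<open>N\<close> or \<open>M N\<close> is 0 there are no observations.\<close>

lemma coef_increments:
  assumes xy: "0 \<le> x" "x < y" "y \<le> 1"
  shows "(\<Sum>i\<in>index N. (coef N i y - coef N i x)\<^sup>2) \<le> y - x"
proof (cases "N = 0 \<or> M N = 0")
  case False
  then have N: "0 < real N" "0 < real (M N)" by auto
  let ?d = "\<lambda>n. unit_clamp n (real N * y) - unit_clamp n (real N * x)"
  have "(\<Sum>i\<in>index N. (coef N i y - coef N i x)\<^sup>2) = (\<Sum>n=1..N. \<Sum>m=1..M N. (?d n)\<^sup>2 / (real N * real (M N)))"
    unfolding index_def coef_def sum.cartesian_product using N
    by (intro sum.cong refl) (auto simp: diff_divide_distrib[symmetric] power_divide)
  also have "\<dots> = (\<Sum>n=1..N. (?d n)\<^sup>2 / real N)" using N by simp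
  also have "\<dots> \<le> (\<Sum>n=1..N. ?d n / real N)"
  proof (intro sum_mono divide_right_mono)
    fix n
    have "0 \<le> ?d n" using xy by (simp add: unit_clamp_mono mult_left_mono)
    moreover have "?d n \<le> 1" using unit_clamp_bounds[of n "real N * y"] unit_clamp_bounds[of n "real N * x"] by linarith
    ultimately show "(?d n)\<^sup>2 \<le> ?d n" by (simp add: power2_eq_square mult_left_le)
  qed simp
  also have "\<dots> = ((\<Sum>n=1..N. unit_clamp n (real N * y)) - (\<Sum>n=1..N. unit_clamp n (real N * x))) / real N"
    by (simp only: sum_divide_distrib[symmetric] sum_subtractf)
  also have "\<dots> = (real N * y - real N * x) / real N"
    using xy by (subst (1 2) unit_clamp_sum) (auto simp: mult_left_le min.absorb1)
  also have "\<dots> = y - x" using N by (simp add: right_diff_distrib[symmetric])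
  finally show ?thesis .
qed (use xy in \<open>auto simp: index_def\<close>)

lemma coef_bound:
  assumes "i \<in> index N"
  shows "\<bar>coef N i x\<bar> \<le> 1 / sqrt (real N)"
proof -
  have N: "1 \<le> real N" "1 \<le> real (M N)" using assms by (auto simp: index_def)
  have "\<bar>coef N i x\<bar> \<le> 1 / sqrt (real N * real (M N))"
    using unit_clamp_bounds[of "fst i" "real N * x"] by (simp add: coef_def divide_right_mono)
  also have "\<dots> \<le> 1 / sqrt (real N)" using N by (intro divide_left_mono) auto
  finally show ?thesis .
qed

lemma jump_obs_mean:
  assumes "i \<in> index N"
  shows "(\<integral>\<omega>. jump (obs N i \<omega>) \<bullet> f \<partial>\<Omega> N) = centre N i \<bullet> f"
proof -
  obtain n m where i: "i = (n, m)" "n \<in> {1..N}" "m \<in> {1..M N}" using assms by (auto simp: index_def)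
  have "(\<integral>\<omega>. jump (obs N i \<omega>) \<bullet> f \<partial>\<Omega> N) = (\<integral>y. jump y \<bullet> f \<partial>distr (\<Omega> N) borel (Y N n m))"
    unfolding i(1) obs_def prod.case
    by (rule integral_distr[symmetric])
      (intro Y_measurable i borel_measurable_continuous_onI continuous_intros jump_cont)+
  also have "\<dots> = profile (Fn N n) \<bullet> f"
    using jump_mean[OF distribution_Y(1)[OF i(2,3)], of f] distribution_Y(2)[OF i(2,3)] by (simp add: cdf_Y[OF i(2,3)])
  finally show ?thesis by (simp add: centre_def i(1))
qed

lemma jump_obs_cov:
  assumes "i \<in> index N"
  shows "(\<integral>\<omega>. ((jump (obs N i \<omega>) - centre N i) \<bullet> f) * ((jump (obs N i \<omega>) - centre N i) \<bullet> g) \<partial>\<Omega> N)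
    = bridge (Fn N (fst i)) f g"
proof -
  obtain n m where i: "i = (n, m)" "n \<in> {1..N}" "m \<in> {1..M N}" using assms by (auto simp: index_def)
  have "(\<integral>\<omega>. ((jump (obs N i \<omega>) - centre N i) \<bullet> f) * ((jump (obs N i \<omega>) - centre N i) \<bullet> g) \<partial>\<Omega> N)
    = (\<integral>y. ((jump y - profile (Fn N n)) \<bullet> f) * ((jump y - profile (Fn N n)) \<bullet> g) \<partial>distr (\<Omega> N) borel (Y N n m))"
    unfolding i(1) obs_def prod.case centre_def fst_conv
    by (rule integral_distr[symmetric])
      (intro Y_measurable i borel_measurable_continuous_onI continuous_intros jump_cont)+
  also have "\<dots> = bridge (Fn N n) f g"
    using jump_cov[OF distribution_Y(1)[OF i(2,3)], of f g] distribution_Y(2)[OF i(2,3)] by (simp add: cdf_Y[OF i(2,3)])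
  finally show ?thesis by (simp add: i(1))
qed

text \<open>Once \<open>M N\<close> is positive, summation over the observations of one time step
  cancels the factor 1 / M and leaves the average over time steps that was treated above.\<close>

lemma covariance_limit:
  assumes xy: "x \<in> {0..1}" "y \<in> {0..1}"
  shows "(\<lambda>N. \<Sum>i\<in>index N. coef N i x * coef N i y *
      (\<integral>\<omega>. ((jump (obs N i \<omega>) - centre N i) \<bullet> f) * ((jump (obs N i \<omega>) - centre N i) \<bullet> g) \<partial>\<Omega> N)) \<longlonglongrightarrow> \<Gamma> x y f g"
proof (rule Lim_transform_eventually)
  show "(\<lambda>N. (1 / real N) * (\<Sum>n=1..N. unit_clamp n (real N * x) * unit_clamp n (real N * y) * bridge (Fn N n) f g)) \<longlonglongrightarrow> \<Gamma> x y f g"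
    unfolding \<Gamma>_def using xy
    by (intro unit_clamp_covariance_limit[where r="\<lambda>N k. bridge (F N k) f g"] \<theta>_0 \<theta>_1 \<theta>_less bridge_limit) (simp_all add: Fn_eq)
  show "\<forall>\<^sub>F N in sequentially. (1 / real N) * (\<Sum>n=1..N. unit_clamp n (real N * x) * unit_clamp n (real N * y) * bridge (Fn N n) f g)
    = (\<Sum>i\<in>index N. coef N i x * coef N i y *
      (\<integral>\<omega>. ((jump (obs N i \<omega>) - centre N i) \<bullet> f) * ((jump (obs N i \<omega>) - centre N i) \<bullet> g) \<partial>\<Omega> N))"
    using M_pos
  proof eventually_elim
    case (elim N)
    have "(\<Sum>i\<in>index N. coef N i x * coef N i y *
      (\<integral>\<omega>. ((jump (obs N i \<omega>) - centre N i) \<bullet> f) * ((jump (obs N i \<omega>) - centre N i) \<bullet> g) \<partial>\<Omega> N))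
      = (\<Sum>i\<in>index N. unit_clamp (fst i) (real N * x) * unit_clamp (fst i) (real N * y) * bridge (Fn N (fst i)) f g / (real N * real (M N)))"
      by (intro sum.cong refl) (simp add: jump_obs_cov coef_def)
    also have "\<dots> = (\<Sum>n=1..N. \<Sum>m=1..M N. unit_clamp n (real N * x) * unit_clamp n (real N * y) * bridge (Fn N n) f g / (real N * real (M N)))"
      unfolding index_def sum.cartesian_product by (intro sum.cong refl) auto
    also have "\<dots> = (\<Sum>n=1..N. unit_clamp n (real N * x) * unit_clamp n (real N * y) * bridge (Fn N n) f g / real N)"
      using elim by simp
    finally show ?case by (simp add: sum_divide_distrib)
  qed
qed

lemma partial_sum_process_embed:
  assumes x: "x \<in> {0..1}"
  shows "partial_sum_process N (\<lambda>n. empirical_error (M N) (\<lambda>m. Y N n m \<omega>) (Fn N n)) x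
    = embed (\<Sum>i\<in>index N. coef N i x *\<^sub>R (jump (obs N i \<omega>) - centre N i))"
proof -
  have e0: "embed 0 = 0" by (rule linear_0[OF embed_linear])
  \<comment> \<open>Convergence in distribution demands measurability for every \<open>N\<close>, so
    the identity must also hold for \<open>N = 0\<close> and \<open>M N = 0\<close>, where both
    sides are zero.\<close>
  consider "N = 0" | "M N = 0" | "0 < N" "0 < M N" by auto
  then show ?thesis
  proof cases
    case 1
    then show ?thesis using x by (simp add: index_def e0 partial_sum_process_def)
  next
    case 2
    have "empirical_error 0 y G = 0" for y G by (simp add: empirical_error_def zero_l0_def)
    then show ?thesis using 2 x by (simp add: index_def e0 partial_sum_process_def)
  next
    case 3
    have er: "empirical_error (M N) (\<lambda>m. Y N n m \<omega>) (Fn N n) = (1 / sqrt (real (M N))) *\<^sub>R (\<Sum>m=1..M N. embed (jump (Y N n m \<omega>) - profile (Fn N n)))"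
      if n: "n \<in> {1..N}" for n
      using 3 distribution_Y(2,3)[OF n, of 1] by (intro empirical_error_embed) auto
    have co: "real N powr (-1/2) * c * (1 / sqrt (real (M N))) = c / sqrt (real N * real (M N))" for c
    proof -
      have "real N powr (-1/2) = 1 / sqrt (real N)"
        using powr_minus_divide[of "real N" "1/2"] powr_half_sqrt[of "real N"] by simp
      then show ?thesis by (simp add: real_sqrt_mult)
    qed
    have "partial_sum_process N (\<lambda>n. empirical_error (M N) (\<lambda>m. Y N n m \<omega>) (Fn N n)) x
      = (\<Sum>n=1..N. (real N powr (-1/2) * unit_clamp n (real N * x)) *\<^sub>R empirical_error (M N) (\<lambda>m. Y N n m \<omega>) (Fn N n))"
      by (rule partial_sum_process_unit_clamp[OF 3(1) x])
    also have "\<dots> = (\<Sum>n=1..N. \<Sum>m=1..M N. coef N (n, m) x *\<^sub>R embed (jump (Y N n m \<omega>) - profile (Fn N n)))"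
      by (intro sum.cong refl) (simp only: er scaleR_scaleR co coef_def fst_conv scaleR_sum_right)
    also have "\<dots> = (\<Sum>i\<in>index N. coef N i x *\<^sub>R embed (jump (obs N i \<omega>) - centre N i))"
      unfolding index_def sum.cartesian_product by (intro sum.cong refl) (auto simp: obs_def centre_def)
    also have "\<dots> = embed (\<Sum>i\<in>index N. coef N i x *\<^sub>R (jump (obs N i \<omega>) - centre N i))"
      by (simp only: embed_sum embed_scaleR)
    finally show ?thesis .
  qed
qed

theorem empirical_fclt:
  assumes \<rho>: "polynomial_weight \<rho> \<or> logarithmic_weight \<rho>"
  shows "\<exists>(Q :: (real \<Rightarrow> l0) measure) W.
           prob_space Q \<and>
           centered_gaussian_process (L2_space w) (L2_inner w) Q {0..1} W \<and>
           (\<forall>x\<in>{0..1}. \<forall>y\<in>{0..1}. \<forall>f\<in>L2_space w. \<forall>g\<in>L2_space w.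
              covariance_function (L2_inner w) Q W x y f g = C_eps w K \<theta> Fstar x y f g) \<and>
           converges_in_distribution (hoelder_topology (L2_space w) (L2_norm w) \<rho>) \<Omega>
             (\<lambda>N \<omega>. partial_sum_process N
                (\<lambda>n. empirical_error (M N) (\<lambda>m. Y N n m \<omega>) (Fn N n)))
             Q W"
proof -
  obtain \<beta> C where hw: "hoelder_weight \<rho> \<beta> C" by (rule hoelder_weight_exists[OF \<rho>])
  interpret weighted_hoelder w \<rho> \<beta> C
    by (intro weighted_hoelder.intro weight_fun_axioms hw)
  obtain e \<eta> where e: "ortho_seq e" "\<eta> \<longlonglongrightarrow> 0" "\<And>d y. norm (jump y - ortho_proj e d (jump y)) \<le> \<eta> d"
    by (rule ortho_seq_totally_bounded[of jump 1, OF jump_net jump_norm]) (assumption, rule that)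
  interpret H: hilbert_fclt \<rho> \<beta> C \<Omega> index obs coef jump centre "\<lambda>N. 1 / sqrt (real N)" \<Gamma> e \<eta>
  proof (intro hilbert_fclt.intro hw hilbert_fclt_axioms.intro)
    show "prob_space (\<Omega> N)" for N by (rule prob_\<Omega>)
    show "finite (index N)" for N by (simp add: index_def)
    show "prob_space.indep_vars (\<Omega> N) (\<lambda>_. borel) (obs N) (index N)" for N unfolding obs_def index_def by (rule indep_Y)
    show "coef N i 0 = 0" if "i \<in> index N" for N i using that by (auto simp: coef_def index_def unit_clamp_0)
    show "(\<lambda>N. 1 / sqrt (real N)) \<longlonglongrightarrow> 0" by real_asymp
    show "\<bar>coef N i x\<bar> \<le> 1 / sqrt (real N)" if "i \<in> index N" for N i x by (rule coef_bound[OF that])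
  qed (rule jump_cont jump_norm jump_obs_mean coef_increments covariance_limit e; assumption?)+
  interpret \<mu>: prob_space H.\<mu> by (rule H.\<mu>)
  let ?T = "hoelder_topology (L2_space w) (L2_norm w) \<rho>"
  \<comment> \<open>The limit is moved to the path space over \<open>l0\<close>, with the identity
    as the process, since the claim asks for a probability measure on functions from the reals to
    \<open>l0\<close>.\<close>
  define Q where "Q = distr H.\<mu> (borel_of ?T) (path \<circ> H.W)"
  have pm: "path \<in> measurable (borel_of hoelder.mtopology) (borel_of ?T)"
    unfolding hoelder_topology_eq by (rule continuous_map_measurable[OF continuous_path])
  have Wm: "path \<circ> H.W \<in> measurable H.\<mu> (borel_of ?T)" by (rule measurable_comp[OF H.W_measurable pm])
  have Q: "prob_space Q" unfolding Q_def by (rule \<mu>.prob_space_distr[OF Wm])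
  have evm: "(\<lambda>v. L2_inner w (v x) (embed a)) \<in> borel_measurable (borel_of ?T)" if "x \<in> {0..1}" for x a
    unfolding hoelder_topology_eq by (rule continuous_map_euclidean_measurable[OF continuous_eval[OF that]])
  have sQ: "sets Q = sets (borel_of ?T)" by (simp add: Q_def)
  have intQ: "(\<integral>v. h v \<partial>Q) = (\<integral>v. h (path (H.W v)) \<partial>H.\<mu>)" if "h \<in> borel_measurable (borel_of ?T)" for h :: "(real \<Rightarrow> l0) \<Rightarrow> real"
    unfolding Q_def using integral_distr[OF Wm that] by simp
  have pW: "L2_inner w (path (H.W v) x) (embed a) = H.W v x \<bullet> a" if "x \<in> {0..1}" for v x a
    by (simp only: path_eq[OF that] embed_inner)
  have gauss: "centered_gaussian_process (L2_space w) (L2_inner w) Q {0..1} (\<lambda>v. v)"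
    unfolding centered_gaussian_process_def
  proof (intro conjI ballI allI impI)
    fix v x assume "v \<in> space Q" and x: "x \<in> {0..1::real}"
    then have "v \<in> wspace" by (simp add: Q_def hoelder_topology_eq)
    then show "v x \<in> L2_space w" using x by (auto simp: hoelder_space_def)
  next
    fix x f assume x: "x \<in> {0..1::real}" and "f \<in> L2_space w"
    then obtain a where f: "f = embed a" by (elim embed_surj)
    show "(\<lambda>v. L2_inner w (v x) f) \<in> borel_measurable Q"
      unfolding f measurable_cong_sets[OF sQ refl] by (rule evm[OF x])
    show "(\<integral>v. L2_inner w (v x) f \<partial>Q) = 0"
      unfolding f intQ[OF evm[OF x]] pW[OF x] using H.W_gaussian(2)[of "{0::nat}" "\<lambda>_. x" "\<lambda>_. a"] x by simp
  next
    fix n :: nat and x :: "nat \<Rightarrow> real" and f :: "nat \<Rightarrow> l0" assume xf: "\<forall>i<n. x i \<in> {0..1} \<and> f i \<in> L2_space w"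
    have "\<forall>i. \<exists>a. i < n \<longrightarrow> f i = embed a" using xf embed_surj by blast
    then obtain a where a: "\<And>i. i < n \<Longrightarrow> f i = embed (a i)" by metis
    have m: "(\<lambda>v. \<Sum>i<n. L2_inner w (v (x i)) (f i)) \<in> borel_measurable (borel_of ?T)"
      using xf by (intro borel_measurable_sum) (simp add: a evm)
    have "distr Q borel (\<lambda>v. \<Sum>i<n. L2_inner w (v (x i)) (f i)) = distr H.\<mu> borel (\<lambda>v. \<Sum>i<n. H.W v (x i) \<bullet> a i)"
      unfolding Q_def distr_distr[OF m Wm]
      by (intro distr_cong refl) (use xf in \<open>auto simp: a pW intro!: sum.cong\<close>)
    then show "gaussian_law (distr Q borel (\<lambda>v. \<Sum>i<n. L2_inner w (v (x i)) (f i)))"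
      using H.W_gaussian(1)[of "{..<n}" x a] xf by auto
  qed
  have cov: "covariance_function (L2_inner w) Q (\<lambda>v. v) x y f g = C_eps w K \<theta> Fstar x y f g"
    if x: "x \<in> {0..1}" and y: "y \<in> {0..1}" and f: "f \<in> L2_space w" and g: "g \<in> L2_space w" for x y f g
  proof -
    obtain a where a: "f = embed a" by (rule embed_surj[OF f])
    obtain b where b: "g = embed b" by (rule embed_surj[OF g])
    have "covariance_function (L2_inner w) Q (\<lambda>v. v) x y f g = (\<integral>v. (H.W v x \<bullet> a) * (H.W v y \<bullet> b) \<partial>H.\<mu>)"
      unfolding covariance_function_def a b by (subst intQ) (intro borel_measurable_times evm x y, simp only: pW x y)
    also have "\<dots> = \<Gamma> x y a b" by (rule H.W_covariance[OF x y])
    also have "\<dots> = C_eps w K \<theta> Fstar x y f g"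
      unfolding a b \<Gamma>_def
      by (rule C_eps_embed[symmetric, OF \<theta>_0 \<theta>_less]) (use x y continuous_cdf_bounds(1)[OF Fstar_cdf] in auto)
    finally show ?thesis .
  qed
  have process: "partial_sum_process N (\<lambda>n. empirical_error (M N) (\<lambda>m. Y N n m \<omega>) (Fn N n)) = path (H.Z N \<omega>)" for N \<omega>
  proof (rule extensionalityI[of _ "{0..1}"])
    show "partial_sum_process N (\<lambda>n. empirical_error (M N) (\<lambda>m. Y N n m \<omega>) (Fn N n)) \<in> extensional {0..1}"
      by (simp add: partial_sum_process_def)
    show "path (H.Z N \<omega>) \<in> extensional {0..1}" by (rule path_extensional)
    fix x assume x: "x \<in> {0..1::real}"
    show "partial_sum_process N (\<lambda>n. empirical_error (M N) (\<lambda>m. Y N n m \<omega>) (Fn N n)) x = path (H.Z N \<omega>) x"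
      unfolding partial_sum_process_embed[OF x] path_eq[OF x] using x by (simp add: H.Z_eq)
  qed
  have "converges_in_distribution ?T \<Omega> (\<lambda>N \<omega>. path (H.Z N \<omega>)) Q (\<lambda>v. v)"
    unfolding converges_in_distribution_def
  proof (intro conjI allI impI)
    show "(\<lambda>\<omega>. path (H.Z N \<omega>)) \<in> measurable (\<Omega> N) (borel_of ?T)" for N by (rule measurable_compose[OF H.Z_measurable pm])
    show "(\<lambda>v. v) \<in> measurable Q (borel_of ?T)" by (simp add: Q_def)
    fix h assume h: "continuous_map ?T euclideanreal h \<and> bounded (h ` topspace ?T)"
    have hc: "continuous_map hoelder.mtopology euclideanreal (\<lambda>z. h (path z))"
      using continuous_map_compose[OF continuous_path, of euclideanreal h] h by (simp add: hoelder_topology_eq comp_def)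
    have hb: "bounded ((\<lambda>z. h (path z)) ` topspace hoelder.mtopology)"
      by (rule bounded_subset[of "h ` topspace ?T"]) (use h in \<open>auto simp: hoelder_topology_eq path_wspace\<close>)
    have hm: "h \<in> borel_measurable (borel_of ?T)" using h by (intro continuous_map_euclidean_measurable) auto
    show "(\<lambda>N. \<integral>\<omega>. h (path (H.Z N \<omega>)) \<partial>\<Omega> N) \<longlonglongrightarrow> (\<integral>v. h v \<partial>Q)"
      unfolding intQ[OF hm] using H.Z_converges hc hb unfolding converges_in_distribution_def by (elim conjE allE[of _ "\<lambda>z. h (path z)"]) auto
  qed
  then have conv: "converges_in_distribution ?T \<Omega>
      (\<lambda>N \<omega>. partial_sum_process N (\<lambda>n. empirical_error (M N) (\<lambda>m. Y N n m \<omega>) (Fn N n))) Q (\<lambda>v. v)"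
    unfolding process .
  show ?thesis by (intro exI[of _ Q] exI[of _ "\<lambda>v. v"] conjI ballI Q gauss cov conv)
qed

end

theorem theorem3p2:
  fixes K :: nat and \<theta> :: "nat \<Rightarrow> real"
    and F Fn :: "nat \<Rightarrow> nat \<Rightarrow> real \<Rightarrow> real" and Fstar :: "nat \<Rightarrow> real \<Rightarrow> real"
    and M :: "nat \<Rightarrow> nat"
    and \<Omega> :: "nat \<Rightarrow> 'a measure" and Y :: "nat \<Rightarrow> nat \<Rightarrow> nat \<Rightarrow> 'a \<Rightarrow> real"
    and w \<rho> :: "real \<Rightarrow> real"
  assumes "\<theta> 0 = 0" and "\<theta> (K + 1) = 1" and "\<forall>k\<le>K. \<theta> k < \<theta> (k + 1)"
    and "\<forall>N. \<forall>k\<in>{1..K+1}. continuous_cdf (F N k)"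
    and "\<forall>N. \<forall>k\<in>{1..K+1}. \<forall>n.
           change_point \<theta> N (k - 1) < n \<and> n \<le> change_point \<theta> N k \<longrightarrow> Fn N n = F N k"
    and "(\<exists>m>0. \<forall>N. M N = m) \<or> filterlim M at_top sequentially"
    and "\<forall>N. prob_space (\<Omega> N)"
    and "\<forall>N. prob_space.indep_vars (\<Omega> N) (\<lambda>_. borel) (\<lambda>(n, m). Y N n m) ({1..N} \<times> {1..M N})"
    and "\<forall>N. \<forall>n\<in>{1..N}. \<forall>m\<in>{1..M N}. cdf (distr (\<Omega> N) borel (Y N n m)) = Fn N n"
    and "continuous_on UNIV w" and "\<forall>x. 0 < w x"
    and "integrable lborel w" and "(LBINT x. w x) = 1"
    and "\<forall>k\<in>{1..K+1}. continuous_cdf (Fstar k)"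
    and "(\<lambda>N. MAX k\<in>{1..K+1}. SUP x. \<bar>F N k x - Fstar k x\<bar>) \<longlonglongrightarrow> 0"
    and "polynomial_weight \<rho> \<or> logarithmic_weight \<rho>"
  shows "\<exists>(Q :: (real \<Rightarrow> l0) measure) W.
           prob_space Q \<and>
           centered_gaussian_process (L2_space w) (L2_inner w) Q {0..1} W \<and>
           (\<forall>x\<in>{0..1}. \<forall>y\<in>{0..1}. \<forall>f\<in>L2_space w. \<forall>g\<in>L2_space w.
              covariance_function (L2_inner w) Q W x y f g = C_eps w K \<theta> Fstar x y f g) \<and>
           converges_in_distribution (hoelder_topology (L2_space w) (L2_norm w) \<rho>) \<Omega>
             (\<lambda>N \<omega>. partial_sum_process N
                (\<lambda>n. empirical_error (M N) (\<lambda>m. Y N n m \<omega>) (Fn N n)))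
             Q W"
proof -
  have M: "\<forall>\<^sub>F N in sequentially. 0 < M N"
    using assms(6)
  proof
    assume "filterlim M at_top sequentially"
    then have "\<forall>\<^sub>F N in sequentially. 1 \<le> M N" by (simp only: filterlim_at_top)
    then show ?thesis by eventually_elim simp
  qed auto
  interpret change_point_model w K \<theta> F Fn Fstar M \<Omega> Y
    by (intro change_point_model.intro weight_fun.intro change_point_model_axioms.intro)
      (rule assms(1,2,10,12,13,15) assms(3,4,7,8,9,11,14)[rule_format] assms(5)[rule_format, OF _ conjI] M; assumption?)+
  show ?thesis by (rule empirical_fclt[OF assms(16)])
qed

end
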